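(* Let $\mathcal{M} \models \mathsf{PA}$ be countable and recursively saturated and $I \subseteq_e M$. Let $F$ be an idempotent sentential operator with template $\Phi(p, q)$, and assume $\Phi(p, q)$ has syntactic depth 1. Suppose $I$ is $F$-closed. Then if $I$ is separable or has no least $F$-gap above it, there is $S$ such that $(\mathcal{M}, S) \models \mathsf{CS}^-$ and $$I = \{ x \in M : \forall y \leq x\ \forall \phi \in \mathrm{Sent}^{\mathcal{M}}\ (\mathcal{M},S)\models T(\phi) \equiv T(F(y, \phi)) \}.$$
   Context: $I\subseteq_e M$ is a cut of $M$. $(\mathcal{M},S)\models\mathsf{CS}^-$: $S\subseteq M^2$ is a full compositional satisfaction class for $\mathcal{L}_{\mathsf{PA}}$-formulas in the sense of $\mathcal{M}$ (Tarski clauses for atomic formulas, $\vee$, $\neg$, $\exists$); $T(\phi)$ abbreviates $S(\phi,\emptyset)$. A template is a finite propositional formula $\Phi(p,q)$ (built from connectives and quantifiers over dummy variables) not logically equivalent to $p$, of non-zero complexity, in which $q$ occurs, with $p\wedge q\vdash\Phi(p,q)$ and $\neg p\wedge\neg q\vdash\neg\Phi(p,q)$; syntactic depth 1 means $\Phi$ consists of a single connective or quantifier applied to the letters $p,q$ (e.g. $p\vee q$, $q\wedge p$, $q\vee q$, $\forall y\,q$). The idempotent sentential operator $F$ is defined in $\mathcal{M}$ by $F(0,\phi)=\phi$, $F(x+1,\phi)=\Phi(\phi,F(x,\phi))$. $F$ is accessible if $p$ occurs in $\Phi$, additive otherwise. $I$ is $F$-closed if either $F$ is accessible, or $F$ is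 additive and $I$ is closed under addition. $I$ has no least $F$-gap above it if: when $F$ is accessible, for every $x>I$ there is $y$ with $x-n>y>I$ for all $n\in\omega$; when $F$ is additive, for every $x>I$ there is $y$ with $\lfloor x/n\rfloor>y>I$ for all $n\in\omega$, $n\ge1$. $I$ is separable if for each $a\in M$ there is $c\in M$ such that for each $n\in\omega$, $(a)_n\in I$ iff $\mathcal{M}\models n\in c$, where $(a)_n$ is the $n$-th element of the sequence coded by $a$. *)

theory Defs
  imports "HOL-Library.Countable_Set" "HOL-Library.Nat_Bijection"
begin

section \<open>First-order arithmetic\<close>

datatype tm = Var nat | Zero | One | Add tm tm | Mult tm tm

datatype fm = Eq tm tm | Less tm tm | Neg fm | Or fm fm | Exists nat fm

text \<open>The domain of a structure is the whole type \<^typ>\<open>'a\<close>.\<close>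

record 'a arith =
  azero :: 'a (\<open>\<zero>\<index>\<close>)
  aone :: 'a (\<open>\<one>\<index>\<close>)
  aadd :: "'a \<Rightarrow> 'a \<Rightarrow> 'a" (infixl \<open>\<oplus>\<index>\<close> 65)
  amult :: "'a \<Rightarrow> 'a \<Rightarrow> 'a" (infixl \<open>\<otimes>\<index>\<close> 70)
  aless :: "'a \<Rightarrow> 'a \<Rightarrow> bool" (infix \<open>\<prec>\<index>\<close> 50)

primrec tm_val :: "'a arith \<Rightarrow> (nat \<Rightarrow> 'a) \<Rightarrow> tm \<Rightarrow> 'a" where
  "tm_val M e (Var n) = e n"
| "tm_val M e Zero = azero M"
| "tm_val M e One = aone M"
| "tm_val M e (Add s t) = aadd M (tm_val M e s) (tm_val M e t)"
| "tm_val M e (Mult s t) = amult M (tm_val M e s) (tm_val M e t)"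

primrec sat :: "'a arith \<Rightarrow> (nat \<Rightarrow> 'a) \<Rightarrow> fm \<Rightarrow> bool" where
  "sat M e (Eq s t) \<longleftrightarrow> tm_val M e s = tm_val M e t"
| "sat M e (Less s t) \<longleftrightarrow> aless M (tm_val M e s) (tm_val M e t)"
| "sat M e (Neg \<phi>) \<longleftrightarrow> \<not> sat M e \<phi>"
| "sat M e (Or \<phi> \<psi>) \<longleftrightarrow> sat M e \<phi> \<or> sat M e \<psi>"
| "sat M e (Exists n \<phi>) \<longleftrightarrow> (\<exists>a. sat M (e(n := a)) \<phi>)"

primrec tm_vars :: "tm \<Rightarrow> nat set" where
  "tm_vars (Var n) = {n}"
| "tm_vars Zero = {}"
| "tm_vars One = {}"
| "tm_vars (Add s t) = tm_vars s \<union> tm_vars t"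
| "tm_vars (Mult s t) = tm_vars s \<union> tm_vars t"

primrec fm_frees :: "fm \<Rightarrow> nat set" where
  "fm_frees (Eq s t) = tm_vars s \<union> tm_vars t"
| "fm_frees (Less s t) = tm_vars s \<union> tm_vars t"
| "fm_frees (Neg \<phi>) = fm_frees \<phi>"
| "fm_frees (Or \<phi> \<psi>) = fm_frees \<phi> \<union> fm_frees \<psi>"
| "fm_frees (Exists n \<phi>) = fm_frees \<phi> - {n}"

definition models_PA :: "'a arith \<Rightarrow> bool" where
  "models_PA M \<longleftrightarrow>
    (\<forall>x. x \<oplus>\<^bsub>M\<^esub> \<one>\<^bsub>M\<^esub> \<noteq> \<zero>\<^bsub>M\<^esub>) \<and>
    (\<forall>x y. x \<oplus>\<^bsub>M\<^esub> \<one>\<^bsub>M\<^esub> = y \<oplus>\<^bsub>M\<^esub> \<one>\<^bsub>M\<^esub> \<longrightarrow> x = y) \<and>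
    (\<forall>x. x \<oplus>\<^bsub>M\<^esub> \<zero>\<^bsub>M\<^esub> = x) \<and>
    (\<forall>x y. x \<oplus>\<^bsub>M\<^esub> (y \<oplus>\<^bsub>M\<^esub> \<one>\<^bsub>M\<^esub>) = (x \<oplus>\<^bsub>M\<^esub> y) \<oplus>\<^bsub>M\<^esub> \<one>\<^bsub>M\<^esub>) \<and>
    (\<forall>x. x \<otimes>\<^bsub>M\<^esub> \<zero>\<^bsub>M\<^esub> = \<zero>\<^bsub>M\<^esub>) \<and>
    (\<forall>x y. x \<otimes>\<^bsub>M\<^esub> (y \<oplus>\<^bsub>M\<^esub> \<one>\<^bsub>M\<^esub>) = (x \<otimes>\<^bsub>M\<^esub> y) \<oplus>\<^bsub>M\<^esub> x) \<and>
    (\<forall>x y. x \<prec>\<^bsub>M\<^esub> y \<longleftrightarrow> (\<exists>z. x \<oplus>\<^bsub>M\<^esub> (z \<oplus>\<^bsub>M\<^esub> \<one>\<^bsub>M\<^esub>) = y)) \<and>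
    (\<forall>\<phi> n e. sat M (e(n := \<zero>\<^bsub>M\<^esub>)) \<phi> \<and>
        (\<forall>a. sat M (e(n := a)) \<phi> \<longrightarrow> sat M (e(n := a \<oplus>\<^bsub>M\<^esub> \<one>\<^bsub>M\<^esub>)) \<phi>)
      \<longrightarrow> (\<forall>a. sat M (e(n := a)) \<phi>))"


section \<open>Recursive saturation\<close>

text \<open>\<open>recfn n f\<close>: on lists of length \<open>n\<close>, \<open>f\<close> is a total recursive function
  (values on lists of other lengths are irrelevant). Minimization is restricted to
  regular functions, so all functions are total.\<close>

inductive recfn :: "nat \<Rightarrow> (nat list \<Rightarrow> nat) \<Rightarrow> bool" where
  zero: "recfn n (\<lambda>xs. 0)"
| succ: "recfn 1 (\<lambda>xs. Suc (hd xs))"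
| proj: "i < n \<Longrightarrow> recfn n (\<lambda>xs. xs ! i)"
| comp: "recfn (length gs) f \<Longrightarrow> (\<And>g. g \<in> set gs \<Longrightarrow> recfn n g)
    \<Longrightarrow> recfn n (\<lambda>xs. f (map (\<lambda>g. g xs) gs))"
| prim: "recfn n f \<Longrightarrow> recfn (Suc (Suc n)) g
    \<Longrightarrow> recfn (Suc n) (\<lambda>xs. rec_nat (f (tl xs)) (\<lambda>k r. g (k # r # tl xs)) (hd xs))"
| mu: "recfn (Suc n) f \<Longrightarrow> (\<And>xs. length xs = n \<Longrightarrow> \<exists>k. f (k # xs) = 0)
    \<Longrightarrow> recfn n (\<lambda>xs. LEAST k. f (k # xs) = 0)"

definition recursive_set :: "nat set \<Rightarrow> bool" where
  "recursive_set A \<longleftrightarrow> (\<exists>f. recfn 1 f \<and> (\<forall>n. f [n] = (if n \<in> A then 1 else 0)))"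

primrec tm_num :: "tm \<Rightarrow> nat" where
  "tm_num (Var n) = prod_encode (0, n)"
| "tm_num Zero = prod_encode (1, 0)"
| "tm_num One = prod_encode (2, 0)"
| "tm_num (Add s t) = prod_encode (3, prod_encode (tm_num s, tm_num t))"
| "tm_num (Mult s t) = prod_encode (4, prod_encode (tm_num s, tm_num t))"

primrec fm_num :: "fm \<Rightarrow> nat" where
  "fm_num (Eq s t) = prod_encode (5, prod_encode (tm_num s, tm_num t))"
| "fm_num (Less s t) = prod_encode (6, prod_encode (tm_num s, tm_num t))"
| "fm_num (Neg \<phi>) = prod_encode (7, fm_num \<phi>)"
| "fm_num (Or \<phi> \<psi>) = prod_encode (8, prod_encode (fm_num \<phi>, fm_num \<psi>))"
| "fm_num (Exists n \<phi>) = prod_encode (9, prod_encode (n, fm_num \<phi>))"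

text \<open>The type variable is \<open>Var 0\<close>; the bound \<open>k\<close> makes the parameters
  \<open>e 1, \<dots>, e k\<close> a finite tuple.\<close>

definition rec_saturated :: "'a arith \<Rightarrow> bool" where
  "rec_saturated M \<longleftrightarrow>
    (\<forall>p k e. recursive_set (fm_num ` p) \<and> (\<forall>\<phi>\<in>p. fm_frees \<phi> \<subseteq> {..k}) \<and>
        (\<forall>q. finite q \<and> q \<subseteq> p \<longrightarrow> (\<exists>a. \<forall>\<phi>\<in>q. sat M (e(0 := a)) \<phi>))
      \<longrightarrow> (\<exists>a. \<forall>\<phi>\<in>p. sat M (e(0 := a)) \<phi>))"


section \<open>Templates\<close>

text \<open>\<open>TEx n\<close> and \<open>TAll n\<close> quantify over the dummy variable with index \<open>n\<close>.\<close>

datatype template = LetterP | LetterQ | TNeg template | TOr template template | TAnd template template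
  | TImp template template | TIff template template | TEx nat template | TAll nat template

text \<open>Since the letters stand for sentences, the dummy quantifiers are semantically void.\<close>

primrec teval :: "template \<Rightarrow> bool \<Rightarrow> bool \<Rightarrow> bool" where
  "teval LetterP p q \<longleftrightarrow> p"
| "teval LetterQ p q \<longleftrightarrow> q"
| "teval (TNeg A) p q \<longleftrightarrow> \<not> teval A p q"
| "teval (TOr A B) p q \<longleftrightarrow> teval A p q \<or> teval B p q"
| "teval (TAnd A B) p q \<longleftrightarrow> teval A p q \<and> teval B p q"
| "teval (TImp A B) p q \<longleftrightarrow> (teval A p q \<longrightarrow> teval B p q)"
| "teval (TIff A B) p q \<longleftrightarrow> (teval A p q \<longleftrightarrow> teval B p q)"
| "teval (TEx n A) p q \<longleftrightarrow> teval A p q"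
| "teval (TAll n A) p q \<longleftrightarrow> teval A p q"

primrec tdepth :: "template \<Rightarrow> nat" where
  "tdepth LetterP = 0"
| "tdepth LetterQ = 0"
| "tdepth (TNeg A) = Suc (tdepth A)"
| "tdepth (TOr A B) = Suc (max (tdepth A) (tdepth B))"
| "tdepth (TAnd A B) = Suc (max (tdepth A) (tdepth B))"
| "tdepth (TImp A B) = Suc (max (tdepth A) (tdepth B))"
| "tdepth (TIff A B) = Suc (max (tdepth A) (tdepth B))"
| "tdepth (TEx n A) = Suc (tdepth A)"
| "tdepth (TAll n A) = Suc (tdepth A)"

primrec letters :: "template \<Rightarrow> template set" where
  "letters LetterP = {LetterP}"
| "letters LetterQ = {LetterQ}"
| "letters (TNeg A) = letters A"
| "letters (TOr A B) = letters A \<union> letters B"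
| "letters (TAnd A B) = letters A \<union> letters B"
| "letters (TImp A B) = letters A \<union> letters B"
| "letters (TIff A B) = letters A \<union> letters B"
| "letters (TEx n A) = letters A"
| "letters (TAll n A) = letters A"

definition is_template :: "template \<Rightarrow> bool" where
  "is_template \<Phi> \<longleftrightarrow>
    \<not> (\<forall>p q. teval \<Phi> p q \<longleftrightarrow> p) \<and>
    tdepth \<Phi> \<noteq> 0 \<and>
    LetterQ \<in> letters \<Phi> \<and>
    (\<forall>p q. p \<and> q \<longrightarrow> teval \<Phi> p q) \<and>
    (\<forall>p q. \<not> p \<and> \<not> q \<longrightarrow> \<not> teval \<Phi> p q)"

definition accessible :: "template \<Rightarrow> bool" where
  "accessible \<Phi> \<longleftrightarrow> LetterP \<in> letters \<Phi>"

abbreviation additive :: "template \<Rightarrow> bool" where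
  "additive \<Phi> \<equiv> \<not> accessible \<Phi>"


section \<open>Arithmetized syntax inside a structure\<close>

text \<open>All quantifiers and descriptions below range over the domain of \<open>M\<close>, and the
  defining conditions are first-order in the arithmetical operations of \<open>M\<close>: each definition
  is the interpretation in \<open>M\<close> of a parameter-free formula of arithmetic, and the descriptions
  have unique solutions whenever \<open>M\<close> is a model of PA and the arguments are of the intended
  kind.\<close>

primrec num :: "'a arith \<Rightarrow> nat \<Rightarrow> 'a" where
  "num M 0 = azero M"
| "num M (Suc n) = aadd M (num M n) (aone M)"

context
  fixes M :: "'a arith" (structure)
begin

definition le :: "'a \<Rightarrow> 'a \<Rightarrow> bool" where
  "le x y \<longleftrightarrow> x \<prec> y \<or> x = y"

definition monus :: "'a \<Rightarrow> 'a \<Rightarrow> 'a" where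
  "monus x y = (if le y x then THE z. x = y \<oplus> z else \<zero>)"

definition quot :: "'a \<Rightarrow> 'a \<Rightarrow> 'a" where
  "quot x d = (THE q. \<exists>r. x = q \<otimes> d \<oplus> r \<and> r \<prec> d)"

text \<open>Cantor pairing, agreeing with \<^const>\<open>prod_encode\<close> on the natural numbers; hence
  the code in \<open>M\<close> of a standard formula \<open>\<phi>\<close> is \<open>num M (fm_num \<phi>)\<close>.\<close>

definition pair :: "'a \<Rightarrow> 'a \<Rightarrow> 'a" where
  "pair x y = (THE z. z \<oplus> z = (x \<oplus> y) \<otimes> (x \<oplus> y \<oplus> \<one>) \<oplus> (x \<oplus> x))"

text \<open>The element \<open>(w)\<^sub>i\<close> of the sequence coded by \<open>w\<close>, by the Goedel beta function:
  if \<open>w\<close> is the pair of \<open>a\<close> and \<open>b\<close>, it is the remainder of \<open>a\<close> modulo \<open>1 + (i + 1) b\<close>.\<close>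

definition nth_elem :: "'a \<Rightarrow> 'a \<Rightarrow> 'a" where
  "nth_elem w i = (THE y. \<exists>a b q. w = pair a b \<and>
      a = q \<otimes> (\<one> \<oplus> (i \<oplus> \<one>) \<otimes> b) \<oplus> y \<and> y \<prec> \<one> \<oplus> (i \<oplus> \<one>) \<otimes> b)"

definition pow2 :: "'a \<Rightarrow> 'a" where
  "pow2 x = (THE y. \<exists>s. nth_elem s \<zero> = \<one> \<and>
      (\<forall>i. i \<prec> x \<longrightarrow> nth_elem s (i \<oplus> \<one>) = nth_elem s i \<oplus> nth_elem s i) \<and>
      nth_elem s x = y)"

text \<open>Ackermann membership: the binary digit of \<open>c\<close> at position \<open>x\<close> is 1. Coded sets are
  extensional, and \<open>\<zero>\<close> codes the empty set.\<close>

definition mem :: "'a \<Rightarrow> 'a \<Rightarrow> bool" (infix \<open>\<epsilon>\<close> 50) where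
  "x \<epsilon> c \<longleftrightarrow> (\<exists>q r. c = (q \<oplus> q \<oplus> \<one>) \<otimes> pow2 x \<oplus> r \<and> r \<prec> pow2 x)"

definition cVar :: "'a \<Rightarrow> 'a" where "cVar x = pair (num M 0) x"
definition cZero :: 'a where "cZero = pair (num M 1) \<zero>"
definition cOne :: 'a where "cOne = pair (num M 2) \<zero>"
definition cAdd :: "'a \<Rightarrow> 'a \<Rightarrow> 'a" where "cAdd s t = pair (num M 3) (pair s t)"
definition cMult :: "'a \<Rightarrow> 'a \<Rightarrow> 'a" where "cMult s t = pair (num M 4) (pair s t)"
definition cEq :: "'a \<Rightarrow> 'a \<Rightarrow> 'a" where "cEq s t = pair (num M 5) (pair s t)"
definition cLess :: "'a \<Rightarrow> 'a \<Rightarrow> 'a" where "cLess s t = pair (num M 6) (pair s t)"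
definition cNeg :: "'a \<Rightarrow> 'a" where "cNeg \<phi> = pair (num M 7) \<phi>"
definition cOr :: "'a \<Rightarrow> 'a \<Rightarrow> 'a" where "cOr \<phi> \<psi> = pair (num M 8) (pair \<phi> \<psi>)"
definition cEx :: "'a \<Rightarrow> 'a \<Rightarrow> 'a" where "cEx x \<phi> = pair (num M 9) (pair x \<phi>)"

definition cAnd :: "'a \<Rightarrow> 'a \<Rightarrow> 'a" where "cAnd \<phi> \<psi> = cNeg (cOr (cNeg \<phi>) (cNeg \<psi>))"
definition cImp :: "'a \<Rightarrow> 'a \<Rightarrow> 'a" where "cImp \<phi> \<psi> = cOr (cNeg \<phi>) \<psi>"
definition cAll :: "'a \<Rightarrow> 'a \<Rightarrow> 'a" where "cAll x \<phi> = cNeg (cEx x (cNeg \<phi>))"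

text \<open>Recursive notions are defined through \<open>M\<close>-finite (coded) sets \<open>C\<close> closed under passing
  to the constituents required by the recursion. Codes of proper constituents are smaller,
  so this is well-founded in \<open>M\<close>.\<close>

definition Term :: "'a \<Rightarrow> bool" where
  "Term t \<longleftrightarrow> (\<exists>C. t \<epsilon> C \<and> (\<forall>u. u \<epsilon> C \<longrightarrow>
      (\<exists>x. u = cVar x) \<or> u = cZero \<or> u = cOne \<or>
      (\<exists>r s. r \<epsilon> C \<and> s \<epsilon> C \<and> (u = cAdd r s \<or> u = cMult r s))))"

definition Form :: "'a \<Rightarrow> bool" where
  "Form \<phi> \<longleftrightarrow> (\<exists>C. \<phi> \<epsilon> C \<and> (\<forall>u. u \<epsilon> C \<longrightarrow>
      (\<exists>s t. Term s \<and> Term t \<and> (u = cEq s t \<or> u = cLess s t)) \<or>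
      (\<exists>\<psi>. \<psi> \<epsilon> C \<and> u = cNeg \<psi>) \<or>
      (\<exists>\<psi> \<chi>. \<psi> \<epsilon> C \<and> \<chi> \<epsilon> C \<and> u = cOr \<psi> \<chi>) \<or>
      (\<exists>x \<psi>. \<psi> \<epsilon> C \<and> u = cEx x \<psi>)))"

text \<open>\<open>Free x u\<close>: the variable with index \<open>x\<close> occurs free in the term or formula \<open>u\<close>; the
  set \<open>C\<close> contains a path in the syntax tree of \<open>u\<close> leading to a free occurrence.\<close>

definition Free :: "'a \<Rightarrow> 'a \<Rightarrow> bool" where
  "Free x u \<longleftrightarrow> (\<exists>C. u \<epsilon> C \<and> (\<forall>w. w \<epsilon> C \<longrightarrow>
      w = cVar x \<or>
      (\<exists>s t. (s \<epsilon> C \<or> t \<epsilon> C) \<and>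
        (w = cAdd s t \<or> w = cMult s t \<or> w = cEq s t \<or> w = cLess s t \<or> w = cOr s t)) \<or>
      (\<exists>\<psi>. \<psi> \<epsilon> C \<and> w = cNeg \<psi>) \<or>
      (\<exists>y \<psi>. y \<noteq> x \<and> \<psi> \<epsilon> C \<and> w = cEx y \<psi>)))"

definition Sent :: "'a \<Rightarrow> bool" where
  "Sent \<phi> \<longleftrightarrow> Form \<phi> \<and> (\<forall>x. \<not> Free x \<phi>)"

text \<open>Assignments for \<open>\<phi>\<close> are coded functions whose domain is exactly the set of free
  variables of \<open>\<phi>\<close>.\<close>

definition Asn :: "'a \<Rightarrow> 'a \<Rightarrow> bool" where
  "Asn \<alpha> \<phi> \<longleftrightarrow>
    (\<forall>u. u \<epsilon> \<alpha> \<longrightarrow> (\<exists>x y. u = pair x y \<and> Free x \<phi>)) \<and>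
    (\<forall>x. Free x \<phi> \<longrightarrow> (\<exists>!y. pair x y \<epsilon> \<alpha>))"

definition restr :: "'a \<Rightarrow> 'a \<Rightarrow> 'a" where
  "restr \<alpha> \<phi> = (THE \<beta>. \<forall>u. u \<epsilon> \<beta> \<longleftrightarrow> u \<epsilon> \<alpha> \<and> (\<exists>x y. u = pair x y \<and> Free x \<phi>))"

text \<open>\<open>C\<close> contains the values under \<open>\<alpha>\<close> of \<open>t\<close> and its subterms.\<close>

definition val :: "'a \<Rightarrow> 'a \<Rightarrow> 'a" where
  "val t \<alpha> = (THE v. \<exists>C. pair t v \<epsilon> C \<and> (\<forall>w. w \<epsilon> C \<longrightarrow>
      (\<exists>x a. w = pair (cVar x) a \<and> pair x a \<epsilon> \<alpha>) \<or>
      w = pair cZero \<zero> \<or>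
      w = pair cOne \<one> \<or>
      (\<exists>r s a b. pair r a \<epsilon> C \<and> pair s b \<epsilon> C \<and>
        (w = pair (cAdd r s) (a \<oplus> b) \<or> w = pair (cMult r s) (a \<otimes> b)))))"

definition CS_minus :: "('a \<times> 'a) set \<Rightarrow> bool" where
  "CS_minus S \<longleftrightarrow>
    (\<forall>\<phi> \<alpha>. (\<phi>, \<alpha>) \<in> S \<longrightarrow> Form \<phi> \<and> Asn \<alpha> \<phi>) \<and>
    (\<forall>s t \<alpha>. Term s \<and> Term t \<and> Asn \<alpha> (cEq s t) \<longrightarrow>
      ((cEq s t, \<alpha>) \<in> S \<longleftrightarrow> val s \<alpha> = val t \<alpha>)) \<and>
    (\<forall>s t \<alpha>. Term s \<and> Term t \<and> Asn \<alpha> (cLess s t) \<longrightarrow>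
      ((cLess s t, \<alpha>) \<in> S \<longleftrightarrow> val s \<alpha> \<prec> val t \<alpha>)) \<and>
    (\<forall>\<phi> \<alpha>. Form \<phi> \<and> Asn \<alpha> (cNeg \<phi>) \<longrightarrow>
      ((cNeg \<phi>, \<alpha>) \<in> S \<longleftrightarrow> (\<phi>, \<alpha>) \<notin> S)) \<and>
    (\<forall>\<phi> \<psi> \<alpha>. Form \<phi> \<and> Form \<psi> \<and> Asn \<alpha> (cOr \<phi> \<psi>) \<longrightarrow>
      ((cOr \<phi> \<psi>, \<alpha>) \<in> S \<longleftrightarrow> (\<phi>, restr \<alpha> \<phi>) \<in> S \<or> (\<psi>, restr \<alpha> \<psi>) \<in> S)) \<and>
    (\<forall>x \<phi> \<alpha>. Form \<phi> \<and> Asn \<alpha> (cEx x \<phi>) \<longrightarrow>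
      ((cEx x \<phi>, \<alpha>) \<in> S \<longleftrightarrow>
        (\<exists>\<beta>. Asn \<beta> \<phi> \<and> (\<forall>y a. y \<noteq> x \<longrightarrow> (pair y a \<epsilon> \<beta> \<longleftrightarrow> pair y a \<epsilon> \<alpha>)) \<and>
          (\<phi>, \<beta>) \<in> S)))"

definition Tr :: "('a \<times> 'a) set \<Rightarrow> 'a \<Rightarrow> bool" where
  "Tr S \<phi> \<longleftrightarrow> (\<phi>, \<zero>) \<in> S"

primrec tsubst :: "template \<Rightarrow> 'a \<Rightarrow> 'a \<Rightarrow> 'a" where
  "tsubst LetterP \<phi> \<psi> = \<phi>"
| "tsubst LetterQ \<phi> \<psi> = \<psi>"
| "tsubst (TNeg A) \<phi> \<psi> = cNeg (tsubst A \<phi> \<psi>)"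
| "tsubst (TOr A B) \<phi> \<psi> = cOr (tsubst A \<phi> \<psi>) (tsubst B \<phi> \<psi>)"
| "tsubst (TAnd A B) \<phi> \<psi> = cAnd (tsubst A \<phi> \<psi>) (tsubst B \<phi> \<psi>)"
| "tsubst (TImp A B) \<phi> \<psi> = cImp (tsubst A \<phi> \<psi>) (tsubst B \<phi> \<psi>)"
| "tsubst (TIff A B) \<phi> \<psi> = cAnd (cImp (tsubst A \<phi> \<psi>) (tsubst B \<phi> \<psi>))
                                (cImp (tsubst B \<phi> \<psi>) (tsubst A \<phi> \<psi>))"
| "tsubst (TEx n A) \<phi> \<psi> = cEx (num M n) (tsubst A \<phi> \<psi>)"
| "tsubst (TAll n A) \<phi> \<psi> = cAll (num M n) (tsubst A \<phi> \<psi>)"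

text \<open>\<open>F(0, \<phi>) = \<phi>\<close> and \<open>F(x + 1, \<phi>) = \<Phi>(\<phi>, F(x, \<phi>))\<close>, where the recursion is carried
  out in \<open>M\<close>.\<close>

definition F_op :: "template \<Rightarrow> 'a \<Rightarrow> 'a \<Rightarrow> 'a" where
  "F_op \<Phi> y \<phi> = (THE \<psi>. \<exists>s. nth_elem s \<zero> = \<phi> \<and>
      (\<forall>i. i \<prec> y \<longrightarrow> nth_elem s (i \<oplus> \<one>) = tsubst \<Phi> \<phi> (nth_elem s i)) \<and>
      nth_elem s y = \<psi>)"


section \<open>Cuts\<close>

text \<open>A cut is not required to be proper.\<close>

definition is_cut :: "'a set \<Rightarrow> bool" where
  "is_cut I \<longleftrightarrow> I \<noteq> {} \<and> (\<forall>x\<in>I. \<forall>y. y \<prec> x \<longrightarrow> y \<in> I) \<and> (\<forall>x\<in>I. x \<oplus> \<one> \<in> I)"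

definition above :: "'a \<Rightarrow> 'a set \<Rightarrow> bool" where
  "above x I \<longleftrightarrow> (\<forall>i\<in>I. i \<prec> x)"

definition F_closed :: "template \<Rightarrow> 'a set \<Rightarrow> bool" where
  "F_closed \<Phi> I \<longleftrightarrow>
    accessible \<Phi> \<or> (additive \<Phi> \<and> (\<forall>x\<in>I. \<forall>y\<in>I. x \<oplus> y \<in> I))"

definition no_least_gap :: "template \<Rightarrow> 'a set \<Rightarrow> bool" where
  "no_least_gap \<Phi> I \<longleftrightarrow>
    (accessible \<Phi> \<longrightarrow>
      (\<forall>x. above x I \<longrightarrow> (\<exists>y. \<forall>n. y \<prec> monus x (num M n) \<and> above y I))) \<and>
    (additive \<Phi> \<longrightarrow>
      (\<forall>x. above x I \<longrightarrow> (\<exists>y. \<forall>n\<ge>1. y \<prec> quot x (num M n) \<and> above y I)))"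

definition separable :: "'a set \<Rightarrow> bool" where
  "separable I \<longleftrightarrow> (\<forall>a. \<exists>c. \<forall>n. nth_elem a (num M n) \<in> I \<longleftrightarrow> num M n \<epsilon> c)"

end

end

theory Submission
  imports Defs
begin

text \<open>The satisfaction class is the union of a countable chain of partial satisfaction classes,
  each living on the subformulas of a single formula together with the bases \<open>\<phi>\<close> of all
  \<open>F(y, \<phi>)\<close> among them. A stage keeps only finitely many decisions of the previous one,
  and by recursive saturation its class exists as soon as every finite set of formulas has an
  approximation. The approximations exist because the truth value of \<open>F(y, \<phi>)\<close> may be
  prescribed by any rule depending on \<open>y\<close>, on \<open>\<phi>\<close> and on the truth value of \<open>\<phi>\<close> that is
  unchanged under \<open>y \<mapsto> y + 1\<close> and respects the truth table of the template.

  If \<open>I\<close> is separable, the rule flips the truth value of \<open>F(y, \<phi>)\<close> exactly for \<open>y \<notin> I\<close>,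
  for one fixed sentence \<open>\<phi>\<close>; separability makes this rule coded at standard indices. If \<open>I\<close>
  has no least gap above it, take thresholds \<open>d\<^sub>0 > d\<^sub>1 > \<dots>\<close> coinitial above \<open>I\<close>, a gap apart.
  Each stage makes \<open>F(d, \<phi>)\<close> differ from a fresh sentence \<open>\<phi>\<close> for the current threshold \<open>d\<close>,
  while \<open>F(y, \<psi>)\<close> keeps agreeing with \<open>\<psi>\<close> for all \<open>y\<close> up to the next threshold.\<close>

section \<open>Definable predicates\<close>

text \<open>A satisfaction class is not an element of \<open>M\<close>, so no single type can be
  realized by it. It is assembled in \<omega> rounds of a game whose positions are coded sets of
  decisions, and recursive saturation is applied once per round. The class of the previous stage may
  be infinite and external: each approximation extends all of it, since saturation only asks that
  approximations exist for every standard length, while the types mention nothing but coded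
  decisions.

  A truth value for F(y, \<phi>) can be prescribed because a finite set of formulas sees only
  finitely many single steps of the operator. A Tarski clause links y to y + 1 and never crosses a
  nonstandard distance, so a rule that is constant along single steps contradicts no clause. Depth 1
  keeps the formulas between F(y, \<phi>) and F(y + 1, \<phi>) few and explicit.

  Bases are there to make the prescription unambiguous: for an additive operator F(y, F(z, \<phi>))
  = F(y + z, \<phi>). The sum in this identity is also the reason for closure under addition and for
  gaps that are measured by multiples and not by steps.\<close>

lemma tm_val_cong: "(\<And>n. n \<in> tm_vars t \<Longrightarrow> e n = e' n) \<Longrightarrow> tm_val M e t = tm_val M e' t"
  by (induction t) auto

lemma sat_cong: "(\<And>n. n \<in> fm_frees \<phi> \<Longrightarrow> e n = e' n) \<Longrightarrow> sat M e \<phi> \<longleftrightarrow> sat M e' \<phi>"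
proof (induction \<phi> arbitrary: e e')
  case (Eq s t)
  then show ?case using tm_val_cong[of s e e' M] tm_val_cong[of t e e' M] by auto
next
  case (Less s t)
  then show ?case using tm_val_cong[of s e e' M] tm_val_cong[of t e e' M] by auto
next
  case (Neg \<phi>)
  then show ?case by (metis fm_frees.simps(3) sat.simps(3))
next
  case (Or \<phi> \<psi>)
  then show ?case by (metis UnCI fm_frees.simps(4) sat.simps(4))
next
  case (Exists n \<phi>)
  have "sat M (e(n := a)) \<phi> \<longleftrightarrow> sat M (e'(n := a)) \<phi>" for a
    by (rule Exists.IH) (use Exists.prems in auto)
  then show ?case by simp
qed

lemma finite_tm_vars [simp]: "finite (tm_vars t)" by (induction t) auto

lemma finite_fm_frees [simp]: "finite (fm_frees \<phi>)" by (induction \<phi>) auto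

section \<open>Simultaneous renaming of variables\<close>

lemma tm_rename: "\<exists>t'. \<forall>e. tm_val M e t' = tm_val M (\<lambda>n. e (\<tau> n)) t"
proof (induction t)
  case (Var n)
  show ?case by (rule exI[of _ "Var (\<tau> n)"]) simp
next
  case Zero
  show ?case by (rule exI[of _ Zero]) simp
next
  case One
  show ?case by (rule exI[of _ One]) simp
next
  case (Add s t)
  then obtain s' t' where "\<forall>e. tm_val M e s' = tm_val M (\<lambda>n. e (\<tau> n)) s"
    "\<forall>e. tm_val M e t' = tm_val M (\<lambda>n. e (\<tau> n)) t" by blast
  then show ?case by (intro exI[of _ "Add s' t'"]) simp
next
  case (Mult s t)
  then obtain s' t' where "\<forall>e. tm_val M e s' = tm_val M (\<lambda>n. e (\<tau> n)) s"
    "\<forall>e. tm_val M e t' = tm_val M (\<lambda>n. e (\<tau> n)) t" by blast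
  then show ?case by (intro exI[of _ "Mult s' t'"]) simp
qed

text \<open>The renaming \<open>\<tau>\<close> may identify variables, which later uses do on
  purpose. Capture is avoided by giving the bound variable an index outside the image of the free
  variables.\<close>

lemma fm_rename: "\<exists>\<phi>'. \<forall>e. sat M e \<phi>' \<longleftrightarrow> sat M (\<lambda>n. e (\<tau> n)) \<phi>"
proof (induction \<phi> arbitrary: \<tau>)
  case (Eq s t)
  obtain s' t' where "\<forall>e. tm_val M e s' = tm_val M (\<lambda>n. e (\<tau> n)) s"
    "\<forall>e. tm_val M e t' = tm_val M (\<lambda>n. e (\<tau> n)) t" using tm_rename by metis
  then show ?case by (intro exI[of _ "Eq s' t'"]) simp
next
  case (Less s t)
  obtain s' t' where "\<forall>e. tm_val M e s' = tm_val M (\<lambda>n. e (\<tau> n)) s"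
    "\<forall>e. tm_val M e t' = tm_val M (\<lambda>n. e (\<tau> n)) t" using tm_rename by metis
  then show ?case by (intro exI[of _ "Less s' t'"]) simp
next
  case (Neg \<phi>)
  obtain \<phi>' where "\<forall>e. sat M e \<phi>' \<longleftrightarrow> sat M (\<lambda>n. e (\<tau> n)) \<phi>" using Neg by blast
  then show ?case by (intro exI[of _ "Neg \<phi>'"]) simp
next
  case (Or \<phi> \<psi>)
  obtain \<phi>' where "\<forall>e. sat M e \<phi>' \<longleftrightarrow> sat M (\<lambda>n. e (\<tau> n)) \<phi>" using Or by blast
  moreover obtain \<psi>' where "\<forall>e. sat M e \<psi>' \<longleftrightarrow> sat M (\<lambda>n. e (\<tau> n)) \<psi>" using Or by blast
  ultimately show ?case by (intro exI[of _ "Or \<phi>' \<psi>'"]) simp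
next
  case (Exists n \<phi>)
  obtain m where m: "m \<notin> \<tau> ` fm_frees \<phi>"
    using ex_new_if_finite[of "\<tau> ` fm_frees \<phi>"] by auto
  obtain \<phi>' where \<phi>': "\<forall>e. sat M e \<phi>' \<longleftrightarrow> sat M (\<lambda>i. e ((\<tau>(n := m)) i)) \<phi>"
    using Exists by blast
  have "sat M (\<lambda>i. (e(m := a)) ((\<tau>(n := m)) i)) \<phi> \<longleftrightarrow> sat M ((\<lambda>i. e (\<tau> i))(n := a)) \<phi>" for e a
    by (rule sat_cong) (use m in auto)
  with \<phi>' show ?case by (intro exI[of _ "Exists m \<phi>'"]) simp
qed

definition mix :: "(nat \<Rightarrow> 'a) \<Rightarrow> (nat \<Rightarrow> 'a) \<Rightarrow> nat \<Rightarrow> 'a" where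
  "mix p e = (\<lambda>i. if even i then p (i div 2) else e (i div 2))"

lemma mix_even [simp]: "mix p e (2 * i) = p i" and mix_odd [simp]: "mix p e (Suc (2 * i)) = e i"
  by (simp_all add: mix_def)

text \<open>\<open>pdf M P\<close>: definability with parameters; the environment of the defining formula
  interleaves the parameters (even indices) with the arguments (odd indices). Under
  the quantifier rules below the arguments behave like de Bruijn indices.\<close>

definition pdf :: "'a arith \<Rightarrow> ((nat \<Rightarrow> 'a) \<Rightarrow> bool) \<Rightarrow> bool" where
  "pdf M P \<longleftrightarrow> (\<exists>\<phi> p. \<forall>e. P e \<longleftrightarrow> sat M (mix p e) \<phi>)"

definition pdfun :: "'a arith \<Rightarrow> ((nat \<Rightarrow> 'a) \<Rightarrow> 'a) \<Rightarrow> bool" where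
  "pdfun M f \<longleftrightarrow> pdf M (\<lambda>e. e 0 = f (\<lambda>n. e (Suc n)))"

named_theorems pdf_intros

lemma pdfI: "(\<And>e. P e \<longleftrightarrow> sat M (mix p e) \<phi>) \<Longrightarrow> pdf M P"
  unfolding pdf_def by blast

lemma pdf_rename: assumes "pdf M P" shows "pdf M (\<lambda>e. P (\<lambda>n. e (\<tau> n)))"
proof -
  obtain \<phi> p where \<phi>: "\<And>e. P e \<longleftrightarrow> sat M (mix p e) \<phi>" using assms unfolding pdf_def by blast
  define \<sigma> where "\<sigma> i = (if even i then i else Suc (2 * \<tau> (i div 2)))" for i
  obtain \<phi>' where \<phi>': "\<forall>e. sat M e \<phi>' \<longleftrightarrow> sat M (\<lambda>n. e (\<sigma> n)) \<phi>" using fm_rename by blast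
  have "(\<lambda>n. mix p e (\<sigma> n)) = mix p (\<lambda>n. e (\<tau> n))" for e
    by (auto simp: mix_def \<sigma>_def fun_eq_iff)
  then show ?thesis using \<phi> \<phi>' by (intro pdfI[of _ _ p \<phi>']) simp
qed

lemma pdf_not [pdf_intros]: assumes "pdf M P" shows "pdf M (\<lambda>e. \<not> P e)"
proof -
  obtain \<phi> p where \<phi>: "\<And>e. P e \<longleftrightarrow> sat M (mix p e) \<phi>" using assms unfolding pdf_def by blast
  show ?thesis by (rule pdfI[of _ _ p "Neg \<phi>"]) (simp add: \<phi>)
qed

lemma pdf_common:
  assumes "pdf M P" "pdf M Q"
  obtains p \<phi> \<psi> where "\<And>e. P e \<longleftrightarrow> sat M (mix p e) \<phi>" "\<And>e. Q e \<longleftrightarrow> sat M (mix p e) \<psi>"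
proof -
  obtain \<phi> p where \<phi>: "\<And>e. P e \<longleftrightarrow> sat M (mix p e) \<phi>" using assms unfolding pdf_def by blast
  obtain \<psi> q where \<psi>: "\<And>e. Q e \<longleftrightarrow> sat M (mix q e) \<psi>" using assms unfolding pdf_def by blast
  \<comment> \<open>The merged parameter sequence is itself interleaved as \<open>mix p q\<close>,
    so \<open>p k\<close> moves from position 2k to 4k and \<open>q k\<close> from 2k to 4k + 2. Odd
    positions, the arguments, stay.\<close>
  define \<sigma> where "\<sigma> i = (if even i then 2 * i else i)" for i :: nat
  define \<rho> where "\<rho> i = (if even i then 2 * Suc i else i)" for i :: nat
  obtain \<phi>' where \<phi>': "\<forall>e. sat M e \<phi>' \<longleftrightarrow> sat M (\<lambda>n. e (\<sigma> n)) \<phi>" using fm_rename by blast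
  obtain \<psi>' where \<psi>': "\<forall>e. sat M e \<psi>' \<longleftrightarrow> sat M (\<lambda>n. e (\<rho> n)) \<psi>" using fm_rename by blast
  have 1: "(\<lambda>n. mix (mix p q) e (\<sigma> n)) = mix p e" for e
    by (auto simp: mix_def \<sigma>_def fun_eq_iff)
  have 2: "(\<lambda>n. mix (mix p q) e (\<rho> n)) = mix q e" for e
  proof
    fix n
    obtain k where "n = 2 * k \<or> n = Suc (2 * k)" by (metis evenE oddE Suc_eq_plus1)
    then show "mix (mix p q) e (\<rho> n) = mix q e n"
      by (auto simp: \<rho>_def mix_def)
  qed
  show ?thesis by (rule that[of "mix p q" \<phi>' \<psi>']) (simp_all add: \<phi> \<psi> \<phi>' \<psi>' 1 2)
qed

lemma pdf_or [pdf_intros]: assumes "pdf M P" "pdf M Q" shows "pdf M (\<lambda>e. P e \<or> Q e)"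
proof -
  obtain p \<phi> \<psi> where "\<And>e. P e \<longleftrightarrow> sat M (mix p e) \<phi>" "\<And>e. Q e \<longleftrightarrow> sat M (mix p e) \<psi>"
    using pdf_common[OF assms] by blast
  then show ?thesis by (intro pdfI[of _ _ p "Or \<phi> \<psi>"]) simp
qed

lemma pdf_and [pdf_intros]: assumes "pdf M P" "pdf M Q" shows "pdf M (\<lambda>e. P e \<and> Q e)"
  using pdf_not[OF pdf_or[OF pdf_not[OF assms(1)] pdf_not[OF assms(2)]]] by simp

lemma pdf_imp [pdf_intros]: assumes "pdf M P" "pdf M Q" shows "pdf M (\<lambda>e. P e \<longrightarrow> Q e)"
  unfolding imp_conv_disj by (rule pdf_or[OF pdf_not[OF assms(1)] assms(2)])

lemma pdf_iff [pdf_intros]: assumes "pdf M P" "pdf M Q" shows "pdf M (\<lambda>e. P e \<longleftrightarrow> Q e)"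
  unfolding iff_conv_conj_imp by (rule pdf_and[OF pdf_imp[OF assms] pdf_imp[OF assms(2,1)]])

lemma pdf_ex [pdf_intros]:
  assumes "pdf M (\<lambda>e. P (e 0) (\<lambda>n. e (Suc n)))"
  shows "pdf M (\<lambda>e. \<exists>x. P x e)"
proof -
  obtain \<phi> p where \<phi>: "\<And>e. P (e 0) (\<lambda>n. e (Suc n)) \<longleftrightarrow> sat M (mix p e) \<phi>"
    using assms unfolding pdf_def by blast
  obtain m where m: "\<forall>n \<in> fm_frees \<phi>. n < m"
    using finite_nat_set_iff_bounded finite_fm_frees by blast
  \<comment> \<open>The quantifier cannot bind index 1: after the shift this index carries the first
    remaining argument. An odd index above all free variables is bound instead, so updating it
    disturbs nothing else that the formula reads.\<close>
  define N where "N = Suc (2 * m)"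
  have N: "n < N" if "n \<in> fm_frees \<phi>" for n
    using that m by (fastforce simp: N_def)
  define \<sigma> where "\<sigma> i = (if even i then i else if i = 1 then N else i - 2)" for i :: nat
  obtain \<phi>' where \<phi>': "\<forall>e. sat M e \<phi>' \<longleftrightarrow> sat M (\<lambda>n. e (\<sigma> n)) \<phi>" using fm_rename by blast
  have "sat M (\<lambda>n. ((mix p e)(N := a)) (\<sigma> n)) \<phi> \<longleftrightarrow> sat M (mix p (case_nat a e)) \<phi>" for a e
  proof (rule sat_cong)
    fix n assume "n \<in> fm_frees \<phi>"
    then have "n < N" by (rule N)
    show "((mix p e)(N := a)) (\<sigma> n) = mix p (case_nat a e) n"
    proof (cases "even n")
      case True
      then show ?thesis by (auto simp: \<sigma>_def mix_def N_def)
    next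
      case False
      then obtain k where k: "n = Suc (2 * k)" by (metis oddE Suc_eq_plus1)
      show ?thesis
      proof (cases k)
        case 0
        then show ?thesis using k by (simp add: \<sigma>_def mix_def)
      next
        case (Suc l)
        then have "\<sigma> n = Suc (2 * l)" "Suc (2 * l) \<noteq> N" using k \<open>n < N\<close> by (auto simp: \<sigma>_def)
        then show ?thesis using k Suc by (metis fun_upd_other mix_odd old.nat.simps(5))
      qed
    qed
  qed
  moreover have "P a e \<longleftrightarrow> sat M (mix p (case_nat a e)) \<phi>" for a e
    using \<phi>[of "case_nat a e"] by simp
  ultimately show ?thesis
    using \<phi>' by (intro pdfI[of _ _ p "Exists N \<phi>'"]) simp
qed

lemma pdf_all [pdf_intros]:
  assumes "pdf M (\<lambda>e. P (e 0) (\<lambda>n. e (Suc n)))"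
  shows "pdf M (\<lambda>e. \<forall>x. P x e)"
  using pdf_not[OF pdf_ex[OF pdf_not[OF assms]]] by simp

lemma pdf_ex1 [pdf_intros]:
  assumes "pdf M (\<lambda>e. P (e 0) (\<lambda>n. e (Suc n)))"
  shows "pdf M (\<lambda>e. \<exists>!x. P x e)"
proof -
  have 2: "pdf M (\<lambda>e. e 0 = e 1)" by (rule pdfI[of _ _ undefined "Eq (Var 1) (Var 3)"]) (simp add: mix_def)
  have 3: "pdf M (\<lambda>e. P (e (0::nat)) (\<lambda>n. e (Suc (Suc n))))"
    using pdf_rename[OF assms, where \<tau> = "\<lambda>i. if i = 0 then 0 else Suc i"] by simp
  have "pdf M (\<lambda>e. \<exists>x. P x e \<and> (\<forall>y. P y e \<longrightarrow> y = x))"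
    using 2 3 assms by (intro pdf_intros) simp_all
  then show ?thesis by (simp add: Ex1_def)
qed

lemma pdf_const [pdf_intros]: "pdf M (\<lambda>e. b)"
  by (rule pdfI[of _ _ undefined "if b then Eq Zero Zero else Neg (Eq Zero Zero)"]) simp

section \<open>Substitution of definable functions\<close>

lemma pdf_sub:
  assumes "pdf M (\<lambda>e. P (e 0) (\<lambda>n. e (Suc n)))" "pdfun M f"
  shows "pdf M (\<lambda>e. P (f e) e)"
proof -
  have "pdf M (\<lambda>e. \<exists>x. x = f e \<and> P x e)" using assms unfolding pdfun_def by (intro pdf_intros)
  then show ?thesis by simp
qed

lemma pdfun_var [pdf_intros]: "pdfun M (\<lambda>e. e i)"
  unfolding pdfun_def by (rule pdfI[of _ _ undefined "Eq (Var 1) (Var (2 * Suc i + 1))"]) (simp add: mix_def)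

lemma pdfun_const [pdf_intros]: "pdfun M (\<lambda>e. c)"
  unfolding pdfun_def by (rule pdfI[of _ _ "\<lambda>_. c" "Eq (Var 1) (Var 0)"]) (simp add: mix_def)

lemma pdfun_rename: "pdfun M f \<Longrightarrow> pdfun M (\<lambda>e. f (\<lambda>n. e (\<tau> n)))"
  using pdf_rename[of M "\<lambda>e. e 0 = f (\<lambda>n. e (Suc n))" "case_nat 0 (\<lambda>n. Suc (\<tau> n))"] by (simp add: pdfun_def)

lemma pdf_app1:
  assumes "pdf M (\<lambda>e. R (e 0))" "pdfun M f" shows "pdf M (\<lambda>e. R (f e))"
  by (rule pdf_sub[of _ "\<lambda>x e. R x", OF assms])

lemma pdf_app2:
  assumes R: "pdf M (\<lambda>e. R (e 0) (e (Suc 0)))" and f: "pdfun M f" and g: "pdfun M g"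
  shows "pdf M (\<lambda>e. R (f e) (g e))"
proof -
  have "pdf M (\<lambda>e. R (e 1) (e 0))"
    using pdf_rename[OF R, where \<tau> = "\<lambda>i. if i = 0 then 1 else 0"] by simp
  then have "pdf M (\<lambda>e. R (e 0) (g (\<lambda>n. e (Suc n))))"
    using pdf_sub[where P = "\<lambda>y e. R (e 0) y" and f = "\<lambda>e. g (\<lambda>n. e (Suc n))"] pdfun_rename[OF g] by simp
  then show ?thesis by (rule pdf_sub[where P = "\<lambda>x e. R x (g e)", OF _ f])
qed

lemma pdf_app3:
  assumes R: "pdf M (\<lambda>e. R (e 0) (e (Suc 0)) (e (Suc (Suc 0))))"
    and f: "pdfun M f" and g: "pdfun M g" and h: "pdfun M h"
  shows "pdf M (\<lambda>e. R (f e) (g e) (h e))"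
proof -
  have "pdf M (\<lambda>e. R (e 1) (e 2) (e 0))"
    using pdf_rename[OF R, where \<tau> = "\<lambda>i. if i = 0 then 1 else if i = 1 then 2 else 0"] by simp
  then have "pdf M (\<lambda>e. R (e 0) (e 1) (h (\<lambda>n. e (n + 2))))"
    using pdf_sub[where P = "\<lambda>y e. R (e 0) (e 1) y" and f = "\<lambda>e. h (\<lambda>n. e (n + 2))"] pdfun_rename[OF h]
    by (simp add: numeral_2_eq_2)
  then have "pdf M (\<lambda>e. R (e 1) (e 0) (h (\<lambda>n. e (n + 2))))"
    using pdf_rename[of M "\<lambda>e. R (e 0) (e 1) (h (\<lambda>n. e (n + 2)))" "\<lambda>i. if i = 0 then 1 else if i = 1 then 0 else i"]
    by simp
  then have "pdf M (\<lambda>e. R (e 0) (g (\<lambda>n. e (Suc n))) (h (\<lambda>n. e (Suc n))))"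
    using pdf_sub[where P = "\<lambda>y e. R (e 0) y (h (\<lambda>n. e (Suc n)))" and f = "\<lambda>e. g (\<lambda>n. e (Suc n))"] pdfun_rename[OF g]
    by simp
  then show ?thesis by (rule pdf_sub[where P = "\<lambda>x e. R x (g e) (h e)", OF _ f])
qed

lemma pdfun_app1:
  assumes "pdfun M (\<lambda>e. h (e 0))" "pdfun M f" shows "pdfun M (\<lambda>e. h (f e))"
  unfolding pdfun_def
  by (rule pdf_app2[where R = "\<lambda>z x. z = h x", OF _ pdfun_var pdfun_rename[OF assms(2)]])
    (use assms(1) in \<open>simp add: pdfun_def\<close>)

lemma pdfun_app2:
  assumes "pdfun M (\<lambda>e. h (e 0) (e (Suc 0)))" "pdfun M f" "pdfun M g"
  shows "pdfun M (\<lambda>e. h (f e) (g e))"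
  unfolding pdfun_def
  by (rule pdf_app3[where R = "\<lambda>z x y. z = h x y", OF _ pdfun_var pdfun_rename[OF assms(2)] pdfun_rename[OF assms(3)]])
    (use assms(1) in \<open>simp add: pdfun_def\<close>)

lemma pdf_eq [pdf_intros]: "pdfun M f \<Longrightarrow> pdfun M g \<Longrightarrow> pdf M (\<lambda>e. f e = g e)"
  by (rule pdf_app2[where R = "(=)"], rule pdfI[of _ _ undefined "Eq (Var 1) (Var 3)"]) (simp_all add: mix_def)

lemma pdf_less [pdf_intros]: "pdfun M f \<Longrightarrow> pdfun M g \<Longrightarrow> pdf M (\<lambda>e. aless M (f e) (g e))"
  by (rule pdf_app2[where R = "aless M"], rule pdfI[of _ _ undefined "Less (Var 1) (Var 3)"]) (simp_all add: mix_def)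

lemma pdfun_add [pdf_intros]: "pdfun M f \<Longrightarrow> pdfun M g \<Longrightarrow> pdfun M (\<lambda>e. aadd M (f e) (g e))"
  by (rule pdfun_app2[where h = "aadd M"], unfold pdfun_def, rule pdfI[of _ _ undefined "Eq (Var 1) (Add (Var 3) (Var 5))"])
    (simp_all add: mix_def pdfun_def flip: numeral_2_eq_2)

lemma pdfun_mult [pdf_intros]: "pdfun M f \<Longrightarrow> pdfun M g \<Longrightarrow> pdfun M (\<lambda>e. amult M (f e) (g e))"
  by (rule pdfun_app2[where h = "amult M"], unfold pdfun_def, rule pdfI[of _ _ undefined "Eq (Var 1) (Mult (Var 3) (Var 5))"])
    (simp_all add: mix_def pdfun_def flip: numeral_2_eq_2)

lemma pdf_le [pdf_intros]: "pdfun M f \<Longrightarrow> pdfun M g \<Longrightarrow> pdf M (\<lambda>e. le M (f e) (g e))"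
  unfolding le_def by (intro pdf_intros)

lemma pdfun_if [pdf_intros]:
  assumes "pdf M P" "pdfun M f" "pdfun M g" shows "pdfun M (\<lambda>e. if P e then f e else g e)"
proof -
  have "pdf M (\<lambda>e. P (\<lambda>n. e (Suc n)))" by (rule pdf_rename[OF assms(1)])
  then have "pdf M (\<lambda>e. P (\<lambda>n. e (Suc n)) \<and> e 0 = f (\<lambda>n. e (Suc n)) \<or> \<not> P (\<lambda>n. e (Suc n)) \<and> e 0 = g (\<lambda>n. e (Suc n)))"
    using assms unfolding pdfun_def by (intro pdf_or pdf_and pdf_not)
  moreover have "(\<lambda>e. P (\<lambda>n. e (Suc n)) \<and> e 0 = f (\<lambda>n. e (Suc n)) \<or> \<not> P (\<lambda>n. e (Suc n)) \<and> e 0 = g (\<lambda>n. e (Suc n)))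
     = (\<lambda>e. e 0 = (if P (\<lambda>n. e (Suc n)) then f (\<lambda>n. e (Suc n)) else g (\<lambda>n. e (Suc n))))"
    by auto
  ultimately show ?thesis by (simp add: pdfun_def)
qed

lemma PA_induct:
  assumes "models_PA M" "pdf M (\<lambda>e. P (e 0))"
    and "P (azero M)" "\<And>a. P a \<Longrightarrow> P (aadd M a (aone M))"
  shows "P a"
proof -
  obtain \<phi> p where \<phi>: "\<And>e. P (e 0) \<longleftrightarrow> sat M (mix p e) \<phi>" using assms unfolding pdf_def by blast
  \<comment> \<open>Index 1 of the interleaved environment is argument 0, hence the variable of the
    induction axiom.\<close>
  have eq: "(mix p (\<lambda>_. x))(1 := a) = mix p ((\<lambda>_. x)(0 := a))" for x a
    by (auto simp: mix_def fun_eq_iff elim!: oddE)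
  have *: "sat M ((mix p (\<lambda>_. x))(1 := a)) \<phi> \<longleftrightarrow> P a" for x a
    unfolding eq by (subst \<phi>[symmetric]) simp
  have "\<forall>\<phi> n e. sat M (e(n := azero M)) \<phi> \<and>
        (\<forall>a. sat M (e(n := a)) \<phi> \<longrightarrow> sat M (e(n := aadd M a (aone M))) \<phi>)
      \<longrightarrow> (\<forall>a. sat M (e(n := a)) \<phi>)"
    using assms(1) unfolding models_PA_def by (elim conjE)
  from this[rule_format, of "mix p (\<lambda>_. a)" 1 \<phi>] show ?thesis using assms(3,4) unfolding * by blast
qed

section \<open>Recursive types and the compactness of games\<close>

text \<open>\<open>recfn\<close> is closed only under the literal shapes of its rules. Identifying
  functions that agree on lists of length \<open>n\<close> leaves room to rewrite them, for instance
  \<open>hd xs\<close> into \<open>xs ! 0\<close>.\<close>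

definition rfn :: "nat \<Rightarrow> (nat list \<Rightarrow> nat) \<Rightarrow> bool" where
  "rfn n f \<longleftrightarrow> (\<exists>g. recfn n g \<and> (\<forall>xs. length xs = n \<longrightarrow> f xs = g xs))"

lemma rfn_proj: "i < n \<Longrightarrow> rfn n (\<lambda>xs. xs ! i)"
  unfolding rfn_def using recfn.proj by blast

lemma rfn_cong: "rfn n f \<Longrightarrow> (\<And>xs. length xs = n \<Longrightarrow> f xs = g xs) \<Longrightarrow> rfn n g"
  unfolding rfn_def by metis

lemma rfn_comp:
  assumes "rfn (length gs) f" "\<And>g. g \<in> set gs \<Longrightarrow> rfn n g"
  shows "rfn n (\<lambda>xs. f (map (\<lambda>g. g xs) gs))"
proof -
  obtain f' where f': "recfn (length gs) f'" "\<And>xs. length xs = length gs \<Longrightarrow> f xs = f' xs"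
    using assms(1) unfolding rfn_def by blast
  obtain c where c: "\<And>g. g \<in> set gs \<Longrightarrow> recfn n (c g)"
    "\<And>g xs. g \<in> set gs \<Longrightarrow> length xs = n \<Longrightarrow> g xs = c g xs"
    using assms(2) unfolding rfn_def by metis
  have "recfn n (\<lambda>xs. f' (map (\<lambda>g. g xs) (map c gs)))"
    using f'(1) c(1) by (intro recfn.comp) auto
  moreover have "f (map (\<lambda>g. g xs) gs) = f' (map (\<lambda>g. g xs) (map c gs))" if "length xs = n" for xs
  proof -
    have "map (\<lambda>g. g xs) gs = map (\<lambda>g. g xs) (map c gs)" using c(2) that by simp
    then show ?thesis using f'(2) by (metis length_map)
  qed
  ultimately show ?thesis unfolding rfn_def by blast
qed

lemma rfn_comp1: "rfn 1 (\<lambda>xs. h (xs ! 0)) \<Longrightarrow> rfn n g \<Longrightarrow> rfn n (\<lambda>xs. h (g xs))"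
  using rfn_comp[of "[g]" "\<lambda>xs. h (xs ! 0)" n] by simp

lemma rfn_comp2: "rfn 2 (\<lambda>xs. h (xs ! 0) (xs ! 1)) \<Longrightarrow> rfn n f \<Longrightarrow> rfn n g \<Longrightarrow> rfn n (\<lambda>xs. h (f xs) (g xs))"
  using rfn_comp[of "[f, g]" "\<lambda>xs. h (xs ! 0) (xs ! 1)" n] by (auto simp: numeral_2_eq_2)

lemma rfn_Suc: "rfn n g \<Longrightarrow> rfn n (\<lambda>xs. Suc (g xs))"
proof (rule rfn_comp1[where h = Suc])
  show "rfn 1 (\<lambda>xs. Suc (xs ! 0))"
    unfolding rfn_def by (rule exI, rule conjI, rule recfn.succ) (auto simp: length_Suc_conv)
qed

lemma rfn_const: "rfn n (\<lambda>_. c)"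
proof (induction c)
  case 0
  then show ?case unfolding rfn_def using recfn.zero by blast
qed (rule rfn_Suc)

lemma rfn_prim:
  assumes "rfn n f" "rfn (Suc (Suc n)) g"
  shows "rfn (Suc n) (\<lambda>xs. rec_nat (f (tl xs)) (\<lambda>k r. g (k # r # tl xs)) (hd xs))"
proof -
  obtain f' where f': "recfn n f'" "\<And>xs. length xs = n \<Longrightarrow> f xs = f' xs"
    using assms(1) unfolding rfn_def by blast
  obtain g' where g': "recfn (Suc (Suc n)) g'" "\<And>xs. length xs = Suc (Suc n) \<Longrightarrow> g xs = g' xs"
    using assms(2) unfolding rfn_def by blast
  have "rec_nat (f ys) (\<lambda>k r. g (k # r # ys)) m = rec_nat (f' ys) (\<lambda>k r. g' (k # r # ys)) m"
    if "length ys = n" for ys m using that f'(2) g'(2) by (induction m) auto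
  then have "\<forall>xs. length xs = Suc n \<longrightarrow> rec_nat (f (tl xs)) (\<lambda>k r. g (k # r # tl xs)) (hd xs)
      = rec_nat (f' (tl xs)) (\<lambda>k r. g' (k # r # tl xs)) (hd xs)" by simp
  then show ?thesis unfolding rfn_def using recfn.prim[OF f'(1) g'(1)] by (intro exI conjI)
qed

lemma rfn_prim1:
  assumes "rfn 2 (\<lambda>xs. h (xs ! 0) (xs ! 1))" "rfn n g"
  shows "rfn n (\<lambda>xs. rec_nat c h (g xs))"
proof (rule rfn_comp1[OF _ assms(2)])
  have "rfn 1 (\<lambda>xs. rec_nat c (\<lambda>k r. h ((k # r # tl xs) ! 0) ((k # r # tl xs) ! 1)) (hd xs))"
    using rfn_prim[of 0 "\<lambda>_. c" "\<lambda>xs. h (xs ! 0) (xs ! 1)"] assms rfn_const by (simp add: numeral_2_eq_2)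
  then show "rfn 1 (\<lambda>xs. rec_nat c h (xs ! 0))"
    by (rule rfn_cong) (auto simp: length_Suc_conv)
qed

lemma rfn_prim2:
  assumes "rfn 1 (\<lambda>xs. f (xs ! 0))" "rfn 3 (\<lambda>xs. h (xs ! 0) (xs ! 1) (xs ! 2))" "rfn n g1" "rfn n g2"
  shows "rfn n (\<lambda>xs. rec_nat (f (g2 xs)) (\<lambda>k r. h k r (g2 xs)) (g1 xs))"
proof (rule rfn_comp2[where h = "\<lambda>x y. rec_nat (f y) (\<lambda>k r. h k r y) x", OF _ assms(3,4)])
  have "rfn 2 (\<lambda>xs. rec_nat (f (tl xs ! 0)) (\<lambda>k r. h ((k # r # tl xs) ! 0) ((k # r # tl xs) ! 1) ((k # r # tl xs) ! 2)) (hd xs))"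
    using rfn_prim[of 1 "\<lambda>xs. f (xs ! 0)" "\<lambda>xs. h (xs ! 0) (xs ! 1) (xs ! 2)"] assms
    by (simp add: numeral_2_eq_2 numeral_3_eq_3)
  then show "rfn 2 (\<lambda>xs. rec_nat (f (xs ! 1)) (\<lambda>k r. h k r (xs ! 1)) (xs ! 0))"
    by (rule rfn_cong) (auto simp: length_Suc_conv numeral_2_eq_2)
qed

lemma rfn_add: assumes "rfn n f" "rfn n g" shows "rfn n (\<lambda>xs. f xs + g xs)"
proof -
  have eq: "rec_nat y (\<lambda>k r. Suc r) x = x + y" for x y by (induction x) auto
  have "rfn n (\<lambda>xs. rec_nat (g xs) (\<lambda>k r. Suc r) (f xs))"
    by (rule rfn_prim2[where f = "\<lambda>x. x" and h = "\<lambda>k r y. Suc r"]) (auto intro!: rfn_proj rfn_Suc assms)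
  then show ?thesis by (simp only: eq)
qed

lemma rfn_triangle: assumes "rfn n f" shows "rfn n (\<lambda>xs. triangle (f xs))"
proof -
  have eq: "rec_nat 0 (\<lambda>k r. r + Suc k) x = triangle x" for x by (induction x) auto
  have "rfn n (\<lambda>xs. rec_nat 0 (\<lambda>k r. r + Suc k) (f xs))"
    by (rule rfn_prim1) (auto intro!: rfn_add rfn_proj rfn_Suc assms)
  then show ?thesis by (simp only: eq)
qed

lemma rfn_prod_encode: "rfn n f \<Longrightarrow> rfn n g \<Longrightarrow> rfn n (\<lambda>xs. prod_encode (f xs, g xs))"
  unfolding prod_encode_def by (auto intro!: rfn_add rfn_triangle)

lemma rfn_diff: assumes "rfn n f" "rfn n g" shows "rfn n (\<lambda>xs. f xs - g xs)"
proof -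
  have eq1: "rec_nat 0 (\<lambda>k r. k) x = x - 1" for x by (cases x) auto
  have pred: "rfn m (\<lambda>xs. q xs - 1)" if "rfn m q" for m q
    using rfn_prim1[where h = "\<lambda>k r. k" and c = 0, OF rfn_proj that] by (simp add: eq1)
  have eq: "rec_nat y (\<lambda>k r. r - 1) x = y - x" for x y by (induction x) auto
  have "rfn n (\<lambda>xs. rec_nat (f xs) (\<lambda>k r. r - 1) (g xs))"
    by (rule rfn_prim2[where f = "\<lambda>x. x" and h = "\<lambda>k r y. r - 1"]) (intro rfn_proj pred assms; simp)+
  then show ?thesis by (simp only: eq)
qed

text \<open>Since \<open>m \<le> H m\<close>, a preimage of \<open>n\<close> is at most
  \<open>n\<close>, so membership in the range is decided by a bounded search.\<close>

lemma recursive_set_range: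
  assumes H: "rfn 1 (\<lambda>xs. H (xs ! 0))" and le: "\<And>m. m \<le> H m"
  shows "recursive_set (range H)"
proof -
  define q where "q k n = 1 - ((H k - n) + (n - H k))" for k n :: nat
  have q: "q k n = (if H k = n then 1 else 0)" for k n by (auto simp: q_def)
  define s where "s b n = rec_nat 0 (\<lambda>k r. r + q k n) b" for b n
  have s: "s b n = 0 \<longleftrightarrow> (\<forall>k<b. H k \<noteq> n)" for b n
    by (induction b) (auto simp: s_def q less_Suc_eq)
  \<comment> \<open>\<open>s (Suc n) n\<close> counts the preimages of \<open>n\<close> up to
    \<open>n\<close>; the double subtraction from 1 reduces the count to 0 or 1.\<close>
  define c where "c n = 1 - (1 - s (Suc n) n)" for n :: nat
  have H': "rfn m (\<lambda>xs. H (g xs))" if "rfn m g" for m g by (rule rfn_comp1[OF H that])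
  have "rfn 1 (\<lambda>xs. s (Suc (xs ! 0)) (xs ! 0))"
    unfolding s_def q_def
    by (rule rfn_prim2[where f = "\<lambda>_. 0" and h = "\<lambda>k r n. r + (1 - ((H k - n) + (n - H k)))"])
      (intro rfn_diff rfn_add rfn_const H' rfn_proj rfn_Suc; simp)+
  then have "rfn 1 (\<lambda>xs. c (xs ! 0))" unfolding c_def by (intro rfn_diff rfn_const)
  then obtain f where f: "recfn 1 f" "\<And>xs. length xs = 1 \<Longrightarrow> f xs = c (xs ! 0)"
    unfolding rfn_def by metis
  have "f [n] = (if n \<in> range H then 1 else 0)" for n
  proof -
    have "n \<in> range H \<longleftrightarrow> (\<exists>k<Suc n. H k = n)" using le by (auto simp: less_Suc_eq_le)
    then show ?thesis using f(2)[of "[n]"] s[of "Suc n" n] by (auto simp: c_def)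
  qed
  with f(1) show ?thesis unfolding recursive_set_def by blast
qed

text \<open>Operations on formulas that act on codes by a recursive function which never decreases
  them; the second property feeds the bounded search of \<open>recursive_set_range\<close>.\<close>

definition fm_context :: "(fm \<Rightarrow> fm) \<Rightarrow> bool" where
  "fm_context C \<longleftrightarrow> (\<exists>h. rfn 1 (\<lambda>xs. h (xs ! 0)) \<and> (\<forall>\<phi>. fm_num (C \<phi>) = h (fm_num \<phi>)) \<and> (\<forall>n. n \<le> h n))"

lemma fm_context_id: "fm_context (\<lambda>\<phi>. \<phi>)"
  unfolding fm_context_def by (rule exI[of _ "\<lambda>n. n"]) (auto intro: rfn_proj)

lemma fm_context_encode:
  assumes "fm_context C" "\<And>\<phi>. fm_num (D \<phi>) = prod_encode (a, fm_num (C \<phi>))"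
  shows "fm_context D"
proof -
  obtain h where h: "rfn 1 (\<lambda>xs. h (xs ! 0))" "\<And>\<phi>. fm_num (C \<phi>) = h (fm_num \<phi>)" "\<And>n. n \<le> h n"
    using assms(1) unfolding fm_context_def by blast
  have "n \<le> prod_encode (a, h n)" for n using h(3)[of n] le_prod_encode_2 le_trans by blast
  then show ?thesis unfolding fm_context_def
    using h assms(2) by (intro exI[of _ "\<lambda>n. prod_encode (a, h n)"]) (auto intro!: rfn_prod_encode rfn_const)
qed

lemma fm_context_Neg: "fm_context C \<Longrightarrow> fm_context (\<lambda>\<phi>. Neg (C \<phi>))"
  by (rule fm_context_encode) auto

lemma fm_context_Or: assumes "fm_context C" shows "fm_context (\<lambda>\<phi>. Or \<psi> (C \<phi>))"
proof -
  obtain h where h: "rfn 1 (\<lambda>xs. h (xs ! 0))" "\<And>\<phi>. fm_num (C \<phi>) = h (fm_num \<phi>)" "\<And>n. n \<le> h n"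
    using assms(1) unfolding fm_context_def by blast
  have "n \<le> prod_encode (8, prod_encode (a, h n))" for n a using h(3)[of n] le_prod_encode_2 le_trans by blast
  then show ?thesis unfolding fm_context_def
    using h by (intro exI[of _ "\<lambda>n. prod_encode (8, prod_encode (fm_num \<psi>, h n))"])
      (auto intro!: rfn_prod_encode rfn_const)
qed

lemma fm_context_Exists: assumes "fm_context C" shows "fm_context (\<lambda>\<phi>. Exists i (C \<phi>))"
proof -
  obtain h where h: "rfn 1 (\<lambda>xs. h (xs ! 0))" "\<And>\<phi>. fm_num (C \<phi>) = h (fm_num \<phi>)" "\<And>n. n \<le> h n"
    using assms(1) unfolding fm_context_def by blast
  have "n \<le> prod_encode (9, prod_encode (a, h n))" for n a using h(3)[of n] le_prod_encode_2 le_trans by blast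
  then show ?thesis unfolding fm_context_def
    using h by (intro exI[of _ "\<lambda>n. prod_encode (9, prod_encode (i, h n))"])
      (auto intro!: rfn_prod_encode rfn_const)
qed

text \<open>Coding a negation strictly increases the code, so the outermost \<open>Neg\<close> in
  the iterated operation forces the m-th iterate to have a code of at least
  \<open>m\<close>.\<close>

lemma recursive_set_iterates:
  assumes C: "fm_context C" and D: "fm_context D"
  shows "recursive_set (fm_num ` range (\<lambda>m. D (((\<lambda>\<phi>. Neg (C \<phi>)) ^^ m) \<phi>)))"
proof -
  obtain h where h: "rfn 1 (\<lambda>xs. h (xs ! 0))" "\<And>\<phi>. fm_num (C \<phi>) = h (fm_num \<phi>)" "\<And>n. n \<le> h n"
    using C unfolding fm_context_def by blast
  obtain d where d: "rfn 1 (\<lambda>xs. d (xs ! 0))" "\<And>\<phi>. fm_num (D \<phi>) = d (fm_num \<phi>)" "\<And>n. n \<le> d n"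
    using D unfolding fm_context_def by blast
  define c where "c m = rec_nat (fm_num \<phi>) (\<lambda>k r. prod_encode (7, h r)) m" for m
  have c: "fm_num (((\<lambda>\<phi>. Neg (C \<phi>)) ^^ m) \<phi>) = c m" for m
    by (induction m) (auto simp: c_def h(2))
  have tri: "n \<le> triangle n" for n by (induction n) auto
  have "m \<le> c m" for m
  proof (induction m)
    case (Suc m)
    have "c m < prod_encode (7, h (c m))"
      using h(3)[of "c m"] tri[of "7 + h (c m)"] by (simp add: prod_encode_def)
    then show ?case using Suc by (simp add: c_def)
  qed simp
  then have "m \<le> d (c m)" for m using d(3) le_trans by blast
  moreover have "rfn 1 (\<lambda>xs. d (c (xs ! 0)))"
  proof (rule rfn_comp1[OF d(1)])
    show "rfn 1 (\<lambda>xs. c (xs ! 0))" unfolding c_def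
      by (rule rfn_prim1) (intro rfn_prod_encode rfn_const rfn_comp1[OF h(1)] rfn_proj; simp)+
  qed
  ultimately have "recursive_set (range (\<lambda>m. d (c m)))" by (intro recursive_set_range)
  moreover have "fm_num ` range (\<lambda>m. D (((\<lambda>\<phi>. Neg (C \<phi>)) ^^ m) \<phi>)) = range (\<lambda>m. d (c m))"
    by (auto simp: d(2) c image_iff)
  ultimately show ?thesis by simp
qed

text \<open>Recursive saturation turns winning strategies of all finite lengths into an infinite play.\<close>

fun wins :: "('a \<Rightarrow> bool) \<Rightarrow> ('a \<Rightarrow> 'a \<Rightarrow> 'a \<Rightarrow> bool) \<Rightarrow> nat \<Rightarrow> 'a \<Rightarrow> bool" where
  "wins A R 0 s \<longleftrightarrow> A s"
| "wins A R (Suc m) s \<longleftrightarrow> A s \<and> (\<forall>t. \<exists>s'. R s t s' \<and> wins A R m s')"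

lemma wins_antimono: "n \<le> m \<Longrightarrow> wins A R m s \<Longrightarrow> wins A R n s"
proof (induction n arbitrary: m s)
  case 0
  then show ?case by (cases m) auto
next
  case (Suc n)
  then obtain k where "m = Suc k" "n \<le> k" by (cases m) auto
  with Suc show ?case by (metis wins.simps(2))
qed

text \<open>The type to be realized by \<open>s'\<close> consists of \<open>R s t s'\<close> and of
  \<open>wins A R m s'\<close> for all \<open>m\<close>. It is finitely satisfiable because a
  position winning for m + 1 rounds has an answer winning for \<open>m\<close>. It is recursive with
  bounded free variables because \<open>wins\<close> is expressed by iterating one formula context
  that reuses three variables.\<close>

lemma wins_step:
  fixes M :: "'a arith"
  assumes sat: "rec_saturated M"
    and A: "pdf M (\<lambda>e. A (e 0))" and R: "pdf M (\<lambda>e. R (e 0) (e (Suc 0)) (e (Suc (Suc 0))))"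
    and wins: "\<And>m. wins A R m s"
  shows "\<exists>s'. R s t s' \<and> (\<forall>m. wins A R m s')"
proof -
  obtain p \<phi> \<psi> where \<phi>: "\<And>e. A (e 0) \<longleftrightarrow> sat M (mix p e) \<phi>"
    and \<psi>: "\<And>e. R (e 0) (e (Suc 0)) (e (Suc (Suc 0))) \<longleftrightarrow> sat M (mix p e) \<psi>"
    using pdf_common[OF A R] by blast
  \<comment> \<open>Slots 0, 1, 2 hold the position, the move and the answer; slots 3 and 4 hold
    \<open>s\<close> and \<open>t\<close>; the parameters start at slot 5.\<close>
  define E where "E x y z = case_nat x (case_nat y (case_nat z (case_nat s (case_nat t p))))" for x y z
  have E_upd: "(E x y z)(0 := a) = E a y z" "(E x y z)(1 := a) = E x a z" "(E x y z)(2 := a) = E x y a" for x y z a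
    by (auto simp: E_def fun_eq_iff split: nat.split) 
  have E_val: "E x y z 0 = x" "E x y z 1 = y" "E x y z (Suc 0) = y" "E x y z 2 = z" "E x y z 3 = s" "E x y z 4 = t" "E x y z (5 + i) = p i" for x y z i
    by (simp_all add: E_def numeral_eq_Suc)
  define \<sigma> where "\<sigma> a b c i = (if even i then 5 + i div 2 else if i = 1 then a else if i = 3 then b else c)" for a b c i :: nat
  have \<sigma>: "(\<lambda>n. E x y z (\<sigma> a b c n)) = mix p (\<lambda>i. E x y z (if i = 0 then a else if i = 1 then b else c))" for x y z a b c
    by (auto simp: \<sigma>_def mix_def fun_eq_iff E_val elim!: oddE)
  obtain \<alpha> where \<alpha>: "\<forall>e. sat M e \<alpha> \<longleftrightarrow> sat M (\<lambda>n. e (\<sigma> 0 0 0 n)) \<phi>" using fm_rename by blast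
  obtain \<rho> where \<rho>: "\<forall>e. sat M e \<rho> \<longleftrightarrow> sat M (\<lambda>n. e (\<sigma> 0 1 2 n)) \<psi>" using fm_rename by blast
  obtain \<tau> where \<tau>: "\<forall>e. sat M e \<tau> \<longleftrightarrow> sat M (\<lambda>n. e (\<sigma> 3 4 0 n)) \<psi>" using fm_rename by blast
  have \<alpha>E: "sat M (E x y z) \<alpha> \<longleftrightarrow> A x" for x y z using \<alpha> \<phi> by (simp add: \<sigma> E_val flip: \<phi>)
  have \<rho>E: "sat M (E x y z) \<rho> \<longleftrightarrow> R x y z" for x y z using \<rho> by (simp add: \<sigma> E_val flip: \<psi>)
  have \<tau>E: "sat M (E x y z) \<tau> \<longleftrightarrow> R s t x" for x y z using \<tau> by (simp add: \<sigma> E_val flip: \<psi>)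
  \<comment> \<open>Up to double negations \<open>Neg (C \<chi>)\<close> says:
    \<open>\<alpha>\<close>, and for every move in slot 1 there is an answer in slot 2 related by
    \<open>\<rho>\<close>, and a value of slot 0 equal to that answer satisfies
    \<open>\<chi>\<close>. Copying the answer back to slot 0 lets the next level use the same
    variables.\<close>
  define C where "C \<chi> = Or (Neg \<alpha>) (Exists 1 (Neg (Exists 2 (Neg (Or (Neg \<rho>)
    (Neg (Exists 0 (Neg (Or (Neg (Eq (Var 0) (Var 2))) (Neg \<chi>))))))))))" for \<chi>
  define D where "D \<chi> = Neg (Or (Neg \<tau>) (Neg \<chi>))" for \<chi>
  define \<chi> where "\<chi> m = ((\<lambda>\<phi>. Neg (C \<phi>)) ^^ m) \<alpha>" for m
  have \<chi>: "sat M (E x y z) (\<chi> m) \<longleftrightarrow> wins A R m x" for x y z m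
  proof (induction m arbitrary: x y z)
    case 0
    then show ?case by (simp add: \<chi>_def \<alpha>E)
  next
    case (Suc m)
    have "\<chi> (Suc m) = Neg (C (\<chi> m))" by (simp add: \<chi>_def)
    then show ?case by (simp add: C_def \<alpha>E \<rho>E E_upd E_val Suc del: One_nat_def)
  qed
  have D: "sat M (E x y z) (D (\<chi> m)) \<longleftrightarrow> R s t x \<and> wins A R m x" for x y z m
    by (simp add: D_def \<tau>E \<chi>)
  define T where "T = range (\<lambda>m. D (\<chi> m))"
  have rec: "recursive_set (fm_num ` T)" unfolding T_def \<chi>_def
    unfolding C_def[abs_def] D_def[abs_def]
    by (intro recursive_set_iterates fm_context_Neg fm_context_Or fm_context_Exists fm_context_id)
  obtain k where k: "\<forall>\<phi>\<in>T. fm_frees \<phi> \<subseteq> {..k}"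
  proof -
    define U where "U = fm_frees \<alpha> \<union> fm_frees \<rho> \<union> fm_frees \<tau> \<union> {0, 1, 2}"
    have "fm_frees (\<chi> m) \<subseteq> U" for m
      by (induction m) (auto simp: \<chi>_def U_def C_def)
    then have "fm_frees (D (\<chi> m)) \<subseteq> U" for m by (auto simp: D_def U_def)
    moreover have "finite U" by (simp add: U_def)
    then obtain k where "\<forall>n\<in>U. n \<le> k" using finite_nat_set_iff_bounded_le by metis
    then have "U \<subseteq> {..k}" by auto
    ultimately show ?thesis by (intro that[of k]) (auto simp: T_def)
  qed
  have fin: "\<exists>a. \<forall>\<phi>\<in>q. sat M ((E s s s)(0 := a)) \<phi>" if q: "finite q" "q \<subseteq> T" for q
  proof -
    obtain F where F: "finite F" "q = (\<lambda>m. D (\<chi> m)) ` F"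
      using q finite_subset_image unfolding T_def by (metis (no_types, lifting))
    obtain N where N: "\<forall>m\<in>F. m \<le> N" using F(1) finite_nat_set_iff_bounded_le by blast
    obtain a where "R s t a" "wins A R N a" using wins[of "Suc N"] by auto
    then have "sat M (E a s s) (D (\<chi> m))" if "m \<in> F" for m
      using that N D wins_antimono by metis
    then show ?thesis using F(2) by (auto simp: E_upd)
  qed
  from sat[unfolded rec_saturated_def, rule_format, of T k "E s s s"]
  obtain a where "\<forall>\<phi>\<in>T. sat M ((E s s s)(0 := a)) \<phi>"
    using rec k fin by blast
  then have "sat M (E a s s) (D (\<chi> m))" for m by (simp add: T_def E_upd)
  then show ?thesis unfolding D by blast
qed

text \<open>The invariants \<open>P\<close> of the finite strategies may be external and may change
  with the length \<open>n\<close>; they only certify the definable statement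
  \<open>wins A R n s0\<close>. The infinite play maintains that the position wins for all lengths,
  which \<open>wins_step\<close> preserves against any move.\<close>

lemma game_compactness:
  fixes M :: "'a arith"
  assumes sat: "rec_saturated M"
    and A: "pdf M (\<lambda>e. A (e 0))" and R: "pdf M (\<lambda>e. R (e 0) (e (Suc 0)) (e (Suc (Suc 0))))"
    and strategy: "\<And>n::nat. \<exists>P. P 0 s0 \<and> (\<forall>j\<le>n. \<forall>s. P j s \<longrightarrow> A s) \<and>
      (\<forall>j<n. \<forall>s t. P j s \<longrightarrow> (\<exists>s'. R s t s' \<and> P (Suc j) s'))"
  shows "\<exists>s. s 0 = s0 \<and> (\<forall>j::nat. A (s j) \<and> R (s j) (t j) (s (Suc j)))"
proof -
  have "wins A R n s0" for n
  proof -
    obtain P where P: "P 0 s0" "\<forall>j\<le>n. \<forall>s. P j s \<longrightarrow> A s"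
      "\<forall>j<n. \<forall>s t. P j s \<longrightarrow> (\<exists>s'. R s t s' \<and> P (Suc j) s')" using strategy[of n] by blast
    have "P j s \<Longrightarrow> j + m = n \<Longrightarrow> wins A R m s" for j m s
    proof (induction m arbitrary: j s)
      case 0
      then show ?case using P(2) by auto
    next
      case (Suc m)
      then have "j < n" "A s" using P(2)[rule_format, of j s] Suc.prems by simp_all
      moreover have "\<exists>s'. R s t s' \<and> wins A R m s'" for t
        using P(3) \<open>j < n\<close> Suc by (metis add_Suc_right add_Suc)
      ultimately show ?case by simp
    qed
    then show ?thesis using P(1) by simp
  qed
  moreover have step: "\<exists>s'. (\<forall>m. wins A R m s') \<and> R s t s'" if "\<forall>m. wins A R m s" for s t
    using wins_step[OF sat A R] that by blast
  ultimately have "\<exists>s. \<forall>j. ((\<forall>m. wins A R m (s j)) \<and> (j = 0 \<longrightarrow> s j = s0)) \<and> R (s j) (t j) (s (Suc j))"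
    by (intro dependent_nat_choice) auto
  then obtain s where s: "\<And>j m. wins A R m (s j)" "s 0 = s0" "\<And>j. R (s j) (t j) (s (Suc j))"
    by blast
  have "A (s j)" for j using s(1)[of 0 j] by simp
  with s show ?thesis by blast
qed

section \<open>Arithmetic in a model of PA\<close>

locale PA =
  fixes M :: "'a arith" (structure)
  assumes PA: "models_PA M"
begin

abbreviation leq (infix \<open>\<preceq>\<close> 50) where "x \<preceq> y \<equiv> le M x y"

lemma ind [case_names pdf zero succ]:
  assumes "pdf M (\<lambda>e. P (e 0))" "P \<zero>" "\<And>a. P a \<Longrightarrow> P (a \<oplus> \<one>)"
  shows "P a"
  using PA_induct[OF PA] assms by blast

section \<open>Ordered semiring laws from the axioms of arithmetic\<close>

lemma succ_neq_zero: "x \<oplus> \<one> \<noteq> \<zero>"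
  and succ_inject: "x \<oplus> \<one> = y \<oplus> \<one> \<Longrightarrow> x = y"
  and add_zero: "x \<oplus> \<zero> = x"
  and add_succ: "x \<oplus> (y \<oplus> \<one>) = (x \<oplus> y) \<oplus> \<one>"
  and mult_zero: "x \<otimes> \<zero> = \<zero>"
  and mult_succ: "x \<otimes> (y \<oplus> \<one>) = (x \<otimes> y) \<oplus> x"
  and less_iff: "x \<prec> y \<longleftrightarrow> (\<exists>z. x \<oplus> (z \<oplus> \<one>) = y)"
  using PA unfolding models_PA_def by simp_all

lemma add_assoc: "(x \<oplus> y) \<oplus> z = x \<oplus> (y \<oplus> z)"
  by (induction z rule: ind) (intro pdf_intros | simp add: add_zero add_succ)+

lemma zero_add: "\<zero> \<oplus> x = x"
  by (induction x rule: ind) (intro pdf_intros | simp add: add_zero add_succ)+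

lemma succ_add: "(x \<oplus> \<one>) \<oplus> y = (x \<oplus> y) \<oplus> \<one>"
  by (induction y rule: ind) (intro pdf_intros | simp add: add_zero add_succ)+

lemma add_comm: "x \<oplus> y = y \<oplus> x"
  by (induction y rule: ind) (intro pdf_intros | simp add: add_zero zero_add add_succ succ_add)+

lemma add_lcomm: "x \<oplus> (y \<oplus> z) = y \<oplus> (x \<oplus> z)"
  by (metis add_assoc add_comm)

lemma zero_mult: "\<zero> \<otimes> x = \<zero>"
  by (induction x rule: ind) (intro pdf_intros | simp add: add_zero mult_zero mult_succ)+

lemma succ_mult: "(x \<oplus> \<one>) \<otimes> y = (x \<otimes> y) \<oplus> y"
  by (induction y rule: ind)
    (intro pdf_intros | simp add: add_zero mult_zero mult_succ add_assoc add_comm add_lcomm)+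

lemma mult_comm: "x \<otimes> y = y \<otimes> x"
  by (induction y rule: ind) (intro pdf_intros | simp add: zero_mult mult_zero mult_succ succ_mult)+

lemma distrib_left: "x \<otimes> (y \<oplus> z) = (x \<otimes> y) \<oplus> (x \<otimes> z)"
  by (induction z rule: ind) (intro pdf_intros | simp add: add_zero mult_zero mult_succ flip: add_assoc)+

lemma mult_one: "x \<otimes> \<one> = x"
  using mult_succ[of x \<zero>] by (simp add: mult_zero zero_add)

lemma mult_assoc: "(x \<otimes> y) \<otimes> z = x \<otimes> (y \<otimes> z)"
  by (induction z rule: ind) (intro pdf_intros | simp add: mult_zero mult_succ distrib_left mult_one)+

lemma cases0: obtains "x = \<zero>" | y where "x = y \<oplus> \<one>"
proof -
  have "x = \<zero> \<or> (\<exists>y. x = y \<oplus> \<one>)"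
    by (induction x rule: ind) (intro pdf_intros | blast)+
  then show ?thesis using that by blast
qed

lemma add_cancel: "x \<oplus> z = y \<oplus> z \<longleftrightarrow> x = y"
  by (induction z rule: ind) (intro pdf_intros | auto simp: add_zero add_succ dest: succ_inject)+

lemma add_eq_zero: "x \<oplus> y = \<zero> \<longleftrightarrow> x = \<zero> \<and> y = \<zero>"
  by (metis add_zero add_succ cases0 succ_neq_zero zero_add)

lemma le_iff: "x \<preceq> y \<longleftrightarrow> (\<exists>z. x \<oplus> z = y)"
  unfolding le_def less_iff by (metis add_zero cases0)

lemma less_irrefl': "\<not> x \<prec> x"
  unfolding less_iff by (metis add_cancel add_comm zero_add succ_neq_zero)

lemma le_trans': "x \<preceq> y \<Longrightarrow> y \<preceq> z \<Longrightarrow> x \<preceq> z"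
  unfolding le_iff by (metis add_assoc)

lemma le_antisym': "x \<preceq> y \<Longrightarrow> y \<preceq> x \<Longrightarrow> x = y"
  unfolding le_iff by (metis add_assoc add_cancel add_comm add_eq_zero zero_add)

lemma le_total': "x \<preceq> y \<or> y \<preceq> x"
proof (induction y rule: ind)
  case zero
  then show ?case unfolding le_iff by (metis zero_add)
next
  case (succ a)
  then show ?case unfolding le_iff by (metis add_succ add_zero cases0 succ_add)
qed (intro pdf_intros)

lemma monus_eq: "monus M (x \<oplus> y) x = y"
proof -
  have "x \<preceq> x \<oplus> y" unfolding le_iff by blast
  moreover have "(THE z. x \<oplus> y = x \<oplus> z) = y" by (rule the_equality) (metis add_cancel add_comm)+
  ultimately show ?thesis by (simp add: monus_def)
qed

lemma monus_0: "\<not> y \<preceq> x \<Longrightarrow> monus M x y = \<zero>" by (simp add: monus_def)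

lemma less_le_not: "x \<prec> y \<longleftrightarrow> x \<preceq> y \<and> \<not> y \<preceq> x"
  by (metis le_antisym' le_def less_irrefl')

lemma add_le: "x \<preceq> y \<Longrightarrow> z \<oplus> x \<preceq> z \<oplus> y"
  unfolding le_iff by (metis add_assoc)

lemma add_le_cancel: "z \<oplus> x \<preceq> z \<oplus> y \<longleftrightarrow> x \<preceq> y"
  unfolding le_iff by (metis add_assoc add_cancel add_comm)

lemma mult_strict: assumes "x \<prec> y" "\<zero> \<prec> z" shows "z \<otimes> x \<prec> z \<otimes> y"
proof -
  obtain u v where "x \<oplus> (u \<oplus> \<one>) = y" "z = v \<oplus> \<one>"
    using assms unfolding less_iff by (metis zero_add)
  then have "z \<otimes> y = z \<otimes> x \<oplus> (z \<otimes> u \<oplus> v \<oplus> \<one>)"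
    by (metis distrib_left mult_one add_assoc)
  then show ?thesis unfolding less_iff by metis
qed

lemma monus_monus: "monus M (monus M a b) c = monus M a (b \<oplus> c)"
proof (cases "b \<preceq> a")
  case True
  then obtain d where d: "a = b \<oplus> d" by (metis le_iff)
  show ?thesis
  proof (cases "c \<preceq> d")
    case True
    then obtain f where "d = c \<oplus> f" by (metis le_iff)
    then show ?thesis using d by (metis monus_eq add_assoc)
  next
    case False
    then have "\<not> b \<oplus> c \<preceq> a" using d by (simp add: add_le_cancel)
    then show ?thesis using False d by (simp add: monus_eq monus_0)
  qed
next
  case False
  then have "\<not> b \<oplus> c \<preceq> a" unfolding le_iff by (metis add_assoc)
  moreover have "monus M \<zero> c = \<zero>"
    by (metis add_eq_zero le_iff monus_0 monus_eq zero_add)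
  ultimately show ?thesis using False by (simp add: monus_0)
qed

lemma le_refl': "x \<preceq> x" by (simp add: le_def)

lemma distrib_right: "(x \<oplus> y) \<otimes> z = x \<otimes> z \<oplus> y \<otimes> z"
  by (metis distrib_left mult_comm)

lemma one_mult: "\<one> \<otimes> x = x"
  by (metis mult_comm mult_one)

lemma zero_neq_one': "\<zero> \<noteq> \<one>"
  by (metis succ_neq_zero zero_add)

lemma mult_eq_zero: "x \<noteq> \<zero> \<Longrightarrow> y \<noteq> \<zero> \<Longrightarrow> x \<otimes> y \<noteq> \<zero>"
  by (metis add_eq_zero cases0 mult_succ)

lemma zero_less_one': "\<zero> \<prec> \<one>"
  unfolding less_iff by (metis zero_add)

lemma monus_add: "y \<preceq> x \<Longrightarrow> monus M x y \<oplus> y = x"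
  by (metis add_comm le_iff monus_eq)

lemma less_succ_le: "x \<prec> y \<longleftrightarrow> x \<oplus> \<one> \<preceq> y"
  unfolding less_iff le_iff by (metis add_assoc add_comm)

lemma mult_monus: "x \<otimes> monus M y z = monus M (x \<otimes> y) (x \<otimes> z)"
proof (cases "z \<preceq> y")
  case True
  then obtain w where "y = z \<oplus> w" by (metis le_iff)
  then show ?thesis by (simp add: monus_eq distrib_left)
next
  case False
  then have "y \<preceq> z" using le_total' by blast
  then obtain w where "z = y \<oplus> w" by (metis le_iff)
  then have "x \<otimes> z \<preceq> x \<otimes> y \<Longrightarrow> x \<otimes> y = x \<otimes> z"
    by (metis distrib_left le_antisym' le_iff)
  then have "monus M (x \<otimes> y) (x \<otimes> z) = \<zero>"
    by (metis add_zero monus_0 monus_eq)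
  then show ?thesis using False by (simp add: monus_0 mult_zero)
qed

text \<open>From here on the simplifier and \<open>algebra_simps\<close> treat \<open>M\<close> as
  an ordered semiring.\<close>

sublocale discrete_linordered_semidom "aadd M" "monus M" "le M" "aless M" "azero M" "amult M" "aone M"
proof unfold_locales
  show "a \<otimes> \<zero> = \<zero>" for a by (rule mult_zero)
  show "x \<preceq> x" for x by (rule le_refl')
qed (fact add_assoc add_comm monus_eq monus_monus less_le_not le_antisym' zero_add mult_assoc
  mult_comm distrib_right zero_mult one_mult zero_neq_one' mult_monus distrib_left zero_less_one' monus_add less_succ_le
  | rule le_total' | erule (1) le_trans' | erule add_le | erule (1) mult_strict | erule (1) mult_eq_zero)+

end

lemma the_eq_iff: "\<exists>!x. P x \<Longrightarrow> (THE x. P x) = z \<longleftrightarrow> P z"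
  using theI'[of P] by blast

context PA
begin

declare one_add_one [simp del]

lemma zero_le [simp]: "\<zero> \<preceq> x"
  unfolding le_iff by (metis zero_add)

lemma not_less_zero [simp]: "\<not> x \<prec> \<zero>"
  using zero_le not_less by blast

lemma less_succ: "x \<prec> y \<oplus> \<one> \<longleftrightarrow> x \<preceq> y"
  using less_eq_iff_succ_less by simp

lemma less_self_succ [simp]: "x \<prec> x \<oplus> \<one>"
  by (simp add: less_succ)

lemma le_add1 [simp]: "x \<preceq> x \<oplus> y" and le_add2 [simp]: "x \<preceq> y \<oplus> x"
  unfolding le_iff by (metis add_comm)+

lemma pos_iff: "\<zero> \<prec> x \<longleftrightarrow> x \<noteq> \<zero>"
  by (metis le_less zero_le less_irrefl)

lemma one_le_iff: "\<one> \<preceq> x \<longleftrightarrow> x \<noteq> \<zero>"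
  by (metis cases0 le_add2 not_one_le_zero)

lemma le_mult1: "y \<noteq> \<zero> \<Longrightarrow> x \<preceq> x \<otimes> y"
  by (metis cases0 le_add2 mult_succ)

section \<open>Least number principle and division with remainder\<close>

lemma least:
  assumes P: "pdf M (\<lambda>e. P (e 0))" and "P x"
  obtains y where "P y" "\<And>z. z \<prec> y \<Longrightarrow> \<not> P z"
proof -
  have "\<exists>y. P y \<and> (\<forall>z. z \<prec> y \<longrightarrow> \<not> P z)"
  proof (rule ccontr)
    assume no: "\<nexists>y. P y \<and> (\<forall>z. z \<prec> y \<longrightarrow> \<not> P z)"
    have "\<forall>z. z \<prec> n \<longrightarrow> \<not> P z" for n
    proof (induction n rule: ind)
      case pdf
      show ?case by (intro pdf_intros pdf_app1[OF P])
    next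
      case (succ a)
      then show ?case using no less_succ le_less by metis
    qed simp
    then show False using \<open>P x\<close> less_self_succ by blast
  qed
  then show ?thesis using that by blast
qed

lemma less_ind [case_names pdf less]:
  assumes "pdf M (\<lambda>e. P (e 0))" and "\<And>x. (\<And>y. y \<prec> x \<Longrightarrow> P y) \<Longrightarrow> P x"
  shows "P x"
  using least[of "\<lambda>x. \<not> P x" x] assms pdf_not by metis

lemma division_ex: assumes "d \<noteq> \<zero>" shows "\<exists>q r. x = q \<otimes> d \<oplus> r \<and> r \<prec> d"
proof (induction x rule: ind)
  case pdf
  show ?case by (intro pdf_intros)
next
  case zero
  have "\<zero> = \<zero> \<otimes> d \<oplus> \<zero>" by simp
  then show ?case using assms pos_iff by metis
next
  case (succ a)
  then obtain q r where qr: "a = q \<otimes> d \<oplus> r" "r \<prec> d" by blast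
  show ?case
  proof (cases "r \<oplus> \<one> \<prec> d")
    case True
    then show ?thesis using qr add_assoc by metis
  next
    case False
    then have "r \<oplus> \<one> = d" using qr less_succ_le le_less by metis
    then have "a \<oplus> \<one> = (q \<oplus> \<one>) \<otimes> d \<oplus> \<zero>" using qr by (simp add: add_assoc succ_mult)
    then show ?thesis using assms pos_iff by metis
  qed
qed

lemma division_unique:
  assumes "q \<otimes> d \<oplus> r = q' \<otimes> d \<oplus> r'" "r \<prec> d" "r' \<prec> d"
  shows "q = q' \<and> r = r'"
proof -
  have less: False if "q \<prec> q'" "q \<otimes> d \<oplus> r = q' \<otimes> d \<oplus> r'" "r \<prec> d" for q q' r r'
  proof -
    have "(q \<oplus> \<one>) \<otimes> d \<preceq> q' \<otimes> d" using that(1) less_succ_le by (intro mult_right_mono) auto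
    then have "q \<otimes> d \<oplus> d \<preceq> q' \<otimes> d \<oplus> r'" using order_trans le_add1 by (simp add: succ_mult) 
    then have "q \<otimes> d \<oplus> d \<preceq> q \<otimes> d \<oplus> r" using that by simp
    then show False using that(3) by (simp add: add_le_cancel flip: not_le)
  qed
  have "q = q'" using less[of q q' r r'] less[of q' q r' r] assms linorder_cases by metis
  then show ?thesis using assms by simp
qed

lemma quot_eq: assumes "x = q \<otimes> d \<oplus> r" "r \<prec> d" shows "quot M x d = q"
  unfolding quot_def by (rule the_equality) (use assms division_unique in blast)+

section \<open>Cantor pairing\<close>

lemma pair_ex: "\<exists>z. z \<oplus> z = (x \<oplus> y) \<otimes> (x \<oplus> y \<oplus> \<one>) \<oplus> (x \<oplus> x)"
proof -
  have "\<exists>t. t \<oplus> t = s \<otimes> (s \<oplus> \<one>)" for s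
  proof (induction s rule: ind)
    case (succ a)
    then obtain t where "t \<oplus> t = a \<otimes> (a \<oplus> \<one>)" by blast
    then have "(t \<oplus> (a \<oplus> \<one>)) \<oplus> (t \<oplus> (a \<oplus> \<one>)) = (a \<oplus> \<one>) \<otimes> (a \<oplus> \<one> \<oplus> \<one>)"
      by (simp add: algebra_simps) (metis add_assoc add_comm)
    then show ?case by blast
  next
    case zero
    show ?case by (rule exI[of _ \<zero>]) simp
  qed (intro pdf_intros)
  then obtain t where "t \<oplus> t = (x \<oplus> y) \<otimes> (x \<oplus> y \<oplus> \<one>)" by blast
  then have "(t \<oplus> x) \<oplus> (t \<oplus> x) = (x \<oplus> y) \<otimes> (x \<oplus> y \<oplus> \<one>) \<oplus> (x \<oplus> x)"
    by (metis add_assoc add_comm)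
  then show ?thesis by blast
qed

lemma double_inject: "x \<oplus> x = y \<oplus> y \<longleftrightarrow> x = y"
  by (metis add_strict_mono linorder_cases less_irrefl)

lemma pair_eq: "pair M x y = z \<longleftrightarrow> z \<oplus> z = (x \<oplus> y) \<otimes> (x \<oplus> y \<oplus> \<one>) \<oplus> (x \<oplus> x)"
proof -
  obtain z where "z \<oplus> z = (x \<oplus> y) \<otimes> (x \<oplus> y \<oplus> \<one>) \<oplus> (x \<oplus> x)"
    using pair_ex by blast
  then have "\<exists>!z. z \<oplus> z = (x \<oplus> y) \<otimes> (x \<oplus> y \<oplus> \<one>) \<oplus> (x \<oplus> x)"
    using double_inject by (intro ex1I[of _ z]) metis+
  then show ?thesis unfolding pair_def by (rule the_eq_iff)
qed

lemmas pair_double = pair_eq[THEN iffD1, OF refl]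

text \<open>The doubled code of a point on the diagonal s lies between s(s + 1) and s(s + 1) + 2s,
  below the start of the next diagonal. So the code fixes the diagonal and then the first
  coordinate.\<close>

lemma pair_inject [simp]: "pair M x y = pair M x' y' \<longleftrightarrow> x = x' \<and> y = y'"
proof
  assume eq: "pair M x y = pair M x' y'"
  have sum: False if "pair M x y = pair M x' y'" "x \<oplus> y \<prec> x' \<oplus> y'" for x y x' y'
  proof -
    define s s' where "s = x \<oplus> y" and "s' = x' \<oplus> y'"
    have "s \<oplus> \<one> \<preceq> s'" using that less_succ_le s_def s'_def by simp
    then have "(s \<oplus> \<one>) \<otimes> (s \<oplus> \<one> \<oplus> \<one>) \<preceq> s' \<otimes> (s' \<oplus> \<one>)"
      by (intro mult_mono) (auto intro: add_right_mono)
    also have "\<dots> \<preceq> pair M x' y' \<oplus> pair M x' y'" by (simp add: pair_double s'_def)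
    also have "\<dots> = s \<otimes> (s \<oplus> \<one>) \<oplus> (x \<oplus> x)" using that(1) pair_double[of x y] by (simp add: s_def)
    also have "\<dots> \<preceq> s \<otimes> (s \<oplus> \<one>) \<oplus> (s \<oplus> s)"
      using add_mono[of x s x s] by (simp add: s_def add_le_cancel)
    also have "\<dots> \<prec> s \<otimes> (s \<oplus> \<one>) \<oplus> (s \<oplus> s) \<oplus> \<one> \<oplus> \<one>"
      using less_self_succ less_trans by blast
    also have "\<dots> = (s \<oplus> \<one>) \<otimes> (s \<oplus> \<one> \<oplus> \<one>)" by (simp add: algebra_simps) 
    finally show False by simp
  qed
  then have s: "x \<oplus> y = x' \<oplus> y'" using eq linorder_cases by metis
  have "x \<oplus> x = x' \<oplus> x'" using pair_double[of x y] pair_double[of x' y'] eq s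
    by (metis add_cancel add_comm)
  then show "x = x' \<and> y = y'" using s by (metis double_inject add_cancel add_comm)
qed simp

text \<open>Induction walks along the diagonals: the successor of (x, 0) is (0, x + 1), and that of
  (x, z + 1) is (x + 1, z).\<close>

lemma pair_surj: "\<exists>x y. w = pair M x y"
proof (induction w rule: ind)
  case pdf
  show ?case unfolding eq_commute[of _ "pair M _ _"] pair_eq by (intro pdf_intros)
next
  case zero
  have "pair M \<zero> \<zero> = \<zero>" by (simp add: pair_eq)
  then show ?case by metis
next
  case (succ w)
  then obtain x y where w: "w = pair M x y" by blast
  show ?case
  proof (cases rule: cases0[of y])
    case 1
    have "pair M \<zero> (x \<oplus> \<one>) = w \<oplus> \<one>"
      using pair_double[of x y] w 1 by (simp add: pair_eq algebra_simps)
    then show ?thesis by metis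
  next
    case (2 z)
    have "pair M (x \<oplus> \<one>) z = w \<oplus> \<one>"
      using pair_double[of x y] w 2 by (simp add: pair_eq algebra_simps)
    then show ?thesis by metis
  qed
qed

lemma le_square: "s \<oplus> s \<preceq> s \<otimes> (s \<oplus> \<one>)"
proof (cases rule: cases0[of s])
  case (2 y)
  have "\<one> \<oplus> \<one> \<preceq> y \<oplus> (\<one> \<oplus> (\<one> \<oplus> y \<otimes> y))"
    by (metis add.left_commute le_add1 add_assoc)
  then show ?thesis using 2 by (simp add: algebra_simps)
qed simp

lemma pair_sum_le: "x \<oplus> y \<preceq> pair M x y"
proof (rule ccontr)
  assume "\<not> x \<oplus> y \<preceq> pair M x y"
  then have "pair M x y \<oplus> pair M x y \<prec> (x \<oplus> y) \<oplus> (x \<oplus> y)" by (simp add: not_le add_strict_mono)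
  also have "\<dots> \<preceq> pair M x y \<oplus> pair M x y"
    using le_square[of "x \<oplus> y"] pair_double[of x y] le_add1 order_trans by metis
  finally show False by simp
qed

lemma le_pair1: "x \<preceq> pair M x y" and le_pair2: "y \<preceq> pair M x y"
  using pair_sum_le[of x y] le_add1 le_add2 order_trans by blast+

lemma less_pair2: assumes "x \<noteq> \<zero>" shows "y \<prec> pair M x y"
proof -
  have "y \<prec> x \<oplus> y" using assms by (metis pos_iff add_strict_right_mono zero_add)
  then show ?thesis using pair_sum_le less_le_trans by blast
qed

lemma pdfun_pair [pdf_intros]: "pdfun M f \<Longrightarrow> pdfun M g \<Longrightarrow> pdfun M (\<lambda>e. pair M (f e) (g e))"
proof (rule pdfun_app2[where h = "pair M"])
  show "pdfun M (\<lambda>e. pair M (e 0) (e (Suc 0)))"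
    unfolding pdfun_def eq_commute[of _ "pair M _ _"] pair_eq by (intro pdf_intros)
qed

lemma monus_graph: "z = monus M x y \<longleftrightarrow> y \<preceq> x \<and> x = y \<oplus> z \<or> \<not> y \<preceq> x \<and> z = \<zero>"
  by (metis monus_0 monus_add monus_eq add_comm le_iff)

lemma pdfun_monus [pdf_intros]: "pdfun M f \<Longrightarrow> pdfun M g \<Longrightarrow> pdfun M (\<lambda>e. monus M (f e) (g e))"
proof (rule pdfun_app2[where h = "monus M"])
  show "pdfun M (\<lambda>e. monus M (e 0) (e (Suc 0)))"
    unfolding pdfun_def monus_graph by (intro pdf_intros)
qed

subsection \<open>Coded sequences\<close>

abbreviation nth (infixl \<open>!!\<close> 100) where "s !! i \<equiv> nth_elem M s i"

definition modulus :: "'a \<Rightarrow> 'a \<Rightarrow> 'a" where "modulus b i = \<one> \<oplus> (i \<oplus> \<one>) \<otimes> b"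

lemma modulus_neq_zero: "modulus b i \<noteq> \<zero>"
  unfolding modulus_def by (simp add: add_eq_zero)

lemma nth_pair: assumes "a = q \<otimes> modulus b i \<oplus> y" "y \<prec> modulus b i" shows "pair M a b !! i = y"
  unfolding nth_elem_def modulus_def[symmetric]
proof (rule the_equality)
  show "\<exists>a' b' q. pair M a b = pair M a' b' \<and> a' = q \<otimes> modulus b' i \<oplus> y \<and> y \<prec> modulus b' i"
    using assms by (intro exI conjI) (rule refl, assumption+)
  fix z
  assume "\<exists>a' b' q. pair M a b = pair M a' b' \<and> a' = q \<otimes> modulus b' i \<oplus> z \<and> z \<prec> modulus b' i"
  then obtain q' where "a = q' \<otimes> modulus b i \<oplus> z" "z \<prec> modulus b i" by auto
  with assms show "z = y" using division_unique[of q' "modulus b i" z q y] by simp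
qed

text \<open>Surjectivity of pairing gives the description a solution at every \<open>w\<close> and
  \<open>i\<close>, which makes element access a total definable function.\<close>

lemma nth_graph: "y = w !! i \<longleftrightarrow> (\<exists>a b q. w = pair M a b \<and>
    a = q \<otimes> (\<one> \<oplus> (i \<oplus> \<one>) \<otimes> b) \<oplus> y \<and> y \<prec> \<one> \<oplus> (i \<oplus> \<one>) \<otimes> b)"
proof -
  obtain a b where w: "w = pair M a b" using pair_surj by blast
  obtain q r where "a = q \<otimes> modulus b i \<oplus> r" "r \<prec> modulus b i"
    using division_ex[OF modulus_neq_zero] by blast
  then have "w !! i = r" "\<exists>a b q. w = pair M a b \<and> a = q \<otimes> modulus b i \<oplus> r \<and> r \<prec> modulus b i"
    using nth_pair w by blast+
  moreover have "y = w !! i" if "w = pair M a b" "a = q \<otimes> modulus b i \<oplus> y" "y \<prec> modulus b i" for a b q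
    using nth_pair that by simp
  ultimately show ?thesis unfolding modulus_def[symmetric] by blast
qed

lemma nth_le: "w !! i \<preceq> w"
proof -
  obtain a b q where "w = pair M a b" "a = q \<otimes> (\<one> \<oplus> (i \<oplus> \<one>) \<otimes> b) \<oplus> w !! i"
    using nth_graph[of "w !! i"] by blast
  then show ?thesis by (metis le_add2 le_pair1 order_trans)
qed

lemma pdfun_nth [pdf_intros]: "pdfun M f \<Longrightarrow> pdfun M g \<Longrightarrow> pdfun M (\<lambda>e. nth_elem M (f e) (g e))"
proof (rule pdfun_app2[where h = "nth_elem M"])
  show "pdfun M (\<lambda>e. nth_elem M (e 0) (e (Suc 0)))"
    unfolding pdfun_def nth_graph by (intro pdf_intros)
qed

section \<open>Divisibility and the Chinese remainder theorem inside the model\<close>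

definition divides (infix \<open>\<bar>\<close> 50) where "d \<bar> x \<longleftrightarrow> (\<exists>k. x = d \<otimes> k)"

lemma divides_triv: "d \<bar> d \<otimes> k"
  unfolding divides_def by blast

lemma divides_mult: "d \<bar> x \<Longrightarrow> d \<bar> x \<otimes> y" "d \<bar> x \<Longrightarrow> d \<bar> y \<otimes> x"
  unfolding divides_def by (metis mult_assoc mult_comm)+

lemma divides_add: "d \<bar> x \<Longrightarrow> d \<bar> y \<Longrightarrow> d \<bar> x \<oplus> y"
  unfolding divides_def by (metis distrib_left)

lemma divides_cancel: assumes "d \<bar> x \<oplus> y" "d \<bar> y" shows "d \<bar> x"
proof -
  obtain k l where kl: "x \<oplus> y = d \<otimes> k" "y = d \<otimes> l" using assms unfolding divides_def by blast
  then have "x = monus M (d \<otimes> k) (d \<otimes> l)" by (metis add_comm monus_eq)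
  then show ?thesis unfolding divides_def by (metis mult_monus)
qed

lemma pdf_divides [pdf_intros]: "pdfun M f \<Longrightarrow> pdfun M g \<Longrightarrow> pdf M (\<lambda>e. f e \<bar> g e)"
  by (rule pdf_app2[where R = "(\<bar>)"]) (unfold divides_def, intro pdf_intros)

text \<open>\<open>f\<close> plays the part of the factorial of \<open>n\<close> in the usual choice
  of moduli for the beta function.\<close>

lemma common_multiple: "\<exists>f. f \<noteq> \<zero> \<and> (\<forall>e. e \<noteq> \<zero> \<and> e \<preceq> n \<longrightarrow> e \<bar> f)"
proof (induction n rule: ind)
  case pdf
  show ?case by (intro pdf_intros)
next
  case zero
  then show ?case by (metis le_antisym' zero_le zero_neq_one')
next
  case (succ n)
  then obtain f where f: "f \<noteq> \<zero>" "\<And>e. e \<noteq> \<zero> \<Longrightarrow> e \<preceq> n \<Longrightarrow> e \<bar> f" by blast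
  have "f \<otimes> (n \<oplus> \<one>) \<noteq> \<zero>" using f succ_neq_zero mult_eq_zero by blast
  moreover have "e \<bar> f \<otimes> (n \<oplus> \<one>)" if "e \<noteq> \<zero>" "e \<preceq> n \<oplus> \<one>" for e
    using that f(2) divides_mult divides_triv by (metis le_less less_succ mult_comm)
  ultimately show ?case by blast
qed

text \<open>Coprimality of \<open>m\<close> and \<open>P\<close> is expressed by
  \<open>t \<otimes> P\<close> being -1 modulo \<open>m\<close>, which avoids subtraction. Two such
  relations multiply to +1, and the factor \<open>m0\<close>, itself -1 modulo \<open>m\<close>,
  restores the sign.\<close>

lemma coprime_mult:
  assumes "m \<bar> t \<otimes> P \<oplus> \<one>" "m \<bar> s \<otimes> Q \<oplus> \<one>" "m = \<one> \<oplus> m0"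
  shows "m \<bar> m0 \<otimes> (t \<otimes> s) \<otimes> (P \<otimes> Q) \<oplus> \<one>"
proof -
  define A B where "A = t \<otimes> P" and "B = s \<otimes> Q"
  have "(m0 \<otimes> (A \<otimes> B) \<oplus> \<one>) \<oplus> A \<otimes> (B \<oplus> \<one>) = m \<otimes> (A \<otimes> B) \<oplus> (A \<oplus> \<one>)"
    by (simp add: assms(3) algebra_simps)
  moreover have "m \<bar> m \<otimes> (A \<otimes> B) \<oplus> (A \<oplus> \<one>)" "m \<bar> A \<otimes> (B \<oplus> \<one>)"
    using assms A_def B_def divides_add divides_triv divides_mult by auto
  ultimately have "m \<bar> m0 \<otimes> (A \<otimes> B) \<oplus> \<one>" using divides_cancel by metis
  then show ?thesis by (simp add: A_def B_def algebra_simps)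
qed

text \<open>With e = j - k, the product of j + 1 and \<open>modulus b k\<close> is e plus a multiple
  of \<open>modulus b j\<close>. Since b = e g, multiplying further by (j + 1) g leaves (j + 1) b,
  which is -1 modulo \<open>modulus b j\<close>.\<close>

lemma coprime_moduli:
  assumes "k \<prec> j" "\<And>e. e \<noteq> \<zero> \<Longrightarrow> e \<preceq> j \<Longrightarrow> e \<bar> b"
  shows "\<exists>s. modulus b j \<bar> s \<otimes> modulus b k \<oplus> \<one>"
proof -
  obtain e where e: "j = k \<oplus> e" "e \<noteq> \<zero>" using assms(1) by (metis less_iff succ_neq_zero)
  obtain g where g: "b = e \<otimes> g" using assms(2)[of e] e divides_def by auto
  have "(j \<oplus> \<one>) \<otimes> (j \<oplus> \<one>) \<otimes> g \<otimes> modulus b k \<oplus> \<one>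
      = modulus b j \<otimes> ((j \<oplus> \<one>) \<otimes> g \<otimes> (k \<oplus> \<one>) \<oplus> \<one>)"
    unfolding modulus_def g e by (simp add: algebra_simps)
  then show ?thesis using divides_triv by metis
qed

text \<open>A beta code cannot be extended in place, so all entries up to \<open>n\<close> are coded
  anew for one \<open>b\<close> with pairwise coprime moduli, by induction on the number
  \<open>k\<close> of entries treated. \<open>Q\<close> is a common multiple of the moduli treated
  so far and coprime to the remaining ones.\<close>

lemma sequence_extend: "\<exists>w'. (\<forall>i. i \<prec> n \<longrightarrow> w' !! i = w !! i) \<and> w' !! n = v"
proof -
  obtain f where f: "f \<noteq> \<zero>" "\<And>e. e \<noteq> \<zero> \<Longrightarrow> e \<preceq> n \<Longrightarrow> e \<bar> f" using common_multiple by blast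
  \<comment> \<open>The factor \<open>f\<close> makes the moduli coprime; the factor
    \<open>w \<oplus> v \<oplus> \<one>\<close> makes each of them exceed every value to be
    coded.\<close>
  define b where "b = f \<otimes> (w \<oplus> v \<oplus> \<one>)"
  have b: "e \<bar> b" if "e \<noteq> \<zero>" "e \<preceq> n" for e using f that divides_mult b_def by simp
  define u where "u i = (if i \<prec> n then w !! i else v)" for i
  have u: "u i \<prec> modulus b i" for i
  proof -
    have "u i \<preceq> w \<oplus> v" using order_trans[OF nth_le[of w i] le_add1[of w v]] le_add2[of v w] by (simp add: u_def)
    also have "w \<oplus> v \<preceq> b" using order_trans[OF le_add1[of "w \<oplus> v" \<one>] le_mult1[OF f(1)]] by (simp add: b_def mult_comm[of f])
    also have "b \<preceq> (i \<oplus> \<one>) \<otimes> b" by (simp add: succ_mult)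
    finally show ?thesis unfolding modulus_def using less_succ add_comm by metis
  qed
  have pu: "pdfun M (\<lambda>e. u (g e))" if "pdfun M g" for g unfolding u_def by (intro pdf_intros that)
  have "k \<preceq> n \<oplus> \<one> \<longrightarrow> (\<exists>a Q. (\<forall>i. i \<prec> k \<longrightarrow> (\<exists>q. a = q \<otimes> modulus b i \<oplus> u i)) \<and>
      (\<forall>i. i \<prec> k \<longrightarrow> modulus b i \<bar> Q) \<and> (\<forall>j. k \<preceq> j \<and> j \<preceq> n \<longrightarrow> (\<exists>t. modulus b j \<bar> t \<otimes> Q \<oplus> \<one>)))" for k
  proof (induction k rule: ind)
    case pdf
    show ?case unfolding modulus_def by (intro pdf_intros pu)
  next
    case zero
    have "modulus b j \<bar> (j \<oplus> \<one>) \<otimes> b \<otimes> \<one> \<oplus> \<one>" for j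
      using divides_triv[of "modulus b j" \<one>] unfolding modulus_def by (simp add: add_comm)
    then show ?case by (metis not_less_zero)
  next
    case (succ k)
    show ?case
    proof
      assume "k \<oplus> \<one> \<preceq> n \<oplus> \<one>"
      then have k: "k \<preceq> n" by simp
      then have "k \<preceq> n \<oplus> \<one>" using le_add1 order_trans by blast
      then obtain a Q where a: "\<And>i. i \<prec> k \<Longrightarrow> \<exists>q. a = q \<otimes> modulus b i \<oplus> u i"
        and Q: "\<And>i. i \<prec> k \<Longrightarrow> modulus b i \<bar> Q" "\<And>j. k \<preceq> j \<Longrightarrow> j \<preceq> n \<Longrightarrow> \<exists>t. modulus b j \<bar> t \<otimes> Q \<oplus> \<one>"
        using succ by blast
      define m m0 where "m = modulus b k" and "m0 = (k \<oplus> \<one>) \<otimes> b"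
      have m: "m = \<one> \<oplus> m0" by (simp add: m_def m0_def modulus_def)
      obtain t where t: "m \<bar> t \<otimes> Q \<oplus> \<one>" using Q(2)[of k] k m_def by auto
      \<comment> \<open>Modulo the earlier moduli the added term vanishes with \<open>Q\<close>.
        Modulo \<open>m\<close> both \<open>t \<otimes> Q\<close> and \<open>m0\<close> are -1, so
        \<open>a'\<close> is the negative of \<open>m0 \<otimes> u k\<close>, that is
        \<open>u k\<close>.\<close>
      define a' where "a' = a \<oplus> Q \<otimes> (t \<otimes> (a \<oplus> m0 \<otimes> u k))"
      have "\<exists>q. a' = q \<otimes> modulus b i \<oplus> u i" if "i \<prec> k \<oplus> \<one>" for i
      proof (cases "i = k")
        case True
        obtain c where c: "t \<otimes> Q \<oplus> \<one> = m \<otimes> c" using t divides_def by blast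
        obtain q r where qr: "a' = q \<otimes> m \<oplus> r" "r \<prec> m"
          using division_ex[of m a'] modulus_neq_zero[of b k] unfolding m_def by blast
        have "(q \<oplus> u k) \<otimes> m \<oplus> r = a' \<oplus> m0 \<otimes> u k \<oplus> u k"
          unfolding qr(1) by (simp add: m algebra_simps)
        also have "\<dots> = (t \<otimes> Q \<oplus> \<one>) \<otimes> (a \<oplus> m0 \<otimes> u k) \<oplus> u k"
          unfolding a'_def by (simp add: algebra_simps)
        also have "\<dots> = (c \<otimes> (a \<oplus> m0 \<otimes> u k)) \<otimes> m \<oplus> u k"
          unfolding c by (simp add: algebra_simps)
        finally have "r = u k" using division_unique qr(2) u[of k] m_def by blast
        then show ?thesis using qr True m_def by blast
      next
        case False
        then have i: "i \<prec> k" using that less_succ le_less by blast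
        then obtain q l where "a = q \<otimes> modulus b i \<oplus> u i" "Q = modulus b i \<otimes> l"
          using a Q(1) divides_def by blast
        then have "a' = (q \<oplus> l \<otimes> (t \<otimes> (a \<oplus> m0 \<otimes> u k))) \<otimes> modulus b i \<oplus> u i"
          unfolding a'_def by (simp add: algebra_simps)
        then show ?thesis by blast
      qed
      moreover have "modulus b i \<bar> Q \<otimes> m" if "i \<prec> k \<oplus> \<one>" for i
        using that Q(1) divides_mult divides_triv less_succ le_less m_def mult_comm by metis
      moreover have "\<exists>t. modulus b j \<bar> t \<otimes> (Q \<otimes> m) \<oplus> \<one>" if "k \<oplus> \<one> \<preceq> j" "j \<preceq> n" for j
      proof -
        have kj: "k \<prec> j" using that less_succ_le by blast
        have bj: "e \<bar> b" if "e \<noteq> \<zero>" "e \<preceq> j" for e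
          using b[OF that(1) order_trans[OF that(2) \<open>j \<preceq> n\<close>]] .
        obtain s where s: "modulus b j \<bar> s \<otimes> m \<oplus> \<one>"
          using coprime_moduli[OF kj bj] unfolding m_def by blast
        obtain t where t: "modulus b j \<bar> t \<otimes> Q \<oplus> \<one>"
          using Q(2)[OF less_imp_le[OF kj] \<open>j \<preceq> n\<close>] by blast
        show ?thesis by (rule exI, rule coprime_mult[OF t s modulus_def])
      qed
      ultimately show "\<exists>a Q. (\<forall>i. i \<prec> k \<oplus> \<one> \<longrightarrow> (\<exists>q. a = q \<otimes> modulus b i \<oplus> u i)) \<and>
        (\<forall>i. i \<prec> k \<oplus> \<one> \<longrightarrow> modulus b i \<bar> Q) \<and>
        (\<forall>j. k \<oplus> \<one> \<preceq> j \<and> j \<preceq> n \<longrightarrow> (\<exists>t. modulus b j \<bar> t \<otimes> Q \<oplus> \<one>))"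
        by blast
    qed
  qed
  then obtain a where a: "\<And>i. i \<preceq> n \<Longrightarrow> \<exists>q. a = q \<otimes> modulus b i \<oplus> u i"
    using less_succ by (metis order_refl)
  have "pair M a b !! i = u i" if "i \<preceq> n" for i using a[OF that] nth_pair u by blast
  then show ?thesis using u_def less_imp_le by (metis less_irrefl order_refl)
qed

text \<open>By \<open>local\<close> the value \<open>H i s\<close> depends only on entries below
  \<open>i\<close>, so recoding the sequence to append an entry leaves the equations already solved
  intact.\<close>

lemma recursion:
  assumes H: "pdf M (\<lambda>e. e 0 = H (e (Suc 0)) (e (Suc (Suc 0))))"
    and local: "\<And>i s s'. (\<And>j. j \<prec> i \<Longrightarrow> s !! j = s' !! j) \<Longrightarrow> H i s = H i s'"
  shows "\<exists>s. \<forall>i. i \<prec> n \<longrightarrow> s !! i = H i s"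
proof (induction n rule: ind)
  case pdf
  have "pdfun M (\<lambda>e. H (e 0) (e (Suc 0)))" using H by (simp add: pdfun_def)
  note pdfun_app2[OF this, pdf_intros]
  show ?case by (intro pdf_intros)
next
  case (succ n)
  then obtain s where s: "\<And>i. i \<prec> n \<Longrightarrow> s !! i = H i s" by blast
  obtain s' where s': "\<And>i. i \<prec> n \<Longrightarrow> s' !! i = s !! i" "s' !! n = H n s"
    using sequence_extend by blast
  have "s' !! i = H i s'" if "i \<preceq> n" for i
  proof -
    have "H i s = H i s'" using s'(1) that less_le_trans by (intro local) metis
    then show ?thesis using s s' that le_less by metis
  qed
  then show ?case using less_succ by metis
qed simp

lemma recursion_step:
  assumes G: "pdfun M (\<lambda>e. G (e 0))"
  shows "\<exists>s. s !! \<zero> = c \<and> (\<forall>i. i \<prec> y \<longrightarrow> s !! (i \<oplus> \<one>) = G (s !! i))"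
proof -
  have G': "pdfun M (\<lambda>e. G (f e))" if "pdfun M f" for f by (rule pdfun_app1[OF G that])
  define H where "H i s = (if i = \<zero> then c else G (s !! monus M i \<one>))" for i s
  have "\<exists>s. \<forall>i. i \<prec> y \<oplus> \<one> \<longrightarrow> s !! i = H i s"
  proof (rule recursion)
    have "pdfun M (\<lambda>e. H (e 0) (e 1))" unfolding H_def by (intro pdf_intros G')
    then show "pdf M (\<lambda>e. e 0 = H (e (Suc 0)) (e (Suc (Suc 0))))" by (simp add: pdfun_def)
    fix i s s' assume *: "\<And>j. j \<prec> i \<Longrightarrow> s !! j = s' !! j"
    show "H i s = H i s'"
    proof (cases rule: cases0[of i])
      case (2 j)
      then have "monus M i \<one> = j" by (metis add_comm monus_eq)
      then show ?thesis using * 2 by (simp add: H_def)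
    qed (simp add: H_def)
  qed
  then obtain s where s: "\<And>i. i \<prec> y \<oplus> \<one> \<Longrightarrow> s !! i = H i s" by blast
  have "s !! (i \<oplus> \<one>) = G (s !! i)" if "i \<prec> y" for i
  proof -
    have "monus M (i \<oplus> \<one>) \<one> = i" by (metis add_comm monus_eq)
    then show ?thesis using s[of "i \<oplus> \<one>"] that by (simp add: H_def succ_neq_zero)
  qed
  moreover have "s !! \<zero> = c" using s[of \<zero>] pos_iff succ_neq_zero by (simp add: H_def)
  ultimately show ?thesis by blast
qed

lemma recursion_unique:
  assumes "s !! \<zero> = c" "\<And>i. i \<prec> y \<Longrightarrow> s !! (i \<oplus> \<one>) = G (s !! i)"
    and "s' !! \<zero> = c" "\<And>i. i \<prec> y \<Longrightarrow> s' !! (i \<oplus> \<one>) = G (s' !! i)"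
    and "i \<preceq> y"
  shows "s !! i = s' !! i"
proof -
  have "i \<preceq> y \<longrightarrow> s !! i = s' !! i"
    by (induction i rule: ind) (intro pdf_intros | use assms less_succ_le less_imp_le in metis)+
  then show ?thesis using assms by blast
qed

text \<open>The common shape of the descriptions behind \<open>pow2\<close> and \<open>F_op\<close>,
  which become instances by mere unfolding.\<close>

definition iterate :: "('a \<Rightarrow> 'a) \<Rightarrow> 'a \<Rightarrow> 'a \<Rightarrow> 'a" where
  "iterate G c y = (THE v. \<exists>s. s !! \<zero> = c \<and> (\<forall>i. i \<prec> y \<longrightarrow> s !! (i \<oplus> \<one>) = G (s !! i)) \<and> s !! y = v)"

lemma iterate_graph:
  assumes G: "pdfun M (\<lambda>e. G (e 0))"
  shows "v = iterate G c y \<longleftrightarrow> (\<exists>s. s !! \<zero> = c \<and> (\<forall>i. i \<prec> y \<longrightarrow> s !! (i \<oplus> \<one>) = G (s !! i)) \<and> s !! y = v)"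
proof -
  have "\<exists>!v. \<exists>s. s !! \<zero> = c \<and> (\<forall>i. i \<prec> y \<longrightarrow> s !! (i \<oplus> \<one>) = G (s !! i)) \<and> s !! y = v"
  proof -
    obtain s where s: "s !! \<zero> = c" "\<forall>i. i \<prec> y \<longrightarrow> s !! (i \<oplus> \<one>) = G (s !! i)"
      using recursion_step[OF G] by blast
    show ?thesis
    proof (rule ex1I[of _ "s !! y"])
      show "\<exists>s'. s' !! \<zero> = c \<and> (\<forall>i. i \<prec> y \<longrightarrow> s' !! (i \<oplus> \<one>) = G (s' !! i)) \<and> s' !! y = s !! y"
        using s by blast
      fix v assume "\<exists>s'. s' !! \<zero> = c \<and> (\<forall>i. i \<prec> y \<longrightarrow> s' !! (i \<oplus> \<one>) = G (s' !! i)) \<and> s' !! y = v"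
      then obtain s' where s': "s' !! \<zero> = c" "\<forall>i. i \<prec> y \<longrightarrow> s' !! (i \<oplus> \<one>) = G (s' !! i)" "s' !! y = v"
        by blast
      have "s' !! y = s !! y"
        by (rule recursion_unique[where G = G and c = c and y = y]) (use s s' in auto)
      then show "v = s !! y" using s' by simp
    qed
  qed
  then show ?thesis unfolding iterate_def eq_commute[of v] by (rule the_eq_iff)
qed

lemma iterate_zero: assumes "pdfun M (\<lambda>e. G (e 0))" shows "iterate G c \<zero> = c"
  using iterate_graph[OF assms, of _ c \<zero>] by (metis not_less_zero recursion_step[OF assms])

lemma iterate_succ: assumes "pdfun M (\<lambda>e. G (e 0))" shows "iterate G c (y \<oplus> \<one>) = G (iterate G c y)"
proof -
  obtain s where s: "s !! \<zero> = c" "\<forall>i. i \<prec> y \<oplus> \<one> \<longrightarrow> s !! (i \<oplus> \<one>) = G (s !! i)"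
    using recursion_step[OF assms] by blast
  then have "iterate G c (y \<oplus> \<one>) = s !! (y \<oplus> \<one>)" using iterate_graph[OF assms, of "s !! (y \<oplus> \<one>)"] by metis
  moreover have "\<forall>i. i \<prec> y \<longrightarrow> s !! (i \<oplus> \<one>) = G (s !! i)" using s less_trans less_self_succ by blast
  then have "iterate G c y = s !! y" using iterate_graph[OF assms, of "s !! y"] s by metis
  ultimately show ?thesis using s by simp
qed

subsection \<open>Numerals\<close>

lemma num_of_nat: "num M n = of_nat n"
  by (induction n) (simp_all add: add_comm)

declare num.simps [simp del]

lemma num_0: "num M 0 = \<zero>" and num_1: "num M (Suc 0) = \<one>"
  by (simp_all add: num.simps zero_add)

lemma num_Suc: "num M (Suc n) = num M n \<oplus> \<one>"
  by (simp add: num.simps)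

lemma num_inject [simp]: "num M m = num M n \<longleftrightarrow> m = n"
  by (simp add: num_of_nat)

lemma num_less [simp]: "num M m \<prec> num M n \<longleftrightarrow> m < n"
  by (simp add: num_of_nat)

lemma num_add: "num M (m + n) = num M m \<oplus> num M n"
  by (simp add: num_of_nat)

lemma num_mult: "num M (m * n) = num M m \<otimes> num M n"
  by (simp add: num_of_nat)

lemma num_neq_zero [simp]: "num M n = \<zero> \<longleftrightarrow> n = 0" "\<zero> = num M n \<longleftrightarrow> n = 0"
  using num_inject[of n 0] num_inject[of 0 n] by (simp_all add: num_0)

lemma less_num: "x \<prec> num M n \<longleftrightarrow> (\<exists>m<n. x = num M m)"
proof (induction n arbitrary: x)
  case 0
  then show ?case by (simp add: num_0)
next
  case (Suc n)
  have "x \<prec> num M (Suc n) \<longleftrightarrow> x \<prec> num M n \<or> x = num M n"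
    by (simp add: num_Suc less_succ le_less)
  then show ?case unfolding Suc.IH by (auto simp: less_Suc_eq)
qed

lemma num_pair: "num M (prod_encode (m, n)) = pair M (num M m) (num M n)"
proof -
  have "triangle k + triangle k = k * (k + 1)" for k by (induction k) auto
  from this[of "m + n"] have "prod_encode (m, n) + prod_encode (m, n) = (m + n) * (m + n + 1) + (m + m)"
    unfolding prod_encode_def by simp
  then have "num M (prod_encode (m, n)) \<oplus> num M (prod_encode (m, n)) =
    (num M m \<oplus> num M n) \<otimes> (num M m \<oplus> num M n \<oplus> \<one>) \<oplus> (num M m \<oplus> num M m)"
    unfolding num_add[symmetric] num_1[symmetric] num_mult[symmetric] by simp
  then show ?thesis by (metis pair_eq)
qed

subsection \<open>Coded sets\<close>

lemma pow2_iterate: "pow2 M x = iterate (\<lambda>v. v \<oplus> v) \<one> x"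
  unfolding pow2_def iterate_def ..

lemma pdfun_double: "pdfun M (\<lambda>e. e 0 \<oplus> e 0)" by (intro pdf_intros)

lemma pow2_zero: "pow2 M \<zero> = \<one>"
  unfolding pow2_iterate using iterate_zero[OF pdfun_double] .

lemma pow2_succ: "pow2 M (x \<oplus> \<one>) = pow2 M x \<oplus> pow2 M x"
  unfolding pow2_iterate using iterate_succ[OF pdfun_double] .

lemma pdfun_pow2 [pdf_intros]: "pdfun M f \<Longrightarrow> pdfun M (\<lambda>e. pow2 M (f e))"
proof (rule pdfun_app1[where h = "pow2 M"])
  show "pdfun M (\<lambda>e. pow2 M (e 0))"
    unfolding pdfun_def pow2_iterate iterate_graph[OF pdfun_double] by (intro pdf_intros)
qed

lemma less_pow2: "x \<prec> pow2 M x"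
proof (induction x rule: ind)
  case zero
  show ?case by (simp add: pow2_zero)
next
  case (succ x)
  have "\<one> \<preceq> pow2 M x" using succ one_le_iff not_less_zero by metis
  then have "x \<oplus> \<one> \<prec> pow2 M x \<oplus> pow2 M x" using succ by (intro add_less_le_mono)
  then show ?case by (simp add: pow2_succ)
qed (intro pdf_intros)

lemma pow2_neq_zero [simp]: "pow2 M x \<noteq> \<zero>"
  using less_pow2[of x] not_less_zero by metis

lemma pow2_multiple: "x \<prec> y \<Longrightarrow> \<exists>k. pow2 M y = (k \<oplus> k) \<otimes> pow2 M x"
proof -
  have "\<exists>k. pow2 M (x \<oplus> \<one> \<oplus> z) = (k \<oplus> k) \<otimes> pow2 M x" for z
  proof (induction z rule: ind)
    case zero
    have "pow2 M (x \<oplus> \<one> \<oplus> \<zero>) = (\<one> \<oplus> \<one>) \<otimes> pow2 M x" by (simp add: pow2_succ distrib_right)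
    then show ?case by blast
  next
    case (succ z)
    then obtain k where "pow2 M (x \<oplus> \<one> \<oplus> z) = (k \<oplus> k) \<otimes> pow2 M x" by blast
    then have "pow2 M (x \<oplus> \<one> \<oplus> (z \<oplus> \<one>)) = ((k \<oplus> k) \<oplus> (k \<oplus> k)) \<otimes> pow2 M x"
      by (simp add: pow2_succ distrib_right flip: add_assoc)
    then show ?case by blast
  qed (intro pdf_intros)
  moreover assume "x \<prec> y"
  then obtain z where "x \<oplus> \<one> \<oplus> z = y" using less_iff by (metis add_assoc add_comm)
  ultimately show ?thesis by blast
qed

lemma pow2_mono: "x \<preceq> y \<Longrightarrow> pow2 M x \<preceq> pow2 M y"
proof (cases "x = y")
  case False
  assume "x \<preceq> y"
  then obtain k where k: "pow2 M y = (k \<oplus> k) \<otimes> pow2 M x" using False pow2_multiple le_less by metis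
  then have "k \<oplus> k \<noteq> \<zero>" using pow2_neq_zero zero_mult by metis
  then show ?thesis unfolding k by (subst mult_comm) (rule le_mult1)
qed simp

abbreviation elem (infix \<open>\<epsilon>\<close> 50) where "x \<epsilon> c \<equiv> mem M x c"

lemma odd_neq_even: "q \<oplus> q \<oplus> \<one> \<noteq> p \<oplus> p"
proof
  assume "q \<oplus> q \<oplus> \<one> = p \<oplus> p"
  then have "q \<otimes> (\<one> \<oplus> \<one>) \<oplus> \<one> = p \<otimes> (\<one> \<oplus> \<one>) \<oplus> \<zero>" by (simp add: distrib_left)
  moreover have "\<one> \<prec> \<one> \<oplus> \<one>" "\<zero> \<prec> \<one> \<oplus> \<one>" by (simp_all add: pos_iff succ_neq_zero)
  ultimately have "\<one> = \<zero>" using division_unique[of q "\<one> \<oplus> \<one>" \<one> p \<zero>] by blast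
  then show False by simp
qed

lemma even_or_odd: "\<exists>q. x = q \<oplus> q \<or> x = q \<oplus> q \<oplus> \<one>"
proof (induction x rule: ind)
  case zero
  show ?case by (rule exI[of _ \<zero>]) simp
next
  case (succ x)
  then obtain q where q: "x = q \<oplus> q \<or> x = q \<oplus> q \<oplus> \<one>" by blast
  have "q \<oplus> q \<oplus> \<one> \<oplus> \<one> = (q \<oplus> \<one>) \<oplus> (q \<oplus> \<one>)" by (simp add: add.left_commute add_comm)
  then show ?case using q by metis
qed (intro pdf_intros)

lemma mem_parity:
  assumes "c = d \<otimes> pow2 M x \<oplus> r" "r \<prec> pow2 M x"
  shows "x \<epsilon> c \<longleftrightarrow> (\<exists>q. d = q \<oplus> q \<oplus> \<one>)"
  unfolding mem_def using assms division_unique by metis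

lemma pdf_mem [pdf_intros]: "pdfun M f \<Longrightarrow> pdfun M g \<Longrightarrow> pdf M (\<lambda>e. f e \<epsilon> g e)"
  by (rule pdf_app2[where R = "mem M"]) (unfold mem_def, intro pdf_intros)

lemma mem_pow2_le: "x \<epsilon> c \<Longrightarrow> pow2 M x \<preceq> c"
proof -
  assume "x \<epsilon> c"
  then obtain q r where "c = (q \<oplus> q \<oplus> \<one>) \<otimes> pow2 M x \<oplus> r" unfolding mem_def by blast
  then have "c = pow2 M x \<oplus> ((q \<oplus> q) \<otimes> pow2 M x \<oplus> r)" by (simp add: distrib_right add.left_commute add_comm)
  then show ?thesis by (metis le_add1)
qed

lemma mem_less: "x \<epsilon> c \<Longrightarrow> x \<prec> c"
  using mem_pow2_le less_pow2 less_le_trans by blast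

lemma not_mem_zero [simp]: "\<not> x \<epsilon> \<zero>"
  using mem_less by force

lemma mem_add_pow2_eq: "c \<prec> pow2 M n \<Longrightarrow> n \<epsilon> c \<oplus> pow2 M n"
  using mem_parity[of "c \<oplus> pow2 M n" \<one> n c] by (metis add_comm one_mult zero_add)

lemma mem_add_pow2_less: assumes "x \<prec> n" shows "x \<epsilon> c \<oplus> pow2 M n \<longleftrightarrow> x \<epsilon> c"
proof -
  obtain d r where c: "c = d \<otimes> pow2 M x \<oplus> r" "r \<prec> pow2 M x"
    using division_ex[OF pow2_neq_zero] by blast
  obtain k where k: "pow2 M n = (k \<oplus> k) \<otimes> pow2 M x" using pow2_multiple[OF assms] by blast
  have "c \<oplus> pow2 M n = (d \<oplus> (k \<oplus> k)) \<otimes> pow2 M x \<oplus> r"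
    unfolding k c(1) by (simp add: distrib_right add.left_commute add_comm)
  then have "x \<epsilon> c \<oplus> pow2 M n \<longleftrightarrow> (\<exists>q. d \<oplus> (k \<oplus> k) = q \<oplus> q \<oplus> \<one>)" using mem_parity c(2) by blast
  also have "\<dots> \<longleftrightarrow> (\<exists>q. d = q \<oplus> q \<oplus> \<one>)"
  proof
    assume "\<exists>q. d = q \<oplus> q \<oplus> \<one>"
    then obtain q where "d = q \<oplus> q \<oplus> \<one>" by blast
    then have "d \<oplus> (k \<oplus> k) = (q \<oplus> k) \<oplus> (q \<oplus> k) \<oplus> \<one>" by (simp add: add.left_commute add_comm)
    then show "\<exists>q. d \<oplus> (k \<oplus> k) = q \<oplus> q \<oplus> \<one>" by blast
  next
    assume *: "\<exists>q. d \<oplus> (k \<oplus> k) = q \<oplus> q \<oplus> \<one>"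
    obtain p where "d = p \<oplus> p \<or> d = p \<oplus> p \<oplus> \<one>" using even_or_odd by blast
    moreover have "p \<oplus> p \<oplus> (k \<oplus> k) = (p \<oplus> k) \<oplus> (p \<oplus> k)" by (simp add: add.left_commute add_comm)
    ultimately show "\<exists>q. d = q \<oplus> q \<oplus> \<one>" using * odd_neq_even by metis
  qed
  also have "\<dots> \<longleftrightarrow> x \<epsilon> c" using mem_parity c by blast
  finally show ?thesis .
qed

lemma less_pow2_succ:
  assumes "c \<prec> pow2 M (n \<oplus> \<one>)"
  obtains "c \<prec> pow2 M n" | d where "d \<prec> pow2 M n" "c = d \<oplus> pow2 M n"
proof (cases "c \<prec> pow2 M n")
  case False
  then obtain d where "c = d \<oplus> pow2 M n" by (metis add_comm le_iff not_less)
  then show ?thesis using that(2)[of d] assms by (simp add: pow2_succ)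
qed (rule that(1))

text \<open>The bound \<open>pow2 M n\<close> carries the induction: setting the bit
  \<open>n\<close> is then the addition of \<open>pow2 M n\<close>, without carry.\<close>

lemma comprehension_pow2:
  assumes P: "pdf M (\<lambda>e. P (e 0))"
  shows "\<exists>c. c \<prec> pow2 M n \<and> (\<forall>x. x \<epsilon> c \<longleftrightarrow> x \<prec> n \<and> P x)"
proof (induction n rule: ind)
  case pdf
  show ?case by (intro pdf_intros pdf_app1[OF P])
next
  case zero
  show ?case by (rule exI[of _ \<zero>]) (simp add: pow2_zero)
next
  case (succ n)
  then obtain c where c: "c \<prec> pow2 M n" "\<And>x. x \<epsilon> c \<longleftrightarrow> x \<prec> n \<and> P x" by blast
  show ?case
  proof (cases "P n")
    case True
    have "c \<oplus> pow2 M n \<prec> pow2 M (n \<oplus> \<one>)" using c(1) by (simp add: pow2_succ)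
    moreover have "x \<epsilon> c \<oplus> pow2 M n \<longleftrightarrow> x \<prec> n \<oplus> \<one> \<and> P x" for x
    proof (cases x n rule: linorder_cases)
      case less
      then show ?thesis using mem_add_pow2_less c(2) less_succ less_imp_le by metis
    next
      case equal
      then show ?thesis using mem_add_pow2_eq c(1) True by simp
    next
      case greater
      then have "pow2 M (n \<oplus> \<one>) \<preceq> pow2 M x" using less_succ_le pow2_mono by blast
      then have "\<not> pow2 M x \<preceq> c \<oplus> pow2 M n" using \<open>c \<oplus> pow2 M n \<prec> _\<close> not_le less_le_trans by blast
      then show ?thesis using mem_pow2_le less_succ not_less greater by blast
    qed
    ultimately show ?thesis by blast
  next
    case False
    have "c \<prec> pow2 M (n \<oplus> \<one>)" using c(1) le_add1 less_le_trans by (metis pow2_succ)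
    moreover have "x \<epsilon> c \<longleftrightarrow> x \<prec> n \<oplus> \<one> \<and> P x" for x using c(2) False less_succ le_less by metis
    ultimately show ?thesis by blast
  qed
qed

lemma comprehension:
  assumes "pdf M (\<lambda>e. P (e 0))" and "\<And>x. P x \<Longrightarrow> x \<prec> n"
  obtains c where "\<And>x. x \<epsilon> c \<longleftrightarrow> P x"
  using comprehension_pow2[OF assms(1), of n] assms(2) by blast

lemma ext_below:
  "c \<prec> pow2 M n \<Longrightarrow> d \<prec> pow2 M n \<Longrightarrow> (\<And>x. x \<prec> n \<Longrightarrow> x \<epsilon> c \<longleftrightarrow> x \<epsilon> d) \<Longrightarrow> c = d"
proof -
  have "\<forall>c d. c \<prec> pow2 M n \<and> d \<prec> pow2 M n \<and> (\<forall>x. x \<prec> n \<longrightarrow> (x \<epsilon> c \<longleftrightarrow> x \<epsilon> d)) \<longrightarrow> c = d"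
  proof (induction n rule: ind)
    case zero
    have "c = \<zero>" if "c \<prec> \<one>" for c using that less_num[of c 1] by (simp add: num_0 num_1)
    then show ?case by (metis pow2_zero)
  next
    case (succ n)
    have IH: "c = d" if "c \<prec> pow2 M n" "d \<prec> pow2 M n" "\<And>x. x \<prec> n \<Longrightarrow> x \<epsilon> c \<longleftrightarrow> x \<epsilon> d" for c d
      using succ that by blast
    show ?case
    proof (intro allI impI, elim conjE)
      fix c d assume c: "c \<prec> pow2 M (n \<oplus> \<one>)" and d: "d \<prec> pow2 M (n \<oplus> \<one>)"
        and eq: "\<forall>x. x \<prec> n \<oplus> \<one> \<longrightarrow> (x \<epsilon> c \<longleftrightarrow> x \<epsilon> d)"
      have eqn: "n \<epsilon> c \<longleftrightarrow> n \<epsilon> d" using eq less_self_succ by blast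
      have eql: "x \<epsilon> c \<longleftrightarrow> x \<epsilon> d" if "x \<prec> n" for x using eq that less_succ less_imp_le by blast
      have small: "\<not> n \<epsilon> c" if "c \<prec> pow2 M n" for c using mem_pow2_le that not_le by blast
      from c show "c = d"
      proof (cases rule: less_pow2_succ)
        case 1
        from d show ?thesis
        proof (cases rule: less_pow2_succ)
          case 1
          show ?thesis by (rule IH[OF \<open>c \<prec> pow2 M n\<close> 1 eql])
        next
          case (2 d')
          then show ?thesis using eqn small[OF \<open>c \<prec> pow2 M n\<close>] mem_add_pow2_eq by blast
        qed
      next
        case c': (2 c')
        from d show ?thesis
        proof (cases rule: less_pow2_succ)
          case 1
          then show ?thesis using eqn small c' mem_add_pow2_eq by blast
        next
          case (2 d')
          have "c' = d'"
          proof (rule IH[OF c'(1) 2(1)])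
            fix x assume "x \<prec> n"
            then show "x \<epsilon> c' \<longleftrightarrow> x \<epsilon> d'" using eql[of x] mem_add_pow2_less c'(2) 2(2) by blast
          qed
          then show ?thesis using c' 2 by simp
        qed
      qed
    qed
  qed (intro pdf_intros)
  then show "c \<prec> pow2 M n \<Longrightarrow> d \<prec> pow2 M n \<Longrightarrow> (\<And>x. x \<prec> n \<Longrightarrow> x \<epsilon> c \<longleftrightarrow> x \<epsilon> d) \<Longrightarrow> c = d" by blast
qed

lemma set_ext: "(\<And>x. x \<epsilon> c \<longleftrightarrow> x \<epsilon> d) \<Longrightarrow> c = d"
proof -
  assume "\<And>x. x \<epsilon> c \<longleftrightarrow> x \<epsilon> d"
  moreover have "c \<prec> pow2 M (c \<oplus> d)" "d \<prec> pow2 M (c \<oplus> d)"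
    using less_pow2[of "c \<oplus> d"] le_add1[of c d] le_add2[of d c] le_less_trans by blast+
  ultimately show ?thesis using ext_below by blast
qed

lemma set_insert: obtains d where "\<And>x. x \<epsilon> d \<longleftrightarrow> x \<epsilon> c \<or> x = u"
proof (rule comprehension[of "\<lambda>x. x \<epsilon> c \<or> x = u" "c \<oplus> u \<oplus> \<one>"])
  show "pdf M (\<lambda>e. e 0 \<epsilon> c \<or> e 0 = u)" by (intro pdf_intros)
  fix x assume "x \<epsilon> c \<or> x = u"
  then show "x \<prec> c \<oplus> u \<oplus> \<one>"
    using mem_less[of x c] le_add1[of c u] le_add2[of u c] less_succ less_imp_le order_trans by metis
qed (use that in blast)

lemma set_union: obtains d where "\<And>x. x \<epsilon> d \<longleftrightarrow> x \<epsilon> c \<or> x \<epsilon> c'"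
proof (rule comprehension[of "\<lambda>x. x \<epsilon> c \<or> x \<epsilon> c'" "c \<oplus> c'"])
  show "pdf M (\<lambda>e. e 0 \<epsilon> c \<or> e 0 \<epsilon> c')" by (intro pdf_intros)
  fix x assume "x \<epsilon> c \<or> x \<epsilon> c'"
  then show "x \<prec> c \<oplus> c'"
    using mem_less[of x] le_add1[of c c'] le_add2[of c' c] less_le_trans by blast
qed (use that in blast)

text \<open>The recursive notions of the arithmetized syntax are all defined in this shape.\<close>

definition closed_in :: "(('a \<Rightarrow> bool) \<Rightarrow> 'a \<Rightarrow> bool) \<Rightarrow> 'a \<Rightarrow> bool" where
  "closed_in Q u \<longleftrightarrow> (\<exists>C. u \<epsilon> C \<and> (\<forall>w. w \<epsilon> C \<longrightarrow> Q (\<lambda>x. x \<epsilon> C) w))"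

text \<open>By \<open>fin\<close> a step uses at most two constituents, so their coded witnesses can
  be united and extended by \<open>u\<close> to a set that is again coded. This gives the direction
  from right to left.\<close>

lemma closed_in_unfold:
  assumes mono: "\<And>A B w. Q A w \<Longrightarrow> (\<And>x. A x \<Longrightarrow> B x) \<Longrightarrow> Q B w"
    and fin: "\<And>A w. Q A w \<Longrightarrow> Q (\<lambda>_. False) w \<or> (\<exists>a b. A a \<and> A b \<and> Q (\<lambda>x. x = a \<or> x = b) w)"
  shows "closed_in Q u \<longleftrightarrow> Q (closed_in Q) u"
proof
  assume "closed_in Q u"
  then obtain C where C: "u \<epsilon> C" "\<And>w. w \<epsilon> C \<Longrightarrow> Q (\<lambda>x. x \<epsilon> C) w" unfolding closed_in_def by blast
  then have "closed_in Q x" if "x \<epsilon> C" for x unfolding closed_in_def using that by blast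
  then show "Q (closed_in Q) u" using C mono[OF C(2)[OF C(1)]] by blast
next
  assume u: "Q (closed_in Q) u"
  have ins: "closed_in Q u" if D: "\<And>w. w \<epsilon> D \<Longrightarrow> Q (\<lambda>x. x \<epsilon> D) w" and Q: "Q (\<lambda>x. x \<epsilon> D) u" for D
  proof -
    obtain C where C: "\<And>x. x \<epsilon> C \<longleftrightarrow> x \<epsilon> D \<or> x = u" using set_insert by blast
    have "Q (\<lambda>x. x \<epsilon> C) w" if "w \<epsilon> C" for w
    proof -
      have "Q (\<lambda>x. x \<epsilon> D) w" using that C D Q by blast
      then show ?thesis by (rule mono) (simp add: C)
    qed
    then show ?thesis unfolding closed_in_def using C by blast
  qed
  from fin[OF u] show "closed_in Q u"
  proof
    assume "Q (\<lambda>_. False) u"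
    then show ?thesis by (intro ins[of \<zero>]) (auto elim: mono)
  next
    assume "\<exists>a b. closed_in Q a \<and> closed_in Q b \<and> Q (\<lambda>x. x = a \<or> x = b) u"
    then obtain a b A B where A: "a \<epsilon> A" "\<And>w. w \<epsilon> A \<Longrightarrow> Q (\<lambda>x. x \<epsilon> A) w"
      and B: "b \<epsilon> B" "\<And>w. w \<epsilon> B \<Longrightarrow> Q (\<lambda>x. x \<epsilon> B) w" and ab: "Q (\<lambda>x. x = a \<or> x = b) u"
      unfolding closed_in_def by blast
    obtain D where D: "\<And>x. x \<epsilon> D \<longleftrightarrow> x \<epsilon> A \<or> x \<epsilon> B" using set_union by blast
    show ?thesis
    proof (rule ins)
      show "Q (\<lambda>x. x \<epsilon> D) w" if "w \<epsilon> D" for w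
      proof -
        have "Q (\<lambda>x. x \<epsilon> A) w \<or> Q (\<lambda>x. x \<epsilon> B) w" using that D A B by blast
        then show ?thesis
        proof
          assume "Q (\<lambda>x. x \<epsilon> A) w"
          then show ?thesis by (rule mono) (simp add: D)
        next
          assume "Q (\<lambda>x. x \<epsilon> B) w"
          then show ?thesis by (rule mono) (simp add: D)
        qed
      qed
      show "Q (\<lambda>x. x \<epsilon> D) u" using ab by (rule mono) (use A B D in auto)
    qed
  qed
qed

section \<open>Arithmetized syntax\<close>

lemmas code_defs = cVar_def cZero_def cOne_def cAdd_def cMult_def cEq_def cLess_def cNeg_def cOr_def cEx_def

lemma code_inject [simp]:
  "cVar M x = cVar M y \<longleftrightarrow> x = y"
  "cAdd M s t = cAdd M s' t' \<longleftrightarrow> s = s' \<and> t = t'"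
  "cMult M s t = cMult M s' t' \<longleftrightarrow> s = s' \<and> t = t'"
  "cEq M s t = cEq M s' t' \<longleftrightarrow> s = s' \<and> t = t'"
  "cLess M s t = cLess M s' t' \<longleftrightarrow> s = s' \<and> t = t'"
  "cNeg M \<phi> = cNeg M \<phi>' \<longleftrightarrow> \<phi> = \<phi>'"
  "cOr M \<phi> \<psi> = cOr M \<phi>' \<psi>' \<longleftrightarrow> \<phi> = \<phi>' \<and> \<psi> = \<psi>'"
  "cEx M x \<phi> = cEx M x' \<phi>' \<longleftrightarrow> x = x' \<and> \<phi> = \<phi>'"
  by (auto simp: code_defs)

lemma code_distinct [simp]:
  "cVar M x \<noteq> cZero M" "cVar M x \<noteq> cOne M" "cVar M x \<noteq> cAdd M r' s'" "cVar M x \<noteq> cMult M r' s'"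
  "cVar M x \<noteq> cEq M r' s'" "cVar M x \<noteq> cLess M r' s'" "cVar M x \<noteq> cNeg M \<phi>'" "cVar M x \<noteq> cOr M \<phi>' \<psi>'"
  "cVar M x \<noteq> cEx M x' \<phi>'"
  "cZero M \<noteq> cVar M x'" "cZero M \<noteq> cOne M" "cZero M \<noteq> cAdd M r' s'" "cZero M \<noteq> cMult M r' s'"
  "cZero M \<noteq> cEq M r' s'" "cZero M \<noteq> cLess M r' s'" "cZero M \<noteq> cNeg M \<phi>'" "cZero M \<noteq> cOr M \<phi>' \<psi>'"
  "cZero M \<noteq> cEx M x' \<phi>'"
  "cOne M \<noteq> cVar M x'" "cOne M \<noteq> cZero M" "cOne M \<noteq> cAdd M r' s'" "cOne M \<noteq> cMult M r' s'" "cOne M \<noteq> cEq M r' s'"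
  "cOne M \<noteq> cLess M r' s'" "cOne M \<noteq> cNeg M \<phi>'" "cOne M \<noteq> cOr M \<phi>' \<psi>'" "cOne M \<noteq> cEx M x' \<phi>'"
  "cAdd M r s \<noteq> cVar M x'" "cAdd M r s \<noteq> cZero M" "cAdd M r s \<noteq> cOne M" "cAdd M r s \<noteq> cMult M r' s'"
  "cAdd M r s \<noteq> cEq M r' s'" "cAdd M r s \<noteq> cLess M r' s'" "cAdd M r s \<noteq> cNeg M \<phi>'"
  "cAdd M r s \<noteq> cOr M \<phi>' \<psi>'" "cAdd M r s \<noteq> cEx M x' \<phi>'"
  "cMult M r s \<noteq> cVar M x'" "cMult M r s \<noteq> cZero M" "cMult M r s \<noteq> cOne M" "cMult M r s \<noteq> cAdd M r' s'"
  "cMult M r s \<noteq> cEq M r' s'" "cMult M r s \<noteq> cLess M r' s'" "cMult M r s \<noteq> cNeg M \<phi>'"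
  "cMult M r s \<noteq> cOr M \<phi>' \<psi>'" "cMult M r s \<noteq> cEx M x' \<phi>'"
  "cEq M r s \<noteq> cVar M x'" "cEq M r s \<noteq> cZero M" "cEq M r s \<noteq> cOne M" "cEq M r s \<noteq> cAdd M r' s'"
  "cEq M r s \<noteq> cMult M r' s'" "cEq M r s \<noteq> cLess M r' s'" "cEq M r s \<noteq> cNeg M \<phi>'" "cEq M r s \<noteq> cOr M \<phi>' \<psi>'"
  "cEq M r s \<noteq> cEx M x' \<phi>'"
  "cLess M r s \<noteq> cVar M x'" "cLess M r s \<noteq> cZero M" "cLess M r s \<noteq> cOne M" "cLess M r s \<noteq> cAdd M r' s'"
  "cLess M r s \<noteq> cMult M r' s'" "cLess M r s \<noteq> cEq M r' s'" "cLess M r s \<noteq> cNeg M \<phi>'"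
  "cLess M r s \<noteq> cOr M \<phi>' \<psi>'" "cLess M r s \<noteq> cEx M x' \<phi>'"
  "cNeg M \<phi> \<noteq> cVar M x'" "cNeg M \<phi> \<noteq> cZero M" "cNeg M \<phi> \<noteq> cOne M" "cNeg M \<phi> \<noteq> cAdd M r' s'"
  "cNeg M \<phi> \<noteq> cMult M r' s'" "cNeg M \<phi> \<noteq> cEq M r' s'" "cNeg M \<phi> \<noteq> cLess M r' s'"
  "cNeg M \<phi> \<noteq> cOr M \<phi>' \<psi>'" "cNeg M \<phi> \<noteq> cEx M x' \<phi>'"
  "cOr M \<phi> \<psi> \<noteq> cVar M x'" "cOr M \<phi> \<psi> \<noteq> cZero M" "cOr M \<phi> \<psi> \<noteq> cOne M"
  "cOr M \<phi> \<psi> \<noteq> cAdd M r' s'" "cOr M \<phi> \<psi> \<noteq> cMult M r' s'" "cOr M \<phi> \<psi> \<noteq> cEq M r' s'"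
  "cOr M \<phi> \<psi> \<noteq> cLess M r' s'" "cOr M \<phi> \<psi> \<noteq> cNeg M \<phi>'" "cOr M \<phi> \<psi> \<noteq> cEx M x' \<phi>'"
  "cEx M x \<phi> \<noteq> cVar M x'" "cEx M x \<phi> \<noteq> cZero M" "cEx M x \<phi> \<noteq> cOne M" "cEx M x \<phi> \<noteq> cAdd M r' s'"
  "cEx M x \<phi> \<noteq> cMult M r' s'" "cEx M x \<phi> \<noteq> cEq M r' s'" "cEx M x \<phi> \<noteq> cLess M r' s'"
  "cEx M x \<phi> \<noteq> cNeg M \<phi>'" "cEx M x \<phi> \<noteq> cOr M \<phi>' \<psi>'"
  by (simp_all add: code_defs)

lemma less_cNeg: "\<phi> \<prec> cNeg M \<phi>"
  unfolding cNeg_def by (rule less_pair2) simp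

lemma less_binary:
  assumes "k \<noteq> 0" shows "s \<prec> pair M (num M k) (pair M s t)" "t \<prec> pair M (num M k) (pair M s t)"
proof -
  have "num M k \<noteq> \<zero>" using assms by simp
  from less_pair2[OF this] show "s \<prec> pair M (num M k) (pair M s t)" "t \<prec> pair M (num M k) (pair M s t)"
    using le_pair1 le_pair2 le_less_trans by blast+
qed

lemma less_cOr: "\<phi> \<prec> cOr M \<phi> \<psi>" "\<psi> \<prec> cOr M \<phi> \<psi>"
  and less_cEx: "x \<prec> cEx M x \<phi>" "\<phi> \<prec> cEx M x \<phi>"
  and less_cAdd: "s \<prec> cAdd M s t" "t \<prec> cAdd M s t"
  and less_cMult: "s \<prec> cMult M s t" "t \<prec> cMult M s t"
  and less_cEq: "s \<prec> cEq M s t" "t \<prec> cEq M s t"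
  and less_cLess: "s \<prec> cLess M s t" "t \<prec> cLess M s t"
  unfolding code_defs by (rule less_binary; simp)+

lemma pdfun_codes [pdf_intros]:
  "pdfun M f \<Longrightarrow> pdfun M (\<lambda>e. cVar M (f e))"
  "pdfun M (\<lambda>e. cZero M)" "pdfun M (\<lambda>e. cOne M)"
  "pdfun M f \<Longrightarrow> pdfun M g \<Longrightarrow> pdfun M (\<lambda>e. cAdd M (f e) (g e))"
  "pdfun M f \<Longrightarrow> pdfun M g \<Longrightarrow> pdfun M (\<lambda>e. cMult M (f e) (g e))"
  "pdfun M f \<Longrightarrow> pdfun M g \<Longrightarrow> pdfun M (\<lambda>e. cEq M (f e) (g e))"
  "pdfun M f \<Longrightarrow> pdfun M g \<Longrightarrow> pdfun M (\<lambda>e. cLess M (f e) (g e))"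
  "pdfun M f \<Longrightarrow> pdfun M (\<lambda>e. cNeg M (f e))"
  "pdfun M f \<Longrightarrow> pdfun M g \<Longrightarrow> pdfun M (\<lambda>e. cOr M (f e) (g e))"
  "pdfun M f \<Longrightarrow> pdfun M g \<Longrightarrow> pdfun M (\<lambda>e. cEx M (f e) (g e))"
  unfolding code_defs by (intro pdf_intros; assumption)+

lemma Term_iff: "Term M t \<longleftrightarrow> (\<exists>x. t = cVar M x) \<or> t = cZero M \<or> t = cOne M \<or>
    (\<exists>r s. Term M r \<and> Term M s \<and> (t = cAdd M r s \<or> t = cMult M r s))"
proof -
  define Q where "Q A u \<longleftrightarrow> (\<exists>x. u = cVar M x) \<or> u = cZero M \<or> u = cOne M \<or>
    (\<exists>r s. A r \<and> A s \<and> (u = cAdd M r s \<or> u = cMult M r s))" for A u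
  have T: "Term M = closed_in Q" unfolding Term_def closed_in_def Q_def by (rule ext) (rule refl)
  have "closed_in Q t \<longleftrightarrow> Q (closed_in Q) t"
  proof (rule closed_in_unfold)
    show "Q A w \<Longrightarrow> (\<And>x. A x \<Longrightarrow> B x) \<Longrightarrow> Q B w" for A B w unfolding Q_def by metis
    show "Q A w \<Longrightarrow> Q (\<lambda>_. False) w \<or> (\<exists>a b. A a \<and> A b \<and> Q (\<lambda>x. x = a \<or> x = b) w)" for A w
      unfolding Q_def by metis
  qed
  then show ?thesis unfolding T Q_def .
qed

lemma Form_iff: "Form M \<phi> \<longleftrightarrow> (\<exists>s t. Term M s \<and> Term M t \<and> (\<phi> = cEq M s t \<or> \<phi> = cLess M s t)) \<or>
    (\<exists>\<psi>. Form M \<psi> \<and> \<phi> = cNeg M \<psi>) \<or> (\<exists>\<psi> \<chi>. Form M \<psi> \<and> Form M \<chi> \<and> \<phi> = cOr M \<psi> \<chi>) \<or>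
    (\<exists>x \<psi>. Form M \<psi> \<and> \<phi> = cEx M x \<psi>)"
proof -
  define Q where "Q A u \<longleftrightarrow> (\<exists>s t. Term M s \<and> Term M t \<and> (u = cEq M s t \<or> u = cLess M s t)) \<or>
    (\<exists>\<psi>. A \<psi> \<and> u = cNeg M \<psi>) \<or> (\<exists>\<psi> \<chi>. A \<psi> \<and> A \<chi> \<and> u = cOr M \<psi> \<chi>) \<or>
    (\<exists>x \<psi>. A \<psi> \<and> u = cEx M x \<psi>)" for A u
  have F: "Form M = closed_in Q" unfolding Form_def closed_in_def Q_def by (rule ext) (rule refl)
  have "closed_in Q \<phi> \<longleftrightarrow> Q (closed_in Q) \<phi>"
  proof (rule closed_in_unfold)
    show "Q A w \<Longrightarrow> (\<And>x. A x \<Longrightarrow> B x) \<Longrightarrow> Q B w" for A B w unfolding Q_def by metis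
    show "Q A w \<Longrightarrow> Q (\<lambda>_. False) w \<or> (\<exists>a b. A a \<and> A b \<and> Q (\<lambda>x. x = a \<or> x = b) w)" for A w
      unfolding Q_def by metis
  qed
  then show ?thesis unfolding F Q_def .
qed

lemma Free_iff: "Free M x u \<longleftrightarrow> u = cVar M x \<or>
    (\<exists>s t. (Free M x s \<or> Free M x t) \<and>
      (u = cAdd M s t \<or> u = cMult M s t \<or> u = cEq M s t \<or> u = cLess M s t \<or> u = cOr M s t)) \<or>
    (\<exists>\<psi>. Free M x \<psi> \<and> u = cNeg M \<psi>) \<or>
    (\<exists>y \<psi>. y \<noteq> x \<and> Free M x \<psi> \<and> u = cEx M y \<psi>)"
proof -
  define Q where "Q A u \<longleftrightarrow> u = cVar M x \<or>
    (\<exists>s t. (A s \<or> A t) \<and>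
      (u = cAdd M s t \<or> u = cMult M s t \<or> u = cEq M s t \<or> u = cLess M s t \<or> u = cOr M s t)) \<or>
    (\<exists>\<psi>. A \<psi> \<and> u = cNeg M \<psi>) \<or> (\<exists>y \<psi>. y \<noteq> x \<and> A \<psi> \<and> u = cEx M y \<psi>)" for A u
  have F: "Free M x = closed_in Q" unfolding Free_def closed_in_def Q_def by (rule ext) (rule refl)
  have "closed_in Q u \<longleftrightarrow> Q (closed_in Q) u"
  proof (rule closed_in_unfold)
    show "Q A w \<Longrightarrow> (\<And>x. A x \<Longrightarrow> B x) \<Longrightarrow> Q B w" for A B w unfolding Q_def by metis
    show "Q A w \<Longrightarrow> Q (\<lambda>_. False) w \<or> (\<exists>a b. A a \<and> A b \<and> Q (\<lambda>x. x = a \<or> x = b) w)" for A w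
      unfolding Q_def by metis
  qed
  then show ?thesis unfolding F Q_def .
qed

lemma Form_simps [simp]:
  "Form M (cEq M s t) \<longleftrightarrow> Term M s \<and> Term M t"
  "Form M (cLess M s t) \<longleftrightarrow> Term M s \<and> Term M t"
  "Form M (cNeg M \<phi>) \<longleftrightarrow> Form M \<phi>"
  "Form M (cOr M \<phi> \<psi>) \<longleftrightarrow> Form M \<phi> \<and> Form M \<psi>"
  "Form M (cEx M x \<phi>) \<longleftrightarrow> Form M \<phi>"
  by (subst Form_iff, simp)+

lemma Form_cases:
  assumes "Form M \<phi>"
  obtains (Eq) s t where "\<phi> = cEq M s t" "Term M s" "Term M t"
    | (Less) s t where "\<phi> = cLess M s t" "Term M s" "Term M t"
    | (Neg) \<psi> where "\<phi> = cNeg M \<psi>" "Form M \<psi>"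
    | (Or) \<psi> \<chi> where "\<phi> = cOr M \<psi> \<chi>" "Form M \<psi>" "Form M \<chi>"
    | (Ex) x \<psi> where "\<phi> = cEx M x \<psi>" "Form M \<psi>"
  using assms unfolding Form_iff[of \<phi>] by blast

lemma Free_term_simps [simp]:
  "Free M x (cVar M y) \<longleftrightarrow> x = y"
  "\<not> Free M x (cZero M)" "\<not> Free M x (cOne M)"
  "Free M x (cAdd M s t) \<longleftrightarrow> Free M x s \<or> Free M x t"
  "Free M x (cMult M s t) \<longleftrightarrow> Free M x s \<or> Free M x t"
  by (subst Free_iff, fastforce)+

lemma Free_simps [simp]:
  "Free M x (cEq M s t) \<longleftrightarrow> Free M x s \<or> Free M x t"
  "Free M x (cLess M s t) \<longleftrightarrow> Free M x s \<or> Free M x t"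
  "Free M x (cNeg M \<phi>) \<longleftrightarrow> Free M x \<phi>"
  "Free M x (cOr M \<phi> \<psi>) \<longleftrightarrow> Free M x \<phi> \<or> Free M x \<psi>"
  "Free M x (cEx M y \<phi>) \<longleftrightarrow> Free M x \<phi> \<and> x \<noteq> y"
  by (subst Free_iff, fastforce)+

lemma Term_simps [simp]: "Term M (cVar M x)" "Term M (cZero M)" "Term M (cOne M)"
  "Term M (cAdd M s t) \<longleftrightarrow> Term M s \<and> Term M t"
  "Term M (cMult M s t) \<longleftrightarrow> Term M s \<and> Term M t"
  by (subst Term_iff, fastforce)+

lemma pdf_Term [pdf_intros]: "pdfun M f \<Longrightarrow> pdf M (\<lambda>e. Term M (f e))"
  by (rule pdf_app1[where R = "Term M"]) (unfold Term_def, intro pdf_intros)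

lemma pdf_Form [pdf_intros]: "pdfun M f \<Longrightarrow> pdf M (\<lambda>e. Form M (f e))"
  by (rule pdf_app1[where R = "Form M"]) (unfold Form_def, intro pdf_intros)

lemma pdf_Free [pdf_intros]: "pdfun M f \<Longrightarrow> pdfun M g \<Longrightarrow> pdf M (\<lambda>e. Free M (f e) (g e))"
  by (rule pdf_app2[where R = "Free M"]) (unfold Free_def, intro pdf_intros)

lemma pdf_Sent [pdf_intros]: "pdfun M f \<Longrightarrow> pdf M (\<lambda>e. Sent M (f e))"
  by (rule pdf_app1[where R = "Sent M"]) (unfold Sent_def, intro pdf_intros)

lemma pdf_Asn [pdf_intros]: "pdfun M f \<Longrightarrow> pdfun M g \<Longrightarrow> pdf M (\<lambda>e. Asn M (f e) (g e))"
  by (rule pdf_app2[where R = "Asn M"]) (unfold Asn_def, intro pdf_intros)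

lemma Asn_cNeg [simp]: "Asn M \<alpha> (cNeg M \<phi>) \<longleftrightarrow> Asn M \<alpha> \<phi>"
  unfolding Asn_def by simp

lemma Asn_zero_iff: "(\<And>x. \<not> Free M x \<phi>) \<Longrightarrow> Asn M \<alpha> \<phi> \<longleftrightarrow> \<alpha> = \<zero>"
  unfolding Asn_def using set_ext[of \<alpha> \<zero>] by auto

lemma Asn_Sent: "Sent M \<phi> \<Longrightarrow> Asn M \<alpha> \<phi> \<longleftrightarrow> \<alpha> = \<zero>"
  using Asn_zero_iff unfolding Sent_def by blast

lemma restr_graph: "\<beta> = restr M \<alpha> \<phi> \<longleftrightarrow> (\<forall>u. u \<epsilon> \<beta> \<longleftrightarrow> u \<epsilon> \<alpha> \<and> (\<exists>x y. u = pair M x y \<and> Free M x \<phi>))"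
proof -
  obtain \<gamma> where \<gamma>: "\<And>u. u \<epsilon> \<gamma> \<longleftrightarrow> u \<epsilon> \<alpha> \<and> (\<exists>x y. u = pair M x y \<and> Free M x \<phi>)"
    by (rule comprehension[of "\<lambda>u. u \<epsilon> \<alpha> \<and> (\<exists>x y. u = pair M x y \<and> Free M x \<phi>)" \<alpha>])
      (intro pdf_intros, auto dest: mem_less)
  have "\<exists>!\<beta>. \<forall>u. u \<epsilon> \<beta> \<longleftrightarrow> u \<epsilon> \<alpha> \<and> (\<exists>x y. u = pair M x y \<and> Free M x \<phi>)"
    by (rule ex1I[of _ \<gamma>]) (use \<gamma> in \<open>auto intro: set_ext\<close>)
  from the_eq_iff[OF this, of \<beta>] show ?thesis unfolding restr_def eq_commute[of \<beta>] .
qed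

lemma mem_restr: "u \<epsilon> restr M \<alpha> \<phi> \<longleftrightarrow> u \<epsilon> \<alpha> \<and> (\<exists>x y. u = pair M x y \<and> Free M x \<phi>)"
  using restr_graph by blast

lemma pdfun_restr [pdf_intros]: "pdfun M f \<Longrightarrow> pdfun M g \<Longrightarrow> pdfun M (\<lambda>e. restr M (f e) (g e))"
proof (rule pdfun_app2[where h = "restr M"])
  show "pdfun M (\<lambda>e. restr M (e 0) (e (Suc 0)))"
    unfolding pdfun_def restr_graph by (intro pdf_intros)
qed

lemma Asn_restr: "Asn M \<alpha> \<theta> \<Longrightarrow> (\<And>x. Free M x \<phi> \<Longrightarrow> Free M x \<theta>) \<Longrightarrow> Asn M (restr M \<alpha> \<phi>) \<phi>"
  unfolding Asn_def by (auto simp: mem_restr)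

lemma restr_zero [simp]: "restr M \<zero> \<phi> = \<zero>"
  by (rule set_ext) (simp add: mem_restr)

subsection \<open>Values of terms\<close>

definition val_step where
  "val_step \<alpha> A w \<longleftrightarrow> (\<exists>x a. w = pair M (cVar M x) a \<and> pair M x a \<epsilon> \<alpha>) \<or>
      w = pair M (cZero M) \<zero> \<or> w = pair M (cOne M) \<one> \<or>
      (\<exists>r s a b. A (pair M r a) \<and> A (pair M s b) \<and>
        (w = pair M (cAdd M r s) (a \<oplus> b) \<or> w = pair M (cMult M r s) (a \<otimes> b)))"

definition val_rel where "val_rel t \<alpha> v \<longleftrightarrow> closed_in (val_step \<alpha>) (pair M t v)"

lemma val_THE: "val M t \<alpha> = (THE v. val_rel t \<alpha> v)"
  unfolding val_def val_rel_def closed_in_def val_step_def ..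

lemma val_rel_unfold: "val_rel t \<alpha> v \<longleftrightarrow> (\<exists>x. t = cVar M x \<and> pair M x v \<epsilon> \<alpha>) \<or>
    t = cZero M \<and> v = \<zero> \<or> t = cOne M \<and> v = \<one> \<or>
    (\<exists>r s a b. val_rel r \<alpha> a \<and> val_rel s \<alpha> b \<and> (t = cAdd M r s \<and> v = a \<oplus> b \<or> t = cMult M r s \<and> v = a \<otimes> b))"
proof -
  have "closed_in (val_step \<alpha>) u \<longleftrightarrow> val_step \<alpha> (closed_in (val_step \<alpha>)) u" for u
  proof (rule closed_in_unfold)
    show "val_step \<alpha> A w \<Longrightarrow> (\<And>x. A x \<Longrightarrow> B x) \<Longrightarrow> val_step \<alpha> B w" for A B w
      unfolding val_step_def by metis
    show "val_step \<alpha> A w \<Longrightarrow> val_step \<alpha> (\<lambda>_. False) w \<or> (\<exists>a b. A a \<and> A b \<and> val_step \<alpha> (\<lambda>x. x = a \<or> x = b) w)" for A w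
      unfolding val_step_def by metis
  qed
  from this[of "pair M t v"] show ?thesis
    unfolding val_rel_def by (simp only: val_step_def pair_inject) blast
qed

lemma pdf_val_rel [pdf_intros]: "pdfun M f \<Longrightarrow> pdfun M g \<Longrightarrow> pdfun M h \<Longrightarrow> pdf M (\<lambda>e. val_rel (f e) (g e) (h e))"
  by (rule pdf_app3[where R = val_rel])
    (unfold val_rel_def closed_in_def val_step_def, intro pdf_intros)

lemma val_rel_ex1:
  assumes "Term M t" "\<And>x. Free M x t \<Longrightarrow> \<exists>!y. pair M x y \<epsilon> \<alpha>"
  shows "\<exists>!v. val_rel t \<alpha> v"
proof -
  have "Term M t \<and> (\<forall>x. Free M x t \<longrightarrow> (\<exists>!y. pair M x y \<epsilon> \<alpha>)) \<longrightarrow> (\<exists>!v. val_rel t \<alpha> v)"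
  proof (induction t rule: less_ind)
    case pdf
    show ?case by (intro pdf_intros)
  next
    case (less t)
    show ?case
    proof (intro impI, elim conjE)
      assume t: "Term M t" and \<alpha>: "\<forall>x. Free M x t \<longrightarrow> (\<exists>!y. pair M x y \<epsilon> \<alpha>)"
      from t consider x where "t = cVar M x" | "t = cZero M" | "t = cOne M"
        | r s where "Term M r" "Term M s" "t = cAdd M r s" | r s where "Term M r" "Term M s" "t = cMult M r s"
        unfolding Term_iff[of t] by blast
      then show "\<exists>!v. val_rel t \<alpha> v"
      proof cases
        case 1
        then show ?thesis using \<alpha> by (subst val_rel_unfold) simp
      next
        case 2
        then show ?thesis by (subst val_rel_unfold) simp
      next
        case 3
        then show ?thesis by (subst val_rel_unfold) simp
      next
        case 4
        then have "\<exists>!v. val_rel r \<alpha> v" "\<exists>!v. val_rel s \<alpha> v"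
          using less[of r] less[of s] \<alpha> by (simp_all add: less_cAdd)
        then obtain a b where ab: "val_rel r \<alpha> a" "val_rel s \<alpha> b"
          and u: "\<And>c. val_rel r \<alpha> c \<Longrightarrow> c = a" "\<And>c. val_rel s \<alpha> c \<Longrightarrow> c = b"
          by metis
        show ?thesis unfolding 4(3)
        proof (rule ex1I[of _ "a \<oplus> b"])
          show "val_rel (cAdd M r s) \<alpha> (a \<oplus> b)" by (subst val_rel_unfold) (use ab in blast)
          show "v = a \<oplus> b" if "val_rel (cAdd M r s) \<alpha> v" for v
            using that u by (subst (asm) val_rel_unfold) auto
        qed
      next
        case 5
        then have "\<exists>!v. val_rel r \<alpha> v" "\<exists>!v. val_rel s \<alpha> v"
          using less[of r] less[of s] \<alpha> by (simp_all add: less_cMult)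
        then obtain a b where ab: "val_rel r \<alpha> a" "val_rel s \<alpha> b"
          and u: "\<And>c. val_rel r \<alpha> c \<Longrightarrow> c = a" "\<And>c. val_rel s \<alpha> c \<Longrightarrow> c = b"
          by metis
        show ?thesis unfolding 5(3)
        proof (rule ex1I[of _ "a \<otimes> b"])
          show "val_rel (cMult M r s) \<alpha> (a \<otimes> b)" by (subst val_rel_unfold) (use ab in blast)
          show "v = a \<otimes> b" if "val_rel (cMult M r s) \<alpha> v" for v
            using that u by (subst (asm) val_rel_unfold) auto
        qed
      qed
    qed
  qed
  with assms show ?thesis by blast
qed

lemma val_eq_iff:
  assumes "Term M t" "Asn M \<alpha> \<theta>" "\<And>x. Free M x t \<Longrightarrow> Free M x \<theta>"
  shows "val M t \<alpha> = v \<longleftrightarrow> val_rel t \<alpha> v"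
  unfolding val_THE by (rule the_eq_iff, rule val_rel_ex1) (use assms in \<open>auto simp: Asn_def\<close>)

text \<open>Stated with \<open>val_rel\<close>, which is definable at all arguments, instead of the description \<open>val\<close>.\<close>

definition atomic_true where
  "atomic_true \<phi> \<alpha> \<longleftrightarrow> (\<exists>s t v w. val_rel s \<alpha> v \<and> val_rel t \<alpha> w \<and>
     (\<phi> = cEq M s t \<and> v = w \<or> \<phi> = cLess M s t \<and> v \<prec> w))"

lemma pdf_atomic_true [pdf_intros]: "pdfun M f \<Longrightarrow> pdfun M g \<Longrightarrow> pdf M (\<lambda>e. atomic_true (f e) (g e))"
  by (rule pdf_app2[where R = atomic_true]) (unfold atomic_true_def, intro pdf_intros)

lemma atomic_true_iff:
  assumes "Term M s" "Term M t"
  shows "Asn M \<alpha> (cEq M s t) \<Longrightarrow> atomic_true (cEq M s t) \<alpha> \<longleftrightarrow> val M s \<alpha> = val M t \<alpha>"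
    and "Asn M \<alpha> (cLess M s t) \<Longrightarrow> atomic_true (cLess M s t) \<alpha> \<longleftrightarrow> val M s \<alpha> \<prec> val M t \<alpha>"
proof -
  assume \<alpha>: "Asn M \<alpha> (cEq M s t)"
  show "atomic_true (cEq M s t) \<alpha> \<longleftrightarrow> val M s \<alpha> = val M t \<alpha>"
    unfolding atomic_true_def using val_eq_iff[OF assms(1) \<alpha>, symmetric] val_eq_iff[OF assms(2) \<alpha>, symmetric]
    by fastforce
next
  assume \<alpha>: "Asn M \<alpha> (cLess M s t)"
  show "atomic_true (cLess M s t) \<alpha> \<longleftrightarrow> val M s \<alpha> \<prec> val M t \<alpha>"
    unfolding atomic_true_def using val_eq_iff[OF assms(1) \<alpha>, symmetric] val_eq_iff[OF assms(2) \<alpha>, symmetric]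
    by fastforce
qed

lemma pdfun_tsubst [pdf_intros]:
  "pdfun M f \<Longrightarrow> pdfun M g \<Longrightarrow> pdfun M (\<lambda>e. tsubst M \<Phi> (f e) (g e))"
  by (induction \<Phi>) (simp_all add: cAnd_def cImp_def cAll_def pdf_intros)

lemma F_op_iterate: "F_op M \<Phi> y \<phi> = iterate (\<lambda>v. tsubst M \<Phi> \<phi> v) \<phi> y"
  unfolding F_op_def iterate_def ..

lemma pdfun_step: "pdfun M (\<lambda>e. tsubst M \<Phi> \<phi> (e 0))" by (intro pdf_intros)

lemma F_op_zero [simp]: "F_op M \<Phi> \<zero> \<phi> = \<phi>"
  unfolding F_op_iterate using iterate_zero[OF pdfun_step] .

lemma F_op_succ: "F_op M \<Phi> (y \<oplus> \<one>) \<phi> = tsubst M \<Phi> \<phi> (F_op M \<Phi> y \<phi>)"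
  unfolding F_op_iterate using iterate_succ[OF pdfun_step] .

lemma pdfun_F_op [pdf_intros]: "pdfun M f \<Longrightarrow> pdfun M g \<Longrightarrow> pdfun M (\<lambda>e. F_op M \<Phi> (f e) (g e))"
proof (rule pdfun_app2[where h = "F_op M \<Phi>"])
  show "pdfun M (\<lambda>e. F_op M \<Phi> (e 0) (e (Suc 0)))"
    unfolding pdfun_def F_op_iterate iterate_graph[OF pdfun_step] by (intro pdf_intros)
qed

end

section \<open>Templates of depth one\<close>

lemma tdepth_zero_iff: "tdepth A = 0 \<longleftrightarrow> A = LetterP \<or> A = LetterQ"
  by (cases A) auto

text \<open>A negated letter fails when p and q are both true, and an implication or equivalence of
  letters holds when both are false. The two entailments exclude these connectives, and the
  occurrence of q leaves the listed forms.\<close>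

lemma template_depth1_cases:
  assumes "is_template \<Phi>" "tdepth \<Phi> = 1"
  obtains (Or) a b where "\<Phi> = TOr a b" "a \<in> {LetterP, LetterQ}" "b \<in> {LetterP, LetterQ}" "a = LetterQ \<or> b = LetterQ"
    | (And) a b where "\<Phi> = TAnd a b" "a \<in> {LetterP, LetterQ}" "b \<in> {LetterP, LetterQ}" "a = LetterQ \<or> b = LetterQ"
    | (Ex) n where "\<Phi> = TEx n LetterQ"
    | (All) n where "\<Phi> = TAll n LetterQ"
proof -
  have ts: "teval \<Phi> True True" "\<not> teval \<Phi> False False" "LetterQ \<in> letters \<Phi>"
    using assms(1) unfolding is_template_def by blast+
  show ?thesis
  proof (cases \<Phi>)
    case (TNeg A)
    then show ?thesis using ts assms(2) tdepth_zero_iff[of A] by auto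
  next
    case (TOr A B)
    then show ?thesis using Or[of A B] ts assms(2) tdepth_zero_iff[of A] tdepth_zero_iff[of B] by auto
  next
    case (TAnd A B)
    then show ?thesis using And[of A B] ts assms(2) tdepth_zero_iff[of A] tdepth_zero_iff[of B] by auto
  next
    case (TImp A B)
    then show ?thesis using ts assms(2) tdepth_zero_iff[of A] tdepth_zero_iff[of B] by auto
  next
    case (TIff A B)
    then show ?thesis using ts assms(2) tdepth_zero_iff[of A] tdepth_zero_iff[of B] by auto
  next
    case (TEx n A)
    then show ?thesis using Ex[of n] ts assms(2) tdepth_zero_iff[of A] by auto
  next
    case (TAll n A)
    then show ?thesis using All[of n] ts assms(2) tdepth_zero_iff[of A] by auto
  qed (use assms(2) in auto)
qed

locale PA_template = PA +
  fixes \<Phi> :: template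
  assumes template: "is_template \<Phi>" and depth: "tdepth \<Phi> = 1"
begin

abbreviation step where "step \<phi> \<psi> \<equiv> tsubst M \<Phi> \<phi> \<psi>"
abbreviation F where "F y \<phi> \<equiv> F_op M \<Phi> y \<phi>"

lemmas template_cases [case_names Or And Ex All] = template_depth1_cases[OF template depth]

lemma teval_same: "teval \<Phi> t t \<longleftrightarrow> t"
  by (cases rule: template_cases) auto

lemma teval_idem: "teval \<Phi> t (teval \<Phi> t q) \<longleftrightarrow> teval \<Phi> t q"
  by (cases rule: template_cases) auto

lemma teval_additive: "additive \<Phi> \<Longrightarrow> teval \<Phi> t q \<longleftrightarrow> q"
  by (cases rule: template_cases) (auto simp: accessible_def)

lemma step_additive: "additive \<Phi> \<Longrightarrow> step \<phi> \<psi> = step \<phi>' \<psi>"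
  by (cases rule: template_cases) (auto simp: accessible_def)

text \<open>\<open>t\<close> is the truth value of a base that allows the iterates to differ from
  it: false for a disjunction with p, true for a conjunction with p, either one if the template is
  additive.\<close>

lemma teval_flip: "\<exists>t. teval \<Phi> t (\<not> t) \<longleftrightarrow> \<not> t"
proof (cases "teval \<Phi> True False")
  case True
  then have "teval \<Phi> False True"
    by (cases rule: template_cases) auto
  then show ?thesis by (intro exI[of _ False]) simp
next
  case False
  then show ?thesis by (intro exI[of _ True]) simp
qed

section \<open>Shape, growth and injectivity of one step\<close>

lemmas step_defs = cAnd_def cAll_def

lemma step_inject: "step \<phi> \<psi> = step \<phi>' \<psi>' \<Longrightarrow> \<psi> = \<psi>' \<and> (accessible \<Phi> \<longrightarrow> \<phi> = \<phi>')"
  by (cases rule: template_cases) (auto simp: accessible_def step_defs)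

lemma less_step: "\<psi> \<prec> step \<phi> \<psi>"
proof (cases rule: template_cases)
  case (Or a b)
  then show ?thesis using less_cOr by auto
next
  case (And a b)
  have *: "\<psi> \<prec> cOr M (cNeg M \<psi>) \<chi>" "\<psi> \<prec> cOr M \<chi> (cNeg M \<psi>)" for \<chi>
    using less_cNeg less_cOr less_trans by blast+
  then show ?thesis using And by (auto simp: step_defs intro: less_trans[OF _ less_cNeg])
next
  case (Ex n)
  then show ?thesis using less_cEx by auto
next
  case (All n)
  have "\<psi> \<prec> cEx M x (cNeg M \<psi>)" for x using less_cNeg less_cEx less_trans by blast
  then show ?thesis using All by (auto simp: step_defs intro: less_trans[OF _ less_cNeg])
qed

text \<open>If a step is a negation, the previous iterate is still a proper constituent of the
  negated body; this keeps a base below all members of its chain.\<close>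

lemma less_step_inner: "cNeg M \<theta> = step \<phi> \<psi> \<Longrightarrow> \<psi> \<prec> \<theta>"
proof (cases rule: template_cases)
  case (And a b)
  have *: "\<psi> \<prec> cOr M (cNeg M \<psi>) \<chi>" "\<psi> \<prec> cOr M \<chi> (cNeg M \<psi>)" for \<chi>
    using less_cNeg less_cOr less_trans by blast+
  assume "cNeg M \<theta> = step \<phi> \<psi>"
  then show ?thesis using And * by (auto simp: step_defs)
next
  case (All n)
  have *: "\<psi> \<prec> cEx M x (cNeg M \<psi>)" for x using less_cNeg less_cEx less_trans by blast
  assume "cNeg M \<theta> = step \<phi> \<psi>"
  then show ?thesis using All * by (auto simp: step_defs)
qed auto

lemma Sent_simps [simp]:
  "Sent M (cNeg M \<phi>) \<longleftrightarrow> Sent M \<phi>"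
  "Sent M (cOr M \<phi> \<psi>) \<longleftrightarrow> Sent M \<phi> \<and> Sent M \<psi>"
  unfolding Sent_def by auto

lemma Sent_cEx: "Sent M \<phi> \<Longrightarrow> Sent M (cEx M x \<phi>)"
  unfolding Sent_def by auto

lemma Sent_step: "Sent M \<phi> \<Longrightarrow> Sent M \<psi> \<Longrightarrow> Sent M (step \<phi> \<psi>)"
  by (cases rule: template_cases) (auto simp: step_defs Sent_cEx)

lemma step_neq_cNeg_step: "step \<phi> \<psi> \<noteq> cNeg M (step \<phi>' \<psi>')"
  by (cases rule: template_cases) (auto simp: step_defs)

lemma step_neq_cNeg_cNeg: "step \<phi> \<psi> \<noteq> cNeg M (cNeg M \<chi>)"
  by (cases rule: template_cases) (auto simp: step_defs)

lemma step_neq_cEq: "step \<phi> \<psi> \<noteq> cEq M s t"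
  by (cases rule: template_cases) (auto simp: step_defs)

text \<open>A step is an existential formula only for the template \<open>TEx n\<close>, and then
  with that variable. Quantifying over another variable therefore yields sentences that are not
  steps, the source of fresh bases.\<close>

lemma step_neq_cEx: "\<exists>n. \<forall>j \<phi> \<psi> \<chi>. j \<noteq> num M n \<longrightarrow> step \<phi> \<psi> \<noteq> cEx M j \<chi>"
  by (cases rule: template_cases) (auto simp: step_defs)

lemma Sent_F: "Sent M \<phi> \<Longrightarrow> Sent M (F y \<phi>)"
  by (induction y rule: ind) (intro pdf_intros | simp add: F_op_succ Sent_step)+

lemma F_strict_mono: "y \<prec> z \<Longrightarrow> F y \<phi> \<prec> F z \<phi>"
proof -
  have "F y \<phi> \<prec> F (y \<oplus> (d \<oplus> \<one>)) \<phi>" for d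
  proof (induction d rule: ind)
    case zero
    show ?case using less_step by (simp add: F_op_succ)
  next
    case (succ d)
    have "F (y \<oplus> (d \<oplus> \<one>)) \<phi> \<prec> F (y \<oplus> (d \<oplus> \<one> \<oplus> \<one>)) \<phi>"
      using less_step by (simp add: add_succ F_op_succ)
    with succ show ?case using less_trans by blast
  qed (intro pdf_intros)
  then show "y \<prec> z \<Longrightarrow> F y \<phi> \<prec> F z \<phi>" using less_iff by metis
qed

lemma F_inject: "F y \<phi> = F z \<phi> \<Longrightarrow> y = z"
  using F_strict_mono less_irrefl linorder_cases by metis

lemma le_F: "\<phi> \<preceq> F y \<phi>"
  using F_strict_mono[of \<zero> y \<phi>] pos_iff le_less by (metis F_op_zero)

lemma F_add: assumes "additive \<Phi>" shows "F (y \<oplus> z) \<phi> = F y (F z \<phi>)"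
proof (induction y rule: ind)
  case (succ y)
  then show ?case by (simp add: succ_add F_op_succ) (rule step_additive[OF assms])
qed (intro pdf_intros | simp)+

text \<open>If p occurs in the template, F(y + 1, \<phi>) determines \<phi> and any sentence can
  serve as a base. Otherwise the same sentence is reached from all earlier iterates, and the base
  has to be one that is not a step; \<open>step \<chi> \<chi>\<close> then stands for the step of
  \<open>\<chi>\<close> with any first argument.\<close>

definition Base where
  "Base \<phi> \<longleftrightarrow> Sent M \<phi> \<and> (accessible \<Phi> \<or> \<not> (\<exists>\<chi>. Sent M \<chi> \<and> \<phi> = step \<chi> \<chi>))"

lemma Base_Sent: "Base \<phi> \<Longrightarrow> Sent M \<phi>" unfolding Base_def by blast

lemma pdf_Base [pdf_intros]: "pdfun M f \<Longrightarrow> pdf M (\<lambda>e. Base (f e))"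
  by (rule pdf_app1[where R = Base]) (unfold Base_def, intro pdf_intros)

lemma Base_F_neq:
  assumes "additive \<Phi>" "Base \<phi>" "Base \<phi>'" shows "\<phi> \<noteq> F (y \<oplus> \<one>) \<phi>'"
proof
  assume "\<phi> = F (y \<oplus> \<one>) \<phi>'"
  then have "\<phi> = step (F y \<phi>') (F y \<phi>')" using step_additive[OF assms(1)] by (simp add: F_op_succ)
  then show False using assms Sent_F unfolding Base_def by blast
qed

lemma F_unique_additive:
  assumes "additive \<Phi>" "Base \<phi>" "Base \<phi>'" "F y \<phi> = F y' \<phi>'" shows "\<phi> = \<phi>' \<and> y = y'"
proof -
  have "\<forall>y'. F y \<phi> = F y' \<phi>' \<longrightarrow> \<phi> = \<phi>' \<and> y = y'"
  proof (induction y rule: ind)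
    case pdf
    show ?case by (intro pdf_intros)
  next
    case zero
    show ?case
    proof (intro allI impI)
      fix y' assume "F \<zero> \<phi> = F y' \<phi>'"
      then show "\<phi> = \<phi>' \<and> \<zero> = y'" using Base_F_neq[OF assms(1-3)] by (cases rule: cases0[of y']) auto
    qed
  next
    case (succ y)
    show ?case
    proof (intro allI impI)
      fix y' assume eq: "F (y \<oplus> \<one>) \<phi> = F y' \<phi>'"
      show "\<phi> = \<phi>' \<and> y \<oplus> \<one> = y'"
      proof (cases rule: cases0[of y'])
        case 1
        then show ?thesis using Base_F_neq[OF assms(1,3,2)] eq by auto
      next
        case (2 z)
        then have "F y \<phi> = F z \<phi>'"
          using eq step_inject[of \<phi> "F y \<phi>" \<phi>' "F z \<phi>'"] by (simp add: F_op_succ)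
        then show ?thesis using succ 2 by blast
      qed
    qed
  qed
  with assms(4) show ?thesis by blast
qed

text \<open>Restricted to positive iterates: with an accessible template every sentence is a base,
  so \<open>F \<zero> \<phi>\<close> may well be an iterate of another base.\<close>

lemma F_unique:
  assumes "Base \<phi>" "Base \<phi>'" "F (y \<oplus> \<one>) \<phi> = F (y' \<oplus> \<one>) \<phi>'" shows "\<phi> = \<phi>' \<and> y = y'"
proof (cases "accessible \<Phi>")
  case True
  then have "\<phi> = \<phi>'"
    using assms(3) step_inject[of \<phi> "F y \<phi>" \<phi>' "F y' \<phi>'"] by (simp add: F_op_succ)
  then show ?thesis using F_inject assms(3) succ_inject by blast
next
  case False
  then show ?thesis using F_unique_additive[OF False assms] succ_inject by blast
qed

text \<open>Codes grow along steps, so the smallest sentence of which \<open>\<theta>\<close> is an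
  iterate cannot be a step itself.\<close>

lemma Base_exists: assumes "additive \<Phi>" "Sent M \<theta>" obtains \<phi> y where "Base \<phi>" "\<theta> = F y \<phi>"
proof (rule least[of "\<lambda>\<phi>. Sent M \<phi> \<and> (\<exists>y. \<theta> = F y \<phi>)" \<theta>])
  show "pdf M (\<lambda>e. Sent M (e 0) \<and> (\<exists>y. \<theta> = F y (e 0)))" by (intro pdf_intros)
  have "\<theta> = F \<zero> \<theta>" by simp
  then show "Sent M \<theta> \<and> (\<exists>y. \<theta> = F y \<theta>)" using assms(2) by blast
  fix \<phi> assume \<phi>: "Sent M \<phi> \<and> (\<exists>y. \<theta> = F y \<phi>)" and min: "\<And>\<chi>. \<chi> \<prec> \<phi> \<Longrightarrow> \<not> (Sent M \<chi> \<and> (\<exists>y. \<theta> = F y \<chi>))"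
  then obtain y where y: "\<theta> = F y \<phi>" by blast
  have "\<phi> \<noteq> step \<chi> \<chi>" if "Sent M \<chi>" for \<chi>
  proof
    assume "\<phi> = step \<chi> \<chi>"
    then have "\<phi> = F \<one> \<chi>" using F_op_succ[of \<Phi> \<zero> \<chi>] by (simp add: zero_add)
    then have "\<theta> = F (y \<oplus> \<one>) \<chi>" using y F_add[OF assms(1)] by simp
    then show False using min[of \<chi>] that less_step \<open>\<phi> = step \<chi> \<chi>\<close> by blast
  qed
  then have "Base \<phi>" unfolding Base_def using \<phi> by blast
  with y show thesis using that by blast
qed

text \<open>\<open>chain \<theta> \<phi> y s\<close>: up to the sign \<open>s\<close>, the sentence \<open>\<theta>\<close> abbreviates \<open>F(y, \<phi>)\<close> for the
  base \<open>\<phi>\<close>. The negative signs cover the auxiliary formulas through which the defined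
  connectives unfold: the negation of \<open>F(y, \<phi>)\<close> and the formula whose negation is \<open>F(y + 1, \<phi>)\<close>.\<close>

definition chain :: "'a \<Rightarrow> 'a \<Rightarrow> 'a \<Rightarrow> bool \<Rightarrow> bool" where
  "chain \<theta> \<phi> y s \<longleftrightarrow> Base \<phi> \<and>
     (s \<and> y \<noteq> \<zero> \<and> \<theta> = F y \<phi> \<or> \<not> s \<and> (y \<noteq> \<zero> \<and> \<theta> = cNeg M (F y \<phi>) \<or> cNeg M \<theta> = F (y \<oplus> \<one>) \<phi>))"

lemma pdf_chain [pdf_intros]:
  "pdfun M f \<Longrightarrow> pdfun M g \<Longrightarrow> pdfun M h \<Longrightarrow> pdf M (\<lambda>e. chain (f e) (g e) (h e) s)"
  by (rule pdf_app3[where R = "\<lambda>\<theta> \<phi> y. chain \<theta> \<phi> y s"])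
    (unfold chain_def, intro pdf_intros)

text \<open>The three shapes in \<open>chain\<close> never overlap, because a step is neither the
  negation of a step nor a double negation. Within one shape the base and the position are
  determined by \<open>F_unique\<close>.\<close>

lemma chain_unique:
  assumes "chain \<theta> \<phi> y s" "chain \<theta> \<phi>' y' s'" shows "\<phi> = \<phi>' \<and> y = y' \<and> s = s'"
proof -
  have B: "Base \<phi>" "Base \<phi>'" using assms unfolding chain_def by blast+
  have pos: "\<exists>z. y = z \<oplus> \<one> \<and> F y \<phi> = step \<phi> (F z \<phi>)" if "y \<noteq> \<zero>" for y \<phi>
    using cases0[of y] that F_op_succ by metis
  have eq: "\<phi> = \<phi>' \<and> y = y'" if "F y \<phi> = F y' \<phi>'" "y \<noteq> \<zero>" "y' \<noteq> \<zero>"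
    using F_unique[OF B] pos that by (metis (full_types))
  have TT: ?thesis if "s" "s'"
  proof -
    have "F y \<phi> = F y' \<phi>'" "y \<noteq> \<zero>" "y' \<noteq> \<zero>" using assms that by (simp_all add: chain_def)
    then show ?thesis using eq that by simp
  qed
  have mixed: False if "y \<noteq> \<zero>" "\<theta> = F y \<phi>" "chain \<theta> \<phi>' y' False" for \<phi> \<phi>' y y'
  proof -
    from pos[OF that(1), of \<phi>] that(2) obtain z where z: "\<theta> = step \<phi> (F z \<phi>)" by auto
    from that(3) consider "y' \<noteq> \<zero>" "\<theta> = cNeg M (F y' \<phi>')" | "cNeg M \<theta> = step \<phi>' (F y' \<phi>')"
      unfolding chain_def by (simp add: F_op_succ) blast
    then show False
    proof cases
      case 1
      then show False using z pos step_neq_cNeg_step by metis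
    next
      case 2
      then show False using z step_neq_cNeg_step by metis
    qed
  qed
  have FF: ?thesis if "\<not> s" "\<not> s'"
  proof -
    from assms that consider
      "y \<noteq> \<zero>" "\<theta> = cNeg M (F y \<phi>)" "y' \<noteq> \<zero>" "\<theta> = cNeg M (F y' \<phi>')"
      | "\<theta> = cNeg M (F y \<phi>)" "cNeg M \<theta> = F (y' \<oplus> \<one>) \<phi>'"
      | "cNeg M \<theta> = F (y \<oplus> \<one>) \<phi>" "\<theta> = cNeg M (F y' \<phi>')"
      | "cNeg M \<theta> = F (y \<oplus> \<one>) \<phi>" "cNeg M \<theta> = F (y' \<oplus> \<one>) \<phi>'"
      unfolding chain_def by blast
    then show ?thesis
    proof cases
      case 1
      then show ?thesis using eq that by simp
    next
      case 2
      then show ?thesis using step_neq_cNeg_cNeg by (metis F_op_succ)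
    next
      case 3
      then show ?thesis using step_neq_cNeg_cNeg by (metis F_op_succ)
    next
      case 4
      then show ?thesis using F_unique[OF B] that by metis
    qed
  qed
  show ?thesis
  proof (cases s; cases s')
    assume "s" "\<not> s'"
    then show ?thesis using mixed[of y \<phi> \<phi>' y'] assms unfolding chain_def by auto
  next
    assume "\<not> s" "s'"
    then show ?thesis using mixed[of y' \<phi>' \<phi> y] assms unfolding chain_def by auto
  qed (use TT FF in blast)+
qed

lemma chain_less: assumes "chain \<theta> \<phi> y s" shows "\<phi> \<prec> \<theta>"
proof -
  have F: "\<phi> \<prec> F y \<phi>" if "y \<noteq> \<zero>" using that F_strict_mono[of \<zero> y \<phi>] pos_iff by simp
  from assms consider "y \<noteq> \<zero>" "\<theta> = F y \<phi>" | "y \<noteq> \<zero>" "\<theta> = cNeg M (F y \<phi>)" | "cNeg M \<theta> = step \<phi> (F y \<phi>)"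
    unfolding chain_def by (auto simp: F_op_succ)
  then show ?thesis
  proof cases
    case 2
    then show ?thesis using F less_cNeg less_trans by blast
  next
    case 3
    then show ?thesis using less_step_inner le_F le_less_trans by blast
  qed (use F in blast)
qed

lemma chain_Sent: "chain \<theta> \<phi> y s \<Longrightarrow> Sent M \<theta>"
  unfolding chain_def using Base_Sent Sent_F by (metis Sent_simps(1))

lemma chain_F: "Base \<phi> \<Longrightarrow> y \<noteq> \<zero> \<Longrightarrow> chain (F y \<phi>) \<phi> y True"
  unfolding chain_def by simp

end

section \<open>Definable functions and iterates\<close>

context PA
begin

text \<open>\<open>recursion\<close> yields coded solutions of every length. They agree where they
  overlap, so their common values form one definable function on all of \<open>M\<close>.\<close>

lemma course_of_values:
  assumes H: "pdfun M (\<lambda>e. H (e 0) (e 1))"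
    and local: "\<And>i s s'. (\<And>j. j \<prec> i \<Longrightarrow> s !! j = s' !! j) \<Longrightarrow> H i s = H i s'"
  obtains f where "pdfun M (\<lambda>e. f (e 0))" "\<And>i s. (\<And>j. j \<prec> i \<Longrightarrow> s !! j = f j) \<Longrightarrow> f i = H i s"
    "\<And>n. \<exists>s. \<forall>i. i \<prec> n \<longrightarrow> s !! i = f i"
proof -
  have H0: "pdfun M (\<lambda>e. H (e 0) (e (Suc 0)))" using H by simp
  note [pdf_intros] = pdfun_app2[OF H0]
  have H1: "pdf M (\<lambda>e. e 0 = H (e (Suc 0)) (e (Suc (Suc 0))))" by (intro pdf_intros)
  note ex = recursion[OF H1 local]
  have uniq: "s !! i = s' !! i" if "\<And>k. k \<prec> n \<Longrightarrow> s !! k = H k s" "\<And>k. k \<prec> n \<Longrightarrow> s' !! k = H k s'" "i \<prec> n" for s s' i n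
  proof -
    have "i \<prec> n \<longrightarrow> s !! i = s' !! i"
    proof (induction i rule: less_ind)
      case pdf
      show ?case by (intro pdf_intros)
    next
      case (less i)
      show ?case
      proof
        assume i: "i \<prec> n"
        have "s !! j = s' !! j" if "j \<prec> i" for j using less that i less_trans by blast
        then show "s !! i = s' !! i" using local that(1)[OF i] that(2)[OF i] by metis
      qed
    qed
    with that show ?thesis by blast
  qed
  define P where "P i v \<longleftrightarrow> (\<exists>s. (\<forall>k. k \<prec> i \<oplus> \<one> \<longrightarrow> s !! k = H k s) \<and> s !! i = v)" for i v
  define f where "f i = (THE v. P i v)" for i
  have f1: "f i = v \<longleftrightarrow> P i v" for i v
  proof -
    obtain s where s: "\<forall>k. k \<prec> i \<oplus> \<one> \<longrightarrow> s !! k = H k s" using ex by blast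
    have "\<exists>!v. P i v"
    proof (rule ex1I[of _ "s !! i"])
      show "P i (s !! i)" using s P_def by blast
      fix v assume "P i v"
      then obtain s' where s': "\<forall>k. k \<prec> i \<oplus> \<one> \<longrightarrow> s' !! k = H k s'" "s' !! i = v" using P_def by blast
      then show "v = s !! i" using uniq[of "i \<oplus> \<one>" s' s i] s less_self_succ by auto
    qed
    then show ?thesis unfolding f_def by (rule the_eq_iff)
  qed
  have approx: "s !! i = f i" if "\<forall>k. k \<prec> n \<longrightarrow> s !! k = H k s" "i \<prec> n" for s i n
  proof -
    have "\<forall>k. k \<prec> i \<oplus> \<one> \<longrightarrow> s !! k = H k s" using that less_succ le_less_trans by blast
    then have "P i (s !! i)" unfolding P_def by blast
    then have "f i = s !! i" by (simp add: f1)
    then show ?thesis by simp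
  qed
  show ?thesis
  proof (rule that[of f])
    have "pdf M (\<lambda>e. P (e 1) (e 0))" unfolding P_def by (intro pdf_intros)
    then show "pdfun M (\<lambda>e. f (e 0))" unfolding pdfun_def by (simp add: f1 eq_commute[of _ "f _"])
    show "\<exists>s. \<forall>i. i \<prec> n \<longrightarrow> s !! i = f i" for n using ex[of n] approx by blast
    show "f i = H i s" if "\<And>j. j \<prec> i \<Longrightarrow> s !! j = f j" for i s
    proof -
      obtain s' where s': "\<forall>k. k \<prec> i \<oplus> \<one> \<longrightarrow> s' !! k = H k s'" using ex by blast
      then have "f i = H i s'" using approx[OF s'] less_self_succ by metis
      also have "\<dots> = H i s"
        by (rule local) (use approx[OF s'] that less_succ less_imp_le in metis)
      finally show ?thesis .
    qed
  qed
qed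

section \<open>Projections and enumerations of closures\<close>

definition pfst where "pfst w = (THE x. \<exists>y. w = pair M x y)"
definition psnd where "psnd w = (THE y. \<exists>x. w = pair M x y)"

lemma pfst_pair [simp]: "pfst (pair M x y) = x" and psnd_pair [simp]: "psnd (pair M x y) = y"
  unfolding pfst_def psnd_def by (rule the_equality; auto)+

lemma pfst_graph: "x = pfst w \<longleftrightarrow> (\<exists>y. w = pair M x y)" and psnd_graph: "y = psnd w \<longleftrightarrow> (\<exists>x. w = pair M x y)"
  using pair_surj[of w] by auto

lemma psnd_le: "psnd w \<preceq> w"
  using pair_surj[of w] le_pair2 by auto

lemma pdfun_pfst [pdf_intros]: "pdfun M f \<Longrightarrow> pdfun M (\<lambda>e. pfst (f e))"
proof (rule pdfun_app1[where h = pfst])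
  show "pdfun M (\<lambda>e. pfst (e 0))" unfolding pdfun_def pfst_graph by (intro pdf_intros)
qed

lemma pdfun_psnd [pdf_intros]: "pdfun M f \<Longrightarrow> pdfun M (\<lambda>e. psnd (f e))"
proof (rule pdfun_app1[where h = psnd])
  show "pdfun M (\<lambda>e. psnd (e 0))" unfolding pdfun_def psnd_graph by (intro pdf_intros)
qed

text \<open>A closure generated outside \<open>M\<close> gets a definable indexing; only its values at standard
  arguments matter.\<close>

lemma enumerate_iterates:
  assumes p: "pdfun M (\<lambda>e. p (0::nat) (e 0))" "pdfun M (\<lambda>e. p 1 (e 0))" "pdfun M (\<lambda>e. p 2 (e 0))"
  obtains f where "pdfun M (\<lambda>e. f (e 0))" "f \<zero> = x"
    "\<And>i n. i < 3 \<Longrightarrow> f (num M (Suc (prod_encode (i, n)))) = p i (f (num M n))"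
    "\<And>P n. P x \<Longrightarrow> (\<And>i z. i < 3 \<Longrightarrow> P z \<Longrightarrow> P (p i z)) \<Longrightarrow> P (f (num M n))"
    "\<And>n. \<exists>s. \<forall>i. i \<prec> n \<longrightarrow> s !! i = f i"
proof -
  define q where "q j z = (if j = \<zero> then p 0 z else if j = \<one> then p 1 z else p 2 z)" for j z
  note [pdf_intros] = pdfun_app1[OF p(1)] pdfun_app1[OF p(2)] pdfun_app1[OF p(3)]
  \<comment> \<open>Entry pair(i, n) + 1 applies the i-th function to entry n, which is an earlier
    one. Every finite composition of the three functions, applied to \<open>x\<close>, therefore
    appears at a standard index.\<close>
  define H where "H i s = (if i = \<zero> then x else q (pfst (monus M i \<one>)) (s !! psnd (monus M i \<one>)))" for i s
  have monus1: "monus M (i \<oplus> \<one>) \<one> = i" for i by (metis add_comm monus_eq)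
  have H: "pdfun M (\<lambda>e. H (e 0) (e 1))" unfolding H_def q_def by (intro pdf_intros)
  have H': "H i s = H i s'" if *: "\<And>j. j \<prec> i \<Longrightarrow> s !! j = s' !! j" for i s s'
  proof (cases rule: cases0[of i])
    case (2 j)
    then have "psnd j \<prec> i" using psnd_le less_self_succ le_less_trans by blast
    then show ?thesis using * 2 by (simp add: H_def monus1)
  qed (simp add: H_def)
  show ?thesis
  proof (rule course_of_values[OF H H'])
    fix f assume f: "pdfun M (\<lambda>e. f (e 0))" "\<And>i s. (\<And>j. j \<prec> i \<Longrightarrow> s !! j = f j) \<Longrightarrow> f i = H i s"
      "\<And>n. \<exists>s. \<forall>i. i \<prec> n \<longrightarrow> s !! i = f i"
    have fs: "f (w \<oplus> \<one>) = q (pfst w) (f (psnd w))" for w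
    proof -
      obtain s where s: "\<forall>i. i \<prec> w \<oplus> \<one> \<longrightarrow> s !! i = f i" using f(3) by blast
      then have "f (w \<oplus> \<one>) = H (w \<oplus> \<one>) s" by (intro f(2)) blast
      also have "\<dots> = q (pfst w) (s !! psnd w)" by (simp add: H_def monus1 succ_neq_zero)
      also have "s !! psnd w = f (psnd w)" using s psnd_le less_succ by blast
      finally show ?thesis .
    qed
    have q: "q (num M i) z = p (if i < 2 then i else 2) z" for i z
      using num_inject[of i 1] by (cases "i = 0"; cases "i = 1") (auto simp: q_def num_0 num_1)
    have fS: "f (num M (Suc (prod_encode (i, n)))) = p (if i < 2 then i else 2) (f (num M n))" for i n
      by (simp add: num_Suc fs num_pair q)
    have f0: "f \<zero> = x" using f(2)[of \<zero> undefined] by (simp add: H_def)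
    show thesis
    proof (rule that[OF f(1) f0 _ _ f(3)])
      show "f (num M (Suc (prod_encode (i, n)))) = p i (f (num M n))" if "i < 3" for i n
      proof -
        have "(if i < 2 then i else 2) = i" using that by auto
        then show ?thesis by (simp only: fS)
      qed
      show "P (f (num M n))" if P: "P x" "\<And>i z. i < 3 \<Longrightarrow> P z \<Longrightarrow> P (p i z)" for P n
      proof (induction n rule: less_induct)
        case (less n)
        show ?case
        proof (cases n)
          case 0
          then show ?thesis using f0 P(1) by (simp add: num_0)
        next
          case (Suc m)
          obtain i k where m: "m = prod_encode (i, k)" by (metis prod_decode_inverse surj_pair)
          then have "k < n" using Suc le_prod_encode_2[of k i] by simp
          then have "P (f (num M k))" by (rule less)
          then show ?thesis unfolding Suc m fS by (intro P(2)) auto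
        qed
      qed
    qed
  qed
qed

text \<open>A step that does not apply returns its argument, so that iterating such steps never
  leaves the closure to be enumerated.\<close>

definition total_fun :: "('a \<Rightarrow> 'a \<Rightarrow> bool) \<Rightarrow> 'a \<Rightarrow> 'a" where
  "total_fun R x = (if \<exists>z. R x z then THE z. R x z else x)"

lemma total_fun_eq: "(\<And>x z z'. R x z \<Longrightarrow> R x z' \<Longrightarrow> z = z') \<Longrightarrow> R x z \<Longrightarrow> total_fun R x = z"
  unfolding total_fun_def by (auto intro: the_equality)

lemma total_fun_cases:
  assumes "\<And>x z z'. R x z \<Longrightarrow> R x z' \<Longrightarrow> z = z'"
  shows "R x (total_fun R x) \<or> total_fun R x = x"
proof (cases "\<exists>z. R x z")
  case True
  then obtain z where "R x z" by blast
  then show ?thesis using total_fun_eq[of R x z] assms by metis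
qed (simp add: total_fun_def)

lemma pdfun_total_fun:
  assumes "pdf M (\<lambda>e. R (e 0) (e 1))" "\<And>x z z'. R x z \<Longrightarrow> R x z' \<Longrightarrow> z = z'"
  shows "pdfun M (\<lambda>e. total_fun R (e 0))"
proof -
  have R: "pdf M (\<lambda>e. R (e 0) (e (Suc 0)))" using assms(1) by simp
  note [pdf_intros] = pdf_app2[OF R]
  have "z = total_fun R x \<longleftrightarrow> R x z \<or> \<not> (\<exists>z. R x z) \<and> z = x" for x z
    using total_fun_eq[of R x] assms(2) by (metis total_fun_def)
  then show ?thesis unfolding pdfun_def by (simp only:) (intro pdf_intros)
qed

section \<open>Partial satisfaction classes\<close>

definition variant where
  "variant x \<alpha> \<beta> \<longleftrightarrow> (\<forall>y a. y \<noteq> x \<longrightarrow> (pair M y a \<epsilon> \<beta> \<longleftrightarrow> pair M y a \<epsilon> \<alpha>))"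

lemma pdf_variant [pdf_intros]:
  "pdfun M f \<Longrightarrow> pdfun M g \<Longrightarrow> pdfun M h \<Longrightarrow> pdf M (\<lambda>e. variant (f e) (g e) (h e))"
  by (rule pdf_app3[where R = variant]) (unfold variant_def, intro pdf_intros)

definition clause :: "('a \<times> 'a) set \<Rightarrow> 'a \<Rightarrow> 'a \<Rightarrow> bool" where
  "clause S \<theta> \<alpha> \<longleftrightarrow> atomic_true \<theta> \<alpha> \<or> (\<exists>\<phi>. \<theta> = cNeg M \<phi> \<and> (\<phi>, \<alpha>) \<notin> S) \<or>
     (\<exists>\<phi> \<psi>. \<theta> = cOr M \<phi> \<psi> \<and> ((\<phi>, restr M \<alpha> \<phi>) \<in> S \<or> (\<psi>, restr M \<alpha> \<psi>) \<in> S)) \<or>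
     (\<exists>x \<phi>. \<theta> = cEx M x \<phi> \<and> (\<exists>\<beta>. Asn M \<beta> \<phi> \<and> variant x \<alpha> \<beta> \<and> (\<phi>, \<beta>) \<in> S))"

definition subfm :: "'a \<Rightarrow> 'a \<Rightarrow> bool" where
  "subfm \<theta> \<phi> \<longleftrightarrow> \<theta> = cNeg M \<phi> \<or> (\<exists>\<psi>. \<theta> = cOr M \<phi> \<psi> \<or> \<theta> = cOr M \<psi> \<phi>) \<or> (\<exists>x. \<theta> = cEx M x \<phi>)"

lemma subfm_simps [simp]:
  "\<not> subfm (cEq M s t) \<phi>" "\<not> subfm (cLess M s t) \<phi>"
  "subfm (cNeg M \<psi>) \<phi> \<longleftrightarrow> \<phi> = \<psi>" "subfm (cOr M \<psi> \<chi>) \<phi> \<longleftrightarrow> \<phi> = \<psi> \<or> \<phi> = \<chi>"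
  "subfm (cEx M x \<psi>) \<phi> \<longleftrightarrow> \<phi> = \<psi>"
  unfolding subfm_def by auto

lemma subfm_less: "subfm \<theta> \<phi> \<Longrightarrow> \<phi> \<prec> \<theta>"
  unfolding subfm_def using less_cNeg less_cOr less_cEx by blast

lemma atomic_true_simps [simp]:
  "\<not> atomic_true (cNeg M \<phi>) \<alpha>" "\<not> atomic_true (cOr M \<phi> \<psi>) \<alpha>" "\<not> atomic_true (cEx M x \<phi>) \<alpha>"
  unfolding atomic_true_def by auto

lemma clause_simps [simp]:
  "clause S (cEq M s t) \<alpha> \<longleftrightarrow> atomic_true (cEq M s t) \<alpha>"
  "clause S (cLess M s t) \<alpha> \<longleftrightarrow> atomic_true (cLess M s t) \<alpha>"
  "clause S (cNeg M \<phi>) \<alpha> \<longleftrightarrow> (\<phi>, \<alpha>) \<notin> S"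
  "clause S (cOr M \<phi> \<psi>) \<alpha> \<longleftrightarrow> (\<phi>, restr M \<alpha> \<phi>) \<in> S \<or> (\<psi>, restr M \<alpha> \<psi>) \<in> S"
  "clause S (cEx M x \<phi>) \<alpha> \<longleftrightarrow> (\<exists>\<beta>. Asn M \<beta> \<phi> \<and> variant x \<alpha> \<beta> \<and> (\<phi>, \<beta>) \<in> S)"
  unfolding clause_def by auto

lemma clause_cong:
  assumes "\<And>\<phi> \<beta>. subfm \<theta> \<phi> \<Longrightarrow> (\<phi>, \<beta>) \<in> S \<longleftrightarrow> (\<phi>, \<beta>) \<in> S'"
  shows "clause S \<theta> \<alpha> \<longleftrightarrow> clause S' \<theta> \<alpha>"
proof -
  have "\<theta> = cNeg M \<phi> \<Longrightarrow> (\<phi>, \<beta>) \<in> S \<longleftrightarrow> (\<phi>, \<beta>) \<in> S'" "\<theta> = cOr M \<phi> \<psi> \<Longrightarrow> (\<phi>, \<beta>) \<in> S \<longleftrightarrow> (\<phi>, \<beta>) \<in> S'"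
    "\<theta> = cOr M \<psi> \<phi> \<Longrightarrow> (\<phi>, \<beta>) \<in> S \<longleftrightarrow> (\<phi>, \<beta>) \<in> S'" "\<theta> = cEx M x \<phi> \<Longrightarrow> (\<phi>, \<beta>) \<in> S \<longleftrightarrow> (\<phi>, \<beta>) \<in> S'"
    for \<phi> \<psi> \<beta> x
    by (rule assms; simp)+
  then show ?thesis unfolding clause_def by blast
qed

text \<open>The clause at \<open>\<theta>\<close> is required only if all immediate subformulas of
  \<open>\<theta>\<close> lie in \<open>D\<close>. On a set \<open>D\<close> that is not closed this
  leaves some formulas unconstrained, which is the freedom used for prescribing truth
  values.\<close>

definition compositional :: "'a set \<Rightarrow> ('a \<times> 'a) set \<Rightarrow> bool" where
  "compositional D S \<longleftrightarrow> (\<forall>\<theta> \<alpha>. \<theta> \<in> D \<and> Form M \<theta> \<and> Asn M \<alpha> \<theta> \<and> (\<forall>\<phi>. subfm \<theta> \<phi> \<longrightarrow> \<phi> \<in> D) \<longrightarrow>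
     ((\<theta>, \<alpha>) \<in> S \<longleftrightarrow> clause S \<theta> \<alpha>))"

lemma compositionalD:
  "compositional D S \<Longrightarrow> \<theta> \<in> D \<Longrightarrow> Form M \<theta> \<Longrightarrow> Asn M \<alpha> \<theta> \<Longrightarrow> (\<And>\<phi>. subfm \<theta> \<phi> \<Longrightarrow> \<phi> \<in> D) \<Longrightarrow>
    (\<theta>, \<alpha>) \<in> S \<longleftrightarrow> clause S \<theta> \<alpha>"
  unfolding compositional_def by blast

lemma CS_minusI:
  assumes "\<And>\<phi> \<alpha>. (\<phi>, \<alpha>) \<in> S \<Longrightarrow> Form M \<phi> \<and> Asn M \<alpha> \<phi>" "compositional UNIV S"
  shows "CS_minus M S"
proof -
  have c: "(\<theta>, \<alpha>) \<in> S \<longleftrightarrow> clause S \<theta> \<alpha>" if "Form M \<theta>" "Asn M \<alpha> \<theta>" for \<theta> \<alpha>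
    using compositionalD[OF assms(2)] that by blast
  have eq: "\<forall>s t \<alpha>. Term M s \<and> Term M t \<and> Asn M \<alpha> (cEq M s t) \<longrightarrow>
      ((cEq M s t, \<alpha>) \<in> S \<longleftrightarrow> val M s \<alpha> = val M t \<alpha>)"
    using c atomic_true_iff(1) by simp
  have less: "\<forall>s t \<alpha>. Term M s \<and> Term M t \<and> Asn M \<alpha> (cLess M s t) \<longrightarrow>
      ((cLess M s t, \<alpha>) \<in> S \<longleftrightarrow> val M s \<alpha> \<prec> val M t \<alpha>)"
    using c atomic_true_iff(2) by simp
  have neg: "\<forall>\<phi> \<alpha>. Form M \<phi> \<and> Asn M \<alpha> (cNeg M \<phi>) \<longrightarrow> ((cNeg M \<phi>, \<alpha>) \<in> S \<longleftrightarrow> (\<phi>, \<alpha>) \<notin> S)"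
    using c[of "cNeg M _"] by simp
  have disj: "\<forall>\<phi> \<psi> \<alpha>. Form M \<phi> \<and> Form M \<psi> \<and> Asn M \<alpha> (cOr M \<phi> \<psi>) \<longrightarrow>
      ((cOr M \<phi> \<psi>, \<alpha>) \<in> S \<longleftrightarrow> (\<phi>, restr M \<alpha> \<phi>) \<in> S \<or> (\<psi>, restr M \<alpha> \<psi>) \<in> S)"
    using c[of "cOr M _ _"] by simp
  have ex: "\<forall>x \<phi> \<alpha>. Form M \<phi> \<and> Asn M \<alpha> (cEx M x \<phi>) \<longrightarrow> ((cEx M x \<phi>, \<alpha>) \<in> S \<longleftrightarrow>
        (\<exists>\<beta>. Asn M \<beta> \<phi> \<and> (\<forall>y a. y \<noteq> x \<longrightarrow> (pair M y a \<epsilon> \<beta> \<longleftrightarrow> pair M y a \<epsilon> \<alpha>)) \<and> (\<phi>, \<beta>) \<in> S))"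
    using c[of "cEx M _ _"] by (simp add: variant_def)
  show ?thesis
    unfolding CS_minus_def by (intro conjI eq less neg disj ex) (use assms(1) in blast)
qed

lemma Tr_cNeg:
  assumes "compositional D S" "Sent M \<phi>" "cNeg M \<phi> \<in> D" "\<phi> \<in> D"
  shows "Tr M S (cNeg M \<phi>) \<longleftrightarrow> \<not> Tr M S \<phi>"
proof -
  have "Form M (cNeg M \<phi>)" "Asn M \<zero> (cNeg M \<phi>)" using assms(2) Asn_Sent by (simp_all add: Sent_def)
  from compositionalD[OF assms(1,3) this] show ?thesis using assms(4) by (simp add: Tr_def)
qed

lemma Tr_cOr:
  assumes "compositional D S" "Sent M \<phi>" "Sent M \<psi>" "cOr M \<phi> \<psi> \<in> D" "\<phi> \<in> D" "\<psi> \<in> D"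
  shows "Tr M S (cOr M \<phi> \<psi>) \<longleftrightarrow> Tr M S \<phi> \<or> Tr M S \<psi>"
proof -
  have "Form M (cOr M \<phi> \<psi>)" "Asn M \<zero> (cOr M \<phi> \<psi>)"
    using assms(2,3) by (auto simp: Sent_def Asn_zero_iff)
  from compositionalD[OF assms(1,4) this] show ?thesis using assms(5,6) by (auto simp: Tr_def)
qed

lemma Tr_cEx:
  assumes "compositional D S" "Sent M \<phi>" "cEx M x \<phi> \<in> D" "\<phi> \<in> D"
  shows "Tr M S (cEx M x \<phi>) \<longleftrightarrow> Tr M S \<phi>"
proof -
  have "Form M (cEx M x \<phi>)" "Asn M \<zero> (cEx M x \<phi>)"
    using assms(2) by (auto simp: Sent_def Asn_zero_iff)
  from compositionalD[OF assms(1,3) this] show ?thesis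
    using assms(4) Asn_Sent[OF assms(2)] by (auto simp: Tr_def variant_def)
qed

end

context PA_template
begin

text \<open>If p does not occur in the template and y is nonstandard, the base of F(y, \<phi>) lies
  infinitely deep, out of reach of finitely many passages to subformulas. It is adjoined directly,
  so that a class on \<open>parts\<close> can compare the two truth values.\<close>

definition part :: "'a \<Rightarrow> 'a \<Rightarrow> bool" where
  "part \<theta> \<phi> \<longleftrightarrow> subfm \<theta> \<phi> \<or> (\<exists>y s. chain \<theta> \<phi> y s)"

lemma part_less: "part \<theta> \<phi> \<Longrightarrow> \<phi> \<prec> \<theta>"
  unfolding part_def using subfm_less chain_less by blast

definition parts_closed :: "'a set \<Rightarrow> bool" where
  "parts_closed Z \<longleftrightarrow> (\<forall>\<theta> \<phi>. \<theta> \<in> Z \<and> part \<theta> \<phi> \<longrightarrow> \<phi> \<in> Z)"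

definition parts :: "'a \<Rightarrow> 'a set" where
  "parts x = {\<theta>. part\<^sup>*\<^sup>* x \<theta>}"

lemma parts_self: "x \<in> parts x"
  unfolding parts_def by simp

lemma parts_closed_parts: "parts_closed (parts x)"
  unfolding parts_closed_def parts_def by (auto intro: rtranclp.rtrancl_into_rtrancl)

lemma parts_least: assumes "parts_closed Z" "x \<in> Z" shows "parts x \<subseteq> Z"
proof
  fix \<theta> assume "\<theta> \<in> parts x"
  then have "part\<^sup>*\<^sup>* x \<theta>" unfolding parts_def by simp
  then show "\<theta> \<in> Z" by induction (use assms in \<open>auto simp: parts_closed_def\<close>)
qed

lemma parts_le: assumes "\<theta> \<in> parts x" shows "\<theta> \<preceq> x"
proof -
  have "part\<^sup>*\<^sup>* x \<theta>" using assms unfolding parts_def by simp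
  then show ?thesis
  proof induction
    case (step \<theta> \<phi>)
    then show ?case using part_less less_imp_le order_trans by blast
  qed simp
qed

text \<open>The closure is formed outside \<open>M\<close>, by paths of standard length. Its
  generating relations are three definable partial functions, the third one by
  \<open>chain_unique\<close>; so it consists of the values of one definable function at standard
  indices.\<close>

lemma parts_enumeration:
  obtains f where "pdfun M (\<lambda>e. f (e 0))" "parts x = range (\<lambda>n. f (num M n))"
    "\<And>n. \<exists>s. \<forall>i. i \<prec> n \<longrightarrow> s !! i = f i"
proof -
  define R where "R i = (if i = (0::nat) then (\<lambda>\<theta> \<phi>. \<theta> = cNeg M \<phi> \<or> (\<exists>\<psi>. \<theta> = cOr M \<phi> \<psi>) \<or> (\<exists>x. \<theta> = cEx M x \<phi>))
    else if i = 1 then (\<lambda>\<theta> \<phi>. \<exists>\<psi>. \<theta> = cOr M \<psi> \<phi>)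
    else (\<lambda>\<theta> \<phi>. (\<exists>y. chain \<theta> \<phi> y True) \<or> (\<exists>y. chain \<theta> \<phi> y False)))" for i
  define p where "p i = total_fun (R i)" for i
  have R01: "R 0 \<theta> \<phi> \<Longrightarrow> R 0 \<theta> \<phi>' \<Longrightarrow> \<phi> = \<phi>'" "R 1 \<theta> \<phi> \<Longrightarrow> R 1 \<theta> \<phi>' \<Longrightarrow> \<phi> = \<phi>'" for \<theta> \<phi> \<phi>'
    by (auto simp: R_def)
  have R2: "R 2 \<theta> \<phi> \<Longrightarrow> R 2 \<theta> \<phi>' \<Longrightarrow> \<phi> = \<phi>'" for \<theta> \<phi> \<phi>'
    unfolding R_def using chain_unique by (simp only: if_False zero_neq_numeral numeral_eq_one_iff semiring_norm, elim disjE exE) blast+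
  have R_fun: "R i \<theta> \<phi> \<Longrightarrow> R i \<theta> \<phi>' \<Longrightarrow> \<phi> = \<phi>'" if "i < 3" for i \<theta> \<phi> \<phi>'
  proof -
    have "i = 0 \<or> i = 1 \<or> i = 2" using that by auto
    then show "R i \<theta> \<phi> \<Longrightarrow> R i \<theta> \<phi>' \<Longrightarrow> \<phi> = \<phi>'" using R01 R2 by metis
  qed
  have R_part: "part \<theta> \<phi> \<longleftrightarrow> (\<exists>i<3. R i \<theta> \<phi>)" for \<theta> \<phi>
  proof -
    have "(\<exists>i<3. R i \<theta> \<phi>) \<longleftrightarrow> R 0 \<theta> \<phi> \<or> R 1 \<theta> \<phi> \<or> R 2 \<theta> \<phi>"
      by (auto simp: less_Suc_eq numeral_3_eq_3 numeral_2_eq_2)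
    moreover have "(\<exists>y s. chain \<theta> \<phi> y s) \<longleftrightarrow> (\<exists>y. chain \<theta> \<phi> y True) \<or> (\<exists>y. chain \<theta> \<phi> y False)" by (metis (full_types))
    ultimately show ?thesis unfolding part_def subfm_def R_def by auto
  qed
  have pd: "pdfun M (\<lambda>e. p i (e 0))" if "i < 3" for i
    unfolding p_def
  proof (rule pdfun_total_fun)
    show "pdf M (\<lambda>e. R i (e 0) (e 1))"
      unfolding R_def by (cases "i = 0"; cases "i = 1") (simp_all, (intro pdf_intros)+)
  qed (use R_fun that in blast)
  have "pdfun M (\<lambda>e. p 0 (e 0))" "pdfun M (\<lambda>e. p 1 (e 0))" "pdfun M (\<lambda>e. p 2 (e 0))"
    using pd by simp_all
  from enumerate_iterates[where p = p and x = x, OF this] obtain f where f: "pdfun M (\<lambda>e. f (e 0))" "f \<zero> = x"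
    "\<And>i n. i < 3 \<Longrightarrow> f (num M (Suc (prod_encode (i, n)))) = p i (f (num M n))"
    "\<And>P n. P x \<Longrightarrow> (\<And>i z. i < 3 \<Longrightarrow> P z \<Longrightarrow> P (p i z)) \<Longrightarrow> P (f (num M n))"
    "\<And>n. \<exists>s. \<forall>i. i \<prec> n \<longrightarrow> s !! i = f i" by blast
  have "parts_closed (range (\<lambda>n. f (num M n)))"
    unfolding parts_closed_def
  proof (intro allI impI, elim conjE)
    fix \<theta> \<phi> assume "\<theta> \<in> range (\<lambda>n. f (num M n))" "part \<theta> \<phi>"
    then obtain n i where n: "\<theta> = f (num M n)" and i: "i < 3" "R i \<theta> \<phi>" using R_part by blast
    then have "p i \<theta> = \<phi>" unfolding p_def using total_fun_eq[of "R i"] R_fun by metis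
    then have "\<phi> = f (num M (Suc (prod_encode (i, n))))" using f(3) i(1) n by simp
    then show "\<phi> \<in> range (\<lambda>n. f (num M n))" by blast
  qed
  moreover have "x \<in> range (\<lambda>n. f (num M n))" using f(2) by (metis num_0 rangeI)
  ultimately have "parts x \<subseteq> range (\<lambda>n. f (num M n))" by (rule parts_least)
  moreover have "f (num M n) \<in> parts x" for n
  proof (rule f(4))
    show "p i z \<in> parts x" if "i < 3" "z \<in> parts x" for i z
    proof -
      have "R i z (p i z) \<or> p i z = z" unfolding p_def using total_fun_cases[of "R i"] R_fun that by blast
      then show ?thesis using that R_part parts_closed_parts parts_closed_def by metis
    qed
  qed (rule parts_self)
  ultimately have "parts x = range (\<lambda>n. f (num M n))" by blast
  with f(1,5) show ?thesis using that by blast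
qed

section \<open>Finite extensions of partial satisfaction classes\<close>

definition obeys :: "'a set \<Rightarrow> ('a \<times> 'a) set \<Rightarrow> ('a \<Rightarrow> 'a \<Rightarrow> bool \<Rightarrow> bool) \<Rightarrow> bool" where
  "obeys D S g \<longleftrightarrow> (\<forall>\<theta> \<phi> y s. \<theta> \<in> D \<and> \<phi> \<in> D \<and> chain \<theta> \<phi> y s \<longrightarrow>
     (Tr M S \<theta> \<longleftrightarrow> s = g \<phi> y (Tr M S \<phi>)))"

definition admissible :: "('a \<Rightarrow> 'a \<Rightarrow> bool \<Rightarrow> bool) \<Rightarrow> bool" where
  "admissible g \<longleftrightarrow> (\<forall>\<phi> y t. g \<phi> \<zero> t = t \<and> g \<phi> (y \<oplus> \<one>) t = g \<phi> y t \<and> teval \<Phi> t (g \<phi> y t) = g \<phi> y t)"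

lemma obeysD: "obeys D S g \<Longrightarrow> chain \<theta> \<phi> y s \<Longrightarrow> \<theta> \<in> D \<Longrightarrow> \<phi> \<in> D \<Longrightarrow> Tr M S \<theta> \<longleftrightarrow> s = g \<phi> y (Tr M S \<phi>)"
  unfolding obeys_def by blast

text \<open>By the clauses F(y + 1, \<phi>) receives the value
  \<open>teval \<Phi> t (g \<phi> y t)\<close> from its constituents, and admissibility turns this
  into \<open>g \<phi> (y \<oplus> \<one>) t\<close>. For conjunction and universal quantification
  the step is a negation, whose body is a negative chain member at position y.\<close>

lemma Tr_chain:
  assumes g: "admissible g" and S: "compositional D S" and chain: "chain \<theta> \<phi> y s"
    and D: "\<theta> \<in> D" "\<phi> \<in> D" "\<And>\<chi>. subfm \<theta> \<chi> \<Longrightarrow> \<chi> \<in> D"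
    and IH: "\<And>\<chi> y s. subfm \<theta> \<chi> \<Longrightarrow> chain \<chi> \<phi> y s \<Longrightarrow> Tr M S \<chi> \<longleftrightarrow> s = g \<phi> y (Tr M S \<phi>)"
  shows "Tr M S \<theta> \<longleftrightarrow> s = g \<phi> y (Tr M S \<phi>)"
proof -
  define t where "t = Tr M S \<phi>"
  have base: "Base \<phi>" using chain unfolding chain_def by blast
  have Sent: "Sent M \<phi>" "Sent M (F y \<phi>)" for y using base Base_Sent Sent_F by blast+
  have g0: "g \<phi> \<zero> t = t" and g1: "g \<phi> (y \<oplus> \<one>) t = g \<phi> y t" and gt: "teval \<Phi> t (g \<phi> y t) = g \<phi> y t" for y
    using g unfolding admissible_def by blast+
  have F: "Tr M S (F y \<phi>) \<longleftrightarrow> g \<phi> y t" if "subfm \<theta> (F y \<phi>)" for y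
  proof (cases "y = \<zero>")
    case False
    then show ?thesis using IH[OF that chain_F[OF base]] t_def by simp
  qed (simp add: t_def[symmetric] g0)
  have N: "Tr M S (cNeg M (F y \<phi>)) \<longleftrightarrow> \<not> g \<phi> y t" if "subfm \<theta> (cNeg M (F y \<phi>))" for y
  proof (cases "y = \<zero>")
    case True
    then show ?thesis using Tr_cNeg[OF S Sent(1)] D(2,3) that t_def g0 by simp
  next
    case False
    then have "chain (cNeg M (F y \<phi>)) \<phi> y False" unfolding chain_def using base by simp
    then show ?thesis using IH[OF that] t_def by simp
  qed
  have N0: "Tr M S (cNeg M \<phi>) \<longleftrightarrow> \<not> t" if "subfm \<theta> (cNeg M \<phi>)"
    using N[of \<zero>] that g0 by simp
  have neg: "Tr M S (cNeg M \<chi>) \<longleftrightarrow> \<not> Tr M S \<chi>" if "\<theta> = cNeg M \<chi>" "Sent M \<chi>" for \<chi>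
    using Tr_cNeg[OF S that(2)] that D by simp
  have lit: "Tr M S (tsubst M c \<phi> (F z \<phi>)) \<longleftrightarrow> teval c t (g \<phi> z t)"
    if "c \<in> {LetterP, LetterQ}" "subfm \<theta> (tsubst M c \<phi> (F z \<phi>))" for c z
    using that F[of z] t_def by auto
  have neg_lit: "Tr M S (cNeg M (tsubst M c \<phi> (F z \<phi>))) \<longleftrightarrow> \<not> teval c t (g \<phi> z t)"
    if "c \<in> {LetterP, LetterQ}" "subfm \<theta> (cNeg M (tsubst M c \<phi> (F z \<phi>)))" for c z
    using that N[of z] N0 by auto
  have Sent_lit: "Sent M (tsubst M c \<phi> (F z \<phi>))" if "c \<in> {LetterP, LetterQ}" for c z
    using that Sent by auto
  from chain consider (pos) "s" "y \<noteq> \<zero>" "\<theta> = F y \<phi>"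
    | (neg) "\<not> s" "y \<noteq> \<zero>" "\<theta> = cNeg M (F y \<phi>)" | (inner) "\<not> s" "cNeg M \<theta> = F (y \<oplus> \<one>) \<phi>"
    unfolding chain_def by blast
  then show ?thesis
  proof cases
    case pos': pos
    obtain z where z: "y = z \<oplus> \<one>" using cases0[of y] pos' by blast
    have pos: "\<theta> = F (z \<oplus> \<one>) \<phi>" "\<theta> = step \<phi> (F z \<phi>)" using pos' z by (simp_all add: F_op_succ)
    have "Tr M S \<theta> \<longleftrightarrow> g \<phi> z t"
    proof (cases rule: template_cases)
      case (Or a b)
      then have \<theta>: "\<theta> = cOr M (tsubst M a \<phi> (F z \<phi>)) (tsubst M b \<phi> (F z \<phi>))" using pos(2) by simp
      then have "Tr M S \<theta> \<longleftrightarrow> Tr M S (tsubst M a \<phi> (F z \<phi>)) \<or> Tr M S (tsubst M b \<phi> (F z \<phi>))"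
        using Tr_cOr[OF S Sent_lit[OF Or(2)] Sent_lit[OF Or(3)]] D by simp
      also have "\<dots> \<longleftrightarrow> teval \<Phi> t (g \<phi> z t)" using lit[OF Or(2)] lit[OF Or(3)] \<theta> Or(1) by simp
      finally have "Tr M S \<theta> \<longleftrightarrow> teval \<Phi> t (g \<phi> z t)" .
      then show ?thesis using gt by simp
    next
      case (Ex n)
      then show ?thesis using Tr_cEx[OF S] D Sent F[of z] pos(2) by simp
    next
      case (And a b)
      then obtain \<chi> where \<chi>: "\<theta> = cNeg M \<chi>" using pos(2) by (auto simp: step_defs)
      then have "cNeg M \<chi> = F (z \<oplus> \<one>) \<phi>" using pos(1) by simp
      then have "chain \<chi> \<phi> z False" unfolding chain_def using base by blast
      then show ?thesis using IH[of \<chi> z False] \<chi> neg chain_Sent t_def by simp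
    next
      case (All n)
      then obtain \<chi> where \<chi>: "\<theta> = cNeg M \<chi>" using pos(2) by (auto simp: step_defs)
      then have "cNeg M \<chi> = F (z \<oplus> \<one>) \<phi>" using pos(1) by simp
      then have "chain \<chi> \<phi> z False" unfolding chain_def using base by blast
      then show ?thesis using IH[of \<chi> z False] \<chi> neg chain_Sent t_def by simp
    qed
    then show ?thesis using pos' z g1 t_def by simp
  next
    case neg
    then show ?thesis using Tr_cNeg[OF S Sent(2)] D F[of y] t_def by simp
  next
    case inner': inner
    then have inner: "cNeg M \<theta> = step \<phi> (F y \<phi>)" by (simp add: F_op_succ)
    have "Tr M S \<theta> \<longleftrightarrow> \<not> g \<phi> y t"
    proof (cases rule: template_cases)
      case (And a b)
      define na nb where "na = cNeg M (tsubst M a \<phi> (F y \<phi>))" and "nb = cNeg M (tsubst M b \<phi> (F y \<phi>))"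
      have \<theta>: "\<theta> = cOr M na nb" using inner And(1) by (simp add: step_defs na_def nb_def)
      have "Sent M na" "Sent M nb" using Sent_lit And(2,3) by (simp_all add: na_def nb_def)
      then have "Tr M S \<theta> \<longleftrightarrow> Tr M S na \<or> Tr M S nb"
        using Tr_cOr[OF S] D \<theta> by simp
      also have "\<dots> \<longleftrightarrow> \<not> teval \<Phi> t (g \<phi> y t)"
        using neg_lit[OF And(2), of y] neg_lit[OF And(3), of y] \<theta> And(1) by (simp add: na_def nb_def)
      finally have "Tr M S \<theta> \<longleftrightarrow> \<not> teval \<Phi> t (g \<phi> y t)" .
      then show ?thesis using gt by simp
    next
      case (All n)
      then show ?thesis using Tr_cEx[OF S] D Sent N[of y] inner by (auto simp: step_defs)
    qed (use inner in auto)
    then show ?thesis using inner' t_def by simp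
  qed
qed

lemma inner_subfm: "cNeg M \<theta> = step \<phi> \<psi> \<Longrightarrow> subfm \<theta> \<chi> \<Longrightarrow> \<exists>\<xi>. \<chi> = cNeg M \<xi>"
  by (cases rule: template_cases) (auto simp: step_defs)

text \<open>The negative chain members follow in two passes through \<open>Tr_chain\<close>: first
  the negations of iterates, then the inner formulas, whose immediate subformulas are negations by
  \<open>inner_subfm\<close>.\<close>

lemma obeys_parts_closed:
  assumes Z: "parts_closed Z" and S: "compositional Z S" and g: "admissible g"
    and F: "\<And>\<phi> y. Base \<phi> \<Longrightarrow> y \<noteq> \<zero> \<Longrightarrow> F y \<phi> \<in> Z \<Longrightarrow> Tr M S (F y \<phi>) \<longleftrightarrow> g \<phi> y (Tr M S \<phi>)"
  shows "obeys Z S g"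
proof -
  have sub: "\<chi> \<in> Z" if "\<theta> \<in> Z" "subfm \<theta> \<chi>" for \<theta> \<chi>
    using Z that unfolding parts_closed_def part_def by blast
  have pos: "Tr M S \<theta> \<longleftrightarrow> True = g \<phi> y (Tr M S \<phi>)" if "\<theta> \<in> Z" "chain \<theta> \<phi> y True" for \<theta> \<phi> y
    using that F unfolding chain_def by auto
  have neg: "Tr M S \<theta> \<longleftrightarrow> False = g \<phi> y (Tr M S \<phi>)"
    if "\<theta> \<in> Z" "\<phi> \<in> Z" "chain \<theta> \<phi> y False" "\<theta> = cNeg M (F y \<phi>)" "y \<noteq> \<zero>" for \<theta> \<phi> y
  proof (rule Tr_chain[OF g S that(3,1,2)])
    have base: "Base \<phi>" using that(3) unfolding chain_def by blast
    fix \<chi> y' s' assume "subfm \<theta> \<chi>" "chain \<chi> \<phi> y' s'"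
    then have "\<chi> \<in> Z" "s'" using sub[of \<theta> \<chi>] that chain_unique[OF _ chain_F[OF base that(5)], of \<phi> y' s'] by auto
    then show "Tr M S \<chi> \<longleftrightarrow> s' = g \<phi> y' (Tr M S \<phi>)" using pos \<open>chain \<chi> \<phi> y' s'\<close> by auto
  qed (use sub that in blast)
  show ?thesis
    unfolding obeys_def
  proof (intro allI impI, elim conjE)
    fix \<theta> \<phi> y s assume \<theta>: "\<theta> \<in> Z" "\<phi> \<in> Z" "chain \<theta> \<phi> y s"
    show "Tr M S \<theta> \<longleftrightarrow> s = g \<phi> y (Tr M S \<phi>)"
    proof (cases "s \<or> y \<noteq> \<zero> \<and> \<theta> = cNeg M (F y \<phi>)")
      case True
      then show ?thesis using pos[of \<theta> \<phi> y] neg[of \<theta> \<phi> y] \<theta> by (cases s) auto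
    next
      case False
      then have inner: "cNeg M \<theta> = step \<phi> (F y \<phi>)"
        using \<theta>(3) unfolding chain_def by (metis F_op_succ)
      show ?thesis
      proof (rule Tr_chain[OF g S \<theta>(3,1,2)])
        fix \<chi> y' s' assume \<chi>: "subfm \<theta> \<chi>" "chain \<chi> \<phi> y' s'"
        then have \<chi>Z: "\<chi> \<in> Z" using sub \<theta> by blast
        obtain \<xi> where \<xi>: "\<chi> = cNeg M \<xi>" using inner_subfm[OF inner \<chi>(1)] by blast
        show "Tr M S \<chi> \<longleftrightarrow> s' = g \<phi> y' (Tr M S \<phi>)"
        proof (cases s')
          case True
          then show ?thesis using pos \<chi>Z \<chi>(2) by simp
        next
          case False
          moreover have "cNeg M \<chi> \<noteq> F (y' \<oplus> \<one>) \<phi>"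
            unfolding \<xi> F_op_succ by (metis step_neq_cNeg_cNeg)
          ultimately have "\<chi> = cNeg M (F y' \<phi>)" "y' \<noteq> \<zero>" using \<chi>(2) unfolding chain_def by auto
          then show ?thesis using neg[OF \<chi>Z \<theta>(2)] \<chi>(2) False by simp
        qed
      qed (use sub \<theta> in blast)
    qed
  qed
qed

text \<open>The formulas of \<open>Y\<close> are added in increasing order. Parts are smaller and
  \<open>Z\<close> is closed, so nothing present has the new formula \<open>b\<close> as a part, and
  its row disturbs no earlier row. If all immediate subformulas of \<open>b\<close> are present, the
  clause dictates the row and \<open>Tr_chain\<close> shows that \<open>g\<close> is obeyed.
  Otherwise no clause applies and the value demanded by \<open>g\<close> is entered.\<close>

lemma finite_extension:
  assumes Z: "parts_closed Z" and S: "compositional Z S" "obeys Z S g" and g: "admissible g" and "finite Y"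
  shows "\<exists>S'. (\<forall>\<theta>\<in>Z. \<forall>\<alpha>. (\<theta>, \<alpha>) \<in> S' \<longleftrightarrow> (\<theta>, \<alpha>) \<in> S) \<and> compositional (Z \<union> Y) S' \<and> obeys (Z \<union> Y) S' g"
  using \<open>finite Y\<close>
proof (induction Y rule: finite_linorder_max_induct)
  case empty
  then show ?case using S by (intro exI[of _ S]) simp
next
  case (insert b Y)
  then obtain S' where S': "\<forall>\<theta>\<in>Z. \<forall>\<alpha>. (\<theta>, \<alpha>) \<in> S' \<longleftrightarrow> (\<theta>, \<alpha>) \<in> S"
    "compositional (Z \<union> Y) S'" "obeys (Z \<union> Y) S' g" by blast
  define D where "D = Z \<union> Y"
  show ?case
  proof (cases "b \<in> D")
    case True
    then have "Z \<union> insert b Y = Z \<union> Y" by (auto simp: D_def)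
    then show ?thesis using S' by auto
  next
    case b: False
    have part: "\<chi> \<noteq> b" if "part \<theta> \<chi>" "\<theta> \<in> insert b D" for \<theta> \<chi>
    proof (cases "\<theta> \<in> Z")
      case True
      then show ?thesis using Z b that unfolding parts_closed_def D_def by blast
    next
      case False
      then have "\<theta> \<preceq> b" using that insert.hyps(2) less_imp_le by (auto simp: D_def)
      then show ?thesis using part_less[OF that(1)] by auto
    qed
    have sub: "\<chi> \<noteq> b" if "subfm \<theta> \<chi>" "\<theta> \<in> insert b D" for \<theta> \<chi>
      using part that unfolding part_def by blast
    have base: "\<phi> \<noteq> b" if "chain \<theta> \<phi> y s" "\<theta> \<in> insert b D" for \<theta> \<phi> y s
      using part that unfolding part_def by blast
    \<comment> \<open>If a subformula is missing and \<open>b\<close> has no base in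
      \<open>D\<close>, the row is empty. This default is safe, since then neither a clause nor
      \<open>g\<close> constrains \<open>b\<close>.\<close>
    define row where "row \<alpha> \<longleftrightarrow> (if \<forall>\<phi>. subfm b \<phi> \<longrightarrow> \<phi> \<in> D then clause S' b \<alpha>
      else \<exists>\<phi> y s. chain b \<phi> y s \<and> \<phi> \<in> D \<and> (s = g \<phi> y (Tr M S' \<phi>)))" for \<alpha>
    define S'' where "S'' = {(\<theta>, \<alpha>). if \<theta> = b then row \<alpha> else (\<theta>, \<alpha>) \<in> S'}"
    have old: "(\<theta>, \<alpha>) \<in> S'' \<longleftrightarrow> (\<theta>, \<alpha>) \<in> S'" if "\<theta> \<noteq> b" for \<theta> \<alpha> using that by (simp add: S''_def)
    have old_Tr: "Tr M S'' \<theta> \<longleftrightarrow> Tr M S' \<theta>" if "\<theta> \<noteq> b" for \<theta> using old[OF that] by (simp add: Tr_def)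
    have cl: "clause S'' \<theta> \<alpha> \<longleftrightarrow> clause S' \<theta> \<alpha>" if "\<theta> \<in> insert b D" for \<theta> \<alpha>
      by (rule clause_cong) (use old sub that in blast)
    have comp: "compositional (insert b D) S''"
      unfolding compositional_def
    proof (intro allI impI, elim conjE)
      fix \<theta> \<alpha> assume \<theta>: "\<theta> \<in> insert b D" "Form M \<theta>" "Asn M \<alpha> \<theta>" "\<forall>\<phi>. subfm \<theta> \<phi> \<longrightarrow> \<phi> \<in> insert b D"
      then have subs: "\<forall>\<phi>. subfm \<theta> \<phi> \<longrightarrow> \<phi> \<in> D" using sub by blast
      show "(\<theta>, \<alpha>) \<in> S'' \<longleftrightarrow> clause S'' \<theta> \<alpha>"
      proof (cases "\<theta> = b")
        case True
        then show ?thesis using subs cl[OF \<theta>(1)] by (simp add: S''_def row_def)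
      next
        case False
        then have "\<theta> \<in> D" using \<theta>(1) by blast
        then show ?thesis using old[OF False] cl[OF \<theta>(1)] compositionalD[OF S'(2)] \<theta> subs
          by (simp add: D_def)
      qed
    qed
    have "obeys (insert b D) S'' g"
      unfolding obeys_def
    proof (intro allI impI, elim conjE)
      fix \<theta> \<phi> y s assume \<theta>: "\<theta> \<in> insert b D" "\<phi> \<in> insert b D" "chain \<theta> \<phi> y s"
      then have \<phi>: "\<phi> \<in> D" "\<phi> \<noteq> b" using base by blast+
      show "Tr M S'' \<theta> \<longleftrightarrow> s = g \<phi> y (Tr M S'' \<phi>)"
      proof (cases "\<theta> = b")
        case False
        then show ?thesis using obeysD[OF S'(3) \<theta>(3)] \<theta> \<phi> old_Tr by (simp add: D_def)
      next
        case True
        show ?thesis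
        proof (cases "\<forall>\<chi>. subfm \<theta> \<chi> \<longrightarrow> \<chi> \<in> D")
          case subs: True
          show ?thesis
          proof (rule Tr_chain[OF g comp \<theta>(3,1,2)])
            fix \<chi> y' s' assume \<chi>: "subfm \<theta> \<chi>" "chain \<chi> \<phi> y' s'"
            then have "\<chi> \<in> D" "\<chi> \<noteq> b" using subs b by blast+
            then show "Tr M S'' \<chi> \<longleftrightarrow> s' = g \<phi> y' (Tr M S'' \<phi>)"
              using obeysD[OF S'(3) \<chi>(2)] \<phi> old_Tr by (simp add: D_def)
          qed (use subs in blast)
        next
          case subs: False
          have "Tr M S'' \<theta> \<longleftrightarrow> row \<zero>" using True by (simp add: Tr_def S''_def)
          also have "\<dots> \<longleftrightarrow> (\<exists>\<phi> y s. chain b \<phi> y s \<and> \<phi> \<in> D \<and> (s = g \<phi> y (Tr M S' \<phi>)))"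
          proof -
            have "(\<forall>\<phi>. subfm b \<phi> \<longrightarrow> \<phi> \<in> D) = False" using subs True by simp
            then show ?thesis unfolding row_def by (simp only: if_False)
          qed
          also have "\<dots> \<longleftrightarrow> s = g \<phi> y (Tr M S' \<phi>)"
          proof
            assume "\<exists>\<phi> y s. chain b \<phi> y s \<and> \<phi> \<in> D \<and> (s = g \<phi> y (Tr M S' \<phi>))"
            then obtain \<phi>' y' s' where *: "chain \<theta> \<phi>' y' s'" "s' = g \<phi>' y' (Tr M S' \<phi>')" using True by blast
            then show "s = g \<phi> y (Tr M S' \<phi>)" using chain_unique[OF \<theta>(3) *(1)] by simp
          qed (use \<theta>(3) True \<phi> in blast)
          finally show ?thesis using old_Tr[OF \<phi>(2)] by simp
        qed
      qed
    qed
    moreover have "\<forall>\<theta>\<in>Z. \<forall>\<alpha>. (\<theta>, \<alpha>) \<in> S'' \<longleftrightarrow> (\<theta>, \<alpha>) \<in> S"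
      using old S'(1) b by (metis D_def UnCI)
    moreover have "Z \<union> insert b Y = insert b D" by (auto simp: D_def)
    ultimately show ?thesis using comp by (intro exI[of _ S'']) simp
  qed
qed

end

text \<open>Requests must recur arbitrarily late, because one is honoured only after the clock has
  passed its index and the decision it refers to has been recorded.\<close>

lemma fair_enumeration:
  assumes "countable (UNIV :: 'a set)"
  obtains t :: "nat \<Rightarrow> 'a" where "\<And>z N. \<exists>j\<ge>N. t j = z"
proof (rule that[of "\<lambda>j. from_nat_into UNIV (fst (prod_decode j))"])
  fix z :: 'a and N
  obtain i where "from_nat_into UNIV i = z" using from_nat_into_surj[OF assms] by blast
  then show "\<exists>j\<ge>N. from_nat_into UNIV (fst (prod_decode j)) = z"
    using le_prod_encode_2[of N i] by (intro exI[of _ "prod_encode (i, N)"]) simp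
qed

section \<open>Compactness for partial satisfaction classes\<close>

context PA
begin

text \<open>The third component is a truth value, \<open>\<one>\<close> or \<open>\<zero>\<close>,
  so that a coded set records negative decisions as well.\<close>

definition decides :: "'a \<Rightarrow> 'a \<Rightarrow> 'a \<Rightarrow> 'a \<Rightarrow> bool" where
  "decides \<Gamma> \<theta> \<alpha> b \<longleftrightarrow> pair M (pair M \<theta> \<alpha>) b \<epsilon> \<Gamma>"

definition sound :: "'a \<Rightarrow> 'a set \<Rightarrow> ('a \<times> 'a) set \<Rightarrow> bool" where
  "sound \<Gamma> D S \<longleftrightarrow> (\<forall>u. u \<epsilon> \<Gamma> \<longrightarrow> (\<exists>\<theta> \<alpha>. \<theta> \<in> D \<and> Form M \<theta> \<and> Asn M \<alpha> \<theta> \<and>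
     u = pair M (pair M \<theta> \<alpha>) (if (\<theta>, \<alpha>) \<in> S then \<one> else \<zero>)))"

lemma soundD:
  assumes "sound \<Gamma> D S" "decides \<Gamma> \<theta> \<alpha> b"
  shows "\<theta> \<in> D" "Form M \<theta>" "Asn M \<alpha> \<theta>" "b = (if (\<theta>, \<alpha>) \<in> S then \<one> else \<zero>)"
  using assms unfolding sound_def decides_def by fastforce+

lemma sound_insert:
  assumes "sound \<Gamma> D S" "\<theta> \<in> D" "Form M \<theta>" "Asn M \<alpha> \<theta>"
  obtains \<Gamma>' where "sound \<Gamma>' D S" "\<And>z. z \<epsilon> \<Gamma> \<Longrightarrow> z \<epsilon> \<Gamma>'" "decides \<Gamma>' \<theta> \<alpha> (if (\<theta>, \<alpha>) \<in> S then \<one> else \<zero>)"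
proof -
  obtain \<Gamma>' where \<Gamma>': "\<And>z. z \<epsilon> \<Gamma>' \<longleftrightarrow> z \<epsilon> \<Gamma> \<or> z = pair M (pair M \<theta> \<alpha>) (if (\<theta>, \<alpha>) \<in> S then \<one> else \<zero>)"
    using set_insert by blast
  show ?thesis
    by (rule that[of \<Gamma>']) (use assms \<Gamma>' in \<open>auto simp: sound_def decides_def\<close>)
qed

text \<open>The clauses mention only decisions that have been taken, so that every set sound for a
  partial class is coherent.\<close>

definition coherent where
  "coherent f R1 R2 \<Gamma> k \<longleftrightarrow>
    (\<forall>\<theta> \<alpha>. \<not> (decides \<Gamma> \<theta> \<alpha> \<one> \<and> decides \<Gamma> \<theta> \<alpha> \<zero>)) \<and>
    (\<forall>\<theta> s t \<alpha>. \<theta> = cEq M s t \<or> \<theta> = cLess M s t \<longrightarrow>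
       (decides \<Gamma> \<theta> \<alpha> \<one> \<longrightarrow> atomic_true \<theta> \<alpha>) \<and> (decides \<Gamma> \<theta> \<alpha> \<zero> \<longrightarrow> \<not> atomic_true \<theta> \<alpha>)) \<and>
    (\<forall>\<phi> \<alpha> b. \<not> (decides \<Gamma> (cNeg M \<phi>) \<alpha> b \<and> decides \<Gamma> \<phi> \<alpha> b)) \<and>
    (\<forall>\<phi> \<psi> \<alpha> b c d. decides \<Gamma> (cOr M \<phi> \<psi>) \<alpha> b \<and> decides \<Gamma> \<phi> (restr M \<alpha> \<phi>) c \<and> decides \<Gamma> \<psi> (restr M \<alpha> \<psi>) d \<longrightarrow>
       (b = \<one> \<longleftrightarrow> c = \<one> \<or> d = \<one>)) \<and>
    (\<forall>x \<phi> \<alpha> \<beta>. \<not> (decides \<Gamma> (cEx M x \<phi>) \<alpha> \<zero> \<and> variant x \<alpha> \<beta> \<and> decides \<Gamma> \<phi> \<beta> \<one>)) \<and>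
    (\<forall>i j b c. i \<prec> k \<and> j \<prec> k \<and> decides \<Gamma> (f i) \<zero> b \<and> decides \<Gamma> (f j) \<zero> c \<longrightarrow>
       (R1 i j \<longrightarrow> b = c) \<and> (R2 i j \<longrightarrow> b \<noteq> c))"

lemmas coherentD1 = coherent_def[THEN iffD1, THEN conjunct1, rule_format]
lemmas coherentD2 = coherent_def[THEN iffD1, THEN conjunct2, THEN conjunct1, rule_format]
lemmas coherentD3 = coherent_def[THEN iffD1, THEN conjunct2, THEN conjunct2, THEN conjunct1, rule_format]
lemmas coherentD4 = coherent_def[THEN iffD1, THEN conjunct2, THEN conjunct2, THEN conjunct2, THEN conjunct1, rule_format]
lemmas coherentD5 = coherent_def[THEN iffD1, THEN conjunct2, THEN conjunct2, THEN conjunct2, THEN conjunct2, THEN conjunct1, rule_format]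
lemmas coherentD6 = coherent_def[THEN iffD1, THEN conjunct2, THEN conjunct2, THEN conjunct2, THEN conjunct2, THEN conjunct2, rule_format]

text \<open>A position pairs the recorded decisions with a clock. The clock keeps requests to
  standard indices, the only ones at which \<open>f i\<close> is known to lie in the intended set.
  One move is read in two ways: as the request to decide \<open>f i\<close> at an assignment, and as
  the request for a witness of a recorded existential formula.\<close>

definition response where
  "response f s t s' \<longleftrightarrow> psnd s' = psnd s \<oplus> \<one> \<and> (\<forall>z. z \<epsilon> pfst s \<longrightarrow> z \<epsilon> pfst s') \<and>
    (\<forall>i \<alpha>. t = pair M i \<alpha> \<and> i \<prec> psnd s \<and> Form M (f i) \<and> Asn M \<alpha> (f i) \<longrightarrow>
       decides (pfst s') (f i) \<alpha> \<one> \<or> decides (pfst s') (f i) \<alpha> \<zero>) \<and>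
    (\<forall>i x \<alpha>. t = pair M i (pair M x \<alpha>) \<and> i \<prec> psnd s \<and> decides (pfst s) (cEx M x (f i)) \<alpha> \<one> \<longrightarrow>
       (\<exists>\<beta>. Asn M \<beta> (f i) \<and> variant x \<alpha> \<beta> \<and> decides (pfst s') (f i) \<beta> \<one>))"

text \<open>An external partial class certifies the definable winning condition: each item of
  \<open>coherent\<close> involves only recorded decisions, their formulas lie in \<open>D\<close>,
  and so the clause that relates them holds for \<open>S\<close>.\<close>

lemma sound_coherent:
  assumes S: "compositional D S" and \<Gamma>: "sound \<Gamma> D S"
    and R1: "\<And>i j. i \<prec> k \<Longrightarrow> j \<prec> k \<Longrightarrow> f i \<in> D \<Longrightarrow> f j \<in> D \<Longrightarrow> R1 i j \<Longrightarrow> Tr M S (f i) \<longleftrightarrow> Tr M S (f j)"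
    and R2: "\<And>i j. i \<prec> k \<Longrightarrow> j \<prec> k \<Longrightarrow> f i \<in> D \<Longrightarrow> f j \<in> D \<Longrightarrow> R2 i j \<Longrightarrow> Tr M S (f i) \<longleftrightarrow> \<not> Tr M S (f j)"
  shows "coherent f R1 R2 \<Gamma> k"
proof -
  note d = soundD[OF \<Gamma>]
  have one: "decides \<Gamma> \<theta> \<alpha> \<one> \<Longrightarrow> (\<theta>, \<alpha>) \<in> S" and zero: "decides \<Gamma> \<theta> \<alpha> \<zero> \<Longrightarrow> (\<theta>, \<alpha>) \<notin> S" for \<theta> \<alpha>
    using d(4)[of \<theta> \<alpha> \<one>] d(4)[of \<theta> \<alpha> \<zero>] by (auto split: if_splits)
  have cl: "(\<theta>, \<alpha>) \<in> S \<longleftrightarrow> clause S \<theta> \<alpha>" if "decides \<Gamma> \<theta> \<alpha> b" "\<And>\<phi>. subfm \<theta> \<phi> \<Longrightarrow> \<phi> \<in> D" for \<theta> \<alpha> b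
    using compositionalD[OF S d(1,2,3)[OF that(1)]] that(2) by blast
  have c1: "\<forall>\<theta> \<alpha>. \<not> (decides \<Gamma> \<theta> \<alpha> \<one> \<and> decides \<Gamma> \<theta> \<alpha> \<zero>)"
    using one zero by blast
  have c2: "\<forall>\<theta> s t \<alpha>. \<theta> = cEq M s t \<or> \<theta> = cLess M s t \<longrightarrow>
       (decides \<Gamma> \<theta> \<alpha> \<one> \<longrightarrow> atomic_true \<theta> \<alpha>) \<and> (decides \<Gamma> \<theta> \<alpha> \<zero> \<longrightarrow> \<not> atomic_true \<theta> \<alpha>)"
  proof (intro allI impI)
    fix \<theta> s t \<alpha> assume "\<theta> = cEq M s t \<or> \<theta> = cLess M s t"
    then show "(decides \<Gamma> \<theta> \<alpha> \<one> \<longrightarrow> atomic_true \<theta> \<alpha>) \<and> (decides \<Gamma> \<theta> \<alpha> \<zero> \<longrightarrow> \<not> atomic_true \<theta> \<alpha>)"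
      using cl[of \<theta> \<alpha> \<one>] cl[of \<theta> \<alpha> \<zero>] one[of \<theta> \<alpha>] zero[of \<theta> \<alpha>] by auto
  qed
  have c3: "\<forall>\<phi> \<alpha> b. \<not> (decides \<Gamma> (cNeg M \<phi>) \<alpha> b \<and> decides \<Gamma> \<phi> \<alpha> b)"
  proof (intro allI notI, elim conjE)
    fix \<phi> \<alpha> b assume b: "decides \<Gamma> (cNeg M \<phi>) \<alpha> b" "decides \<Gamma> \<phi> \<alpha> b"
    have "(cNeg M \<phi>, \<alpha>) \<in> S \<longleftrightarrow> (\<phi>, \<alpha>) \<notin> S" using cl[OF b(1)] d(1)[OF b(2)] by simp
    then show False using d(4)[OF b(1)] d(4)[OF b(2)] by (auto split: if_splits)
  qed
  have c4: "\<forall>\<phi> \<psi> \<alpha> b c d. decides \<Gamma> (cOr M \<phi> \<psi>) \<alpha> b \<and> decides \<Gamma> \<phi> (restr M \<alpha> \<phi>) c \<and> decides \<Gamma> \<psi> (restr M \<alpha> \<psi>) d \<longrightarrow>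
       (b = \<one> \<longleftrightarrow> c = \<one> \<or> d = \<one>)"
  proof (intro allI impI, elim conjE)
    fix \<phi> \<psi> \<alpha> b c e assume b: "decides \<Gamma> (cOr M \<phi> \<psi>) \<alpha> b" "decides \<Gamma> \<phi> (restr M \<alpha> \<phi>) c" "decides \<Gamma> \<psi> (restr M \<alpha> \<psi>) e"
    have "(cOr M \<phi> \<psi>, \<alpha>) \<in> S \<longleftrightarrow> (\<phi>, restr M \<alpha> \<phi>) \<in> S \<or> (\<psi>, restr M \<alpha> \<psi>) \<in> S"
      using cl[OF b(1)] d(1)[OF b(2)] d(1)[OF b(3)] by auto
    then show "b = \<one> \<longleftrightarrow> c = \<one> \<or> e = \<one>" using d(4)[OF b(1)] d(4)[OF b(2)] d(4)[OF b(3)] by (auto split: if_splits)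
  qed
  have c5: "\<forall>x \<phi> \<alpha> \<beta>. \<not> (decides \<Gamma> (cEx M x \<phi>) \<alpha> \<zero> \<and> variant x \<alpha> \<beta> \<and> decides \<Gamma> \<phi> \<beta> \<one>)"
  proof (intro allI notI, elim conjE)
    fix x \<phi> \<alpha> \<beta> assume b: "decides \<Gamma> (cEx M x \<phi>) \<alpha> \<zero>" "variant x \<alpha> \<beta>" "decides \<Gamma> \<phi> \<beta> \<one>"
    have "clause S (cEx M x \<phi>) \<alpha>" using d(3)[OF b(3)] one[OF b(3)] b(2) by auto
    then show False using cl[OF b(1)] d(1)[OF b(3)] zero[OF b(1)] by simp
  qed
  have c6: "\<forall>i j b c. i \<prec> k \<and> j \<prec> k \<and> decides \<Gamma> (f i) \<zero> b \<and> decides \<Gamma> (f j) \<zero> c \<longrightarrow>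
       (R1 i j \<longrightarrow> b = c) \<and> (R2 i j \<longrightarrow> b \<noteq> c)"
  proof (intro allI impI, elim conjE)
    fix i j b c assume b: "i \<prec> k" "j \<prec> k" "decides \<Gamma> (f i) \<zero> b" "decides \<Gamma> (f j) \<zero> c"
    show "(R1 i j \<longrightarrow> b = c) \<and> (R2 i j \<longrightarrow> b \<noteq> c)"
      using R1[OF b(1,2) d(1)[OF b(3)] d(1)[OF b(4)]] R2[OF b(1,2) d(1)[OF b(3)] d(1)[OF b(4)]]
        d(4)[OF b(3)] d(4)[OF b(4)] by (simp add: Tr_def)
  qed
  show ?thesis unfolding coherent_def by (intro conjI c1 c2 c3 c4 c5 c6)
qed

lemma sound_response:
  assumes S: "compositional D S" and \<Gamma>: "sound \<Gamma> D S" and D: "\<And>i. i \<prec> k \<Longrightarrow> f i \<in> D"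
  shows "\<exists>\<Gamma>'. response f (pair M \<Gamma> k) t (pair M \<Gamma>' (k \<oplus> \<one>)) \<and> sound \<Gamma>' D S"
proof -
  obtain i u where t: "t = pair M i u" using pair_surj by blast
  obtain x \<alpha> where u: "u = pair M x \<alpha>" using pair_surj by blast
  obtain \<Gamma>1 where \<Gamma>1: "sound \<Gamma>1 D S" "\<And>z. z \<epsilon> \<Gamma> \<Longrightarrow> z \<epsilon> \<Gamma>1"
    "i \<prec> k \<and> Form M (f i) \<and> Asn M u (f i) \<Longrightarrow> decides \<Gamma>1 (f i) u \<one> \<or> decides \<Gamma>1 (f i) u \<zero>"
  proof (cases "i \<prec> k \<and> Form M (f i) \<and> Asn M u (f i)")
    case True
    then obtain \<Gamma>1 where "sound \<Gamma>1 D S" "\<And>z. z \<epsilon> \<Gamma> \<Longrightarrow> z \<epsilon> \<Gamma>1" "decides \<Gamma>1 (f i) u (if (f i, u) \<in> S then \<one> else \<zero>)"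
      using sound_insert[OF \<Gamma> D] by blast
    then show ?thesis by (intro that[of \<Gamma>1]) (auto split: if_splits)
  next
    case False
    show ?thesis by (rule that[OF \<Gamma>]) (use False in simp_all)
  qed
  obtain \<Gamma>' where \<Gamma>': "sound \<Gamma>' D S" "\<And>z. z \<epsilon> \<Gamma>1 \<Longrightarrow> z \<epsilon> \<Gamma>'"
    "i \<prec> k \<and> decides \<Gamma> (cEx M x (f i)) \<alpha> \<one> \<Longrightarrow> \<exists>\<beta>. Asn M \<beta> (f i) \<and> variant x \<alpha> \<beta> \<and> decides \<Gamma>' (f i) \<beta> \<one>"
  proof (cases "i \<prec> k \<and> decides \<Gamma> (cEx M x (f i)) \<alpha> \<one>")
    case True
    then have i: "i \<prec> k" and dec: "decides \<Gamma> (cEx M x (f i)) \<alpha> \<one>" by blast+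
    note d = soundD[OF \<Gamma> dec]
    have "clause S (cEx M x (f i)) \<alpha>"
      using compositionalD[OF S d(1-3)] D[OF i] d(4) by (auto split: if_splits)
    then obtain \<beta> where \<beta>: "Asn M \<beta> (f i)" "variant x \<alpha> \<beta>" "(f i, \<beta>) \<in> S" by auto
    obtain \<Gamma>' where "sound \<Gamma>' D S" "\<And>z. z \<epsilon> \<Gamma>1 \<Longrightarrow> z \<epsilon> \<Gamma>'" "decides \<Gamma>' (f i) \<beta> (if (f i, \<beta>) \<in> S then \<one> else \<zero>)"
      using sound_insert[OF \<Gamma>1(1) D[OF i] _ \<beta>(1)] d(2) by auto
    then show ?thesis using \<beta> by (intro that[of \<Gamma>']) auto
  next
    case False
    show ?thesis by (rule that[OF \<Gamma>1(1)]) (use False in simp_all)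
  qed
  have "response f (pair M \<Gamma> k) t (pair M \<Gamma>' (k \<oplus> \<one>))"
    unfolding response_def t u using \<Gamma>1(2,3) \<Gamma>'(2,3) by (auto simp: decides_def u)
  with \<Gamma>' show ?thesis by blast
qed

text \<open>For length n the strategy reads its answers off an approximation containing the first n
  formulas. Along the infinite play the approximations are gone and only coherence is left, but each
  Tarski clause is checked on at most three decisions, and these are all recorded from some round
  on.\<close>

lemma partial_satisfaction_compactness:
  assumes count: "countable (UNIV :: 'a set)" and sat: "rec_saturated M"
    and f: "pdfun M (\<lambda>e. f (e 0))" and R1: "pdf M (\<lambda>e. R1 (e 0) (e 1))" and R2: "pdf M (\<lambda>e. R2 (e 0) (e 1))"
    and Z: "Z = range (\<lambda>n. f (num M n))"
    and approx: "\<And>n. \<exists>D S. compositional D S \<and> sound \<gamma> D S \<and> D \<subseteq> Z \<and> (\<forall>i<n. f (num M i) \<in> D) \<and>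
      (\<forall>i<n. \<forall>j<n. (R1 (num M i) (num M j) \<longrightarrow> (Tr M S (f (num M i)) \<longleftrightarrow> Tr M S (f (num M j)))) \<and>
         (R2 (num M i) (num M j) \<longrightarrow> (Tr M S (f (num M i)) \<longleftrightarrow> \<not> Tr M S (f (num M j)))))"
  shows "\<exists>S. compositional Z S \<and> sound \<gamma> Z S \<and>
      (\<forall>i j. Sent M (f (num M i)) \<and> Sent M (f (num M j)) \<longrightarrow>
         (R1 (num M i) (num M j) \<longrightarrow> (Tr M S (f (num M i)) \<longleftrightarrow> Tr M S (f (num M j)))) \<and>
         (R2 (num M i) (num M j) \<longrightarrow> (Tr M S (f (num M i)) \<longleftrightarrow> \<not> Tr M S (f (num M j)))))"
proof -
  obtain t :: "nat \<Rightarrow> 'a" where t: "\<And>z N. \<exists>j\<ge>N. t j = z" using fair_enumeration[OF count] by blast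
  define A where "A s \<longleftrightarrow> coherent f R1 R2 (pfst s) (psnd s)" for s
  have R1': "pdf M (\<lambda>e. R1 (e 0) (e (Suc 0)))" and R2': "pdf M (\<lambda>e. R2 (e 0) (e (Suc 0)))" using R1 R2 by simp_all
  note [pdf_intros] = pdfun_app1[OF f] pdf_app2[OF R1'] pdf_app2[OF R2']
  have "\<exists>s. s 0 = pair M \<gamma> \<zero> \<and> (\<forall>j::nat. A (s j) \<and> response f (s j) (t j) (s (Suc j)))"
  proof (rule game_compactness[OF sat])
    show "pdf M (\<lambda>e. A (e 0))" unfolding A_def coherent_def decides_def by (intro pdf_intros)
    show "pdf M (\<lambda>e. response f (e 0) (e (Suc 0)) (e (Suc (Suc 0))))"
      unfolding response_def decides_def by (intro pdf_intros)
    fix n :: nat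
    obtain D S where S: "compositional D S" "sound \<gamma> D S" "\<And>i. i < n \<Longrightarrow> f (num M i) \<in> D"
      "\<And>i j. i < n \<Longrightarrow> j < n \<Longrightarrow> R1 (num M i) (num M j) \<Longrightarrow> (Tr M S (f (num M i)) \<longleftrightarrow> Tr M S (f (num M j)))"
      "\<And>i j. i < n \<Longrightarrow> j < n \<Longrightarrow> R2 (num M i) (num M j) \<Longrightarrow> (Tr M S (f (num M i)) \<longleftrightarrow> \<not> Tr M S (f (num M j)))"
      using approx[of n] by blast
    \<comment> \<open>The clock equals the number of rounds played, so in a game of length
      \<open>n\<close> only indices below \<open>n\<close> are asked, and these are covered by the
      approximation.\<close>
    define P where "P j s \<longleftrightarrow> (\<exists>\<Gamma>. s = pair M \<Gamma> (num M j) \<and> sound \<Gamma> D S)" for j s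
    have "P 0 (pair M \<gamma> \<zero>)" using S(2) num_0 unfolding P_def by metis
    moreover have "A s" if "j \<le> n" "P j s" for j s
    proof -
      from that(2) obtain \<Gamma> where \<Gamma>: "s = pair M \<Gamma> (num M j)" "sound \<Gamma> D S" unfolding P_def by blast
      have lt: "\<exists>m<n. i = num M m" if "i \<prec> num M j" for i
        using that \<open>j \<le> n\<close> less_num[of i j] by auto
      show ?thesis unfolding A_def \<Gamma>(1) pfst_pair psnd_pair
        by (rule sound_coherent[OF S(1) \<Gamma>(2)]) (use lt S(4,5) in blast)+
    qed
    moreover have "\<exists>s'. response f s t s' \<and> P (Suc j) s'" if "j < n" "P j s" for j s t
    proof -
      from that(2) obtain \<Gamma> where \<Gamma>: "s = pair M \<Gamma> (num M j)" "sound \<Gamma> D S" unfolding P_def by blast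
      have "f i \<in> D" if "i \<prec> num M j" for i
        using that \<open>j < n\<close> S(3) less_num[of i j] by auto
      from sound_response[OF S(1) \<Gamma>(2), where f = f, OF this] show ?thesis
        unfolding P_def \<Gamma>(1) num_Suc by blast
    qed
    ultimately show "\<exists>P. P 0 (pair M \<gamma> \<zero>) \<and> (\<forall>j\<le>n. \<forall>s. P j s \<longrightarrow> A s) \<and>
      (\<forall>j<n. \<forall>s t. P j s \<longrightarrow> (\<exists>s'. response f s t s' \<and> P (Suc j) s'))"
      by (intro exI[of _ P]) blast
  qed
  then obtain s where s: "s 0 = pair M \<gamma> \<zero>" "\<And>j. A (s j)" "\<And>j. response f (s j) (t j) (s (Suc j))" by blast
  define \<Gamma> where "\<Gamma> j = pfst (s j)" for j
  have k: "psnd (s j) = num M j" for j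
  proof (induction j)
    case (Suc j)
    then show ?case using s(3)[of j] by (simp add: response_def num_Suc)
  qed (simp add: s(1) num_0)
  have mono: "decides (\<Gamma> i) \<theta> \<alpha> b \<Longrightarrow> i \<le> j \<Longrightarrow> decides (\<Gamma> j) \<theta> \<alpha> b" for i j \<theta> \<alpha> b
  proof (induction j)
    case (Suc j)
    then show ?case using s(3)[of j] by (auto simp: response_def decides_def \<Gamma>_def le_Suc_eq)
  qed simp
  have coh: "coherent f R1 R2 (\<Gamma> j) (num M j)" for j using s(2)[of j] by (simp add: A_def \<Gamma>_def k)
  define G where "G \<theta> \<alpha> b \<longleftrightarrow> (\<exists>j. decides (\<Gamma> j) \<theta> \<alpha> b)" for \<theta> \<alpha> b
  have G2: "\<exists>j\<ge>N. decides (\<Gamma> j) \<theta> \<alpha> b \<and> decides (\<Gamma> j) \<theta>' \<alpha>' b'" if "G \<theta> \<alpha> b" "G \<theta>' \<alpha>' b'" for \<theta> \<alpha> b \<theta>' \<alpha>' b' N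
  proof -
    from that obtain i j where "decides (\<Gamma> i) \<theta> \<alpha> b" "decides (\<Gamma> j) \<theta>' \<alpha>' b'" unfolding G_def by blast
    then show ?thesis by (intro exI[of _ "N + i + j"]) (auto intro: mono)
  qed
  have G3: "\<exists>j. decides (\<Gamma> j) \<theta> \<alpha> b \<and> decides (\<Gamma> j) \<theta>' \<alpha>' b' \<and> decides (\<Gamma> j) \<theta>'' \<alpha>'' b''"
    if "G \<theta> \<alpha> b" "G \<theta>' \<alpha>' b'" "G \<theta>'' \<alpha>'' b''" for \<theta> \<alpha> b \<theta>' \<alpha>' b' \<theta>'' \<alpha>'' b''
  proof -
    from that(3) obtain i where "decides (\<Gamma> i) \<theta>'' \<alpha>'' b''" unfolding G_def by blast
    moreover from G2[OF that(1,2)] obtain j where "j \<ge> i" "decides (\<Gamma> j) \<theta> \<alpha> b" "decides (\<Gamma> j) \<theta>' \<alpha>' b'" by blast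
    ultimately show ?thesis using mono by blast
  qed
  have decided: "G \<theta> \<alpha> \<one> \<or> G \<theta> \<alpha> \<zero>" if \<theta>: "\<theta> \<in> Z" "Form M \<theta>" "Asn M \<alpha> \<theta>" for \<theta> \<alpha>
  proof -
    obtain n where n: "\<theta> = f (num M n)" using \<theta> Z by blast
    \<comment> \<open>Late enough for the clock to have passed \<open>n\<close>, so that the request
      must be answered.\<close>
    obtain j where j: "j \<ge> Suc n" "t j = pair M (num M n) \<alpha>" using t by blast
    have "decides (\<Gamma> (Suc j)) (f (num M n)) \<alpha> \<one> \<or> decides (\<Gamma> (Suc j)) (f (num M n)) \<alpha> \<zero>"
      using s(3)[of j] j \<theta> n unfolding response_def k \<Gamma>_def by simp
    then show ?thesis unfolding G_def n by blast
  qed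
  define S where "S = {(\<theta>, \<alpha>). G \<theta> \<alpha> \<one>}"
  have not_both: "\<not> (G \<theta> \<alpha> \<one> \<and> G \<theta> \<alpha> \<zero>)" for \<theta> \<alpha>
    using G2[of \<theta> \<alpha> \<one> \<theta> \<alpha> \<zero>] coherentD1[OF coh] by blast
  have S: "G \<theta> \<alpha> (if (\<theta>, \<alpha>) \<in> S then \<one> else \<zero>)" if "\<theta> \<in> Z" "Form M \<theta>" "Asn M \<alpha> \<theta>" for \<theta> \<alpha>
    using decided[OF that] by (auto simp: S_def)
  have "compositional Z S"
    unfolding compositional_def
  proof (intro allI impI, elim conjE)
    fix \<theta> \<alpha> assume \<theta>: "\<theta> \<in> Z" "Form M \<theta>" "Asn M \<alpha> \<theta>" and sub: "\<forall>\<phi>. subfm \<theta> \<phi> \<longrightarrow> \<phi> \<in> Z"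
    note G\<theta> = S[OF \<theta>]
    from \<theta>(2) show "(\<theta>, \<alpha>) \<in> S \<longleftrightarrow> clause S \<theta> \<alpha>"
    proof (cases rule: Form_cases)
      case (Eq u v)
      obtain j where "decides (\<Gamma> j) \<theta> \<alpha> (if (\<theta>, \<alpha>) \<in> S then \<one> else \<zero>)" using G\<theta> G_def by blast
      then show ?thesis using coherentD2[OF coh[of j], of \<theta>] Eq(1) by (auto split: if_splits)
    next
      case (Less u v)
      obtain j where "decides (\<Gamma> j) \<theta> \<alpha> (if (\<theta>, \<alpha>) \<in> S then \<one> else \<zero>)" using G\<theta> G_def by blast
      then show ?thesis using coherentD2[OF coh[of j], of \<theta>] Less(1) by (auto split: if_splits)
    next
      case (Neg \<psi>)
      then have "\<psi> \<in> Z" "Asn M \<alpha> \<psi>" using sub \<theta>(3) by auto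
      from S[OF this(1) Neg(2) this(2)] G\<theta>
      obtain j where "decides (\<Gamma> j) \<psi> \<alpha> (if (\<psi>, \<alpha>) \<in> S then \<one> else \<zero>)" "decides (\<Gamma> j) \<theta> \<alpha> (if (\<theta>, \<alpha>) \<in> S then \<one> else \<zero>)"
        using G2 by blast
      moreover have "\<not> (decides (\<Gamma> j) (cNeg M \<psi>) \<alpha> b \<and> decides (\<Gamma> j) \<psi> \<alpha> b)" for b
        using coherentD3[OF coh[of j]] by blast
      ultimately show ?thesis unfolding Neg(1) by (auto split: if_splits)
    next
      case (Or \<psi> \<chi>)
      have Z': "\<psi> \<in> Z" "\<chi> \<in> Z" using sub Or(1) by auto
      have as: "Asn M (restr M \<alpha> \<psi>) \<psi>" "Asn M (restr M \<alpha> \<chi>) \<chi>"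
        using Asn_restr[OF \<theta>(3)] Or(1) by auto
      from G3[OF G\<theta> S[OF Z'(1) Or(2) as(1)] S[OF Z'(2) Or(3) as(2)]]
      obtain j where "decides (\<Gamma> j) \<theta> \<alpha> (if (\<theta>, \<alpha>) \<in> S then \<one> else \<zero>)"
        "decides (\<Gamma> j) \<psi> (restr M \<alpha> \<psi>) (if (\<psi>, restr M \<alpha> \<psi>) \<in> S then \<one> else \<zero>)"
        "decides (\<Gamma> j) \<chi> (restr M \<alpha> \<chi>) (if (\<chi>, restr M \<alpha> \<chi>) \<in> S then \<one> else \<zero>)" by blast
      then have "(if (\<theta>, \<alpha>) \<in> S then \<one> else \<zero>) = \<one> \<longleftrightarrow>
          (if (\<psi>, restr M \<alpha> \<psi>) \<in> S then \<one> else \<zero>) = \<one> \<or> (if (\<chi>, restr M \<alpha> \<chi>) \<in> S then \<one> else \<zero>) = \<one>"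
        unfolding Or(1) by (intro coherentD4[OF coh[of j], of \<psi> \<chi>] conjI)
      then show ?thesis unfolding Or(1) clause_simps by (auto split: if_splits)
    next
      case (Ex x \<psi>)
      have \<psi>: "\<psi> \<in> Z" using sub Ex(1) by auto
      show ?thesis
      proof
        assume "(\<theta>, \<alpha>) \<in> S"
        then obtain i where i: "decides (\<Gamma> i) (cEx M x \<psi>) \<alpha> \<one>" unfolding S_def G_def Ex(1) by blast
        obtain n where n: "\<psi> = f (num M n)" using \<psi> Z by blast
        \<comment> \<open>Late enough for the existential decision to be recorded and for the clock
          to have passed the index of \<open>\<psi>\<close>.\<close>
        obtain j where j: "j \<ge> i + Suc n" "t j = pair M (num M n) (pair M x \<alpha>)" using t by blast
        have "decides (\<Gamma> j) (cEx M x \<psi>) \<alpha> \<one>" using mono[OF i] j(1) by simp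
        then obtain \<beta> where "Asn M \<beta> \<psi>" "variant x \<alpha> \<beta>" "decides (\<Gamma> (Suc j)) \<psi> \<beta> \<one>"
          using s(3)[of j] j n unfolding response_def k \<Gamma>_def by auto
        then show "clause S \<theta> \<alpha>" unfolding Ex(1) clause_simps S_def G_def by blast
      next
        assume "clause S \<theta> \<alpha>"
        then obtain \<beta> where \<beta>: "variant x \<alpha> \<beta>" "G \<psi> \<beta> \<one>" unfolding Ex(1) clause_simps S_def by blast
        show "(\<theta>, \<alpha>) \<in> S"
        proof (rule ccontr)
          assume "(\<theta>, \<alpha>) \<notin> S"
          then have "G \<theta> \<alpha> \<zero>" using G\<theta> by simp
          then obtain j where "decides (\<Gamma> j) \<theta> \<alpha> \<zero>" "decides (\<Gamma> j) \<psi> \<beta> \<one>" using G2[OF _ \<beta>(2)] by blast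
          then show False using coherentD5[OF coh[of j]] \<beta>(1) unfolding Ex(1) by blast
        qed
      qed
    qed
  qed
  moreover have "sound \<gamma> Z S"
    unfolding sound_def
  proof (intro allI impI)
    fix u assume u: "u \<epsilon> \<gamma>"
    \<comment> \<open>The decisions in \<open>\<gamma>\<close> precede the play; that they concern
      formulas of \<open>Z\<close> with proper assignments is read off any approximation.\<close>
    obtain D S' where D: "sound \<gamma> D S'" "D \<subseteq> Z" using approx[of 0] by blast
    then obtain \<theta> \<alpha> where \<theta>: "\<theta> \<in> Z" "Form M \<theta>" "Asn M \<alpha> \<theta>" "u = pair M (pair M \<theta> \<alpha>) (if (\<theta>, \<alpha>) \<in> S' then \<one> else \<zero>)"
      using u unfolding sound_def by blast
    have "decides (\<Gamma> 0) \<theta> \<alpha> (if (\<theta>, \<alpha>) \<in> S' then \<one> else \<zero>)"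
      using u \<theta>(4) by (simp add: decides_def \<Gamma>_def s(1))
    then have "G \<theta> \<alpha> (if (\<theta>, \<alpha>) \<in> S' then \<one> else \<zero>)" using G_def by blast
    then have "(\<theta>, \<alpha>) \<in> S' \<longleftrightarrow> (\<theta>, \<alpha>) \<in> S" using S[OF \<theta>(1-3)] not_both[of \<theta> \<alpha>] by (auto split: if_splits)
    then show "\<exists>\<theta> \<alpha>. \<theta> \<in> Z \<and> Form M \<theta> \<and> Asn M \<alpha> \<theta> \<and> u = pair M (pair M \<theta> \<alpha>) (if (\<theta>, \<alpha>) \<in> S then \<one> else \<zero>)"
      using \<theta> by auto
  qed
  moreover have "(R1 (num M i) (num M j) \<longrightarrow> (Tr M S (f (num M i)) \<longleftrightarrow> Tr M S (f (num M j)))) \<and>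
         (R2 (num M i) (num M j) \<longrightarrow> (Tr M S (f (num M i)) \<longleftrightarrow> \<not> Tr M S (f (num M j))))"
    if "Sent M (f (num M i))" "Sent M (f (num M j))" for i j
  proof -
    have "G (f (num M m)) \<zero> (if Tr M S (f (num M m)) then \<one> else \<zero>)" if "Sent M (f (num M m))" for m
      unfolding Tr_def by (rule S) (use that Asn_Sent Z in \<open>auto simp: Sent_def\<close>)
    from G2[OF this[OF that(1)] this[OF that(2)], of "Suc (i + j)"]
    obtain n where n: "n \<ge> Suc (i + j)" "decides (\<Gamma> n) (f (num M i)) \<zero> (if Tr M S (f (num M i)) then \<one> else \<zero>)"
      "decides (\<Gamma> n) (f (num M j)) \<zero> (if Tr M S (f (num M j)) then \<one> else \<zero>)" by blast
    have "num M i \<prec> num M n" "num M j \<prec> num M n" using n(1) by auto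
    then have "R1 (num M i) (num M j) \<Longrightarrow> (if Tr M S (f (num M i)) then \<one> else \<zero>) = (if Tr M S (f (num M j)) then \<one> else \<zero>)"
      "R2 (num M i) (num M j) \<Longrightarrow> (if Tr M S (f (num M i)) then \<one> else \<zero>) \<noteq> (if Tr M S (f (num M j)) then \<one> else \<zero>)"
      using coherentD6[OF coh[of n]] n(2,3) by blast+
    then show ?thesis by (auto split: if_splits)
  qed
  ultimately show ?thesis by blast
qed

section \<open>Union of a chain of finite approximations\<close>

lemma sound_zero: "sound \<zero> Z S"
  unfolding sound_def by simp

lemma sound_decide:
  assumes "sound \<gamma> Z S" "\<theta> \<in> Z" "Form M \<theta>" "Asn M \<alpha> \<theta>"
  obtains \<gamma>' where "sound \<gamma>' Z S" "\<And>z. z \<epsilon> \<gamma> \<Longrightarrow> z \<epsilon> \<gamma>'" "\<exists>b. decides \<gamma>' \<theta> \<alpha> b"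
  using sound_insert[OF assms] by metis

text \<open>Only the finitely many decisions coded in \<open>\<gamma>\<close> are passed on to the next stage.\<close>

lemma union_construction:
  assumes count: "countable (UNIV :: 'a set)"
    and init: "Good 0 Z0 S0"
    and comp: "\<And>i Z S. Good i Z S \<Longrightarrow> compositional Z S"
    and closed: "\<And>i Z S \<theta> \<phi>. Good i Z S \<Longrightarrow> \<theta> \<in> Z \<Longrightarrow> subfm \<theta> \<phi> \<Longrightarrow> \<phi> \<in> Z"
    and step: "\<And>i Z S \<gamma> \<phi>. Good i Z S \<Longrightarrow> sound \<gamma> Z S \<Longrightarrow> Form M \<phi> \<Longrightarrow>
      \<exists>Z' S'. Good (Suc i) Z' S' \<and> sound \<gamma> Z' S' \<and> \<phi> \<in> Z' \<and>
        (Q \<longrightarrow> (\<exists>\<delta> \<eta>. P i \<delta> \<eta> \<and> Sent M \<delta> \<and> Sent M \<eta> \<and> \<delta> \<in> Z' \<and> \<eta> \<in> Z' \<and> (Tr M S' \<delta> \<longleftrightarrow> \<not> Tr M S' \<eta>)))"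
  shows "\<exists>S. CS_minus M S \<and>
    (\<forall>\<delta> \<eta>. Sent M \<delta> \<and> Sent M \<eta> \<longrightarrow> (\<exists>i Z S'. Good i Z S' \<and> \<delta> \<in> Z \<and> \<eta> \<in> Z \<and>
       (Tr M S \<delta> \<longleftrightarrow> Tr M S' \<delta>) \<and> (Tr M S \<eta> \<longleftrightarrow> Tr M S' \<eta>))) \<and>
    (Q \<longrightarrow> (\<forall>i. \<exists>\<delta> \<eta>. P i \<delta> \<eta> \<and> Sent M \<delta> \<and> Sent M \<eta> \<and> (Tr M S \<delta> \<longleftrightarrow> \<not> Tr M S \<eta>)))"
proof -
  obtain t :: "nat \<Rightarrow> 'a" where t: "\<And>z N. \<exists>j\<ge>N. t j = z" using fair_enumeration[OF count] by blast
  define N :: "nat \<Rightarrow> 'a set \<times> ('a \<times> 'a) set \<times> 'a \<Rightarrow> 'a set \<times> ('a \<times> 'a) set \<times> 'a \<Rightarrow> bool"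
    where "N i = (\<lambda>(Z, S, \<gamma>) (Z', S', \<gamma>'). (\<forall>z. z \<epsilon> \<gamma> \<longrightarrow> z \<epsilon> \<gamma>') \<and>
     (\<forall>\<phi> \<alpha>. t i = pair M \<phi> \<alpha> \<and> Form M \<phi> \<and> Asn M \<alpha> \<phi> \<longrightarrow> (\<exists>b. decides \<gamma>' \<phi> \<alpha> b) \<and>
        (\<forall>x \<psi>. \<phi> = cEx M x \<psi> \<and> decides \<gamma>' \<phi> \<alpha> \<one> \<longrightarrow> (\<exists>\<beta>. Asn M \<beta> \<psi> \<and> variant x \<alpha> \<beta> \<and> decides \<gamma>' \<psi> \<beta> \<one>))) \<and>
     (Q \<longrightarrow> (\<exists>\<delta> \<eta> b c. P i \<delta> \<eta> \<and> Sent M \<delta> \<and> Sent M \<eta> \<and> decides \<gamma>' \<delta> \<zero> b \<and> decides \<gamma>' \<eta> \<zero> c \<and> b \<noteq> c)))"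
    for i
  have next_state: "\<exists>Z' S' \<gamma>'. (Good (Suc i) Z' S' \<and> sound \<gamma>' Z' S') \<and> N i (Z, S, \<gamma>) (Z', S', \<gamma>')"
    if G: "Good i Z S" "sound \<gamma> Z S" for i Z S \<gamma>
  proof -
    obtain \<phi> \<alpha> where ti: "t i = pair M \<phi> \<alpha>" using pair_surj by blast
    \<comment> \<open>A request that names no formula is replaced by 0 = 0, so that
      \<open>step\<close> applies in every case.\<close>
    define \<phi>' where "\<phi>' = (if Form M \<phi> then \<phi> else cEq M (cZero M) (cZero M))"
    have "Form M \<phi>'" by (simp add: \<phi>'_def)
    from step[OF G this] obtain Z' S' where G': "Good (Suc i) Z' S'" and s0: "sound \<gamma> Z' S'" and \<phi>': "\<phi>' \<in> Z'"
      and Q: "Q \<longrightarrow> (\<exists>\<delta> \<eta>. P i \<delta> \<eta> \<and> Sent M \<delta> \<and> Sent M \<eta> \<and> \<delta> \<in> Z' \<and> \<eta> \<in> Z' \<and> (Tr M S' \<delta> \<longleftrightarrow> \<not> Tr M S' \<eta>))"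
      by blast
    have c: "compositional Z' S'" using comp[OF G'] .
    obtain \<gamma>1 where \<gamma>1: "sound \<gamma>1 Z' S'" "\<And>z. z \<epsilon> \<gamma> \<Longrightarrow> z \<epsilon> \<gamma>1"
      "Form M \<phi> \<and> Asn M \<alpha> \<phi> \<Longrightarrow> \<exists>b. decides \<gamma>1 \<phi> \<alpha> b"
    proof (cases "Form M \<phi> \<and> Asn M \<alpha> \<phi>")
      case True
      then have "\<phi> \<in> Z'" using \<phi>' by (simp add: \<phi>'_def)
      from sound_decide[OF s0 this] True that show ?thesis by blast
    next
      case False
      show ?thesis by (rule that[OF s0]) (use False in simp_all)
    qed
    \<comment> \<open>The witness of a true existential formula is recorded too: later classes are
      bound only by recorded decisions and could otherwise lose it.\<close>
    obtain \<gamma>2 where \<gamma>2: "sound \<gamma>2 Z' S'" "\<And>z. z \<epsilon> \<gamma>1 \<Longrightarrow> z \<epsilon> \<gamma>2"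
      "\<And>x \<psi>. Form M \<phi> \<Longrightarrow> Asn M \<alpha> \<phi> \<Longrightarrow> \<phi> = cEx M x \<psi> \<Longrightarrow> (\<phi>, \<alpha>) \<in> S' \<Longrightarrow>
         \<exists>\<beta>. Asn M \<beta> \<psi> \<and> variant x \<alpha> \<beta> \<and> decides \<gamma>2 \<psi> \<beta> \<one>"
    proof (cases "\<exists>x \<psi>. Form M \<phi> \<and> Asn M \<alpha> \<phi> \<and> \<phi> = cEx M x \<psi> \<and> (\<phi>, \<alpha>) \<in> S'")
      case True
      then obtain x \<psi> where \<psi>: "Form M \<phi>" "Asn M \<alpha> \<phi>" "\<phi> = cEx M x \<psi>" "(\<phi>, \<alpha>) \<in> S'" by blast
      have Z': "\<phi> \<in> Z'" using \<phi>' \<psi>(1) by (simp add: \<phi>'_def)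
      have \<psi>Z: "\<psi> \<in> Z'" using closed[OF G' Z'] \<psi>(3) by simp
      have "clause S' \<phi> \<alpha>" using compositionalD[OF c Z' \<psi>(1,2)] \<psi>(3,4) \<psi>Z by simp
      then obtain \<beta> where \<beta>: "Asn M \<beta> \<psi>" "variant x \<alpha> \<beta>" "(\<psi>, \<beta>) \<in> S'" unfolding \<psi>(3) by auto
      have "Form M \<psi>" using \<psi> by simp
      from sound_insert[OF \<gamma>1(1) \<psi>Z this \<beta>(1)] obtain \<gamma>2 where
        "sound \<gamma>2 Z' S'" "\<And>z. z \<epsilon> \<gamma>1 \<Longrightarrow> z \<epsilon> \<gamma>2" "decides \<gamma>2 \<psi> \<beta> (if (\<psi>, \<beta>) \<in> S' then \<one> else \<zero>)" by blast
      then show ?thesis using \<beta> \<psi>(3) by (intro that[of \<gamma>2]) auto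
    next
      case False
      show ?thesis by (rule that[OF \<gamma>1(1)]) (use False in auto)
    qed
    \<comment> \<open>Recording both truth values makes the separation achieved at this stage
      survive into the union.\<close>
    obtain \<gamma>3 where \<gamma>3: "sound \<gamma>3 Z' S'" "\<And>z. z \<epsilon> \<gamma>2 \<Longrightarrow> z \<epsilon> \<gamma>3"
      "Q \<Longrightarrow> \<exists>\<delta> \<eta> b c. P i \<delta> \<eta> \<and> Sent M \<delta> \<and> Sent M \<eta> \<and> decides \<gamma>3 \<delta> \<zero> b \<and> decides \<gamma>3 \<eta> \<zero> c \<and> b \<noteq> c"
    proof (cases Q)
      case True
      then obtain \<delta> \<eta> where \<delta>: "P i \<delta> \<eta>" "Sent M \<delta>" "Sent M \<eta>" "\<delta> \<in> Z'" "\<eta> \<in> Z'" "Tr M S' \<delta> \<longleftrightarrow> \<not> Tr M S' \<eta>"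
        using Q by blast
      have FA: "Form M \<delta>" "Asn M \<zero> \<delta>" "Form M \<eta>" "Asn M \<zero> \<eta>" using \<delta>(2,3) Asn_Sent by (auto simp: Sent_def)
      obtain \<gamma>' where g': "sound \<gamma>' Z' S'" "\<And>z. z \<epsilon> \<gamma>2 \<Longrightarrow> z \<epsilon> \<gamma>'" "decides \<gamma>' \<delta> \<zero> (if (\<delta>, \<zero>) \<in> S' then \<one> else \<zero>)"
        using sound_insert[OF \<gamma>2(1) \<delta>(4) FA(1,2)] by blast
      obtain \<gamma>3 where g3: "sound \<gamma>3 Z' S'" "\<And>z. z \<epsilon> \<gamma>' \<Longrightarrow> z \<epsilon> \<gamma>3" "decides \<gamma>3 \<eta> \<zero> (if (\<eta>, \<zero>) \<in> S' then \<one> else \<zero>)"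
        using sound_insert[OF g'(1) \<delta>(5) FA(3,4)] by blast
      have "decides \<gamma>3 \<delta> \<zero> (if (\<delta>, \<zero>) \<in> S' then \<one> else \<zero>)" using g'(3) g3(2) by (simp add: decides_def)
      then have "\<exists>\<delta> \<eta> b c. P i \<delta> \<eta> \<and> Sent M \<delta> \<and> Sent M \<eta> \<and> decides \<gamma>3 \<delta> \<zero> b \<and> decides \<gamma>3 \<eta> \<zero> c \<and> b \<noteq> c"
        using \<delta>(1-3,6) g3(3) by (intro exI[of _ \<delta>] exI[of _ \<eta>] exI conjI) (assumption | auto simp: Tr_def)+
      with g3 g'(2) show ?thesis using that by blast
    next
      case False
      show ?thesis by (rule that[OF \<gamma>2(1)]) (use False in simp_all)
    qed
    have mono: "decides \<gamma>1 \<theta> \<beta> b \<Longrightarrow> decides \<gamma>3 \<theta> \<beta> b" "decides \<gamma>2 \<theta> \<beta> b \<Longrightarrow> decides \<gamma>3 \<theta> \<beta> b" for \<theta> \<beta> b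
      using \<gamma>2(2) \<gamma>3(2) by (auto simp: decides_def)
    have "N i (Z, S, \<gamma>) (Z', S', \<gamma>3)"
      unfolding N_def split_conv
    proof (intro conjI allI impI)
      show "z \<epsilon> \<gamma>3" if "z \<epsilon> \<gamma>" for z using that \<gamma>1(2) \<gamma>2(2) \<gamma>3(2) by blast
      fix \<phi>'' \<alpha>' assume a: "t i = pair M \<phi>'' \<alpha>' \<and> Form M \<phi>'' \<and> Asn M \<alpha>' \<phi>''"
      then have eq: "\<phi>'' = \<phi>" "\<alpha>' = \<alpha>" using ti by simp_all
      show "\<exists>b. decides \<gamma>3 \<phi>'' \<alpha>' b" using \<gamma>1(3) mono a eq by blast
      fix x \<psi> assume b: "\<phi>'' = cEx M x \<psi> \<and> decides \<gamma>3 \<phi>'' \<alpha>' \<one>"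
      then have "(\<phi>, \<alpha>) \<in> S'" using soundD(4)[OF \<gamma>3(1), of \<phi> \<alpha> \<one>] eq by (auto split: if_splits)
      then show "\<exists>\<beta>. Asn M \<beta> \<psi> \<and> variant x \<alpha>' \<beta> \<and> decides \<gamma>3 \<psi> \<beta> \<one>"
        using \<gamma>2(3)[of x \<psi>] a b eq mono(2) by blast
    next
      assume Q
      then show "\<exists>\<delta> \<eta> b c. P i \<delta> \<eta> \<and> Sent M \<delta> \<and> Sent M \<eta> \<and> decides \<gamma>3 \<delta> \<zero> b \<and> decides \<gamma>3 \<eta> \<zero> c \<and> b \<noteq> c"
        by (rule \<gamma>3(3))
    qed
    with G' \<gamma>3(1) show ?thesis by blast
  qed
  have "\<exists>s. \<forall>i. (case s i of (Z, S, \<gamma>) \<Rightarrow> Good i Z S \<and> sound \<gamma> Z S) \<and> N i (s i) (s (Suc i))"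
  proof (rule dependent_nat_choice)
    show "\<exists>s. case s of (Z, S, \<gamma>) \<Rightarrow> Good 0 Z S \<and> sound \<gamma> Z S"
      using init sound_zero by (intro exI[of _ "(Z0, S0, \<zero>)"]) simp
    fix s and i :: nat assume "case s of (Z, S, \<gamma>) \<Rightarrow> Good i Z S \<and> sound \<gamma> Z S"
    moreover obtain Z S \<gamma> where "s = (Z, S, \<gamma>)" by (cases s)
    ultimately show "\<exists>s'. (case s' of (Z, S, \<gamma>) \<Rightarrow> Good (Suc i) Z S \<and> sound \<gamma> Z S) \<and> N i s s'"
      using next_state[of i Z S \<gamma>] by auto
  qed
  then obtain s where s': "\<forall>i. (case s i of (Z, S, \<gamma>) \<Rightarrow> Good i Z S \<and> sound \<gamma> Z S) \<and> N i (s i) (s (Suc i))" by (rule exE)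
  note s = s'[THEN spec, THEN conjunct1] s'[THEN spec, THEN conjunct2]
  define Z S' \<gamma> where "Z i = fst (s i)" and "S' i = fst (snd (s i))" and "\<gamma> i = snd (snd (s i))" for i
  have si: "s i = (Z i, S' i, \<gamma> i)" for i by (simp add: Z_def S'_def \<gamma>_def)
  have Good: "Good i (Z i) (S' i)" and snd: "sound (\<gamma> i) (Z i) (S' i)" for i using s(1)[of i] by (simp_all add: si)
  have Ni: "N i (Z i, S' i, \<gamma> i) (Z (Suc i), S' (Suc i), \<gamma> (Suc i))" for i using s(2)[of i] by (simp add: si)
  have mono: "decides (\<gamma> i) \<theta> \<alpha> b \<Longrightarrow> i \<le> j \<Longrightarrow> decides (\<gamma> j) \<theta> \<alpha> b" for i j \<theta> \<alpha> b
  proof (induction j)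
    case (Suc j)
    then show ?case using Ni[of j] by (auto simp: N_def decides_def le_Suc_eq)
  qed simp
  define S where "S = {(\<theta>, \<alpha>). \<exists>i. decides (\<gamma> i) \<theta> \<alpha> \<one>}"
  \<comment> \<open>Classes of different stages may differ wherever nothing is recorded. Where stage
    i has recorded a decision, soundness of all later records forces the union to have the value of
    the i-th class.\<close>
  have agree: "(\<theta>, \<alpha>) \<in> S \<longleftrightarrow> (\<theta>, \<alpha>) \<in> S' i" if "decides (\<gamma> i) \<theta> \<alpha> b" for i \<theta> \<alpha> b
  proof
    assume "(\<theta>, \<alpha>) \<in> S"
    then obtain j where "decides (\<gamma> j) \<theta> \<alpha> \<one>" unfolding S_def by blast
    then have "decides (\<gamma> (i + j)) \<theta> \<alpha> \<one>" "decides (\<gamma> (i + j)) \<theta> \<alpha> b" using mono that by simp_all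
    then have "b = \<one>" using soundD(4)[OF snd] by metis
    then show "(\<theta>, \<alpha>) \<in> S' i" using soundD(4)[OF snd that] by (auto split: if_splits)
  next
    assume "(\<theta>, \<alpha>) \<in> S' i"
    then show "(\<theta>, \<alpha>) \<in> S" using soundD(4)[OF snd that] that unfolding S_def by auto
  qed
  have decided: "\<exists>i. \<forall>j\<ge>i. \<exists>b. decides (\<gamma> j) \<theta> \<alpha> b" if \<theta>: "Form M \<theta>" "Asn M \<alpha> \<theta>" for \<theta> \<alpha>
  proof -
    obtain j where "t j = pair M \<theta> \<alpha>" using t by blast
    then obtain b where "decides (\<gamma> (Suc j)) \<theta> \<alpha> b" using Ni[of j] \<theta> unfolding N_def by auto
    then show ?thesis using mono by (intro exI[of _ "Suc j"]) blast
  qed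
  have comp_S: "compositional UNIV S"
    unfolding compositional_def
  proof (intro allI impI, elim conjE)
    fix \<theta> \<alpha> assume \<theta>: "Form M \<theta>" "Asn M \<alpha> \<theta>"
    obtain i where i: "\<And>j. j \<ge> i \<Longrightarrow> \<exists>b. decides (\<gamma> j) \<theta> \<alpha> b" using decided[OF \<theta>] by blast
    \<comment> \<open>Each clause is borrowed from a single stage so late that
      \<open>\<theta>\<close> and the instances needed are decided there, and then transferred by
      \<open>agree\<close>.\<close>
    have cl: "(\<theta>, \<alpha>) \<in> S \<longleftrightarrow> clause (S' j) \<theta> \<alpha>" if "j \<ge> i" for j
    proof -
      obtain b where b: "decides (\<gamma> j) \<theta> \<alpha> b" using i \<open>j \<ge> i\<close> by blast
      have "\<theta> \<in> Z j" using soundD(1)[OF snd b] .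
      then show ?thesis
        using agree[OF b] compositionalD[OF comp[OF Good] _ \<theta>] closed[OF Good] by blast
    qed
    from \<theta>(1) show "(\<theta>, \<alpha>) \<in> S \<longleftrightarrow> clause S \<theta> \<alpha>"
    proof (cases rule: Form_cases)
      case (Eq u v)
      then show ?thesis using cl[of i] by simp
    next
      case (Less u v)
      then show ?thesis using cl[of i] by simp
    next
      case (Neg \<psi>)
      then have "Asn M \<alpha> \<psi>" using \<theta>(2) by simp
      then obtain j where j: "\<And>k. k \<ge> j \<Longrightarrow> \<exists>b. decides (\<gamma> k) \<psi> \<alpha> b" using decided Neg(2) by blast
      obtain b where "decides (\<gamma> (i + j)) \<psi> \<alpha> b" using j[of "i + j"] by auto
      from agree[OF this] show ?thesis using cl[of "i + j"] Neg(1) by simp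
    next
      case (Or \<psi> \<chi>)
      have as: "Asn M (restr M \<alpha> \<psi>) \<psi>" "Asn M (restr M \<alpha> \<chi>) \<chi>"
        using Asn_restr[OF \<theta>(2)] Or(1) by auto
      obtain j where j: "\<And>n. n \<ge> j \<Longrightarrow> \<exists>b. decides (\<gamma> n) \<psi> (restr M \<alpha> \<psi>) b" using decided[OF Or(2) as(1)] by blast
      obtain k where k: "\<And>n. n \<ge> k \<Longrightarrow> \<exists>b. decides (\<gamma> n) \<chi> (restr M \<alpha> \<chi>) b" using decided[OF Or(3) as(2)] by blast
      obtain b c where "decides (\<gamma> (i + j + k)) \<psi> (restr M \<alpha> \<psi>) b" "decides (\<gamma> (i + j + k)) \<chi> (restr M \<alpha> \<chi>) c"
        using j[of "i + j + k"] k[of "i + j + k"] by auto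
      from agree[OF this(1)] agree[OF this(2)] show ?thesis using cl[of "i + j + k"] Or(1) by simp
    next
      case (Ex x \<psi>)
      show ?thesis
      proof
        assume "(\<theta>, \<alpha>) \<in> S"
        then obtain m where m: "decides (\<gamma> m) \<theta> \<alpha> \<one>" unfolding S_def by blast
        obtain j where j: "j \<ge> m" "t j = pair M \<theta> \<alpha>" using t by blast
        then have "decides (\<gamma> (Suc j)) \<theta> \<alpha> \<one>" using mono[OF m] by simp
        then obtain \<beta> where "Asn M \<beta> \<psi>" "variant x \<alpha> \<beta>" "decides (\<gamma> (Suc j)) \<psi> \<beta> \<one>"
          using Ni[of j] j \<theta> Ex(1) unfolding N_def by auto
        then show "clause S \<theta> \<alpha>" unfolding Ex(1) clause_simps S_def by blast
      next
        assume "clause S \<theta> \<alpha>"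
        then obtain \<beta> m where \<beta>: "Asn M \<beta> \<psi>" "variant x \<alpha> \<beta>" "decides (\<gamma> m) \<psi> \<beta> \<one>"
          unfolding Ex(1) clause_simps S_def by blast
        have "decides (\<gamma> (i + m)) \<psi> \<beta> \<one>" using mono[OF \<beta>(3)] by simp
        then have "(\<psi>, \<beta>) \<in> S' (i + m)" using agree \<beta>(3) unfolding S_def by blast
        then show "(\<theta>, \<alpha>) \<in> S" using cl[of "i + m"] \<beta>(1,2) Ex(1) by auto
      qed
    qed
  qed
  have "CS_minus M S"
  proof (rule CS_minusI[OF _ comp_S])
    fix \<phi> \<alpha> assume "(\<phi>, \<alpha>) \<in> S"
    then obtain i where "decides (\<gamma> i) \<phi> \<alpha> \<one>" unfolding S_def by blast
    from soundD(2,3)[OF snd this] show "Form M \<phi> \<and> Asn M \<alpha> \<phi>" by blast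
  qed
  moreover have "\<exists>i Z S'. Good i Z S' \<and> \<delta> \<in> Z \<and> \<eta> \<in> Z \<and>
       (Tr M S \<delta> \<longleftrightarrow> Tr M S' \<delta>) \<and> (Tr M S \<eta> \<longleftrightarrow> Tr M S' \<eta>)" if "Sent M \<delta>" "Sent M \<eta>" for \<delta> \<eta>
  proof -
    have "Form M \<delta>" "Asn M \<zero> \<delta>" "Form M \<eta>" "Asn M \<zero> \<eta>" using that Asn_Sent by (auto simp: Sent_def)
    then obtain i j where i: "\<And>n. n \<ge> i \<Longrightarrow> \<exists>b. decides (\<gamma> n) \<delta> \<zero> b" and j: "\<And>n. n \<ge> j \<Longrightarrow> \<exists>b. decides (\<gamma> n) \<eta> \<zero> b"
      using decided by meson
    obtain b c where bc: "decides (\<gamma> (i + j)) \<delta> \<zero> b" "decides (\<gamma> (i + j)) \<eta> \<zero> c" using i[of "i + j"] j[of "i + j"] by auto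
    show ?thesis
      using Good[of "i + j"] soundD(1)[OF snd bc(1)] soundD(1)[OF snd bc(2)] agree[OF bc(1)] agree[OF bc(2)]
      unfolding Tr_def by blast
  qed
  moreover have "\<exists>\<delta> \<eta>. P i \<delta> \<eta> \<and> Sent M \<delta> \<and> Sent M \<eta> \<and> (Tr M S \<delta> \<longleftrightarrow> \<not> Tr M S \<eta>)" if Q for i
  proof -
    obtain \<delta> \<eta> b c where d: "P i \<delta> \<eta>" "Sent M \<delta>" "Sent M \<eta>" "decides (\<gamma> (Suc i)) \<delta> \<zero> b" "decides (\<gamma> (Suc i)) \<eta> \<zero> c" "b \<noteq> c"
      using Ni[of i] \<open>Q\<close> unfolding N_def by auto
    have "Tr M S \<delta> \<longleftrightarrow> \<not> Tr M S \<eta>"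
      using agree[OF d(4)] agree[OF d(5)] soundD(4)[OF snd d(4)] soundD(4)[OF snd d(5)] d(6)
      unfolding Tr_def by (auto split: if_splits)
    with d show ?thesis by blast
  qed
  ultimately show ?thesis by blast
qed

end

text \<open>A countdown game: the first round announces a number and every later round must lower it
  by one. A game of n rounds is survived by announcing n - 1, and an infinite play forces a number
  that is at least every standard one.\<close>

lemma (in PA) nonstandard_exists:
  assumes "rec_saturated M" obtains N where "\<And>n. num M n \<prec> N"
proof -
  define R where "R s s' \<longleftrightarrow> pfst s' = \<one> \<and> (pfst s = \<one> \<longrightarrow> psnd s = psnd s' \<oplus> \<one>)" for s s'
  have "\<exists>s. s 0 = pair M \<zero> \<zero> \<and> (\<forall>j::nat. True \<and> R (s j) (s (Suc j)))"
  proof (rule game_compactness[OF assms])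
    show "pdf M (\<lambda>e. True)" by (rule pdf_const)
    show "pdf M (\<lambda>e. R (e 0) (e (Suc (Suc 0))))" unfolding R_def by (intro pdf_intros)
    fix n :: nat
    define P where "P j s \<longleftrightarrow> s = (if j = 0 then pair M \<zero> \<zero> else pair M \<one> (num M (n - j)))" for j s
    have "\<exists>s'. R s s' \<and> P (Suc j) s'" if "j < n" "P j s" for j s
    proof (intro exI conjI)
      have "num M (n - j) = num M (n - Suc j) \<oplus> \<one>" using that(1) by (simp flip: num_Suc add: Suc_diff_Suc)
      then show "R s (pair M \<one> (num M (n - Suc j)))" using that by (auto simp: R_def P_def)
      show "P (Suc j) (pair M \<one> (num M (n - Suc j)))" by (simp add: P_def)
    qed
    then show "\<exists>P. P 0 (pair M \<zero> \<zero>) \<and> (\<forall>j\<le>n. \<forall>s. P j s \<longrightarrow> True) \<and>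
      (\<forall>j<n. \<forall>s t. P j s \<longrightarrow> (\<exists>s'. R s s' \<and> P (Suc j) s'))"
      by (intro exI[of _ P]) (auto simp: P_def)
  qed
  then obtain s where s: "s 0 = pair M \<zero> \<zero>" "\<And>j. R (s j) (s (Suc j))" by blast
  have "psnd (s (Suc 0)) = psnd (s (Suc n)) \<oplus> num M n" for n
  proof (induction n)
    case (Suc n)
    have "psnd (s (Suc n)) = psnd (s (Suc (Suc n))) \<oplus> \<one>"
      using s(2)[of n] s(2)[of "Suc n"] by (simp add: R_def)
    with Suc show ?case by (simp add: num_Suc add_assoc add_comm[of "num M n"])
  qed (simp add: num_0)
  then have "num M n \<preceq> psnd (s (Suc 0))" for n by (metis le_add2)
  then show ?thesis using that less_succ by blast
qed

context PA_template
begin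

section \<open>Extending a class to the parts of a larger formula\<close>

lemma parts_closed_subfm: "parts_closed Z \<Longrightarrow> \<theta> \<in> Z \<Longrightarrow> subfm \<theta> \<phi> \<Longrightarrow> \<phi> \<in> Z"
  unfolding parts_closed_def part_def by blast

lemma parts_closed_F: "parts_closed Z \<Longrightarrow> Base \<phi> \<Longrightarrow> F y \<phi> \<in> Z \<Longrightarrow> \<phi> \<in> Z"
  using chain_F[of \<phi> y] unfolding parts_closed_def part_def by (cases "y = \<zero>") auto

lemma obeys_F:
  assumes "admissible g" "obeys D S g" "Base \<phi>" "\<phi> \<in> D" "F y \<phi> \<in> D"
  shows "Tr M S (F y \<phi>) \<longleftrightarrow> g \<phi> y (Tr M S \<phi>)"
proof (cases "y = \<zero>")
  case True
  then show ?thesis using assms(1) unfolding admissible_def by simp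
next
  case False
  then show ?thesis using obeysD[OF assms(2) chain_F[OF assms(3) False] assms(5,4)] by simp
qed

text \<open>The rule \<open>g\<close> is external and cannot enter a type. What saturation carries
  over are the relations \<open>K1\<close> (equal values) and \<open>K2\<close> (opposite values),
  which only have to be definable at the standard indices of an enumeration. Hypothesis
  \<open>K\<close> derives them from obedience to \<open>g\<close> once the auxiliary sentences in
  \<open>E\<close> are present.\<close>

lemma extension:
  assumes count: "countable (UNIV :: 'a set)" and sat: "rec_saturated M"
    and Z: "parts_closed Z" "Z \<subseteq> parts x" and S: "compositional Z S" "obeys Z S g" "sound \<gamma> Z S"
    and g: "admissible g" and E: "finite E" "E \<subseteq> parts x"
    and index: "\<And>f. pdfun M (\<lambda>e. f (e 0)) \<Longrightarrow> (\<And>n. \<exists>s. \<forall>i. i \<prec> n \<longrightarrow> s !! i = f i) \<Longrightarrow>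
       \<exists>R1 R2. pdf M (\<lambda>e. R1 (e 0) (e 1)) \<and> pdf M (\<lambda>e. R2 (e 0) (e 1)) \<and>
        (\<forall>i j. (R1 (num M i) (num M j) \<longleftrightarrow> K1 (f (num M i)) (f (num M j))) \<and>
               (R2 (num M i) (num M j) \<longleftrightarrow> K2 (f (num M i)) (f (num M j))))"
    and K: "\<And>D S' \<theta> \<psi>. compositional D S' \<Longrightarrow> obeys D S' g \<Longrightarrow> E \<subseteq> D \<Longrightarrow>
       (\<And>\<phi> y. additive \<Phi> \<Longrightarrow> Base \<phi> \<Longrightarrow> F y \<phi> \<in> D \<Longrightarrow> \<phi> \<in> D) \<Longrightarrow> \<theta> \<in> D \<Longrightarrow> \<psi> \<in> D \<Longrightarrow>
       (K1 \<theta> \<psi> \<longrightarrow> (Tr M S' \<theta> \<longleftrightarrow> Tr M S' \<psi>)) \<and> (K2 \<theta> \<psi> \<longrightarrow> (Tr M S' \<theta> \<longleftrightarrow> \<not> Tr M S' \<psi>))"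
  shows "\<exists>S'. compositional (parts x) S' \<and> sound \<gamma> (parts x) S' \<and>
    (\<forall>\<theta>\<in>parts x. \<forall>\<psi>\<in>parts x. Sent M \<theta> \<and> Sent M \<psi> \<longrightarrow>
       (K1 \<theta> \<psi> \<longrightarrow> (Tr M S' \<theta> \<longleftrightarrow> Tr M S' \<psi>)) \<and> (K2 \<theta> \<psi> \<longrightarrow> (Tr M S' \<theta> \<longleftrightarrow> \<not> Tr M S' \<psi>)))"
proof -
  obtain f where f: "pdfun M (\<lambda>e. f (e 0))" "parts x = range (\<lambda>n. f (num M n))"
    "\<And>n. \<exists>s. \<forall>i. i \<prec> n \<longrightarrow> s !! i = f i" using parts_enumeration[of x] by blast
  from index[OF f(1,3)] obtain R1 R2 where R: "pdf M (\<lambda>e. R1 (e 0) (e 1))" "pdf M (\<lambda>e. R2 (e 0) (e 1))"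
    "\<And>i j. R1 (num M i) (num M j) \<longleftrightarrow> K1 (f (num M i)) (f (num M j))"
    "\<And>i j. R2 (num M i) (num M j) \<longleftrightarrow> K2 (f (num M i)) (f (num M j))" by blast
  have "\<exists>D S'. compositional D S' \<and> sound \<gamma> D S' \<and> D \<subseteq> parts x \<and> (\<forall>i<n. f (num M i) \<in> D) \<and>
      (\<forall>i<n. \<forall>j<n. (R1 (num M i) (num M j) \<longrightarrow> (Tr M S' (f (num M i)) \<longleftrightarrow> Tr M S' (f (num M j)))) \<and>
         (R2 (num M i) (num M j) \<longrightarrow> (Tr M S' (f (num M i)) \<longleftrightarrow> \<not> Tr M S' (f (num M j)))))" for n
  proof -
    define Y0 where "Y0 = (\<lambda>i. f (num M i)) ` {..<n} \<union> E"
    \<comment> \<open>\<open>obeys\<close> says something about a formula only if its base is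
      present. One round of adding bases suffices: with an additive operator a base is never a
      positive iterate of another base.\<close>
    define B where "B = {\<phi>. \<exists>\<theta>\<in>Y0. \<exists>y s. chain \<theta> \<phi> y s}"
    have Y0: "finite Y0" "Y0 \<subseteq> parts x" using E f(2) by (auto simp: Y0_def)
    have "B \<subseteq> (\<lambda>\<theta>. THE \<phi>. \<exists>y s. chain \<theta> \<phi> y s) ` Y0"
    proof
      fix \<phi> assume "\<phi> \<in> B"
      then obtain \<theta> y s where \<theta>: "\<theta> \<in> Y0" "chain \<theta> \<phi> y s" unfolding B_def by blast
      have "(THE \<phi>. \<exists>y s. chain \<theta> \<phi> y s) = \<phi>" by (rule the_equality) (use \<theta> chain_unique in blast)+
      then show "\<phi> \<in> (\<lambda>\<theta>. THE \<phi>. \<exists>y s. chain \<theta> \<phi> y s) ` Y0" using \<theta>(1) by blast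
    qed
    then have "finite B" using Y0(1) finite_surj by blast
    have B: "B \<subseteq> parts x"
      using Y0(2) parts_closed_parts[of x] unfolding B_def parts_closed_def part_def by blast
    have "finite (Y0 \<union> B)" using Y0(1) \<open>finite B\<close> by simp
    from finite_extension[OF Z(1) S(1,2) g this] obtain S' where S': "\<forall>\<theta>\<in>Z. \<forall>\<alpha>. (\<theta>, \<alpha>) \<in> S' \<longleftrightarrow> (\<theta>, \<alpha>) \<in> S"
      "compositional (Z \<union> (Y0 \<union> B)) S'" "obeys (Z \<union> (Y0 \<union> B)) S' g" by blast
    define D where "D = Z \<union> (Y0 \<union> B)"
    have base: "\<phi> \<in> D" if "additive \<Phi>" "Base \<phi>" "F y \<phi> \<in> D" for \<phi> y
    proof (cases rule: cases0[of y])
      case 1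
      then show ?thesis using that by simp
    next
      case (2 z)
      have c: "chain (F y \<phi>) \<phi> y True" by (rule chain_F[OF that(2)]) (simp add: 2 succ_neq_zero)
      from that(3) consider "F y \<phi> \<in> Z" | "F y \<phi> \<in> Y0" | "F y \<phi> \<in> B" unfolding D_def by blast
      then show ?thesis
      proof cases
        case 1
        then show ?thesis using parts_closed_F[OF Z(1) that(2)] D_def by blast
      next
        case 2
        then show ?thesis using c unfolding D_def B_def by blast
      next
        case 3
        then have "Base (F y \<phi>)" unfolding B_def chain_def by blast
        then show ?thesis using Base_F_neq[OF that(1) _ that(2)] 2 by blast
      qed
    qed
    have fD: "f (num M i) \<in> D" if "i < n" for i using that unfolding D_def Y0_def by blast
    have "E \<subseteq> D" unfolding D_def Y0_def by blast
    note KD = K[OF S'(2,3)[folded D_def] this base]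
    have "sound \<gamma> D S'"
      unfolding sound_def
    proof (intro allI impI)
      fix u assume "u \<epsilon> \<gamma>"
      then obtain \<theta> \<alpha> where \<theta>: "\<theta> \<in> Z" "Form M \<theta>" "Asn M \<alpha> \<theta>" "u = pair M (pair M \<theta> \<alpha>) (if (\<theta>, \<alpha>) \<in> S then \<one> else \<zero>)"
        using S(3) unfolding sound_def by blast
      then have "u = pair M (pair M \<theta> \<alpha>) (if (\<theta>, \<alpha>) \<in> S' then \<one> else \<zero>)" using S'(1) by auto
      then show "\<exists>\<theta> \<alpha>. \<theta> \<in> D \<and> Form M \<theta> \<and> Asn M \<alpha> \<theta> \<and> u = pair M (pair M \<theta> \<alpha>) (if (\<theta>, \<alpha>) \<in> S' then \<one> else \<zero>)"
        using \<theta>(1-3) unfolding D_def by blast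
    qed
    moreover have "D \<subseteq> parts x" using Z(2) Y0(2) B unfolding D_def by blast
    ultimately show ?thesis
      using S'(2)[folded D_def] fD by (intro exI[of _ D] exI[of _ S'] conjI) (simp_all add: R(3,4) KD)
  qed
  from partial_satisfaction_compactness[OF count sat f(1) R(1,2) f(2) this]
  obtain S' where S': "compositional (parts x) S'" "sound \<gamma> (parts x) S'"
    "\<And>i j. Sent M (f (num M i)) \<Longrightarrow> Sent M (f (num M j)) \<Longrightarrow>
         (R1 (num M i) (num M j) \<longrightarrow> (Tr M S' (f (num M i)) \<longleftrightarrow> Tr M S' (f (num M j)))) \<and>
         (R2 (num M i) (num M j) \<longrightarrow> (Tr M S' (f (num M i)) \<longleftrightarrow> \<not> Tr M S' (f (num M j))))" by blast
  show ?thesis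
  proof (intro exI[of _ S'] conjI ballI impI S'(1,2))
    fix \<theta> \<psi> assume "\<theta> \<in> parts x" "\<psi> \<in> parts x" and Se: "Sent M \<theta> \<and> Sent M \<psi>"
    then obtain i j where "\<theta> = f (num M i)" "\<psi> = f (num M j)" using f(2) by blast
    then show "K1 \<theta> \<psi> \<Longrightarrow> Tr M S' \<theta> \<longleftrightarrow> Tr M S' \<psi>" "K2 \<theta> \<psi> \<Longrightarrow> Tr M S' \<theta> \<longleftrightarrow> \<not> Tr M S' \<psi>"
      using S'(3)[of i j] R(3,4) Se by auto
  qed
qed

section \<open>A base with a known truth value\<close>

definition truth0 where "truth0 = cEq M (cZero M) (cZero M)"

lemma Sent_truth0: "Sent M truth0"
  unfolding Sent_def truth0_def by simp

lemma Tr_truth0: assumes "compositional D S" "truth0 \<in> D" shows "Tr M S truth0"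
proof -
  have "val_rel (cZero M) \<zero> \<zero>" by (subst val_rel_unfold) simp
  then have "atomic_true truth0 \<zero>" unfolding atomic_true_def truth0_def by blast
  moreover have "Form M truth0" "Asn M \<zero> truth0" using Sent_truth0 Asn_Sent by (simp_all add: Sent_def)
  ultimately show ?thesis
    using compositionalD[OF assms] unfolding Tr_def truth0_def by simp
qed

text \<open>A base on which iterates can be made to differ must have the truth value
  \<open>t\<close> of \<open>teval_flip\<close> in every class. Hence it is 0 = 0 or its negation,
  and \<open>truth0\<close> is among its parts so that the value can be computed there.\<close>

lemma special_base:
  obtains \<phi> t where "Base \<phi>" "teval \<Phi> t (\<not> t) \<longleftrightarrow> \<not> t" "truth0 \<in> parts \<phi>"
    "\<And>D S. compositional D S \<Longrightarrow> truth0 \<in> D \<Longrightarrow> \<phi> \<in> D \<Longrightarrow> Tr M S \<phi> \<longleftrightarrow> t"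
proof (cases "teval \<Phi> True False")
  case False
  have "Base truth0" unfolding Base_def using Sent_truth0 step_neq_cEq unfolding truth0_def by metis
  then show ?thesis using that[of truth0 True] False Tr_truth0 parts_self by simp
next
  case True
  then have acc: "accessible \<Phi>" using teval_additive[of True False] by blast
  obtain t where t: "teval \<Phi> t (\<not> t) \<longleftrightarrow> \<not> t" using teval_flip by blast
  with True have "t = False" by (cases t) auto
  have "Base (cNeg M truth0)" unfolding Base_def using acc Sent_truth0 by simp
  moreover have "truth0 \<in> parts (cNeg M truth0)"
    using parts_closed_subfm[OF parts_closed_parts parts_self] by simp
  ultimately show ?thesis
    using that[of "cNeg M truth0" False] t \<open>t = False\<close> Tr_cNeg[OF _ Sent_truth0] Tr_truth0 by simp
qed

lemma parts_cOr: "parts \<phi> \<subseteq> parts (cOr M \<phi> \<psi>)" "parts \<psi> \<subseteq> parts (cOr M \<phi> \<psi>)"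
  by (rule parts_least[OF parts_closed_parts],
      use parts_closed_subfm[OF parts_closed_parts parts_self, of "cOr M \<phi> \<psi>"] in simp)+

lemma Tr_step:
  assumes Z: "parts_closed Z" and S: "compositional Z S" and \<phi>: "Sent M \<phi>" "Sent M \<psi>" "step \<phi> \<psi> \<in> Z"
  shows "Tr M S (step \<phi> \<psi>) \<longleftrightarrow> teval \<Phi> (Tr M S \<phi>) (Tr M S \<psi>)" "\<psi> \<in> Z"
proof -
  note sub = parts_closed_subfm[OF Z]
  have or: "Tr M S (cOr M \<chi> \<xi>) \<longleftrightarrow> Tr M S \<chi> \<or> Tr M S \<xi>" "\<chi> \<in> Z" "\<xi> \<in> Z"
    if "cOr M \<chi> \<xi> \<in> Z" "Sent M \<chi>" "Sent M \<xi>" for \<chi> \<xi>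
    using Tr_cOr[OF S that(2,3,1)] sub[OF that(1)] by simp_all
  have neg: "Tr M S (cNeg M \<chi>) \<longleftrightarrow> \<not> Tr M S \<chi>" "\<chi> \<in> Z" if "cNeg M \<chi> \<in> Z" "Sent M \<chi>" for \<chi>
    using Tr_cNeg[OF S that(2,1)] sub[OF that(1)] by simp_all
  have ex: "Tr M S (cEx M y \<chi>) \<longleftrightarrow> Tr M S \<chi>" "\<chi> \<in> Z" if "cEx M y \<chi> \<in> Z" "Sent M \<chi>" for y \<chi>
    using Tr_cEx[OF S that(2,1)] sub[OF that(1)] by simp_all
  have "(Tr M S (step \<phi> \<psi>) \<longleftrightarrow> teval \<Phi> (Tr M S \<phi>) (Tr M S \<psi>)) \<and> \<psi> \<in> Z"
  proof (cases rule: template_cases)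
    case (Or a b)
    define A B where "A = tsubst M a \<phi> \<psi>" and "B = tsubst M b \<phi> \<psi>"
    have AB: "Sent M A" "Sent M B" using Or(2,3) \<phi> by (auto simp: A_def B_def)
    have st: "cOr M A B \<in> Z" "step \<phi> \<psi> = cOr M A B" using Or(1) \<phi>(3) by (simp_all add: A_def B_def)
    show ?thesis using or[OF st(1) AB] st(2) Or unfolding A_def B_def by auto
  next
    case (And a b)
    define A B where "A = tsubst M a \<phi> \<psi>" and "B = tsubst M b \<phi> \<psi>"
    have AB: "Sent M A" "Sent M B" using And(2,3) \<phi> by (auto simp: A_def B_def)
    have st: "step \<phi> \<psi> = cNeg M (cOr M (cNeg M A) (cNeg M B))" using And(1) by (simp add: step_defs A_def B_def)
    have 1: "cOr M (cNeg M A) (cNeg M B) \<in> Z" using neg(2) st \<phi>(3) AB by simp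
    have 2: "cNeg M A \<in> Z" "cNeg M B \<in> Z" using or(2,3)[OF 1] AB by simp_all
    have "Tr M S (step \<phi> \<psi>) \<longleftrightarrow> Tr M S A \<and> Tr M S B"
      using st \<phi>(3) neg(1) or(1)[OF 1] 1 2 AB by simp
    moreover have "A \<in> Z" "B \<in> Z" using 2 neg(2) AB by blast+
    ultimately show ?thesis using And unfolding A_def B_def by auto
  next
    case (Ex n)
    then show ?thesis using ex \<phi> by auto
  next
    case (All n)
    have st: "step \<phi> \<psi> = cNeg M (cEx M (num M n) (cNeg M \<psi>))" using All by (simp add: step_defs)
    have 1: "cEx M (num M n) (cNeg M \<psi>) \<in> Z" using neg(2) st \<phi>(2,3) Sent_cEx by simp
    have 2: "cNeg M \<psi> \<in> Z" using ex(2)[OF 1] \<phi> by simp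
    show ?thesis using st \<phi> neg ex(1)[OF 1] 1 2 Sent_cEx All by auto
  qed
  then show "Tr M S (step \<phi> \<psi>) \<longleftrightarrow> teval \<Phi> (Tr M S \<phi>) (Tr M S \<psi>)" "\<psi> \<in> Z" by blast+
qed

lemma cut_zero: "is_cut M I \<Longrightarrow> \<zero> \<in> I"
  unfolding is_cut_def using pos_iff by blast

lemma cut_le: "is_cut M I \<Longrightarrow> x \<in> I \<Longrightarrow> y \<preceq> x \<Longrightarrow> y \<in> I"
  unfolding is_cut_def le_def by blast

lemma cut_succ: "is_cut M I \<Longrightarrow> y \<oplus> \<one> \<in> I \<longleftrightarrow> y \<in> I"
  using cut_le[of I "y \<oplus> \<one>" y] less_imp_le[OF less_self_succ] unfolding is_cut_def by blast

lemma not_in_cut: "is_cut M I \<Longrightarrow> x \<notin> I \<longleftrightarrow> above M x I"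
  unfolding above_def using cut_le not_less less_irrefl by blast

section \<open>Separable cuts\<close>

lemma separable_case:
  assumes count: "countable (UNIV :: 'a set)" and sat: "rec_saturated M"
    and I: "is_cut M I" and closed: "F_closed M \<Phi> I" and sep: "separable M I"
  shows "\<exists>S. CS_minus M S \<and>
    I = {x. \<forall>y. y \<preceq> x \<longrightarrow> (\<forall>\<phi>. Sent M \<phi> \<longrightarrow> (Tr M S \<phi> \<longleftrightarrow> Tr M S (F y \<phi>)))}"
proof -
  obtain \<phi>0 t0 where \<phi>0: "Base \<phi>0" and t0: "teval \<Phi> t0 (\<not> t0) \<longleftrightarrow> \<not> t0" and tr0: "truth0 \<in> parts \<phi>0"
    and Tr0: "\<And>D S. compositional D S \<Longrightarrow> truth0 \<in> D \<Longrightarrow> \<phi>0 \<in> D \<Longrightarrow> Tr M S \<phi>0 \<longleftrightarrow> t0"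
    using special_base by blast
  define flip where "flip \<phi> y \<longleftrightarrow> \<phi> = \<phi>0 \<and> y \<notin> I" for \<phi> y
  \<comment> \<open>The guard \<open>t = t0\<close> keeps the rule admissible, since for the other
    truth value the template may forbid a change. In every class that contains \<open>truth0\<close>
    and \<open>\<phi>0\<close>, the value of \<open>\<phi>0\<close> is \<open>t0\<close>.\<close>
  define g where "g \<phi> y t = (if flip \<phi> y \<and> t = t0 then \<not> t else t)" for \<phi> y t
  define K1 where "K1 \<theta> \<psi> \<longleftrightarrow> Base \<psi> \<and> (\<exists>y. \<theta> = F y \<psi> \<and> \<not> flip \<psi> y)" for \<theta> \<psi>
  define K2 where "K2 \<theta> \<psi> \<longleftrightarrow> Base \<psi> \<and> (\<exists>y. \<theta> = F y \<psi> \<and> flip \<psi> y)" for \<theta> \<psi>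
  define rel where "rel Z S \<longleftrightarrow> (\<forall>\<phi> y. Base \<phi> \<and> \<phi> \<in> Z \<and> F y \<phi> \<in> Z \<longrightarrow>
    (Tr M S (F y \<phi>) \<longleftrightarrow> (Tr M S \<phi> \<longleftrightarrow> \<not> flip \<phi> y)))" for Z S
  have g: "admissible g"
    unfolding admissible_def
  proof (intro allI conjI)
    fix \<phi> y t
    show "g \<phi> \<zero> t = t" using cut_zero[OF I] by (simp add: g_def flip_def)
    show "g \<phi> (y \<oplus> \<one>) t = g \<phi> y t" using cut_succ[OF I] by (simp add: g_def flip_def)
    show "teval \<Phi> t (g \<phi> y t) = g \<phi> y t" using teval_same t0 by (auto simp: g_def)
  qed
  have index: "\<exists>R1 R2. pdf M (\<lambda>e. R1 (e 0) (e 1)) \<and> pdf M (\<lambda>e. R2 (e 0) (e 1)) \<and>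
        (\<forall>i j. (R1 (num M i) (num M j) \<longleftrightarrow> K1 (f (num M i)) (f (num M j))) \<and>
               (R2 (num M i) (num M j) \<longleftrightarrow> K2 (f (num M i)) (f (num M j))))"
    if f: "pdfun M (\<lambda>e. f (e 0))" for f
  proof -
    note [pdf_intros] = pdfun_app1[OF f]
    \<comment> \<open>\<open>h\<close> turns the external question whether a position lies in
      \<open>I\<close> into one about the entries of a coded sequence, the form to which
      separability applies.\<close>
    define h where "h i = (if \<exists>y. f i = F y \<phi>0 then THE y. f i = F y \<phi>0 else \<zero>)" for i
    have h: "h i = y" if "f i = F y \<phi>0" for i y
    proof -
      have "(THE y. f i = F y \<phi>0) = y"
      proof (rule the_equality)
        show "f i = F y \<phi>0" by (rule that)
        fix z assume "f i = F z \<phi>0"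
        then show "z = y" by (intro F_inject[OF trans[OF sym that]])
      qed
      moreover have "\<exists>y. f i = F y \<phi>0" using that by (rule exI)
      ultimately show ?thesis unfolding h_def by (simp only: if_True)
    qed
    have h_graph: "z = h i \<longleftrightarrow> f i = F z \<phi>0 \<or> \<not> (\<exists>y. f i = F y \<phi>0) \<and> z = \<zero>" for i z
    proof (cases "\<exists>y. f i = F y \<phi>0")
      case True
      then obtain y where y: "f i = F y \<phi>0" by (rule exE)
      then have hy: "h i = y" by (rule h)
      have "z = y \<longleftrightarrow> f i = F z \<phi>0" using y h[of i z] hy by (intro iffI) (simp only:, rule trans[OF sym], assumption+)
      then show ?thesis unfolding hy using True by (simp only: not_True_eq_False simp_thms)
    next
      case False
      have "h i = \<zero>" unfolding h_def by (simp only: False if_False)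
      then show ?thesis using False by (simp only: simp_thms) blast
    qed
    have ph: "pdfun M (\<lambda>e. h (e 0))" unfolding pdfun_def h_graph by (intro pdf_intros)
    obtain N where N: "\<And>n. num M n \<prec> N" using nonstandard_exists[OF sat] by blast
    \<comment> \<open>A code of nonstandard length \<open>N\<close> agrees with \<open>h\<close> at
      all standard indices.\<close>
    have "\<exists>a. \<forall>i. i \<prec> N \<longrightarrow> a !! i = h i"
    proof (rule recursion)
      show "pdf M (\<lambda>e. e 0 = h (e (Suc 0)))" by (intro pdf_intros pdfun_app1[OF ph])
    qed (rule refl)
    then obtain a where a: "\<And>n. a !! num M n = h (num M n)" using N by blast
    obtain c where c: "\<And>n. a !! num M n \<in> I \<longleftrightarrow> num M n \<epsilon> c" using sep unfolding separable_def by blast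
    \<comment> \<open>\<open>i \<epsilon> c\<close> replaces the external condition y \<in> I; for
      standard \<open>i\<close> with \<open>f i = F y \<phi>0\<close> the two are
      equivalent.\<close>
    define R where "R b i j \<longleftrightarrow> Base (f j) \<and> (\<exists>y. f i = F y (f j)) \<and> (b \<longleftrightarrow> f j = \<phi>0 \<and> \<not> i \<epsilon> c)" for b i j
    have R: "R b (num M i) (num M j) \<longleftrightarrow> Base (f (num M j)) \<and> (\<exists>y. f (num M i) = F y (f (num M j)) \<and> (b \<longleftrightarrow> flip (f (num M j)) y))"
      for b i j
    proof -
      have "num M i \<epsilon> c \<longleftrightarrow> y \<in> I" if "f (num M i) = F y \<phi>0" for y
        using h[OF that] a[of i] c[of i] by simp
      then show ?thesis unfolding R_def flip_def by metis
    qed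
    have "pdf M (\<lambda>e. R b (e 0) (e 1))" for b unfolding R_def by (intro pdf_intros)
    then show ?thesis using R unfolding K1_def K2_def by (intro exI[of _ "R False"] exI[of _ "R True"]) simp
  qed
  have extend: "\<exists>S'. compositional (parts x) S' \<and> sound \<gamma> (parts x) S' \<and> rel (parts x) S'"
    if Z: "parts_closed Z" "Z \<subseteq> parts x" and x: "\<phi>0 \<in> parts x"
      and S: "compositional Z S" "sound \<gamma> Z S" "rel Z S" for Z x S \<gamma>
  proof -
    have T0: "truth0 \<in> Z" if "\<phi>0 \<in> Z" "parts_closed Z" for Z using parts_least[OF that(2,1)] tr0 by blast
    have ob: "obeys Z S g"
    proof (rule obeys_parts_closed[OF Z(1) S(1) g])
      fix \<phi> y assume "Base \<phi>" "F y \<phi> \<in> Z"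
      then have "\<phi> \<in> Z" using parts_closed_F[OF Z(1)] by blast
      then have *: "Tr M S (F y \<phi>) \<longleftrightarrow> (Tr M S \<phi> \<longleftrightarrow> \<not> flip \<phi> y)"
        using S(3) \<open>Base \<phi>\<close> \<open>F y \<phi> \<in> Z\<close> unfolding rel_def by blast
      have "flip \<phi> y \<Longrightarrow> Tr M S \<phi> \<longleftrightarrow> t0" using Tr0[OF S(1)] T0[OF _ Z(1)] \<open>\<phi> \<in> Z\<close> unfolding flip_def by blast
      then show "Tr M S (F y \<phi>) \<longleftrightarrow> g \<phi> y (Tr M S \<phi>)" using * unfolding g_def by auto
    qed
    have "{\<phi>0, truth0} \<subseteq> parts x" using x T0[OF x parts_closed_parts] by blast
    moreover have "(K1 \<theta> \<psi> \<longrightarrow> (Tr M S' \<theta> \<longleftrightarrow> Tr M S' \<psi>)) \<and> (K2 \<theta> \<psi> \<longrightarrow> (Tr M S' \<theta> \<longleftrightarrow> \<not> Tr M S' \<psi>))"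
      if D: "compositional D S'" "obeys D S' g" "{\<phi>0, truth0} \<subseteq> D" "\<theta> \<in> D" "\<psi> \<in> D" for D S' \<theta> \<psi>
    proof -
      have "Tr M S' \<theta> \<longleftrightarrow> (Tr M S' \<psi> \<longleftrightarrow> \<not> flip \<psi> y)" if "Base \<psi>" "\<theta> = F y \<psi>" for y
      proof -
        have "flip \<psi> y \<Longrightarrow> Tr M S' \<psi> \<longleftrightarrow> t0" using Tr0[OF D(1)] D(3) unfolding flip_def by blast
        then show ?thesis using obeys_F[OF g D(2) that(1) D(5), of y] D(4) that(2) unfolding g_def by auto
      qed
      then show ?thesis unfolding K1_def K2_def by blast
    qed
    ultimately obtain S' where S': "compositional (parts x) S'" "sound \<gamma> (parts x) S'"
      "\<And>\<theta> \<psi>. \<theta> \<in> parts x \<Longrightarrow> \<psi> \<in> parts x \<Longrightarrow> Sent M \<theta> \<Longrightarrow> Sent M \<psi> \<Longrightarrow>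
       (K1 \<theta> \<psi> \<longrightarrow> (Tr M S' \<theta> \<longleftrightarrow> Tr M S' \<psi>)) \<and> (K2 \<theta> \<psi> \<longrightarrow> (Tr M S' \<theta> \<longleftrightarrow> \<not> Tr M S' \<psi>))"
      using extension[OF count sat Z S(1) ob S(2) g, of "{\<phi>0, truth0}" K1 K2] index by auto
    have "rel (parts x) S'"
      unfolding rel_def
    proof (intro allI impI, elim conjE)
      fix \<phi> y assume *: "Base \<phi>" "\<phi> \<in> parts x" "F y \<phi> \<in> parts x"
      have "Sent M \<phi>" "Sent M (F y \<phi>)" using *(1) Base_Sent Sent_F by blast+
      from S'(3)[OF *(3,2) this(2,1)] show "Tr M S' (F y \<phi>) \<longleftrightarrow> (Tr M S' \<phi> \<longleftrightarrow> \<not> flip \<phi> y)"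
        using *(1) unfolding K1_def K2_def by (cases "flip \<phi> y") auto
    qed
    with S' show ?thesis by blast
  qed
  define Good where "Good i Z S \<longleftrightarrow> (\<exists>x. Form M x \<and> Z = parts x) \<and> \<phi>0 \<in> Z \<and> compositional Z S \<and> rel Z S"
    for i :: nat and Z S
  have Form0: "Form M \<phi>0" using Base_Sent[OF \<phi>0] by (simp add: Sent_def)
  obtain S0 where S0: "Good 0 (parts \<phi>0) S0"
  proof -
    have "parts_closed {}" "{} \<subseteq> parts \<phi>0" "compositional {} {}" "sound \<zero> {} {}" "rel {} {}"
      by (simp_all add: parts_closed_def compositional_def sound_zero rel_def)
    from extend[OF this(1,2) parts_self this(3,4,5)] show ?thesis
      using that parts_self Form0 unfolding Good_def by blast
  qed
  have "\<exists>Z' S'. Good (Suc i) Z' S' \<and> sound \<gamma> Z' S' \<and> \<phi> \<in> Z' \<and> (False \<longrightarrow>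
      (\<exists>\<delta> \<eta>. True \<and> Sent M \<delta> \<and> Sent M \<eta> \<and> \<delta> \<in> Z' \<and> \<eta> \<in> Z' \<and> (Tr M S' \<delta> \<longleftrightarrow> \<not> Tr M S' \<eta>)))"
    if G: "Good i Z S" "sound \<gamma> Z S" "Form M \<phi>" for i Z S \<gamma> \<phi>
  proof -
    obtain x where x: "Form M x" "Z = parts x" "\<phi>0 \<in> Z" "compositional Z S" "rel Z S"
      using G(1) unfolding Good_def by blast
    define x' where "x' = cOr M x \<phi>"
    have sub: "Z \<subseteq> parts x'" "\<phi> \<in> parts x'" using parts_cOr parts_self x(2) unfolding x'_def by blast+
    have "parts_closed Z" using x(2) parts_closed_parts by simp
    from extend[OF this sub(1) _ x(4) G(2) x(5)] sub(1) x(3) obtain S' where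
      "compositional (parts x') S'" "sound \<gamma> (parts x') S'" "rel (parts x') S'" by blast
    moreover have "Form M x'" using x(1) G(3) by (simp add: x'_def)
    ultimately have "Good (Suc i) (parts x') S'" "sound \<gamma> (parts x') S'"
      using sub x(3) unfolding Good_def by blast+
    with sub(2) show ?thesis by blast
  qed
  note step = this
  have comp: "compositional Z S" if "Good i Z S" for i Z S using that unfolding Good_def by blast
  have closed': "\<phi> \<in> Z" if "Good i Z S" "\<theta> \<in> Z" "subfm \<theta> \<phi>" for i Z S \<theta> \<phi>
  proof -
    have "parts_closed Z" using that(1) parts_closed_parts unfolding Good_def by blast
    from parts_closed_subfm[OF this that(2,3)] show ?thesis .
  qed
  \<comment> \<open>The stages are not asked for separations (\<open>Q\<close> is
    \<open>False\<close>), because \<open>rel\<close> already contains those at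
    \<open>\<phi>0\<close>.\<close>
  have "\<exists>S. CS_minus M S \<and>
    (\<forall>\<delta> \<eta>. Sent M \<delta> \<and> Sent M \<eta> \<longrightarrow> (\<exists>i Z S'. Good i Z S' \<and> \<delta> \<in> Z \<and> \<eta> \<in> Z \<and>
       (Tr M S \<delta> \<longleftrightarrow> Tr M S' \<delta>) \<and> (Tr M S \<eta> \<longleftrightarrow> Tr M S' \<eta>))) \<and>
    (False \<longrightarrow> (\<forall>i::nat. \<exists>\<delta> \<eta>. True \<and> Sent M \<delta> \<and> Sent M \<eta> \<and> (Tr M S \<delta> \<longleftrightarrow> \<not> Tr M S \<eta>)))"
    by (rule union_construction[where Good = Good and Q = False and P = "\<lambda>_ _ _. True", OF count S0],
      erule comp, erule (2) closed', erule (2) step)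
  then obtain S where S: "CS_minus M S" "\<And>\<delta> \<eta>. Sent M \<delta> \<Longrightarrow> Sent M \<eta> \<Longrightarrow> \<exists>i Z S'. Good i Z S' \<and> \<delta> \<in> Z \<and> \<eta> \<in> Z \<and>
       (Tr M S \<delta> \<longleftrightarrow> Tr M S' \<delta>) \<and> (Tr M S \<eta> \<longleftrightarrow> Tr M S' \<eta>)"
    by blast
  have same: "Tr M S \<phi> \<longleftrightarrow> Tr M S (F y \<phi>)" if y: "y \<in> I" and \<phi>: "Sent M \<phi>" for y \<phi>
  proof -
    obtain i Z S' where Z: "Good i Z S'" "\<phi> \<in> Z" "F y \<phi> \<in> Z"
      and eq: "Tr M S \<phi> \<longleftrightarrow> Tr M S' \<phi>" "Tr M S (F y \<phi>) \<longleftrightarrow> Tr M S' (F y \<phi>)"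
      using S(2)[OF \<phi> Sent_F[OF \<phi>]] by blast
    have cl: "parts_closed Z" and rel: "rel Z S'" using Z(1) parts_closed_parts unfolding Good_def by blast+
    have "Tr M S' \<phi> \<longleftrightarrow> Tr M S' (F y \<phi>)"
    proof (cases "accessible \<Phi>")
      case True
      then have "Base \<phi>" unfolding Base_def using \<phi> by blast
      then show ?thesis using rel Z y unfolding rel_def flip_def by blast
    next
      case False
      then obtain r z where r: "Base r" "\<phi> = F z r" using Base_exists[OF False \<phi>] by blast
      have rZ: "r \<in> Z" using parts_closed_F[OF cl r(1)] Z(2) r(2) by blast
      have F: "F y \<phi> = F (y \<oplus> z) r" using F_add[OF False] r(2) by simp
      have "\<forall>x\<in>I. \<forall>y\<in>I. x \<oplus> y \<in> I" using closed False unfolding F_closed_def by blast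
      \<comment> \<open>Moving by an element of \<open>I\<close> along the iterates of
        \<open>r\<close> never crosses the cut, so \<open>F z r\<close> and
        \<open>F (y \<oplus> z) r\<close> are flipped together or not at all.\<close>
      then have "y \<oplus> z \<in> I \<longleftrightarrow> z \<in> I" using y cut_le[OF I _ le_add2] by blast
      then have fl: "flip r (y \<oplus> z) \<longleftrightarrow> flip r z" unfolding flip_def by blast
      have "Tr M S' (F z r) \<longleftrightarrow> (Tr M S' r \<longleftrightarrow> \<not> flip r z)" using rel r Z(2) rZ unfolding rel_def by blast
      moreover have "Tr M S' (F (y \<oplus> z) r) \<longleftrightarrow> (Tr M S' r \<longleftrightarrow> \<not> flip r (y \<oplus> z))"
        using rel r(1) Z(3) rZ F unfolding rel_def by metis
      ultimately show ?thesis using fl F r(2) by simp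
    qed
    with eq show ?thesis by simp
  qed
  have differ: "\<not> (Tr M S \<phi>0 \<longleftrightarrow> Tr M S (F y \<phi>0))" if "y \<notin> I" for y
  proof -
    have Se: "Sent M \<phi>0" using Base_Sent[OF \<phi>0] .
    obtain i Z S' where Z: "Good i Z S'" "\<phi>0 \<in> Z" "F y \<phi>0 \<in> Z"
      and eq: "Tr M S \<phi>0 \<longleftrightarrow> Tr M S' \<phi>0" "Tr M S (F y \<phi>0) \<longleftrightarrow> Tr M S' (F y \<phi>0)"
      using S(2)[OF Se Sent_F[OF Se]] by blast
    then have "rel Z S'" unfolding Good_def by blast
    then have "Tr M S' (F y \<phi>0) \<longleftrightarrow> (Tr M S' \<phi>0 \<longleftrightarrow> \<not> flip \<phi>0 y)" using \<phi>0 Z unfolding rel_def by blast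
    then show ?thesis using eq that unfolding flip_def by blast
  qed
  have "I = {x. \<forall>y. y \<preceq> x \<longrightarrow> (\<forall>\<phi>. Sent M \<phi> \<longrightarrow> (Tr M S \<phi> \<longleftrightarrow> Tr M S (F y \<phi>)))}"
  proof (rule set_eqI)
    fix x
    show "x \<in> I \<longleftrightarrow> x \<in> {x. \<forall>y. y \<preceq> x \<longrightarrow> (\<forall>\<phi>. Sent M \<phi> \<longrightarrow> (Tr M S \<phi> \<longleftrightarrow> Tr M S (F y \<phi>)))}"
      unfolding mem_Collect_eq
    proof (rule iffI, (intro allI impI)[1])
      fix y \<phi> assume "x \<in> I" "y \<preceq> x" "Sent M \<phi>"
      then show "Tr M S \<phi> = Tr M S (F y \<phi>)" using same cut_le[OF I] by blast
    next
      assume "\<forall>y. y \<preceq> x \<longrightarrow> (\<forall>\<phi>. Sent M \<phi> \<longrightarrow> (Tr M S \<phi> \<longleftrightarrow> Tr M S (F y \<phi>)))"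
      then have "Tr M S \<phi>0 \<longleftrightarrow> Tr M S (F x \<phi>0)" using Base_Sent[OF \<phi>0] by simp
      then show "x \<in> I" using differ by blast
    qed
  qed
  with S(1) show ?thesis by blast
qed

section \<open>Cuts without a least gap above them\<close>

text \<open>The first step returns the value of the base (\<open>teval_same\<close>), and a further
  step changes nothing (\<open>teval_idem\<close>). So in an actual class a change along the
  iterates can happen only across a nonstandard distance.\<close>

lemma F_succ_agree:
  assumes "parts_closed Z" "compositional Z S" "Base \<phi>" "F (y \<oplus> \<one>) \<phi> \<in> Z"
  shows "Tr M S (F (y \<oplus> \<one>) \<phi>) \<longleftrightarrow> Tr M S (F y \<phi>)" "F y \<phi> \<in> Z"
proof -
  have Se: "Sent M \<phi>" "Sent M (F z \<phi>)" for z using assms(3) Base_Sent Sent_F by blast+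
  note st = Tr_step[OF assms(1,2) Se]
  have y: "Tr M S (F (y \<oplus> \<one>) \<phi>) \<longleftrightarrow> teval \<Phi> (Tr M S \<phi>) (Tr M S (F y \<phi>))" "F y \<phi> \<in> Z"
    using st[of y] assms(4) by (simp_all add: F_op_succ)
  show "F y \<phi> \<in> Z" by (rule y(2))
  show "Tr M S (F (y \<oplus> \<one>) \<phi>) \<longleftrightarrow> Tr M S (F y \<phi>)"
  proof (cases rule: cases0[of y])
    case 1
    then show ?thesis using y(1) teval_same by simp
  next
    case (2 z)
    then have "Tr M S (F y \<phi>) \<longleftrightarrow> teval \<Phi> (Tr M S \<phi>) (Tr M S (F z \<phi>))" using st(1)[of z] y(2) by (simp add: F_op_succ)
    then show ?thesis using y(1) teval_idem by simp
  qed
qed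

lemma F_add_num_agree:
  assumes "parts_closed Z" "compositional Z S" "Base \<phi>" "F (y \<oplus> num M n) \<phi> \<in> Z"
  shows "Tr M S (F (y \<oplus> num M n) \<phi>) \<longleftrightarrow> Tr M S (F y \<phi>)"
  using assms(4)
proof (induction n)
  case (Suc n)
  then have "F (y \<oplus> num M n \<oplus> \<one>) \<phi> \<in> Z" by (simp add: num_Suc add_assoc)
  from F_succ_agree[OF assms(1-3) this] Suc.IH show ?case by (simp add: num_Suc add_assoc)
qed (simp add: num_0)

text \<open>All sentences are included and not just bases: for an additive operator this also
  controls shifts by at most \<open>d\<close> that start from any iterate.\<close>

definition small_agree where
  "small_agree d Z S \<longleftrightarrow> (\<forall>\<psi> y. Sent M \<psi> \<and> \<psi> \<in> Z \<and> F y \<psi> \<in> Z \<and> y \<preceq> d \<longrightarrow> (Tr M S (F y \<psi>) \<longleftrightarrow> Tr M S \<psi>))"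

text \<open>The rule for the new class has to copy the old class, to follow the base up to
  \<open>d'\<close> and to break at \<open>d\<close> on a fresh base. \<open>u\<close> is the shift
  under which it must be invariant: 1 if p occurs in the template, and \<open>d'\<close> if the
  operator is additive, where agreement up to \<open>d'\<close> compares F(w + y, r) with F(w, r)
  for every w. The hypothesis \<open>gap\<close> puts \<open>d\<close> out of reach of standard
  multiples of \<open>u\<close> above \<open>d'\<close>.\<close>

lemma gap_step:
  assumes count: "countable (UNIV :: 'a set)" and sat: "rec_saturated M"
    and Z: "parts_closed Z" "Z \<subseteq> parts x" and S: "compositional Z S" "sound \<gamma> Z S" "small_agree d Z S"
    and u: "u = (if accessible \<Phi> then \<one> else d')" "u \<noteq> \<zero>" and gap: "\<And>n. d' \<oplus> num M n \<otimes> u \<prec> d"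
    and x: "Form M x" "Form M \<phi>"
  shows "\<exists>x' S' \<phi>1. Form M x' \<and> \<phi> \<in> parts x' \<and> compositional (parts x') S' \<and> sound \<gamma> (parts x') S' \<and>
    small_agree d' (parts x') S' \<and> Sent M \<phi>1 \<and> \<phi>1 \<in> parts x' \<and> F d \<phi>1 \<in> parts x' \<and>
    (Tr M S' (F d \<phi>1) \<longleftrightarrow> \<not> Tr M S' \<phi>1)"
proof -
  obtain \<phi>0 t0 where \<phi>0: "Base \<phi>0" and t0: "teval \<Phi> t0 (\<not> t0) \<longleftrightarrow> \<not> t0" and tr0: "truth0 \<in> parts \<phi>0"
    and Tr0: "\<And>D S. compositional D S \<Longrightarrow> truth0 \<in> D \<Longrightarrow> \<phi>0 \<in> D \<Longrightarrow> Tr M S \<phi>0 \<longleftrightarrow> t0"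
    using special_base by blast
  obtain m where m: "\<And>j \<phi> \<psi> \<chi>. j \<noteq> num M m \<Longrightarrow> step \<phi> \<psi> \<noteq> cEx M j \<chi>" using step_neq_cEx by blast
  \<comment> \<open>An index above \<open>x\<close> makes \<open>\<phi>1\<close> larger than every
    formula of \<open>Z\<close>, hence fresh. Being different from \<open>num M m\<close>, it keeps
    \<open>\<phi>1\<close> from being a step, so \<open>\<phi>1\<close> is a base.\<close>
  define j where "j = x \<oplus> num M m \<oplus> \<one>"
  define \<phi>1 where "\<phi>1 = cEx M j \<phi>0"
  have "x \<prec> j" "num M m \<prec> j" unfolding j_def by (simp_all add: less_succ)
  then have x\<phi>1: "x \<prec> \<phi>1" and jm: "j \<noteq> num M m" unfolding \<phi>1_def using less_cEx(1) less_trans by blast+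
  have Se1: "Sent M \<phi>1" using Sent_cEx Base_Sent[OF \<phi>0] by (simp add: \<phi>1_def)
  have \<phi>1: "Base \<phi>1" unfolding Base_def using Se1 m[OF jm] unfolding \<phi>1_def by metis
  have notZ: "F y \<phi>1 \<notin> Z" for y
    using parts_le[of "F y \<phi>1" x] Z(2) le_F[of \<phi>1 y] x\<phi>1 by (metis less_le_trans not_less subsetD)
  have nu: "num M n \<otimes> u \<preceq> d" for n
    using gap[of n] le_add2[of "num M n \<otimes> u" d'] less_imp_le le_less_trans by blast
  have numS: "num M (Suc n) \<otimes> u = num M n \<otimes> u \<oplus> u" for n by (simp add: num_Suc succ_mult)
  have one_u: "\<one> \<preceq> u" using u(2) one_le_iff by blast
  \<comment> \<open>\<open>near\<close> and \<open>far\<close> quantify over standard n. They enter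
    only the external rule \<open>g\<close>, never a type.\<close>
  define near where "near z y \<longleftrightarrow> (\<exists>n. z \<preceq> y \<oplus> num M n \<otimes> u \<and> y \<preceq> z \<oplus> num M n \<otimes> u)" for z y
  define far where "far y \<longleftrightarrow> (\<forall>n. \<not> y \<preceq> d' \<oplus> num M n \<otimes> u)" for y
  have near_shift: "near z (y \<oplus> v) \<longleftrightarrow> near z y" if v: "v \<preceq> u" for z y v
  proof
    assume "near z (y \<oplus> v)"
    then obtain n where n: "z \<preceq> y \<oplus> v \<oplus> num M n \<otimes> u" "y \<oplus> v \<preceq> z \<oplus> num M n \<otimes> u" unfolding near_def by blast
    have "y \<oplus> v \<oplus> num M n \<otimes> u \<preceq> y \<oplus> num M (Suc n) \<otimes> u"
      using v by (simp add: numS add_assoc add_comm[of v] add_le_cancel)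
    moreover have "z \<oplus> num M n \<otimes> u \<preceq> z \<oplus> num M (Suc n) \<otimes> u" by (simp add: numS add_le_cancel)
    ultimately show "near z y"
      unfolding near_def using n le_add1[of y v] order_trans by (intro exI[of _ "Suc n"]) blast
  next
    assume "near z y"
    then obtain n where n: "z \<preceq> y \<oplus> num M n \<otimes> u" "y \<preceq> z \<oplus> num M n \<otimes> u" unfolding near_def by blast
    have "y \<oplus> num M n \<otimes> u \<preceq> y \<oplus> v \<oplus> num M (Suc n) \<otimes> u"
      by (simp add: numS add_assoc add_le_cancel) (metis add.left_commute le_add1)
    moreover have "y \<oplus> v \<preceq> z \<oplus> num M (Suc n) \<otimes> u"
      unfolding numS add_assoc[symmetric] by (rule add_mono[OF n(2) v])
    ultimately show "near z (y \<oplus> v)"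
      unfolding near_def using n order_trans by (intro exI[of _ "Suc n"]) blast
  qed
  have far_shift: "far (y \<oplus> v) \<longleftrightarrow> far y" if v: "v \<preceq> u" for y v
  proof -
    have "y \<oplus> v \<preceq> d' \<oplus> num M n \<otimes> u \<Longrightarrow> y \<preceq> d' \<oplus> num M n \<otimes> u" for n using le_add1 order_trans by blast
    moreover have "y \<oplus> v \<preceq> d' \<oplus> num M (Suc n) \<otimes> u" if "y \<preceq> d' \<oplus> num M n \<otimes> u" for n
      unfolding numS add_assoc[symmetric] by (rule add_mono[OF that v])
    ultimately show ?thesis unfolding far_def by blast
  qed
  have near_self: "near y y" for y unfolding near_def by (intro exI[of _ 0]) simp
  have not_far: "\<not> far y" if "y \<preceq> d'" for y using that le_add1 order_trans unfolding far_def by blast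
  have far_d: "far d" unfolding far_def using gap not_le by blast
  have near_le: "z \<preceq> d" if "near z y" "y \<preceq> d'" for z y
  proof -
    from that(1) obtain n where n: "z \<preceq> y \<oplus> num M n \<otimes> u" unfolding near_def by blast
    have "y \<oplus> num M n \<otimes> u \<preceq> d' \<oplus> num M n \<otimes> u" using that(2) by (rule add_right_mono)
    then show ?thesis using n gap[of n] order_trans less_imp_le by blast
  qed
  \<comment> \<open>The old class is constant on each gap. For an accessible template the distance
    is standard and \<open>F_add_num_agree\<close> applies; for an additive one it is a standard
    multiple of \<open>d'\<close>, or less, hence at most \<open>d\<close>, and
    \<open>small_agree\<close> applies to the lower iterate.\<close>
  have agree_le: "Tr M S (F z \<phi>) \<longleftrightarrow> Tr M S (F y \<phi>)"
    if "Base \<phi>" "F z \<phi> \<in> Z" "F y \<phi> \<in> Z" "near z y" "z \<preceq> y" for z y \<phi>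
  proof -
    from that(4) obtain n where n: "y \<preceq> z \<oplus> num M n \<otimes> u" unfolding near_def by blast
    from that(5) obtain w where w: "y = z \<oplus> w" using le_iff by metis
    then have wn: "w \<preceq> num M n \<otimes> u" using n add_le_cancel by simp
    show ?thesis
    proof (cases "accessible \<Phi>")
      case True
      then have "w \<prec> num M (Suc n)" using wn u(1) by (simp add: num_Suc less_succ)
      then obtain k where "w = num M k" using less_num by blast
      then show ?thesis using F_add_num_agree[OF Z(1) S(1) that(1)] that(3) w by simp
    next
      case False
      have "F y \<phi> = F w (F z \<phi>)" using F_add[OF False] w add_comm by metis
      moreover have "w \<preceq> d" using wn nu order_trans by blast
      ultimately show ?thesis using S(3) that(2,3) Sent_F[OF Base_Sent[OF that(1)]] unfolding small_agree_def by metis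
    qed
  qed
  have near_sym: "near z y \<Longrightarrow> near y z" for z y unfolding near_def by blast
  have agree: "Tr M S (F z \<phi>) \<longleftrightarrow> Tr M S (F y \<phi>)"
    if "Base \<phi>" "F z \<phi> \<in> Z" "F y \<phi> \<in> Z" "near z y" for z y \<phi>
    using agree_le[of \<phi> z y] agree_le[of \<phi> y z] that near_sym le_total' by blast
  have base_agree: "Tr M S (F z \<phi>) \<longleftrightarrow> Tr M S \<phi>"
    if "Base \<phi>" "F z \<phi> \<in> Z" "\<phi> \<in> Z" "z \<preceq> d" for z \<phi>
    using S(3) that Base_Sent unfolding small_agree_def by blast
  \<comment> \<open>The condition on \<open>t\<close> restricts copying to the truth value that the
    base really has; only with it are the copied values known to respect the truth table.\<close>
  define old where "old \<phi> y t \<longleftrightarrow> Base \<phi> \<and> \<phi> \<in> Z \<and> t = Tr M S \<phi> \<and> (\<exists>z. near z y \<and> F z \<phi> \<in> Z)" for \<phi> y t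
  \<comment> \<open>Three sources in order of priority: the break on the fresh base, then the old
    class if it has a value in the same gap, then the base. The break cannot clash with the old
    class, since no iterate of \<open>\<phi>1\<close> lies in \<open>Z\<close>.\<close>
  define g where "g \<phi> y t = (if \<phi> = \<phi>1 \<and> far y \<and> t = t0 then \<not> t
    else if old \<phi> y t then \<exists>z. near z y \<and> F z \<phi> \<in> Z \<and> Tr M S (F z \<phi>) else t)" for \<phi> y t
  have g_shift: "g \<phi> (y \<oplus> v) t = g \<phi> y t" if "v \<preceq> u" for \<phi> y v t
    unfolding g_def old_def near_shift[OF that] far_shift[OF that] by (rule refl)
  \<comment> \<open>A position near some y \<preceq> \<open>d'\<close> is still at most
    \<open>d\<close>, where the old class follows the base.\<close>
  have g_small: "g \<phi> y t = t" if "y \<preceq> d'" for \<phi> y t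
  proof (cases "old \<phi> y t")
    case True
    then obtain z where "near z y" "F z \<phi> \<in> Z" and o: "Base \<phi>" "\<phi> \<in> Z" "t = Tr M S \<phi>" unfolding old_def by blast
    moreover have "Tr M S (F z \<phi>) \<longleftrightarrow> t" if "near z y" "F z \<phi> \<in> Z" for z
      using base_agree[OF o(1) that(2) o(2) near_le[OF that(1) \<open>y \<preceq> d'\<close>]] o(3) by simp
    ultimately have "(\<exists>z. near z y \<and> F z \<phi> \<in> Z \<and> Tr M S (F z \<phi>)) \<longleftrightarrow> t" by blast
    then show ?thesis unfolding g_def using True not_far[OF that] by simp
  next
    case False
    then show ?thesis unfolding g_def using not_far[OF that] by simp
  qed
  have g: "admissible g"
    unfolding admissible_def
  proof (intro allI conjI)
    fix \<phi> y t
    show "g \<phi> \<zero> t = t" by (rule g_small) simp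
    show "g \<phi> (y \<oplus> \<one>) t = g \<phi> y t" by (rule g_shift[OF one_u])
    show "teval \<Phi> t (g \<phi> y t) = g \<phi> y t"
    proof (cases "\<phi> = \<phi>1 \<and> far y \<and> t = t0")
      case True
      then show ?thesis using t0 by (simp add: g_def)
    next
      case not_break: False
      show ?thesis
      proof (cases "old \<phi> y t")
        case True
        then obtain z where z: "near z y" "F z \<phi> \<in> Z" and o: "Base \<phi>" "\<phi> \<in> Z" "t = Tr M S \<phi>" unfolding old_def by blast
        have "g \<phi> y t \<longleftrightarrow> (\<exists>z. near z y \<and> F z \<phi> \<in> Z \<and> Tr M S (F z \<phi>))" unfolding g_def by (simp only: not_break True if_False if_True)
        then obtain w where w: "F w \<phi> \<in> Z" "g \<phi> y t \<longleftrightarrow> Tr M S (F w \<phi>)" using z by blast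
        \<comment> \<open>A copied value respects the truth table because it is the value of an
          actual class at an iterate of \<open>\<phi>\<close>.\<close>
        have "teval \<Phi> t (Tr M S (F w \<phi>)) \<longleftrightarrow> Tr M S (F w \<phi>)"
        proof (cases rule: cases0[of w])
          case 1
          then show ?thesis using o(3) teval_same by simp
        next
          case (2 v)
          have "Sent M \<phi>" "Sent M (F v \<phi>)" using o(1) Base_Sent Sent_F by blast+
          from Tr_step(1)[OF Z(1) S(1) this] have "Tr M S (F w \<phi>) \<longleftrightarrow> teval \<Phi> t (Tr M S (F v \<phi>))"
            using w(1) 2 o(3) by (simp add: F_op_succ)
          then show ?thesis using teval_idem by simp
        qed
        then show ?thesis using w(2) by simp
      next
        case False
        then have "g \<phi> y t = t" unfolding g_def by (simp only: not_break if_False)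
        then show ?thesis using teval_same by simp
      qed
    qed
  qed
  have ob: "obeys Z S g"
  proof (rule obeys_parts_closed[OF Z(1) S(1) g])
    fix \<phi> y assume b: "Base \<phi>" "F y \<phi> \<in> Z"
    then have "\<phi> \<in> Z" using parts_closed_F[OF Z(1)] by blast
    then have "old \<phi> y (Tr M S \<phi>)" unfolding old_def using b near_self by blast
    moreover have "\<phi> \<noteq> \<phi>1" using b(2) notZ by blast
    moreover have "(\<exists>z. near z y \<and> F z \<phi> \<in> Z \<and> Tr M S (F z \<phi>)) \<longleftrightarrow> Tr M S (F y \<phi>)"
      using agree[OF b(1) _ b(2)] b(2) near_self by blast
    ultimately show "Tr M S (F y \<phi>) \<longleftrightarrow> g \<phi> y (Tr M S \<phi>)" unfolding g_def by simp
  qed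
  define K1 where "K1 \<theta> \<psi> \<longleftrightarrow> Sent M \<psi> \<and> (\<exists>y. y \<preceq> d' \<and> \<theta> = F y \<psi>)" for \<theta> \<psi>
  define K2 where "K2 \<theta> \<psi> \<longleftrightarrow> \<theta> = F d \<phi>1 \<and> \<psi> = \<phi>1" for \<theta> \<psi>
  define x' where "x' = cOr M (cOr M x \<phi>) (F d \<phi>1)"
  define E where "E = {\<phi>1, \<phi>0, truth0}"
  have sub: "parts x \<subseteq> parts x'" "parts \<phi> \<subseteq> parts x'" "parts (F d \<phi>1) \<subseteq> parts x'"
    unfolding x'_def using parts_cOr by blast+
  have Fd: "F d \<phi>1 \<in> parts x'" and \<phi>x: "\<phi> \<in> parts x'" using sub(2,3) parts_self by blast+
  have 1: "\<phi>1 \<in> parts x'" using parts_closed_F[OF parts_closed_parts \<phi>1 Fd] .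
  have "\<phi>0 \<in> parts x'" using parts_closed_subfm[OF parts_closed_parts 1, of \<phi>0] by (simp add: \<phi>1_def)
  moreover from this have "truth0 \<in> parts x'" using parts_least[OF parts_closed_parts] tr0 by blast
  ultimately have E: "finite E" "E \<subseteq> parts x'" using 1 by (simp_all add: E_def)
  have index: "\<exists>R1 R2. pdf M (\<lambda>e. R1 (e 0) (e 1)) \<and> pdf M (\<lambda>e. R2 (e 0) (e 1)) \<and>
        (\<forall>i j. (R1 (num M i) (num M j) \<longleftrightarrow> K1 (f (num M i)) (f (num M j))) \<and>
               (R2 (num M i) (num M j) \<longleftrightarrow> K2 (f (num M i)) (f (num M j))))"
    if f: "pdfun M (\<lambda>e. f (e 0))" for f
  proof -
    note [pdf_intros] = pdfun_app1[OF f]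
    have "pdf M (\<lambda>e. K1 (f (e 0)) (f (e 1)))" "pdf M (\<lambda>e. K2 (f (e 0)) (f (e 1)))"
      unfolding K1_def K2_def by (intro pdf_intros)+
    then show ?thesis by (intro exI[of _ "\<lambda>i j. K1 (f i) (f j)"] exI[of _ "\<lambda>i j. K2 (f i) (f j)"]) simp
  qed
  have K: "(K1 \<theta> \<psi> \<longrightarrow> (Tr M S' \<theta> \<longleftrightarrow> Tr M S' \<psi>)) \<and> (K2 \<theta> \<psi> \<longrightarrow> (Tr M S' \<theta> \<longleftrightarrow> \<not> Tr M S' \<psi>))"
    if D: "compositional D S'" "obeys D S' g" "E \<subseteq> D" "\<And>\<phi> y. additive \<Phi> \<Longrightarrow> Base \<phi> \<Longrightarrow> F y \<phi> \<in> D \<Longrightarrow> \<phi> \<in> D"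
      "\<theta> \<in> D" "\<psi> \<in> D" for D S' \<theta> \<psi>
  proof (intro conjI impI)
    assume "K1 \<theta> \<psi>"
    then obtain y where y: "Sent M \<psi>" "y \<preceq> d'" "\<theta> = F y \<psi>" unfolding K1_def by blast
    show "Tr M S' \<theta> \<longleftrightarrow> Tr M S' \<psi>"
    proof (cases "accessible \<Phi>")
      case True
      then have "Base \<psi>" unfolding Base_def using y(1) by blast
      then show ?thesis using obeys_F[OF g D(2) _ D(6)] D(5) y g_small[OF y(2)] by simp
    next
      case False
      obtain r w where r: "Base r" "\<psi> = F w r" using Base_exists[OF False y(1)] by blast
      have rD: "r \<in> D" using D(4)[OF False r(1)] D(6) r(2) by blast
      have \<theta>: "\<theta> = F (w \<oplus> y) r" using y(3) r(2) F_add[OF False] add_comm by metis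
      have "y \<preceq> u" using y(2) u(1) False by simp
      \<comment> \<open>Invariance under all shifts up to \<open>d'\<close>, and not merely under
        successor, enters here.\<close>
      then have "g r (w \<oplus> y) t = g r w t" for t by (rule g_shift)
      then show ?thesis
        using obeys_F[OF g D(2) r(1) rD, of w] obeys_F[OF g D(2) r(1) rD, of "w \<oplus> y"] D(5,6) \<theta> r(2) by simp
    qed
  next
    assume "K2 \<theta> \<psi>"
    then have eq: "\<theta> = F d \<phi>1" "\<psi> = \<phi>1" unfolding K2_def by blast+
    have in_D: "\<phi>1 \<in> D" "\<phi>0 \<in> D" "truth0 \<in> D" using D(3) unfolding E_def by blast+
    have "Tr M S' \<phi>1 \<longleftrightarrow> t0"
      using Tr_cEx[OF D(1) Base_Sent[OF \<phi>0], of j] in_D Tr0[OF D(1)] unfolding \<phi>1_def by blast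
    moreover have "Tr M S' (F d \<phi>1) \<longleftrightarrow> g \<phi>1 d (Tr M S' \<phi>1)" using obeys_F[OF g D(2) \<phi>1] D(5,6) eq by simp
    ultimately show "Tr M S' \<theta> \<longleftrightarrow> \<not> Tr M S' \<psi>" unfolding eq g_def using far_d by simp
  qed
  have Zx: "Z \<subseteq> parts x'" using Z(2) sub(1) by blast
  have "\<exists>S'. compositional (parts x') S' \<and> sound \<gamma> (parts x') S' \<and>
    (\<forall>\<theta>\<in>parts x'. \<forall>\<psi>\<in>parts x'. Sent M \<theta> \<and> Sent M \<psi> \<longrightarrow>
       (K1 \<theta> \<psi> \<longrightarrow> (Tr M S' \<theta> \<longleftrightarrow> Tr M S' \<psi>)) \<and> (K2 \<theta> \<psi> \<longrightarrow> (Tr M S' \<theta> \<longleftrightarrow> \<not> Tr M S' \<psi>)))"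
  proof (rule extension[where ?K1.0 = K1 and ?K2.0 = K2, OF count sat Z(1) Zx S(1) ob S(2) g E], goal_cases)
    case (1 f)
    from index[OF 1(1)] show ?case .
  next
    case (2 D S' \<theta> \<psi>)
    from K[OF 2] show ?case .
  qed
  then obtain S' where S': "compositional (parts x') S'" "sound \<gamma> (parts x') S'"
    "\<And>\<theta> \<psi>. \<theta> \<in> parts x' \<Longrightarrow> \<psi> \<in> parts x' \<Longrightarrow> Sent M \<theta> \<Longrightarrow> Sent M \<psi> \<Longrightarrow>
       (K1 \<theta> \<psi> \<longrightarrow> (Tr M S' \<theta> \<longleftrightarrow> Tr M S' \<psi>)) \<and> (K2 \<theta> \<psi> \<longrightarrow> (Tr M S' \<theta> \<longleftrightarrow> \<not> Tr M S' \<psi>))"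
    by blast
  have "small_agree d' (parts x') S'"
    unfolding small_agree_def
  proof (intro allI impI, elim conjE)
    fix \<psi> y assume *: "Sent M \<psi>" "\<psi> \<in> parts x'" "F y \<psi> \<in> parts x'" "y \<preceq> d'"
    have "K1 (F y \<psi>) \<psi>" unfolding K1_def using * by blast
    then show "Tr M S' (F y \<psi>) \<longleftrightarrow> Tr M S' \<psi>" using S'(3)[OF *(3,2) Sent_F[OF *(1)] *(1)] by blast
  qed
  moreover have "Tr M S' (F d \<phi>1) \<longleftrightarrow> \<not> Tr M S' \<phi>1"
    using S'(3)[OF Fd 1 Sent_F[OF Se1] Se1] unfolding K2_def by blast
  moreover have "Form M x'" using x Sent_F[OF Se1, of d] by (simp add: x'_def Sent_def)
  ultimately show ?thesis using S'(1,2) \<phi>x Fd 1 Se1 by blast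
qed

lemma num_mult_succ: "d \<oplus> num M n \<otimes> d = num M (Suc n) \<otimes> d"
  by (simp only: num_Suc succ_mult add_comm[of d])

lemma less_quot:
  assumes "d \<noteq> \<zero>" "y \<prec> quot M x d"
  shows "y \<otimes> d \<prec> x"
proof -
  obtain q r where x: "x = q \<otimes> d \<oplus> r" "r \<prec> d" using division_ex[OF assms(1)] by blast
  then have "y \<prec> q" using assms(2) quot_eq by simp
  moreover have "\<zero> \<prec> d" using assms(1) pos_iff by blast
  ultimately have "d \<otimes> y \<prec> d \<otimes> q" by (intro mult_strict)
  also have "d \<otimes> q \<preceq> x" using x(1) le_add1 mult_comm by simp
  finally show ?thesis by (simp only: mult_comm)
qed

lemma less_monus: "y \<prec> monus M x d \<Longrightarrow> y \<oplus> d \<prec> x"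
proof -
  assume y: "y \<prec> monus M x d"
  then have "d \<preceq> x" using monus_0[of d x] not_less_zero by metis
  with y show ?thesis using monus_add[of d x] add_strict_right_mono[of y "monus M x d" d] by simp
qed

text \<open>If y is below x / (n + 1), then y + n y is below x; so a single shape of inequality
  covers both kinds of gap.\<close>

lemma gap_below:
  assumes gap: "no_least_gap M \<Phi> I" and x: "above M x I" and I: "is_cut M I"
  shows "\<exists>y. above M y I \<and> (\<forall>n. y \<oplus> num M n \<otimes> (if accessible \<Phi> then \<one> else y) \<prec> x)"
proof (cases "accessible \<Phi>")
  case True
  then obtain y where y: "\<And>n. y \<prec> monus M x (num M n) \<and> above M y I" using gap x unfolding no_least_gap_def by blast
  have "y \<oplus> num M n \<prec> x" for n using y less_monus by blast
  then show ?thesis using y True by (intro exI[of _ y]) simp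
next
  case False
  then obtain y where y: "\<And>n. n \<ge> 1 \<Longrightarrow> y \<prec> quot M x (num M n) \<and> above M y I" using gap x unfolding no_least_gap_def by blast
  have "y \<oplus> num M n \<otimes> y \<prec> x" for n
  proof -
    have "num M (Suc n) \<noteq> \<zero>" by (simp add: num_Suc succ_neq_zero)
    then have "y \<otimes> num M (Suc n) \<prec> x" using y[of "Suc n"] less_quot by simp
    then show ?thesis unfolding num_mult_succ by (simp only: mult_comm)
  qed
  then show ?thesis using y[of 1] False by (intro exI[of _ y]) simp
qed

lemma no_gap_case:
  assumes count: "countable (UNIV :: 'a set)" and sat: "rec_saturated M"
    and I: "is_cut M I" and gap: "no_least_gap M \<Phi> I" and proper: "I \<noteq> UNIV"
  shows "\<exists>S. CS_minus M S \<and>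
    I = {x. \<forall>y. y \<preceq> x \<longrightarrow> (\<forall>\<phi>. Sent M \<phi> \<longrightarrow> (Tr M S \<phi> \<longleftrightarrow> Tr M S (F y \<phi>)))}"
proof -
  define u where "u d = (if accessible \<Phi> then \<one> else d)" for d
  have "\<exists>d. \<forall>i. above M (d i) I \<and> ((\<forall>n. d (Suc i) \<oplus> num M n \<otimes> u (d (Suc i)) \<prec> d i) \<and>
      (above M (from_nat_into UNIV i) I \<longrightarrow> d (Suc i) \<preceq> from_nat_into UNIV i))"
  proof (rule dependent_nat_choice)
    obtain x where "x \<notin> I" using proper by blast
    then show "\<exists>x. above M x I" using not_in_cut[OF I] by blast
  next
    fix d and i :: nat assume d: "above M d I"
    define e :: 'a where "e = from_nat_into UNIV i"
    \<comment> \<open>Going below the i-th element of \<open>M\<close> too, whenever that element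
      lies above \<open>I\<close>, makes the thresholds coinitial above \<open>I\<close>.\<close>
    define m where "m = (if above M e I \<and> e \<preceq> d then e else d)"
    have m: "above M m I" "m \<preceq> d" "above M e I \<Longrightarrow> m \<preceq> e" using d le_total'[of e d] unfolding m_def by auto
    obtain y where y: "above M y I" "\<And>n. y \<oplus> num M n \<otimes> u y \<prec> m"
      using gap_below[OF gap m(1) I] unfolding u_def by blast
    have "y \<preceq> m" using y(2)[of 0] by (simp add: num_0 less_imp_le)
    then show "\<exists>y. above M y I \<and> ((\<forall>n. y \<oplus> num M n \<otimes> u y \<prec> d) \<and>
        (above M (from_nat_into UNIV i) I \<longrightarrow> y \<preceq> from_nat_into UNIV i))"
      using y m(2,3) less_le_trans order_trans unfolding e_def by blast
  qed
  then obtain d where d: "\<And>i. above M (d i) I" "\<And>i n. d (Suc i) \<oplus> num M n \<otimes> u (d (Suc i)) \<prec> d i"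
    and d_le: "\<And>i. above M (from_nat_into UNIV i) I \<Longrightarrow> d (Suc i) \<preceq> from_nat_into UNIV i"
    by blast
  have coinitial: "\<exists>i. d (Suc i) \<preceq> x" if "x \<notin> I" for x
  proof -
    obtain i where "x = from_nat_into UNIV i" using from_nat_into_surj[OF count, of x] by auto
    then show ?thesis using d_le[of i] that not_in_cut[OF I] by blast
  qed
  have u0: "u (d i) \<noteq> \<zero>" for i
  proof -
    have "\<zero> \<prec> d i" using d(1)[of i] cut_zero[OF I] unfolding above_def by blast
    then show ?thesis using pos_iff zero_neq_one' unfolding u_def by auto
  qed
  \<comment> \<open>Stage i has already spent the threshold \<open>d i\<close> and agrees up to
    \<open>d (Suc i)\<close>. Accordingly stage 0 results from a first application of
    \<open>gap_step\<close> to the empty class.\<close>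
  define Good where "Good i Z S \<longleftrightarrow> (\<exists>x. Form M x \<and> Z = parts x) \<and> compositional Z S \<and> small_agree (d (Suc i)) Z S"
    for i Z S
  note step = gap_step[OF count sat _ _ _ _ _ u_def[of "d (Suc i)" for i] u0 d(2)]
  obtain \<phi>0 where "Base \<phi>0" by (rule special_base) (rule that)
  then have Form0: "Form M \<phi>0" using Base_Sent by (simp add: Sent_def)
  have "parts_closed {}" "{} \<subseteq> parts \<phi>0" "compositional {} {}" "sound \<zero> {} {}" "small_agree (d 0) {} {}"
    by (simp_all add: parts_closed_def compositional_def sound_zero small_agree_def)
  from step[OF this Form0 Form0] obtain Z0 S0 where init: "Good 0 Z0 S0" unfolding Good_def by blast
  have "\<exists>Z' S'. Good (Suc i) Z' S' \<and> sound \<gamma> Z' S' \<and> \<phi> \<in> Z' \<and> (True \<longrightarrow>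
      (\<exists>\<delta> \<eta>. \<delta> = F (d (Suc i)) \<eta> \<and> Sent M \<delta> \<and> Sent M \<eta> \<and> \<delta> \<in> Z' \<and> \<eta> \<in> Z' \<and> (Tr M S' \<delta> \<longleftrightarrow> \<not> Tr M S' \<eta>)))"
    if G: "Good i Z S" "sound \<gamma> Z S" and \<phi>: "Form M \<phi>" for i Z S \<gamma> \<phi>
  proof -
    obtain x where x: "Form M x" "Z = parts x" "compositional Z S" "small_agree (d (Suc i)) Z S"
      using G(1) unfolding Good_def by blast
    have "parts_closed Z" "Z \<subseteq> parts x" using x(2) parts_closed_parts by simp_all
    from step[OF this x(3) G(2) x(4) x(1) \<phi>] obtain x' S' \<phi>1 where
      new: "Form M x'" "\<phi> \<in> parts x'" "compositional (parts x') S'" "sound \<gamma> (parts x') S'"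
        "small_agree (d (Suc (Suc i))) (parts x') S'" and
      split: "Sent M \<phi>1" "\<phi>1 \<in> parts x'" "F (d (Suc i)) \<phi>1 \<in> parts x'"
        "Tr M S' (F (d (Suc i)) \<phi>1) \<longleftrightarrow> \<not> Tr M S' \<phi>1" by blast
    have "Good (Suc i) (parts x') S'" unfolding Good_def using new by blast
    with new(2,4) split Sent_F[OF split(1)] show ?thesis by blast
  qed
  note next_stage = this
  have comp: "compositional Z S" if "Good i Z S" for i Z S using that unfolding Good_def by blast
  have closed: "\<phi> \<in> Z" if "Good i Z S" "\<theta> \<in> Z" "subfm \<theta> \<phi>" for i Z S \<theta> \<phi>
  proof -
    have "parts_closed Z" using that(1) parts_closed_parts unfolding Good_def by blast
    from parts_closed_subfm[OF this that(2,3)] show ?thesis .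
  qed
  have "\<exists>S. CS_minus M S \<and>
    (\<forall>\<delta> \<eta>. Sent M \<delta> \<and> Sent M \<eta> \<longrightarrow> (\<exists>i Z S'. Good i Z S' \<and> \<delta> \<in> Z \<and> \<eta> \<in> Z \<and>
       (Tr M S \<delta> \<longleftrightarrow> Tr M S' \<delta>) \<and> (Tr M S \<eta> \<longleftrightarrow> Tr M S' \<eta>))) \<and>
    (True \<longrightarrow> (\<forall>i. \<exists>\<delta> \<eta>. \<delta> = F (d (Suc i)) \<eta> \<and> Sent M \<delta> \<and> Sent M \<eta> \<and> (Tr M S \<delta> \<longleftrightarrow> \<not> Tr M S \<eta>)))"
    by (rule union_construction[where Good = Good and Q = True and P = "\<lambda>i \<delta> \<eta>. \<delta> = F (d (Suc i)) \<eta>", OF count init],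
      erule comp, erule (2) closed, erule (2) next_stage)
  then obtain S where S: "CS_minus M S" "\<And>\<delta> \<eta>. Sent M \<delta> \<Longrightarrow> Sent M \<eta> \<Longrightarrow> \<exists>i Z S'. Good i Z S' \<and> \<delta> \<in> Z \<and> \<eta> \<in> Z \<and>
       (Tr M S \<delta> \<longleftrightarrow> Tr M S' \<delta>) \<and> (Tr M S \<eta> \<longleftrightarrow> Tr M S' \<eta>)"
    and split: "\<And>i. \<exists>\<eta>. Sent M \<eta> \<and> (Tr M S (F (d (Suc i)) \<eta>) \<longleftrightarrow> \<not> Tr M S \<eta>)"
    by blast
  have "I = {x. \<forall>y. y \<preceq> x \<longrightarrow> (\<forall>\<phi>. Sent M \<phi> \<longrightarrow> (Tr M S \<phi> \<longleftrightarrow> Tr M S (F y \<phi>)))}"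
  proof (rule set_eqI)
    fix x
    show "x \<in> I \<longleftrightarrow> x \<in> {x. \<forall>y. y \<preceq> x \<longrightarrow> (\<forall>\<phi>. Sent M \<phi> \<longrightarrow> (Tr M S \<phi> \<longleftrightarrow> Tr M S (F y \<phi>)))}"
      unfolding mem_Collect_eq
    proof (rule iffI, (intro allI impI)[1])
      fix y \<phi> assume "x \<in> I" "y \<preceq> x" and \<phi>: "Sent M \<phi>"
      then have "y \<in> I" using cut_le[OF I] by blast
      obtain i Z S' where Z: "Good i Z S'" "\<phi> \<in> Z" "F y \<phi> \<in> Z"
        and eq: "Tr M S \<phi> \<longleftrightarrow> Tr M S' \<phi>" "Tr M S (F y \<phi>) \<longleftrightarrow> Tr M S' (F y \<phi>)"
        using S(2)[OF \<phi> Sent_F[OF \<phi>]] by blast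
      have "y \<preceq> d (Suc i)" using d(1)[of "Suc i"] \<open>y \<in> I\<close> less_imp_le unfolding above_def by blast
      then have "Tr M S' (F y \<phi>) \<longleftrightarrow> Tr M S' \<phi>" using Z \<phi> unfolding Good_def small_agree_def by blast
      then show "Tr M S \<phi> \<longleftrightarrow> Tr M S (F y \<phi>)" using eq by simp
    next
      assume x: "\<forall>y. y \<preceq> x \<longrightarrow> (\<forall>\<phi>. Sent M \<phi> \<longrightarrow> (Tr M S \<phi> \<longleftrightarrow> Tr M S (F y \<phi>)))"
      show "x \<in> I"
      proof (rule ccontr)
        assume "x \<notin> I"
        then obtain i where "d (Suc i) \<preceq> x" using coinitial by blast
        then show False using x split[of i] by blast
      qed
    qed
  qed
  with S(1) show ?thesis by blast
qed

text \<open>The improper cut has no thresholds above it and is treated as a separable one: the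
  interval below a nonstandard element contains all standard numbers.\<close>

lemma separable_UNIV:
  assumes "rec_saturated M" shows "separable M UNIV"
proof -
  obtain N where N: "\<And>n. num M n \<prec> N" using nonstandard_exists[OF assms] by blast
  have "pdf M (\<lambda>e. e 0 \<prec> N)" by (intro pdf_intros)
  from comprehension_pow2[OF this, of N] obtain c where "\<And>x. x \<epsilon> c \<longleftrightarrow> x \<prec> N" by blast
  then show ?thesis unfolding separable_def using N by auto
qed

end

theorem theorem4p13:
  fixes M :: "'a arith" and I :: "'a set" and \<Phi> :: template
  assumes "countable (UNIV :: 'a set)"
    and "models_PA M"
    and "rec_saturated M"
    and "is_cut M I"
    and "is_template \<Phi>"
    and "tdepth \<Phi> = 1"
    and "F_closed M \<Phi> I"
    and "separable M I \<or> no_least_gap M \<Phi> I"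
  shows "\<exists>S. CS_minus M S \<and>
    I = {x. \<forall>y. le M y x \<longrightarrow>
           (\<forall>\<phi>. Sent M \<phi> \<longrightarrow> (Tr M S \<phi> \<longleftrightarrow> Tr M S (F_op M \<Phi> y \<phi>)))}"
proof -
  interpret PA_template M \<Phi> using assms(2,5,6) by unfold_locales
  show ?thesis
  proof (cases "separable M I \<or> I = UNIV")
    case True
    then have "separable M I" using separable_UNIV[OF assms(3)] by auto
    from separable_case[OF assms(1,3,4,7) this] show ?thesis .
  next
    case False
    then show ?thesis using no_gap_case[OF assms(1,3,4)] assms(8) by blast
  qed
qed

end
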